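(* For all integers $n,m\ge2$ there exist a number field $k$ and two adelic hermitian vector bundles $\overline E$ and $\overline F$ over $k$ of respective dimensions $n$ and $m$ such that $$\Lambda(\overline E\otimes\overline F,\overline{\mathbf Q})<\Lambda(\overline E,\overline{\mathbf Q})\,\Lambda(\overline F,\overline{\mathbf Q}).$$
   Context: Let $k$ be a number field, viewed as a subfield of $\overline{\mathbf Q}$, with set of places $V(k)$ and adele ring $k_{\mathbf A}$. For $v\in V(k)$, $k_v$ is the completion of $k$, $\mathbf Q_v$ the closure of $\mathbf Q$ in $k_v$, and $\mathbf C_v$ the completion of an algebraic closure of $k_v$, with absolute value $|\cdot|_v$ extending the usual one on $\mathbf Q_v$. For $x\in\mathbf C_v^n$ put $|x|_{2,v}=(\sum_i|x_i|_v^2)^{1/2}$ if $v$ is archimedean and $\max_i|x_i|_v$ otherwise. An adelic hermitian vector bundle $\overline E$ over $k$ of dimension $n$ is a $k$-vector space $E$ of dimension $n$ with a norm $\|\cdot\|_{\overline E,v}$ on $E\otimes_k\mathbf C_v$ for each $v$, such that there exist a basis $e_1,\dots,e_n$ of $E$ and $a=(a_v)_v\in GL_n(k_{\mathbf A})$ with $\|\sum_ix_ie_i\|_{\overline E,v}=|a_v(x)|_{2,v}$ for all $v$, $x\in\mathbf C_v^n$. A basis $(e_i)$ of $E\otimes\mathbf C_v$ is orthonormal if $\|\sum x_ie_i\|_{\overline E,v}=|x|_{2,v}$ for all $x$. For a finite extension $K'\subset\overline{\mathbf Q}$ of $k$ and a place $w$ of $K'$ above $v$, $E\otimes_kK'\otimes\mathbf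 C_w$ is identified with $E\otimes_k\mathbf C_v$ with the same norm. The height of $x\in E\otimes_k\overline{\mathbf Q}$ is $H_{\overline E}(x)=\prod_{w\in V(K')}\|x\|_{\overline E,w}^{[K'_w:\mathbf Q_w]/[K':\mathbf Q]}$ for any finite $K'$ with $x\in E\otimes_kK'$. The absolute minimum is $\Lambda(\overline E,\overline{\mathbf Q})=\inf\{H_{\overline E}(x):0\neq x\in E\otimes_k\overline{\mathbf Q}\}$. The tensor product $\overline E\otimes\overline F$ is $E\otimes_kF$ equipped at each place with the norm for which tensor products of orthonormal bases of $E\otimes\mathbf C_v$ and $F\otimes\mathbf C_v$ are orthonormal bases. *)

theory Defs
  imports Complex_Main "HOL-Algebra.Algebraic_Closure_Type"
begin

section \<open>Number fields inside the algebraic numbers\<close>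

abbreviation complex_field :: "complex ring" where
  "complex_field \<equiv> ring_of_type_algebra"

definition Qbar :: "complex set" where
  "Qbar = {x. algebraic x}"

abbreviation field_on :: "complex set \<Rightarrow> complex ring" where
  "field_on k \<equiv> complex_field\<lparr>carrier := k\<rparr>"

text \<open>Being finite over the rationals, such a \<open>k\<close> is contained in \<^const>\<open>Qbar\<close>.\<close>

definition number_field :: "complex set \<Rightarrow> bool" where
  "number_field k \<longleftrightarrow> subfield k complex_field \<and> ring.finite_dimension complex_field \<rat> k"

definition global_degree :: "complex set \<Rightarrow> nat" where
  "global_degree k = ring.dim complex_field \<rat> k"


section \<open>Absolute values, completions\<close>

definition absolute_value :: "('a, 'b) ring_scheme \<Rightarrow> ('a \<Rightarrow> real) \<Rightarrow> bool" where
  "absolute_value R \<nu> \<longleftrightarrow>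
     (\<forall>x\<in>carrier R. 0 \<le> \<nu> x \<and> (\<nu> x = 0 \<longleftrightarrow> x = \<zero>\<^bsub>R\<^esub>)) \<and>
     (\<forall>x\<in>carrier R. \<forall>y\<in>carrier R. \<nu> (x \<otimes>\<^bsub>R\<^esub> y) = \<nu> x * \<nu> y) \<and>
     (\<forall>x\<in>carrier R. \<forall>y\<in>carrier R. \<nu> (x \<oplus>\<^bsub>R\<^esub> y) \<le> \<nu> x + \<nu> y)"

definition cauchy_ring :: "('a, 'b) ring_scheme \<Rightarrow> ('a \<Rightarrow> real) \<Rightarrow> (nat \<Rightarrow> 'a) ring" where
  "cauchy_ring R \<nu> =
     \<lparr> carrier = {s. range s \<subseteq> carrier R \<and>
                     (\<forall>\<epsilon>>0. \<exists>N. \<forall>i\<ge>N. \<forall>j\<ge>N. \<nu> (s i \<ominus>\<^bsub>R\<^esub> s j) < \<epsilon>)},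
       monoid.mult = (\<lambda>s t i. s i \<otimes>\<^bsub>R\<^esub> t i),
       one = (\<lambda>i. \<one>\<^bsub>R\<^esub>),
       ring.zero = (\<lambda>i. \<zero>\<^bsub>R\<^esub>),
       add = (\<lambda>s t i. s i \<oplus>\<^bsub>R\<^esub> t i) \<rparr>"

definition null_sequences :: "('a, 'b) ring_scheme \<Rightarrow> ('a \<Rightarrow> real) \<Rightarrow> (nat \<Rightarrow> 'a) set" where
  "null_sequences R \<nu> = {s \<in> carrier (cauchy_ring R \<nu>). (\<lambda>i. \<nu> (s i)) \<longlonglongrightarrow> 0}"

definition completion :: "('a, 'b) ring_scheme \<Rightarrow> ('a \<Rightarrow> real) \<Rightarrow> (nat \<Rightarrow> 'a) set ring" where
  "completion R \<nu> = cauchy_ring R \<nu> Quot null_sequences R \<nu>"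

text \<open>The elements of a completion are classes of Cauchy sequences; the limit below does not
  depend on the representative chosen.\<close>

definition completion_abs :: "('a \<Rightarrow> real) \<Rightarrow> (nat \<Rightarrow> 'a) set \<Rightarrow> real" where
  "completion_abs \<nu> C = lim (\<lambda>i. \<nu> ((SOME s. s \<in> C) i))"

definition completion_map ::
    "('a, 'b) ring_scheme \<Rightarrow> ('a \<Rightarrow> real) \<Rightarrow> 'a \<Rightarrow> (nat \<Rightarrow> 'a) set" where
  "completion_map R \<nu> x = null_sequences R \<nu> +>\<^bsub>cauchy_ring R \<nu>\<^esub> (\<lambda>i. x)"

definition closure_in :: "('a, 'b) ring_scheme \<Rightarrow> ('a \<Rightarrow> real) \<Rightarrow> 'a set \<Rightarrow> 'a set" where
  "closure_in R \<nu> S = {x \<in> carrier R. \<forall>\<epsilon>>0. \<exists>y\<in>S. \<nu> (x \<ominus>\<^bsub>R\<^esub> y) < \<epsilon>}"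


section \<open>Places\<close>

definition padic_abs :: "nat \<Rightarrow> rat \<Rightarrow> real" where
  "padic_abs p q =
     (if q = 0 then 0
      else case quotient_of q of (a, b) \<Rightarrow>
        real p powi (int (multiplicity (int p) b) - int (multiplicity (int p) a)))"

text \<open>A place is represented by the unique absolute value in its class that extends one of the
  usual absolute values of \<open>\<rat>\<close>; it is made \<^const>\<open>undefined\<close> outside \<open>k\<close>, so that
  distinct elements of \<open>places k\<close> are distinct places.\<close>

type_synonym place = "complex \<Rightarrow> real"

definition archimedean :: "place \<Rightarrow> bool" where
  "archimedean v \<longleftrightarrow> (\<forall>q::rat. v (of_rat q) = \<bar>of_rat q\<bar>)"

definition places :: "complex set \<Rightarrow> place set" where
  "places k = {v \<in> extensional k. absolute_value (field_on k) v \<and>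
     (archimedean v \<or> (\<exists>p. prime p \<and> (\<forall>q::rat. v (of_rat q) = padic_abs p q)))}"

type_synonym kv = "(nat \<Rightarrow> complex) set"
type_synonym kv_bar = "(kv list \<times> nat) multiset \<Rightarrow> kv"
type_synonym Cv = "(nat \<Rightarrow> kv_bar) set"

definition kv_field :: "complex set \<Rightarrow> place \<Rightarrow> kv ring" where
  "kv_field k v = completion (field_on k) v"

definition kv_abs :: "place \<Rightarrow> kv \<Rightarrow> real" where
  "kv_abs v = completion_abs v"

definition k_to_kv :: "complex set \<Rightarrow> place \<Rightarrow> complex \<Rightarrow> kv" where
  "k_to_kv k v = completion_map (field_on k) v"

text \<open>The closure \<open>\<rat>\<^sub>v\<close> of \<open>\<rat>\<close> in \<open>k\<^sub>v\<close>, and \<open>[k\<^sub>v : \<rat>\<^sub>v]\<close>.\<close>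

definition Qv :: "complex set \<Rightarrow> place \<Rightarrow> kv set" where
  "Qv k v = closure_in (kv_field k v) (kv_abs v) (k_to_kv k v ` \<rat>)"

definition local_degree :: "complex set \<Rightarrow> place \<Rightarrow> nat" where
  "local_degree k v = ring.dim (kv_field k v) (Qv k v) (carrier (kv_field k v))"

definition kv_bar_field :: "complex set \<Rightarrow> place \<Rightarrow> kv_bar ring" where
  "kv_bar_field k v = field.alg_closure (kv_field k v)"

definition kv_to_bar :: "complex set \<Rightarrow> place \<Rightarrow> kv \<Rightarrow> kv_bar" where
  "kv_to_bar k v = ring.indexed_const (kv_field k v)"

text \<open>As \<open>k\<^sub>v\<close> is complete, its absolute value extends to the algebraic closure in exactly one
  way, so the choice only concerns values outside the carrier.\<close>

definition kv_bar_abs :: "complex set \<Rightarrow> place \<Rightarrow> kv_bar \<Rightarrow> real" where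
  "kv_bar_abs k v = (SOME \<mu>. absolute_value (kv_bar_field k v) \<mu> \<and>
     (\<forall>x\<in>carrier (kv_field k v). \<mu> (kv_to_bar k v x) = kv_abs v x))"

definition Cv_field :: "complex set \<Rightarrow> place \<Rightarrow> Cv ring" where
  "Cv_field k v = completion (kv_bar_field k v) (kv_bar_abs k v)"

definition Cv_abs :: "complex set \<Rightarrow> place \<Rightarrow> Cv \<Rightarrow> real" where
  "Cv_abs k v = completion_abs (kv_bar_abs k v)"

definition kv_to_Cv :: "complex set \<Rightarrow> place \<Rightarrow> kv \<Rightarrow> Cv" where
  "kv_to_Cv k v x = completion_map (kv_bar_field k v) (kv_bar_abs k v) (kv_to_bar k v x)"

definition k_to_Cv :: "complex set \<Rightarrow> place \<Rightarrow> complex \<Rightarrow> Cv" where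
  "k_to_Cv k v x = kv_to_Cv k v (k_to_kv k v x)"


section \<open>Adeles and the general linear group\<close>

definition adele_ring :: "complex set \<Rightarrow> (place \<Rightarrow> kv) ring" where
  "adele_ring k =
     \<lparr> carrier = {x \<in> (\<Pi>\<^sub>E v\<in>places k. carrier (kv_field k v)).
                   finite {v \<in> places k. \<not> archimedean v \<and> kv_abs v (x v) > 1}},
       monoid.mult = (\<lambda>x y. \<lambda>v\<in>places k. x v \<otimes>\<^bsub>kv_field k v\<^esub> y v),
       one = (\<lambda>v\<in>places k. \<one>\<^bsub>kv_field k v\<^esub>),
       ring.zero = (\<lambda>v\<in>places k. \<zero>\<^bsub>kv_field k v\<^esub>),
       add = (\<lambda>x y. \<lambda>v\<in>places k. x v \<oplus>\<^bsub>kv_field k v\<^esub> y v) \<rparr>"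

text \<open>Only the entries \<open>a i j\<close> with \<open>i, j < n\<close> of a matrix matter.\<close>

definition GL :: "nat \<Rightarrow> ('a, 'b) ring_scheme \<Rightarrow> (nat \<Rightarrow> nat \<Rightarrow> 'a) set" where
  "GL n R = {a. (\<forall>i<n. \<forall>j<n. a i j \<in> carrier R) \<and>
     (\<exists>b. (\<forall>i<n. \<forall>j<n. b i j \<in> carrier R) \<and>
       (\<forall>i<n. \<forall>j<n.
          (\<Oplus>\<^bsub>R\<^esub>l\<in>{..<n}. a i l \<otimes>\<^bsub>R\<^esub> b l j) = (if i = j then \<one>\<^bsub>R\<^esub> else \<zero>\<^bsub>R\<^esub>) \<and>
          (\<Oplus>\<^bsub>R\<^esub>l\<in>{..<n}. b i l \<otimes>\<^bsub>R\<^esub> a l j) = (if i = j then \<one>\<^bsub>R\<^esub> else \<zero>\<^bsub>R\<^esub>)))}"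


section \<open>Coordinate spaces\<close>

text \<open>Finite-dimensional spaces are coordinate spaces \<open>R\<^sup>I\<close> for a finite index set \<open>I\<close>.  Thus
  the scalar extension of \<open>k\<^sup>I\<close> to \<open>L\<close> is \<open>L\<^sup>I\<close>, and the tensor product of \<open>R\<^sup>I\<close> and \<open>R\<^sup>J\<close> is
  \<open>R\<^bsup>I \<times> J\<^esup>\<close> with \<open>(x \<otimes> y) (i, j) = x i y j\<close>.\<close>

definition vectors :: "('a, 'b) ring_scheme \<Rightarrow> 'i set \<Rightarrow> ('i \<Rightarrow> 'a) set" where
  "vectors R I = (I \<rightarrow>\<^sub>E carrier R)"

definition lin_comb ::
    "('a, 'b) ring_scheme \<Rightarrow> 'i set \<Rightarrow> 'j set \<Rightarrow> ('j \<Rightarrow> 'i \<Rightarrow> 'a) \<Rightarrow> ('j \<Rightarrow> 'a) \<Rightarrow> 'i \<Rightarrow> 'a" where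
  "lin_comb R I J e x = (\<lambda>i\<in>I. \<Oplus>\<^bsub>R\<^esub>j\<in>J. x j \<otimes>\<^bsub>R\<^esub> e j i)"

definition is_basis ::
    "('a, 'b) ring_scheme \<Rightarrow> 'i set \<Rightarrow> 'j set \<Rightarrow> ('j \<Rightarrow> 'i \<Rightarrow> 'a) \<Rightarrow> bool" where
  "is_basis R I J e \<longleftrightarrow> finite J \<and> (\<forall>j\<in>J. e j \<in> vectors R I) \<and>
     bij_betw (lin_comb R I J e) (vectors R J) (vectors R I)"

definition tensor_family ::
    "('a, 'b) ring_scheme \<Rightarrow> 'i set \<Rightarrow> 'j set \<Rightarrow> (nat \<Rightarrow> 'i \<Rightarrow> 'a) \<Rightarrow> (nat \<Rightarrow> 'j \<Rightarrow> 'a) \<Rightarrow>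
     nat \<times> nat \<Rightarrow> 'i \<times> 'j \<Rightarrow> 'a" where
  "tensor_family R I J b c = (\<lambda>(r, s). \<lambda>(i, j)\<in>I \<times> J. b r i \<otimes>\<^bsub>R\<^esub> c s j)"

text \<open>The norm \<open>|\<cdot>|\<^bsub>2,v\<^esub>\<close> on \<open>\<complex>\<^sub>v\<^sup>J\<close>; inserting \<open>0\<close> only matters for empty \<open>J\<close>.\<close>

definition norm2 :: "complex set \<Rightarrow> place \<Rightarrow> 'j set \<Rightarrow> ('j \<Rightarrow> Cv) \<Rightarrow> real" where
  "norm2 k v J x =
     (if archimedean v then sqrt (\<Sum>j\<in>J. (Cv_abs k v (x j))\<^sup>2)
      else Max (insert 0 ((\<lambda>j. Cv_abs k v (x j)) ` J)))"


section \<open>Adelic hermitian vector bundles\<close>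

record 'i herm_bundle =
  index_set :: "'i set"
  bundle_norm :: "place \<Rightarrow> ('i \<Rightarrow> Cv) \<Rightarrow> real"

definition bundle_dim :: "'i herm_bundle \<Rightarrow> nat" where
  "bundle_dim E = card (index_set E)"

text \<open>The underlying \<open>k\<close>-space is \<open>k\<^sup>I\<close> with \<open>I = index_set E\<close>.\<close>

definition adelic_hermitian_bundle :: "complex set \<Rightarrow> 'i herm_bundle \<Rightarrow> bool" where
  "adelic_hermitian_bundle k E \<longleftrightarrow> finite (index_set E) \<and>
     (\<exists>e a. is_basis (field_on k) (index_set E) {..<bundle_dim E} e \<and>
        a \<in> GL (bundle_dim E) (adele_ring k) \<and>
        (\<forall>v\<in>places k. \<forall>x\<in>vectors (Cv_field k v) {..<bundle_dim E}.
           bundle_norm E v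
             (lin_comb (Cv_field k v) (index_set E) {..<bundle_dim E} (\<lambda>j i. k_to_Cv k v (e j i)) x)
           = norm2 k v {..<bundle_dim E}
               (\<lambda>i\<in>{..<bundle_dim E}. \<Oplus>\<^bsub>Cv_field k v\<^esub>j\<in>{..<bundle_dim E}.
                  kv_to_Cv k v (a i j v) \<otimes>\<^bsub>Cv_field k v\<^esub> x j)))"

definition orthonormal_basis ::
    "complex set \<Rightarrow> place \<Rightarrow> 'i set \<Rightarrow> (('i \<Rightarrow> Cv) \<Rightarrow> real) \<Rightarrow> 'j set \<Rightarrow> ('j \<Rightarrow> 'i \<Rightarrow> Cv) \<Rightarrow> bool" where
  "orthonormal_basis k v I N J b \<longleftrightarrow> is_basis (Cv_field k v) I J b \<and>
     (\<forall>x\<in>vectors (Cv_field k v) J. N (lin_comb (Cv_field k v) I J b x) = norm2 k v J x)"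

definition tensor_norm ::
    "complex set \<Rightarrow> 'i herm_bundle \<Rightarrow> 'j herm_bundle \<Rightarrow> place \<Rightarrow> ('i \<times> 'j \<Rightarrow> Cv) \<Rightarrow> real" where
  "tensor_norm k E F v =
     (THE N. N \<in> extensional (vectors (Cv_field k v) (index_set E \<times> index_set F)) \<and>
        (\<forall>b c. orthonormal_basis k v (index_set E) (bundle_norm E v) {..<bundle_dim E} b \<and>
               orthonormal_basis k v (index_set F) (bundle_norm F v) {..<bundle_dim F} c \<longrightarrow>
               orthonormal_basis k v (index_set E \<times> index_set F) N
                 ({..<bundle_dim E} \<times> {..<bundle_dim F})
                 (tensor_family (Cv_field k v) (index_set E) (index_set F) b c)))"

definition tensor_bundle :: "complex set \<Rightarrow> 'i herm_bundle \<Rightarrow> 'j herm_bundle \<Rightarrow> ('i \<times> 'j) herm_bundle" where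
  "tensor_bundle k E F =
     \<lparr> index_set = index_set E \<times> index_set F, bundle_norm = tensor_norm k E F \<rparr>"


section \<open>Heights and the absolute minimum\<close>

text \<open>Let \<open>w\<close> be a place of \<open>K\<close> above \<open>v\<close>.  A \<open>k\<close>-embedding \<open>K \<rightarrow> \<complex>\<^sub>v\<close> inducing \<open>w\<close> makes \<open>\<complex>\<^sub>v\<close>
  the completion of an algebraic closure of \<open>K\<^sub>w\<close>; fixing one therefore amounts to identifying
  \<open>\<complex>\<^sub>w\<close> with \<open>\<complex>\<^sub>v\<close>.  The norms below do not depend on its choice, since the
  matrices \<open>a\<^sub>v\<close> have their entries in \<open>k\<^sub>v\<close>.\<close>

definition place_embedding :: "complex set \<Rightarrow> complex set \<Rightarrow> place \<Rightarrow> complex \<Rightarrow> Cv" where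
  "place_embedding k K w = (SOME \<sigma>.
     \<sigma> \<in> ring_hom (field_on K) (Cv_field k (restrict w k)) \<and>
     (\<forall>x\<in>k. \<sigma> x = k_to_Cv k (restrict w k) x) \<and>
     (\<forall>x\<in>K. Cv_abs k (restrict w k) (\<sigma> x) = w x))"

definition norm_above ::
    "complex set \<Rightarrow> 'i herm_bundle \<Rightarrow> complex set \<Rightarrow> place \<Rightarrow> ('i \<Rightarrow> complex) \<Rightarrow> real" where
  "norm_above k E K w x =
     bundle_norm E (restrict w k) (\<lambda>i\<in>index_set E. place_embedding k K w (x i))"

definition height_factor ::
    "complex set \<Rightarrow> 'i herm_bundle \<Rightarrow> complex set \<Rightarrow> ('i \<Rightarrow> complex) \<Rightarrow> place \<Rightarrow> real" where
  "height_factor k E K x w =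
     norm_above k E K w x powr (real (local_degree K w) / real (global_degree K))"

text \<open>For nonzero \<open>x\<close> almost all factors equal \<open>1\<close>, and the product over all places is the product
  over the others.\<close>

definition height_over ::
    "complex set \<Rightarrow> 'i herm_bundle \<Rightarrow> complex set \<Rightarrow> ('i \<Rightarrow> complex) \<Rightarrow> real" where
  "height_over k E K x =
     (\<Prod>w\<in>{w \<in> places K. height_factor k E K x w \<noteq> 1}. height_factor k E K x w)"

text \<open>Any finite extension \<open>K\<close> containing the coordinates of \<open>x\<close> gives the same value.\<close>

definition height :: "complex set \<Rightarrow> 'i herm_bundle \<Rightarrow> ('i \<Rightarrow> complex) \<Rightarrow> real" where
  "height k E x = height_over k E
     (SOME K. number_field K \<and> k \<subseteq> K \<and> x \<in> vectors (field_on K) (index_set E)) x"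

definition absolute_minimum :: "complex set \<Rightarrow> 'i herm_bundle \<Rightarrow> real" where
  "absolute_minimum k E =
     Inf {height k E x | x. x \<in> vectors (field_on Qbar) (index_set E) \<and> x \<noteq> (\<lambda>i\<in>index_set E. 0)}"

end

theory Submission
  imports Defs
begin

text \<open>Let \<open>k\<close> contain \<open>\<rho>\<close> with \<open>\<rho>\<^sup>4 = 2\<close> and a primitive cube root of unity \<open>\<omega>\<close>, and put
  \<open>\<theta> = 2\<omega> + 1 = \<surd>-3\<close>. On \<open>k\<^sup>n\<close> the standard norms are modified in the first two coordinates only, at
  the archimedean places and above \<open>2\<close> and \<open>3\<close>, in such a way that for \<open>x \<noteq> 0\<close> over any extension \<open>K\<close>
  some \<open>g \<in> K\<^sup>*\<close> satisfies \<open>|g|\<^sub>w \<le> \<parallel>x\<parallel>\<^sub>w\<^sup>d\<close> at all places with \<open>d \<in> {1, 4}\<close>: generically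
  \<open>g = 2\<theta>x\<^sub>1(x\<^sub>0\<^sup>3 - x\<^sub>1\<^sup>3)\<close> with \<open>d = 4\<close>, and \<open>g = \<theta>x\<^sub>1\<close> or a coordinate of \<open>x\<close> with \<open>d = 1\<close> where this vanishes.
  By the product formula every height is at least \<open>1\<close>. The tensor \<open>e\<^sub>0 \<otimes> e\<^sub>1 - e\<^sub>1 \<otimes> e\<^sub>0\<close> however has norm
  at most \<open>|\<rho>\<theta>|\<^sub>w\<close> everywhere, and \<open>2 < |\<rho>\<theta>|\<^sub>w\<close> at the archimedean places, where its norm is \<open>2\<close>; so its
  height is less than \<open>1\<close>.

  The product formula is reduced to \<open>\<rat>\<close> by means of the norm of \<open>K\<close> over \<open>\<rat>\<close>: if \<open>Q\<close> is an absolute value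
  of a normal closure of \<open>K\<close>, then every \<open>w\<close> above the same place of \<open>\<rat>\<close> is of the form \<open>Q \<circ> \<tau>\<close>, and weak
  approximation identifies the local degree of \<open>w\<close> with the number of such embeddings \<open>\<tau>\<close> of \<open>K\<close>.\<close>

section \<open>Polynomials over a subfield of the complex numbers\<close>

text \<open>The quartic is a tetrahedron. In the coordinates \<open>x 0\<close>,
  \<open>sqrt 2 * x 1\<close>, orthonormal at an archimedean place, the four zeros of
  \<open>x 1 * (x 0 ^ 3 - x 1 ^ 3)\<close> on the projective line are the vertices of a regular
  tetrahedron on the Riemann sphere. The finite places are set so that these four lines have height
  1: (1, 0) has norm 1 everywhere, and (\<omega>^i, 1) has everywhere the norm of \<theta>. Away
  from them the coefficient 2 is shared above 2 by the four linear factors, one \<rho> each, and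
  \<theta> is absorbed above 3 by \<open>x 1\<close>. The tensor is alternating, so its norm is that
  of the determinant, times the square root of 2 at archimedean places; its height is the fourth
  root of 16/18. A second difficulty is that C_v carries a chosen absolute value on an algebraic
  closure, so nothing can be computed before absolute values are known to extend. At finite places
  Chevalley's maximal subrings do this. At infinite places \<omega> makes the field totally
  imaginary: every k_v is then the field of complex numbers, and no real completion occurs.\<close>

definition subf :: "complex set \<Rightarrow> bool" where
  "subf B \<longleftrightarrow> 0 \<in> B \<and> 1 \<in> B \<and> (\<forall>x\<in>B. \<forall>y\<in>B. x + y \<in> B \<and> x * y \<in> B \<and> x - y \<in> B) \<and>
     (\<forall>x\<in>B. inverse x \<in> B)"

lemma subfD:
  assumes "subf B"
  shows "0 \<in> B" "1 \<in> B" "\<And>x y. x \<in> B \<Longrightarrow> y \<in> B \<Longrightarrow> x + y \<in> B"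
    "\<And>x y. x \<in> B \<Longrightarrow> y \<in> B \<Longrightarrow> x * y \<in> B" "\<And>x y. x \<in> B \<Longrightarrow> y \<in> B \<Longrightarrow> x - y \<in> B"
    "\<And>x. x \<in> B \<Longrightarrow> inverse x \<in> B" "\<And>x y. x \<in> B \<Longrightarrow> y \<in> B \<Longrightarrow> x / y \<in> B"
    "\<And>x. x \<in> B \<Longrightarrow> - x \<in> B" "\<And>x n. x \<in> B \<Longrightarrow> x ^ n \<in> B"
proof -
  show *: "0 \<in> B" "1 \<in> B" "\<And>x y. x \<in> B \<Longrightarrow> y \<in> B \<Longrightarrow> x + y \<in> B"
    "\<And>x y. x \<in> B \<Longrightarrow> y \<in> B \<Longrightarrow> x * y \<in> B" "\<And>x y. x \<in> B \<Longrightarrow> y \<in> B \<Longrightarrow> x - y \<in> B"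
    "\<And>x. x \<in> B \<Longrightarrow> inverse x \<in> B"
    using assms by (auto simp: subf_def)
  show "x / y \<in> B" if "x \<in> B" "y \<in> B" for x y
    using that * by (simp add: divide_inverse)
  show "- x \<in> B" if "x \<in> B" for x
    using that *(1) *(5)[of 0 x] by simp
  show "x ^ n \<in> B" if "x \<in> B" for x n
    using that * by (induction n) auto
qed

lemma subf_sum: "subf B \<Longrightarrow> (\<And>i. i \<in> I \<Longrightarrow> f i \<in> B) \<Longrightarrow> sum f I \<in> B"
  by (induction I rule: infinite_finite_induct) (auto simp: subfD)

lemma subf_prod: "subf B \<Longrightarrow> (\<And>i. i \<in> I \<Longrightarrow> f i \<in> B) \<Longrightarrow> prod f I \<in> B"
  by (induction I rule: infinite_finite_induct) (auto simp: subfD)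

lemma subf_of_nat: "subf B \<Longrightarrow> of_nat n \<in> B"
  by (induction n) (auto simp: subfD)

lemma subf_of_int: "subf B \<Longrightarrow> of_int n \<in> B"
  by (cases n) (auto simp: subfD subf_of_nat simp del: of_nat_Suc)

lemma subf_numeral: "subf B \<Longrightarrow> numeral n \<in> B"
  using subf_of_nat[of B "numeral n"] by simp

lemma subf_Rats: "subf \<rat>"
  by (auto simp: subf_def)

lemma Rats_subset: "subf B \<Longrightarrow> \<rat> \<subseteq> B"
proof
  fix x :: complex assume "subf B" "x \<in> \<rat>"
  then obtain q where "x = of_rat q" by (auto elim: Rats_cases)
  moreover obtain a b where "quotient_of q = (a, b)" by (cases "quotient_of q")
  ultimately have "x = of_int a / of_int b"
    using quotient_of_div[of q a b] by (simp add: of_rat_divide)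
  then show "x \<in> B" using \<open>subf B\<close> by (simp add: subfD subf_of_int)
qed

text \<open>Polynomials stay in the type \<open>complex poly\<close>, where roots and splitting into
  linear factors are available; the field of coefficients is a side condition.\<close>

definition polys_over :: "complex set \<Rightarrow> complex poly set" where
  "polys_over B = {p. \<forall>i. coeff p i \<in> B}"

context
  fixes B assumes B: "subf B"
begin

lemma polys_over_0: "0 \<in> polys_over B" and polys_over_1: "1 \<in> polys_over B"
  by (auto simp: polys_over_def subfD[OF B] coeff_1)

lemma polys_over_const: "c \<in> B \<Longrightarrow> [:c:] \<in> polys_over B"
  by (auto simp: polys_over_def coeff_pCons subfD[OF B] split: nat.splits)

lemma polys_over_pCons_iff: "pCons c p \<in> polys_over B \<longleftrightarrow> c \<in> B \<and> p \<in> polys_over B"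
  by (auto simp: polys_over_def coeff_pCons split: nat.splits)

lemma polys_over_add: "p \<in> polys_over B \<Longrightarrow> q \<in> polys_over B \<Longrightarrow> p + q \<in> polys_over B"
  and polys_over_diff: "p \<in> polys_over B \<Longrightarrow> q \<in> polys_over B \<Longrightarrow> p - q \<in> polys_over B"
  and polys_over_uminus: "p \<in> polys_over B \<Longrightarrow> - p \<in> polys_over B"
  and polys_over_smult: "c \<in> B \<Longrightarrow> p \<in> polys_over B \<Longrightarrow> smult c p \<in> polys_over B"
  and polys_over_monom: "c \<in> B \<Longrightarrow> monom c n \<in> polys_over B"
  by (auto simp: polys_over_def subfD[OF B])

lemma polys_over_mult: "p \<in> polys_over B \<Longrightarrow> q \<in> polys_over B \<Longrightarrow> p * q \<in> polys_over B"
  by (auto simp: polys_over_def coeff_mult intro!: subf_sum[OF B] subfD[OF B])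

lemma polys_over_prod: "(\<And>i. i \<in> I \<Longrightarrow> f i \<in> polys_over B) \<Longrightarrow> prod f I \<in> polys_over B"
  by (induction I rule: infinite_finite_induct) (auto intro: polys_over_mult polys_over_1)

lemma polys_over_sum: "(\<And>i. i \<in> I \<Longrightarrow> f i \<in> polys_over B) \<Longrightarrow> sum f I \<in> polys_over B"
  by (induction I rule: infinite_finite_induct) (auto intro: polys_over_add polys_over_0)

lemma polys_over_pderiv: "p \<in> polys_over B \<Longrightarrow> pderiv p \<in> polys_over B"
  unfolding polys_over_def mem_Collect_eq coeff_pderiv using subfD(4)[OF B subf_of_nat[OF B]] by blast

lemma polys_over_pcompose: "p \<in> polys_over B \<Longrightarrow> q \<in> polys_over B \<Longrightarrow> pcompose p q \<in> polys_over B"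
proof (induction p)
  case (pCons a p)
  then show ?case
    unfolding pcompose_pCons polys_over_pCons_iff
    by (intro polys_over_add polys_over_mult polys_over_const) auto
qed (auto simp: polys_over_0)

lemma poly_in_subf: "subf A \<Longrightarrow> p \<in> polys_over B \<Longrightarrow> B \<subseteq> A \<Longrightarrow> c \<in> A \<Longrightarrow> poly p c \<in> A"
  unfolding poly_altdef polys_over_def by (auto intro!: subf_sum subfD)

text \<open>Long division, by induction on the degree of the dividend: cancelling leading terms uses
  only the field operations of \<open>B\<close>, so quotient and remainder keep their coefficients
  there.\<close>

lemma polys_over_division:
  assumes q: "q \<in> polys_over B" "q \<noteq> 0" and p: "p \<in> polys_over B"
  shows "\<exists>s\<in>polys_over B. \<exists>r\<in>polys_over B. p = q * s + r \<and> (r = 0 \<or> degree r < degree q)"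
  using p
proof (induction "degree p" arbitrary: p rule: less_induct)
  case less
  show ?case
  proof (cases "p = 0 \<or> degree p < degree q")
    case True
    then show ?thesis
      using less.prems polys_over_0 by (intro bexI[of _ 0] bexI[of _ p]) auto
  next
    case False
    define t where "t = monom (lead_coeff p / lead_coeff q) (degree p - degree q)"
    have t: "t \<in> polys_over B"
      using q less.prems unfolding t_def
      by (intro polys_over_monom subfD(7)[OF B]) (auto simp: polys_over_def)
    have p0: "p \<noteq> 0" "degree q \<le> degree p" using False by auto
    have ne: "lead_coeff p / lead_coeff q \<noteq> 0"
      using p0 q by auto
    define p' where "p' = p - q * t"
    have p': "p' \<in> polys_over B"
      unfolding p'_def using less.prems q t polys_over_diff polys_over_mult by blast
    have d: "degree (q * t) = degree p"
      using p0 q ne by (subst degree_mult_eq) (auto simp: t_def degree_monom_eq)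
    have lc: "coeff (q * t) (degree p) = lead_coeff p"
      using d[symmetric] lead_coeff_mult[of q t] q ne
      by (simp add: t_def degree_monom_eq)
    have small: "p' = 0 \<or> degree p' < degree p"
    proof (cases "degree p = 0")
      case True
      have "degree p' \<le> 0"
        unfolding p'_def using degree_diff_le_max[of p "q * t"] d True by simp
      moreover have "coeff p' 0 = 0"
        unfolding p'_def using lc True by simp
      ultimately show ?thesis
        by (metis bot_nat_0.extremum_uniqueI leading_coeff_0_iff)
    next
      case False
      have "degree p' \<le> degree p"
        unfolding p'_def using degree_diff_le_max[of p "q * t"] d by simp
      moreover have "coeff p' (degree p) = 0"
        unfolding p'_def using lc by simp
      ultimately show ?thesis
        using False by (metis le_neq_implies_less leading_coeff_0_iff)
    qed
    have "\<exists>s\<in>polys_over B. \<exists>r\<in>polys_over B. p' = q * s + r \<and> (r = 0 \<or> degree r < degree q)"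
    proof (cases "p' = 0")
      case True
      then show ?thesis
        using polys_over_0 by (intro bexI[of _ 0]) auto
    next
      case False
      then show ?thesis
        using small less.hyps p' by auto
    qed
    then obtain s r where sr: "s \<in> polys_over B" "r \<in> polys_over B" "p' = q * s + r"
      "r = 0 \<or> degree r < degree q" by auto
    have "p = q * (s + t) + r"
      using sr(3) unfolding p'_def by (simp add: algebra_simps)
    then show ?thesis
      using sr t polys_over_add by blast
  qed
qed

end

lemma polys_over_mono: "A \<subseteq> B \<Longrightarrow> polys_over A \<subseteq> polys_over B"
  by (auto simp: polys_over_def)

section \<open>Minimal polynomials\<close>

definition is_minpoly :: "complex set \<Rightarrow> complex \<Rightarrow> complex poly \<Rightarrow> bool" where
  "is_minpoly B c m \<longleftrightarrow> m \<in> polys_over B \<and> lead_coeff m = 1 \<and> poly m c = 0 \<and>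
     (\<forall>p\<in>polys_over B. poly p c = 0 \<longrightarrow> p = 0 \<or> degree m \<le> degree p)"

definition alg_over :: "complex set \<Rightarrow> complex \<Rightarrow> bool" where
  "alg_over B c \<longleftrightarrow> (\<exists>p\<in>polys_over B. p \<noteq> 0 \<and> poly p c = 0)"

lemma alg_over_Rats: "alg_over \<rat> c \<longleftrightarrow> algebraic c"
  by (auto simp: alg_over_def algebraic_altdef polys_over_def)

lemma alg_over_mono: "alg_over A c \<Longrightarrow> A \<subseteq> B \<Longrightarrow> alg_over B c"
  unfolding alg_over_def using polys_over_mono by blast

lemma ex_minpoly:
  assumes B: "subf B" and "alg_over B c"
  shows "\<exists>m. is_minpoly B c m"
proof -
  define P where "P = (\<lambda>p. p \<in> polys_over B \<and> p \<noteq> 0 \<and> poly p c = 0)"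
  have "\<exists>p. P p" using assms(2) by (auto simp: P_def alg_over_def)
  then obtain p where p: "P p" "\<And>q. P q \<Longrightarrow> degree p \<le> degree q"
    using ex_has_least_nat[of P _ degree] by metis
  define m where "m = smult (inverse (lead_coeff p)) p"
  have "m \<in> polys_over B"
    unfolding m_def using p(1) B by (intro polys_over_smult) (auto simp: P_def polys_over_def subfD)
  moreover have "lead_coeff m = 1" "poly m c = 0" "degree m = degree p"
    using p(1) by (auto simp: m_def P_def)
  ultimately show ?thesis
    using p(2) unfolding is_minpoly_def P_def by (metis)
qed

lemma is_minpolyD:
  assumes "is_minpoly B c m"
  shows "m \<in> polys_over B" "lead_coeff m = 1" "poly m c = 0" "m \<noteq> 0" "degree m > 0"
    "\<And>p. p \<in> polys_over B \<Longrightarrow> poly p c = 0 \<Longrightarrow> p \<noteq> 0 \<Longrightarrow> degree m \<le> degree p"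
proof -
  show *: "m \<in> polys_over B" "lead_coeff m = 1" "poly m c = 0"
    "\<And>p. p \<in> polys_over B \<Longrightarrow> poly p c = 0 \<Longrightarrow> p \<noteq> 0 \<Longrightarrow> degree m \<le> degree p"
    using assms by (auto simp: is_minpoly_def)
  show "m \<noteq> 0" using *(2) by auto
  then show "degree m > 0"
    using *(3) by (metis gr0I degree_0_id poly_const_conv poly_0 degree_eq_zeroE pCons_0_0)
qed

lemma minpoly_dvd:
  assumes B: "subf B" and m: "is_minpoly B c m" and p: "p \<in> polys_over B" "poly p c = 0"
  shows "\<exists>s\<in>polys_over B. p = m * s"
proof -
  obtain s r where sr: "s \<in> polys_over B" "r \<in> polys_over B" "p = m * s + r" "r = 0 \<or> degree r < degree m"
    using polys_over_division[OF B is_minpolyD(1,4)[OF m] p(1)] by auto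
  have "poly r c = 0"
    using sr(3) p(2) is_minpolyD(3)[OF m] by simp
  then have "r = 0"
    using sr is_minpolyD(6)[OF m] by (meson linorder_not_less)
  then show ?thesis using sr by auto
qed

text \<open>Irreducibility in terms of degrees: with \<open>m = q * s\<close> and \<open>q\<close>
  minimal for \<open>r\<close>, the number \<open>c\<close> is a root of \<open>q\<close> or of
  \<open>s\<close>. The second would force \<open>degree m\<close> to be at most
  \<open>degree s\<close>, which is smaller. So \<open>q\<close> has full degree, and
  \<open>m\<close> is minimal for \<open>r\<close> too.\<close>

lemma minpoly_other_root:
  assumes B: "subf B" and m: "is_minpoly B c m" and r: "poly m r = 0"
  shows "is_minpoly B r m"
proof -
  obtain q where q: "is_minpoly B r q"
    using ex_minpoly[OF B, of r] is_minpolyD[OF m] r by (auto simp: alg_over_def)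
  obtain s where s: "s \<in> polys_over B" "m = q * s"
    using minpoly_dvd[OF B q is_minpolyD(1)[OF m] r] by auto
  have ne: "q \<noteq> 0" "s \<noteq> 0" using s is_minpolyD(4)[OF m] by auto
  have deg: "degree m = degree q + degree s" using s ne by (simp add: degree_mult_eq)
  have "poly q c = 0 \<or> poly s c = 0"
    using is_minpolyD(3)[OF m] s by simp
  then have "degree m = degree q"
  proof
    assume "poly q c = 0"
    then show ?thesis using is_minpolyD(6)[OF m is_minpolyD(1)[OF q]] ne deg by simp
  next
    assume "poly s c = 0"
    then show ?thesis using is_minpolyD(6)[OF m s(1)] ne deg is_minpolyD(5)[OF q] by simp
  qed
  then show ?thesis
    using is_minpolyD[OF m] is_minpolyD[OF q] r unfolding is_minpoly_def by auto
qed

text \<open>Characteristic 0: a double root would be a root of the nonzero polynomial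
  \<open>pderiv m\<close> of smaller degree, although \<open>m\<close> is minimal for each of its
  roots.\<close>

lemma minpoly_simple_roots:
  assumes B: "subf B" and m: "is_minpoly B c m"
  shows "(\<Prod>z | poly m z = 0. [:-z, 1:]) = m"
    and "card {z. poly m z = 0} = degree m"
    and "poly m r = 0 \<Longrightarrow> poly (pderiv m) r \<noteq> 0"
proof -
  show *: "poly (pderiv m) r \<noteq> 0" if "poly m r = 0" for r
  proof
    assume "poly (pderiv m) r = 0"
    moreover have "pderiv m \<noteq> 0"
      using is_minpolyD(5)[OF m] by (simp add: pderiv_eq_0_iff)
    ultimately have "degree m \<le> degree (pderiv m)"
      using is_minpolyD(6)[OF minpoly_other_root[OF B m that]] polys_over_pderiv[OF B] is_minpolyD(1)[OF m] by blast
    then show False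
      using is_minpolyD(5)[OF m] by (simp add: degree_pderiv)
  qed
  then have "rsquarefree m"
    by (auto simp: rsquarefree_roots)
  then show eq: "(\<Prod>z | poly m z = 0. [:-z, 1:]) = m"
    using complex_poly_decompose_rsquarefree[of m] is_minpolyD(2)[OF m] by simp
  have "degree (\<Prod>z | poly m z = 0. [:-z, 1:]) = (\<Sum>z | poly m z = 0. degree [:-z, 1:])"
    by (rule degree_prod_eq_sum_degree) auto
  then show "card {z. poly m z = 0} = degree m"
    using eq by simp
qed

text \<open>The ring \<open>B[c]\<close>; for algebraic \<open>c\<close> it is the field generated
  by \<open>c\<close>, by \<open>subf_adj\<close>.\<close>

definition adj :: "complex set \<Rightarrow> complex \<Rightarrow> complex set" where
  "adj B c = (\<lambda>p. poly p c) ` polys_over B"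

lemma adj_contains: "subf B \<Longrightarrow> c \<in> adj B c" "subf B \<Longrightarrow> B \<subseteq> adj B c"
proof -
  assume B: "subf B"
  show "c \<in> adj B c"
    unfolding adj_def using B
    by (intro image_eqI[of _ _ "[:0, 1:]"]) (auto simp: polys_over_pCons_iff subfD polys_over_0)
  show "B \<subseteq> adj B c"
  proof
    fix b assume "b \<in> B"
    then show "b \<in> adj B c"
      unfolding adj_def using B by (intro image_eqI[of _ _ "[:b:]"]) (auto simp: polys_over_const)
  qed
qed

lemma adj_subset: "subf A \<Longrightarrow> subf B \<Longrightarrow> B \<subseteq> A \<Longrightarrow> c \<in> A \<Longrightarrow> adj B c \<subseteq> A"
  by (auto simp: adj_def poly_in_subf)

text \<open>Euclid's algorithm evaluated at \<open>c\<close>: dividing \<open>m\<close> by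
  \<open>p\<close> turns an inverse of \<open>poly r c\<close>, where \<open>r\<close> has smaller
  degree, into one of \<open>poly p c\<close>. The remainder does not vanish at \<open>c\<close>
  because \<open>degree m\<close> is minimal.\<close>

lemma adj_inverse_aux:
  assumes B: "subf B" and m: "is_minpoly B c m"
    and p: "p \<in> polys_over B" "poly p c \<noteq> 0" "degree p < degree m"
  shows "\<exists>q\<in>polys_over B. poly q c * poly p c = 1"
  using p
proof (induction "degree p" arbitrary: p rule: less_induct)
  case less
  show ?case
  proof (cases "degree p = 0")
    case True
    then obtain a where a: "p = [:a:]" by (metis degree_eq_zeroE)
    then have "a \<in> B" "a \<noteq> 0" using less.prems B by (auto simp: polys_over_pCons_iff)
    then show ?thesis
      using a B by (intro bexI[of _ "[:inverse a:]"]) (auto simp: polys_over_const subfD)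
  next
    case False
    have p0: "p \<noteq> 0" using less.prems by auto
    obtain s r where sr: "s \<in> polys_over B" "r \<in> polys_over B" "m = p * s + r" "r = 0 \<or> degree r < degree p"
      using polys_over_division[OF B less.prems(1) p0 is_minpolyD(1)[OF m]] by auto
    have rel: "poly p c * poly s c + poly r c = 0"
      using arg_cong[OF sr(3), of "\<lambda>q. poly q c"] is_minpolyD(3)[OF m] by simp
    have "r \<noteq> 0"
    proof
      assume r: "r = 0"
      then have "s \<noteq> 0" "m = p * s" using sr is_minpolyD(4)[OF m] by auto
      moreover have "poly s c = 0" using rel r less.prems by simp
      ultimately have "degree m \<le> degree s" "degree m = degree p + degree s"
        using is_minpolyD(6)[OF m sr(1)] p0 by (auto simp: degree_mult_eq)
      then show False using False by simp
    qed
    then have "degree r < degree p" using sr by auto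
    moreover have "poly r c \<noteq> 0"
      using is_minpolyD(6)[OF m sr(2)] \<open>r \<noteq> 0\<close> \<open>degree r < degree p\<close> less.prems by auto
    ultimately obtain q where q: "q \<in> polys_over B" "poly q c * poly r c = 1"
      using less.hyps[of r] sr less.prems by auto
    have "poly (- q * s) c * poly p c = poly q c * poly r c"
    proof -
      have "poly p c * poly s c = - poly r c" using rel by (simp add: eq_neg_iff_add_eq_0)
      then show ?thesis by (simp add: mult.assoc) (simp add: mult.commute)
    qed
    then show ?thesis
      using q sr B by (intro bexI[of _ "- q * s"]) (auto intro!: polys_over_mult polys_over_uminus)
  qed
qed

lemma adj_reduce:
  assumes B: "subf B" and m: "is_minpoly B c m" and y: "y \<in> adj B c"
  shows "\<exists>p\<in>polys_over B. y = poly p c \<and> degree p < degree m"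
proof -
  obtain p where p: "p \<in> polys_over B" "y = poly p c" using y by (auto simp: adj_def)
  obtain s r where sr: "s \<in> polys_over B" "r \<in> polys_over B" "p = m * s + r" "r = 0 \<or> degree r < degree m"
    using polys_over_division[OF B is_minpolyD(1,4)[OF m] p(1)] by auto
  then have "y = poly r c" "degree r < degree m"
    using p is_minpolyD(3,5)[OF m] by auto
  then show ?thesis using sr by blast
qed

lemma subf_adj:
  assumes B: "subf B" and "alg_over B c"
  shows "subf (adj B c)"
proof -
  obtain m where m: "is_minpoly B c m" using ex_minpoly[OF assms] ..
  have inv: "inverse y \<in> adj B c" if y: "y \<in> adj B c" for y
  proof (cases "y = 0")
    case False
    obtain p where p: "p \<in> polys_over B" "y = poly p c" "degree p < degree m"
      using adj_reduce[OF B m y] by auto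
    obtain q where q: "q \<in> polys_over B" "poly q c * poly p c = 1"
      using adj_inverse_aux[OF B m p(1) _ p(3)] False p(2) by auto
    have "inverse y = poly q c"
      using q p(2) by (metis inverse_unique mult.commute)
    then show ?thesis using q by (auto simp: adj_def)
  qed (use y in auto)
  show ?thesis
    unfolding subf_def
  proof (intro conjI ballI inv)
    show "0 \<in> adj B c" "1 \<in> adj B c"
      using adj_contains(2)[OF B] subfD[OF B] by auto
    fix x y assume "x \<in> adj B c" "y \<in> adj B c"
    then obtain p q where "p \<in> polys_over B" "q \<in> polys_over B" "x = poly p c" "y = poly q c"
      by (auto simp: adj_def)
    then show "x + y \<in> adj B c" "x * y \<in> adj B c" "x - y \<in> adj B c"
      unfolding adj_def
      using image_eqI[of _ "\<lambda>p. poly p c", OF _ polys_over_add[OF B, of p q]]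
        image_eqI[of _ "\<lambda>p. poly p c", OF _ polys_over_mult[OF B, of p q]]
        image_eqI[of _ "\<lambda>p. poly p c", OF _ polys_over_diff[OF B, of p q]] by simp_all
  qed
qed

section \<open>Embeddings\<close>

text \<open>Being extensional, embeddings that agree on \<open>K\<close> are equal and can be
  counted. They preserve 1 because they fix \<open>B\<close>.\<close>

definition embs :: "complex set \<Rightarrow> complex set \<Rightarrow> (complex \<Rightarrow> complex) set" where
  "embs B K = {\<sigma> \<in> extensional K. (\<forall>x\<in>K. \<forall>y\<in>K. \<sigma> (x + y) = \<sigma> x + \<sigma> y \<and> \<sigma> (x * y) = \<sigma> x * \<sigma> y) \<and>
     (\<forall>b\<in>B. \<sigma> b = b)}"

lemma embsD:
  assumes "\<sigma> \<in> embs B K"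
  shows "\<sigma> \<in> extensional K" "\<And>x y. x \<in> K \<Longrightarrow> y \<in> K \<Longrightarrow> \<sigma> (x + y) = \<sigma> x + \<sigma> y"
    "\<And>x y. x \<in> K \<Longrightarrow> y \<in> K \<Longrightarrow> \<sigma> (x * y) = \<sigma> x * \<sigma> y" "\<And>b. b \<in> B \<Longrightarrow> \<sigma> b = b"
  using assms by (auto simp: embs_def)

context
  fixes B K assumes B: "subf B" and K: "subf K" and BK: "B \<subseteq> K"
begin

lemma emb_simps:
  assumes "\<sigma> \<in> embs B K"
  shows "\<sigma> 0 = 0" "\<sigma> 1 = 1" "\<And>x. x \<in> K \<Longrightarrow> \<sigma> (- x) = - \<sigma> x"
    "\<And>x y. x \<in> K \<Longrightarrow> y \<in> K \<Longrightarrow> \<sigma> (x - y) = \<sigma> x - \<sigma> y"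
    "\<And>x. x \<in> K \<Longrightarrow> \<sigma> x = 0 \<longleftrightarrow> x = 0"
    "\<And>x. x \<in> K \<Longrightarrow> \<sigma> (inverse x) = inverse (\<sigma> x)"
    "\<And>x n. x \<in> K \<Longrightarrow> \<sigma> (x ^ n) = \<sigma> x ^ n"
    "\<And>x y. x \<in> K \<Longrightarrow> y \<in> K \<Longrightarrow> \<sigma> (x / y) = \<sigma> x / \<sigma> y"
proof -
  note e = embsD[OF assms]
  show 01: "\<sigma> 0 = 0" "\<sigma> 1 = 1" using e(4) subfD[OF B] by auto
  show neg: "\<sigma> (- x) = - \<sigma> x" if "x \<in> K" for x
    using e(2)[of x "-x"] that 01 subfD(8)[OF K] by (simp add: eq_neg_iff_add_eq_0 add.commute)
  show "\<sigma> (x - y) = \<sigma> x - \<sigma> y" if "x \<in> K" "y \<in> K" for x y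
    using e(2)[of x "-y"] neg that subfD(8)[OF K] by simp
  have inv: "\<sigma> x * \<sigma> (inverse x) = 1" if "x \<in> K" "x \<noteq> 0" for x
    using e(3)[of x "inverse x"] that 01 subfD(6)[OF K] by simp
  show nz: "\<sigma> x = 0 \<longleftrightarrow> x = 0" if "x \<in> K" for x
    using inv[OF that] 01 by fastforce
  show iv: "\<sigma> (inverse x) = inverse (\<sigma> x)" if "x \<in> K" for x
    using inv[OF that] 01 by (cases "x = 0") (auto simp: inverse_unique)
  show "\<sigma> (x ^ n) = \<sigma> x ^ n" if "x \<in> K" for x n
    using that by (induction n) (auto simp: 01 e(3) subfD(9)[OF K])
  show "\<sigma> (x / y) = \<sigma> x / \<sigma> y" if "x \<in> K" "y \<in> K" for x y
    using that by (simp add: divide_inverse e(3) iv subfD(6)[OF K])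
qed

lemma emb_sum: "\<sigma> \<in> embs B K \<Longrightarrow> (\<And>i. i \<in> I \<Longrightarrow> f i \<in> K) \<Longrightarrow> \<sigma> (sum f I) = (\<Sum>i\<in>I. \<sigma> (f i))"
proof (induction I rule: infinite_finite_induct)
  case (insert x F)
  then show ?case using embsD(2)[OF insert(4)] subf_sum[OF K, of F f] by simp
qed (auto simp: emb_simps)

lemma emb_prod: "\<sigma> \<in> embs B K \<Longrightarrow> (\<And>i. i \<in> I \<Longrightarrow> f i \<in> K) \<Longrightarrow> \<sigma> (prod f I) = (\<Prod>i\<in>I. \<sigma> (f i))"
proof (induction I rule: infinite_finite_induct)
  case (insert x F)
  then show ?case using embsD(3)[OF insert(4)] subf_prod[OF K, of F f] by simp
qed (auto simp: emb_simps)

lemma emb_inj: "\<sigma> \<in> embs B K \<Longrightarrow> inj_on \<sigma> K"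
proof (rule inj_onI)
  fix x y assume "\<sigma> \<in> embs B K" "x \<in> K" "y \<in> K" "\<sigma> x = \<sigma> y"
  then have "x - y = 0"
    using emb_simps(4,5)[of \<sigma>] subfD(5)[OF K] by (metis diff_self)
  then show "x = y" by simp
qed

lemma emb_poly:
  assumes s: "\<sigma> \<in> embs B K" and p: "p \<in> polys_over K" and x: "x \<in> K"
  shows "\<sigma> (poly p x) = poly (map_poly \<sigma> p) (\<sigma> x)"
  using p
proof (induction p)
  case (pCons a p)
  have pK: "poly p x \<in> K" using pCons x K polys_over_pCons_iff poly_in_subf by blast
  have aK: "a \<in> K" using pCons K polys_over_pCons_iff by blast
  show ?case
    using pCons pK aK x K embsD(2,3)[OF s] emb_simps(1)[OF s]
    by (simp add: map_poly_pCons polys_over_pCons_iff subfD)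
qed (auto simp: emb_simps(1)[OF s])

lemma emb_poly_over:
  assumes s: "\<sigma> \<in> embs B K" and p: "p \<in> polys_over B" and x: "x \<in> K"
  shows "\<sigma> (poly p x) = poly p (\<sigma> x)"
proof -
  have "map_poly \<sigma> p = p"
    using p embsD(4)[OF s] by (intro poly_eqI) (auto simp: coeff_map_poly emb_simps(1)[OF s] polys_over_def)
  then show ?thesis using emb_poly[OF s _ x, of p] p polys_over_mono[OF BK] by auto
qed

lemma emb_map_poly_mult:
  assumes s: "\<sigma> \<in> embs B K" and p: "p \<in> polys_over K" "q \<in> polys_over K"
  shows "map_poly \<sigma> (p * q) = map_poly \<sigma> p * map_poly \<sigma> q"
proof (rule poly_eqI)
  fix n
  have "\<sigma> (\<Sum>i\<le>n. coeff p i * coeff q (n - i)) = (\<Sum>i\<le>n. \<sigma> (coeff p i * coeff q (n - i)))"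
    using p by (intro emb_sum[OF s]) (auto simp: polys_over_def subfD[OF K])
  also have "\<dots> = (\<Sum>i\<le>n. \<sigma> (coeff p i) * \<sigma> (coeff q (n - i)))"
    using p by (intro sum.cong) (auto simp: polys_over_def embsD(3)[OF s])
  finally show "coeff (map_poly \<sigma> (p * q)) n = coeff (map_poly \<sigma> p * map_poly \<sigma> q) n"
    by (simp add: coeff_map_poly emb_simps(1)[OF s] coeff_mult)
qed

lemma emb_map_poly_prod:
  assumes s: "\<sigma> \<in> embs B K" and p: "\<And>i. i \<in> I \<Longrightarrow> f i \<in> polys_over K"
  shows "map_poly \<sigma> (prod f I) = (\<Prod>i\<in>I. map_poly \<sigma> (f i))"
  using p
proof (induction I rule: infinite_finite_induct)
  case (insert x F)
  then show ?case
    using emb_map_poly_mult[OF s, of "f x" "prod f F"] polys_over_prod[OF K, of F f] by simp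
qed (auto simp: map_poly_1 emb_simps(2)[OF s])

lemma emb_comp:
  assumes s: "\<sigma> \<in> embs B K" and t: "\<tau> \<in> embs B M" and M: "subf M" and im: "\<tau> ` M \<subseteq> K" and BM: "B \<subseteq> M"
  shows "restrict (\<sigma> \<circ> \<tau>) M \<in> embs B M"
proof -
  have i: "\<tau> x \<in> K" if "x \<in> M" for x using im that by auto
  have "\<sigma> (\<tau> (x + y)) = \<sigma> (\<tau> x) + \<sigma> (\<tau> y)" "\<sigma> (\<tau> (x * y)) = \<sigma> (\<tau> x) * \<sigma> (\<tau> y)"
    if "x \<in> M" "y \<in> M" for x y
    using that i embsD(2,3)[OF s] embsD(2,3)[OF t] by simp_all
  moreover have "\<sigma> (\<tau> b) = b" if "b \<in> B" for b
    using that embsD(4)[OF s] embsD(4)[OF t] by simp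
  ultimately show ?thesis
    using BM subfD(3,4)[OF M] by (auto simp: embs_def)
qed

end

lemma emb_id: "subf K \<Longrightarrow> B \<subseteq> K \<Longrightarrow> restrict id K \<in> embs B K"
  by (auto simp: embs_def subfD)

lemma emb_mono: "\<sigma> \<in> embs B K \<Longrightarrow> A \<subseteq> B \<Longrightarrow> \<sigma> \<in> embs A K"
  by (auto simp: embs_def)

context
  fixes B c m assumes B: "subf B" and m: "is_minpoly B c m"
begin

lemma alg_over_gen: "alg_over B c"
  using is_minpolyD[OF m] by (auto simp: alg_over_def)

lemma emb_root: "\<sigma> \<in> embs B (adj B c) \<Longrightarrow> poly m (\<sigma> c) = 0"
  using emb_poly_over[OF B subf_adj[OF B alg_over_gen] adj_contains(2)[OF B], of \<sigma> m c]
    is_minpolyD(1,3)[OF m] adj_contains(1)[OF B] emb_simps(1)[OF B subf_adj[OF B alg_over_gen] adj_contains(2)[OF B], of \<sigma>] by simp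

lemma emb_determined: "\<sigma> \<in> embs B (adj B c) \<Longrightarrow> p \<in> polys_over B \<Longrightarrow> \<sigma> (poly p c) = poly p (\<sigma> c)"
  using emb_poly_over[OF B subf_adj[OF B alg_over_gen] adj_contains(2)[OF B] _ _ adj_contains(1)[OF B]] by blast

text \<open>Two polynomials with the same value at \<open>c\<close> differ by a multiple of
  \<open>m\<close> and hence agree at \<open>r\<close>; so the choice of a representative in
  \<open>\<sigma>\<close> is immaterial.\<close>

lemma emb_exists:
  assumes r: "poly m r = 0"
  shows "\<exists>\<sigma>\<in>embs B (adj B c). \<sigma> c = r"
proof -
  define \<sigma> where "\<sigma> = (\<lambda>y\<in>adj B c. poly (SOME p. p \<in> polys_over B \<and> poly p c = y) r)"
  have s: "\<sigma> (poly p c) = poly p r" if "p \<in> polys_over B" for p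
  proof -
    define q where "q = (SOME q. q \<in> polys_over B \<and> poly q c = poly p c)"
    have q: "q \<in> polys_over B" "poly q c = poly p c"
      using someI_ex[of "\<lambda>q. q \<in> polys_over B \<and> poly q c = poly p c"] that unfolding q_def by auto
    have "\<exists>s\<in>polys_over B. p - q = m * s"
      using minpoly_dvd[OF B m] polys_over_diff[OF B that q(1)] q by auto
    then have "poly p r = poly q r"
      using r by (metis diff_eq_eq add_0 mult_zero_left poly_diff poly_mult)
    then show ?thesis using that by (simp add: \<sigma>_def q_def adj_def)
  qed
  have "\<sigma> \<in> embs B (adj B c)"
    unfolding embs_def
  proof (intro CollectI conjI ballI)
    show "\<sigma> \<in> extensional (adj B c)" by (simp add: \<sigma>_def)
    fix x y assume "x \<in> adj B c" "y \<in> adj B c"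
    then obtain p q where pq: "p \<in> polys_over B" "q \<in> polys_over B" "x = poly p c" "y = poly q c"
      by (auto simp: adj_def)
    show "\<sigma> (x + y) = \<sigma> x + \<sigma> y"
      using s[of "p + q"] s pq polys_over_add[OF B] by simp
    show "\<sigma> (x * y) = \<sigma> x * \<sigma> y"
      using s[of "p * q"] s pq polys_over_mult[OF B] by simp
  next
    fix b assume "b \<in> B"
    then show "\<sigma> b = b" using s[of "[:b:]"] polys_over_const[OF B] by simp
  qed
  moreover have "\<sigma> c = r"
    using s[of "[:0, 1:]"] by (simp add: polys_over_pCons_iff B subfD polys_over_0)
  ultimately show ?thesis by blast
qed

lemma embs_bij: "bij_betw (\<lambda>\<sigma>. \<sigma> c) (embs B (adj B c)) {r. poly m r = 0}"
  unfolding bij_betw_def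
proof (intro conjI inj_onI)
  fix \<sigma> \<tau> assume st: "\<sigma> \<in> embs B (adj B c)" "\<tau> \<in> embs B (adj B c)" "\<sigma> c = \<tau> c"
  show "\<sigma> = \<tau>"
  proof (rule extensionalityI[OF embsD(1)[OF st(1)] embsD(1)[OF st(2)]])
    fix x assume "x \<in> adj B c"
    then obtain p where "p \<in> polys_over B" "x = poly p c" by (auto simp: adj_def)
    then show "\<sigma> x = \<tau> x" using emb_determined[OF st(1)] emb_determined[OF st(2)] st(3) by simp
  qed
next
  show "(\<lambda>\<sigma>. \<sigma> c) ` embs B (adj B c) = {r. poly m r = 0}"
    using emb_root emb_exists by blast
qed

lemma finite_embs: "finite (embs B (adj B c))"
  using bij_betw_finite[OF embs_bij] poly_roots_finite[OF is_minpolyD(4)[OF m]] by simp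

text \<open>Represent \<open>y\<close> by \<open>p\<close> of degree below \<open>degree m\<close>.
  As all embeddings fix \<open>y\<close>, the polynomial \<open>p - [:y:]\<close> vanishes at all
  \<open>degree m\<close> conjugates of \<open>c\<close> and must be 0. This takes the place of the
  fixed field theorem.\<close>

lemma fixed_in_base:
  assumes y: "y \<in> adj B c" and fx: "\<And>\<sigma>. \<sigma> \<in> embs B (adj B c) \<Longrightarrow> \<sigma> y = y"
  shows "y \<in> B"
proof -
  obtain p where p: "p \<in> polys_over B" "y = poly p c" "degree p < degree m"
    using adj_reduce[OF B m y] by auto
  have "poly (p - [:y:]) r = 0" if "poly m r = 0" for r
    using emb_exists[OF that] emb_determined[OF _ p(1)] fx p(2) by auto
  then have sub: "{r. poly m r = 0} \<subseteq> {r. poly (p - [:y:]) r = 0}" by auto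
  have "p - [:y:] = 0"
  proof (rule ccontr)
    assume ne: "p - [:y:] \<noteq> 0"
    have "degree m \<le> card {r. poly (p - [:y:]) r = 0}"
      using card_mono[OF poly_roots_finite[OF ne] sub] minpoly_simple_roots(2)[OF B m] by simp
    also have "\<dots> \<le> degree (p - [:y:])"
      using ne card_poly_roots_bound by blast
    also have "\<dots> < degree m"
      using p(3) degree_diff_le_max[of p "[:y:]"] by auto
    finally show False by simp
  qed
  then have "p = [:y:]" by simp
  then show ?thesis using p(1) polys_over_pCons_iff[OF B] by blast
qed

end

section \<open>Number fields\<close>

interpretation QV: vector_space "\<lambda>(q::rat) (x::complex). of_rat q * x"
  by unfold_locales (auto simp: algebra_simps of_rat_add of_rat_mult)

lemma QV_span_scale: "r \<in> \<rat> \<Longrightarrow> x \<in> QV.span S \<Longrightarrow> r * x \<in> QV.span S"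
  by (erule Rats_cases) (auto intro: QV.span_scale)

text \<open>If the powers of \<open>c\<close> are pairwise distinct, they form an infinite set in a
  space of finite dimension, hence a dependent one; a repeated power gives a relation at
  once.\<close>

lemma algebraic_if_powers_span:
  assumes S: "finite S" and pw: "\<And>n. c ^ n \<in> QV.span S"
  shows "algebraic (c :: complex)"
proof (cases "inj (\<lambda>n::nat. c ^ n)")
  case False
  then obtain i j where ij: "i \<noteq> j" "c ^ i = c ^ j" by (auto simp: inj_def)
  show ?thesis
  proof (rule algebraicI')
    show "monom 1 i - monom 1 j \<noteq> (0 :: complex poly)"
      using ij(1) by (auto simp: monom_eq_iff')
    show "poly (monom 1 i - monom 1 j) c = 0" using ij by (simp add: poly_monom)
  qed auto
next
  case True
  define T where "T = range (\<lambda>n::nat. c ^ n)"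
  have "infinite T" using True by (simp add: T_def finite_image_iff)
  then have "QV.dependent T"
    using QV.independent_span_bound[OF S, of T] pw by (auto simp: T_def)
  then obtain t u where t: "finite t" "t \<subseteq> T" "(\<Sum>v\<in>t. of_rat (u v) * v) = 0" "\<exists>v\<in>t. u v \<noteq> 0"
    unfolding QV.dependent_explicit by auto
  define I where "I = {n. c ^ n \<in> t}"
  have tI: "t = (\<lambda>n. c ^ n) ` I" using t(2) by (auto simp: I_def T_def)
  have finI: "finite I"
    using t(1) True unfolding tI by (metis finite_image_iff inj_on_subset subset_UNIV)
  define p where "p = (\<Sum>n\<in>I. monom (of_rat (u (c ^ n)) :: complex) n)"
  have cf: "coeff p n = (if n \<in> I then of_rat (u (c ^ n)) else 0)" for n
    unfolding p_def using finI by (simp add: coeff_sum)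
  show ?thesis
  proof (rule algebraicI')
    show "coeff p i \<in> \<rat>" for i by (simp add: cf)
    obtain n where "n \<in> I" "u (c ^ n) \<noteq> 0" using t(4) tI by auto
    then have "coeff p n \<noteq> 0" by (simp add: cf)
    then show "p \<noteq> 0" by auto
    have "poly p c = (\<Sum>n\<in>I. of_rat (u (c ^ n)) * c ^ n)"
      by (simp add: p_def poly_sum poly_monom)
    also have "\<dots> = (\<Sum>v\<in>t. of_rat (u v) * v)"
      unfolding tI using True by (subst sum.reindex) (auto intro: inj_on_subset)
    finally show "poly p c = 0" using t(3) by simp
  qed
qed

lemma power_in_span:
  assumes m: "is_minpoly \<rat> a m"
  shows "a ^ i \<in> QV.span ((\<lambda>k. a ^ k) ` {..<degree m})"
proof -
  have "a ^ i \<in> adj \<rat> a"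
    unfolding adj_def by (intro image_eqI[of _ _ "monom 1 i"]) (auto simp: poly_monom polys_over_def)
  then obtain p where p: "p \<in> polys_over \<rat>" "a ^ i = poly p a" "degree p < degree m"
    using adj_reduce[OF subf_Rats m] by blast
  have "poly p a = (\<Sum>k\<le>degree p. coeff p k * a ^ k)"
    by (simp add: poly_altdef)
  also have "\<dots> \<in> QV.span ((\<lambda>k. a ^ k) ` {..<degree m})"
    using p(1,3) by (intro QV.span_sum QV_span_scale QV.span_base) (auto simp: polys_over_def)
  finally show ?thesis using p(2) by simp
qed

text \<open>The sum has the shape of a primitive element. Its powers lie in the span of the finitely
  many products \<open>a ^ i * b ^ j\<close>.\<close>

lemma algebraic_lincomb:
  assumes a: "algebraic a" and b: "algebraic b"
  shows "algebraic (a + of_nat l * b :: complex)"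
proof -
  obtain f where f: "is_minpoly \<rat> a f" using a ex_minpoly[OF subf_Rats] by (auto simp: alg_over_Rats)
  obtain g where g: "is_minpoly \<rat> b g" using b ex_minpoly[OF subf_Rats] by (auto simp: alg_over_Rats)
  define S where "S = (\<lambda>(i, j). a ^ i * b ^ j) ` ({..<degree f} \<times> {..<degree g})"
  have right: "y \<in> QV.span ((\<lambda>k. b ^ k) ` {..<degree g}) \<Longrightarrow> i < degree f \<Longrightarrow> a ^ i * y \<in> QV.span S" for i y
  proof (induction rule: QV.span_induct_alt)
    case (step c x y)
    then obtain j where j: "j < degree g" "x = b ^ j" by auto
    have "a ^ i * x \<in> QV.span S"
      using j step(3) unfolding S_def by (intro QV.span_base) auto
    then have "of_rat c * (a ^ i * x) + a ^ i * y \<in> QV.span S"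
      using step by (intro QV.span_add QV.span_scale) auto
    then show ?case by (simp add: algebra_simps)
  qed (auto intro: QV.span_zero)
  have left: "x \<in> QV.span ((\<lambda>k. a ^ k) ` {..<degree f}) \<Longrightarrow>
      y \<in> QV.span ((\<lambda>k. b ^ k) ` {..<degree g}) \<Longrightarrow> x * y \<in> QV.span S" for x y
  proof (induction rule: QV.span_induct_alt)
    case (step c z x)
    then obtain j where j: "j < degree f" "z = a ^ j" by auto
    have "of_rat c * (z * y) + x * y \<in> QV.span S"
      using step j right by (intro QV.span_add QV.span_scale) auto
    then show ?case by (simp add: algebra_simps)
  qed (auto intro: QV.span_zero)
  show ?thesis
  proof (rule algebraic_if_powers_span)
    show "finite S" by (simp add: S_def)
    fix n
    have "(a + of_nat l * b) ^ n = (\<Sum>k\<le>n. (of_nat (n choose k) * of_nat (l ^ (n - k))) * (a ^ k * b ^ (n - k)))"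
      by (simp add: binomial_ring power_mult_distrib algebra_simps)
    also have "\<dots> \<in> QV.span S"
      by (intro QV.span_sum QV_span_scale left power_in_span[OF f] power_in_span[OF g]) auto
    finally show "(a + of_nat l * b) ^ n \<in> QV.span S" .
  qed
qed

text \<open>A polynomial over \<open>A\<close> of minimal degree vanishing at \<open>b\<close> divides both \<open>g\<close> and
  \<open>f (c - l X)\<close>; for suitable \<open>l\<close> these have only the simple common root \<open>b\<close>.\<close>

lemma primitive_element:
  assumes a: "algebraic a" and b: "algebraic b"
  shows "\<exists>c. algebraic c \<and> a \<in> adj \<rat> c \<and> b \<in> adj \<rat> c \<and> (\<forall>A. subf A \<longrightarrow> a \<in> A \<longrightarrow> b \<in> A \<longrightarrow> c \<in> A)"
proof -
  obtain f where f: "is_minpoly \<rat> a f" using a ex_minpoly[OF subf_Rats] by (auto simp: alg_over_Rats)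
  obtain g where g: "is_minpoly \<rat> b g" using b ex_minpoly[OF subf_Rats] by (auto simp: alg_over_Rats)
  \<comment> \<open>The values of \<open>l\<close> for which another pair of conjugates satisfies
    \<open>a' + l * b' = a + l * b\<close>. Pairs with \<open>b' = b\<close> contribute only 0,
    since division by 0 yields 0.\<close>
  define bad where "bad = (\<lambda>(a', b'). (a' - a) / (b - b')) ` ({x. poly f x = 0} \<times> {x. poly g x = 0})"
  have "finite bad"
    using poly_roots_finite[OF is_minpolyD(4)[OF f]] poly_roots_finite[OF is_minpolyD(4)[OF g]]
    by (simp add: bad_def)
  moreover have "infinite (range (of_nat :: nat \<Rightarrow> complex))"
    using infinite_UNIV_nat by (simp add: finite_image_iff inj_of_nat)
  ultimately have "\<not> range (of_nat :: nat \<Rightarrow> complex) \<subseteq> bad" by (meson finite_subset)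
  then obtain l :: nat where l: "of_nat l \<notin> bad" by auto
  define c where "c = a + of_nat l * b"
  have c: "algebraic c" unfolding c_def by (rule algebraic_lincomb[OF a b])
  define A where "A = adj \<rat> c"
  have A: "subf A" unfolding A_def using c by (intro subf_adj subf_Rats) (simp add: alg_over_Rats)
  have QA: "\<rat> \<subseteq> A" using Rats_subset[OF A] .
  have cA: "c \<in> A" unfolding A_def by (rule adj_contains(1)[OF subf_Rats])
  define h where "h = pcompose f [:c, - of_nat l:]"
  have fA: "f \<in> polys_over A" and gA: "g \<in> polys_over A"
    using is_minpolyD(1)[OF f] is_minpolyD(1)[OF g] polys_over_mono[OF QA] by auto
  have hA: "h \<in> polys_over A"
    unfolding h_def using A cA fA
    by (intro polys_over_pcompose[OF A]) (auto simp: polys_over_pCons_iff polys_over_0 subfD subf_of_nat)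
  have "alg_over A b"
    unfolding alg_over_def using gA is_minpolyD(3,4)[OF g] by auto
  then obtain r where r: "is_minpoly A b r" using ex_minpoly[OF A] by blast
  have hb: "poly h b = 0"
    using is_minpolyD(3)[OF f] by (simp add: h_def poly_pcompose c_def algebra_simps)
  obtain s1 where s1: "g = r * s1" using minpoly_dvd[OF A r gA is_minpolyD(3)[OF g]] by auto
  obtain s2 where s2: "h = r * s2" using minpoly_dvd[OF A r hA hb] by auto
  have only: "z = b" if z: "poly r z = 0" for z
  proof (rule ccontr)
    assume ne: "z \<noteq> b"
    have gz: "poly g z = 0" and hz: "poly h z = 0" using s1 s2 z by auto
    define a' where "a' = c - of_nat l * z"
    have "poly f a' = 0" using hz by (simp add: h_def poly_pcompose a'_def algebra_simps)
    moreover have "of_nat l = (a' - a) / (b - z)"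
    proof -
      have "a' - a = of_nat l * (b - z)" by (simp add: a'_def c_def right_diff_distrib)
      then show ?thesis using ne by simp
    qed
    ultimately have "of_nat l \<in> bad" using gz unfolding bad_def by (intro image_eqI[of _ _ "(a', z)"]) simp_all
    then show False using l by blast
  qed
  have "{z. poly r z = 0} = {b}"
    using is_minpolyD(3)[OF r] only by blast
  then have "r = [:- b, 1:]" using minpoly_simple_roots(1)[OF A r] by simp
  then have "- b \<in> A" using is_minpolyD(1)[OF r] polys_over_pCons_iff[OF A] by blast
  then have bA: "b \<in> A" using subfD(8)[OF A, of "- b"] by simp
  have "c - of_nat l * b \<in> A" using A cA bA by (simp add: subfD subf_of_nat)
  then have "a \<in> A" by (simp add: c_def)
  then show ?thesis
    using c bA unfolding A_def by (intro exI[of _ c]) (auto simp: c_def subfD subf_of_nat)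
qed

text \<open>The last clause makes \<open>adj \<rat> c\<close> the smallest field containing
  \<open>S\<close>; \<open>number_field_iff\<close> and \<open>normal_closure\<close> use it to
  reach \<open>c\<close> from the members of \<open>S\<close>.\<close>

lemma primitive_element_set:
  assumes "finite S" and "\<And>x. x \<in> S \<Longrightarrow> algebraic x"
  shows "\<exists>c. algebraic c \<and> S \<subseteq> adj \<rat> c \<and> (\<forall>A. subf A \<longrightarrow> S \<subseteq> A \<longrightarrow> c \<in> A)"
  using assms
proof (induction S)
  case empty
  then show ?case by (intro exI[of _ 0]) (auto simp: subfD)
next
  case (insert x S)
  obtain c where c: "algebraic c" "S \<subseteq> adj \<rat> c" "\<And>A. subf A \<Longrightarrow> S \<subseteq> A \<Longrightarrow> c \<in> A"
    using insert by auto
  obtain d where d: "algebraic d" "x \<in> adj \<rat> d" "c \<in> adj \<rat> d" "\<And>A. subf A \<Longrightarrow> x \<in> A \<Longrightarrow> c \<in> A \<Longrightarrow> d \<in> A"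
    using primitive_element[of x c] insert.prems c(1) by auto
  have sd: "subf (adj \<rat> d)" using d(1) by (intro subf_adj subf_Rats) (simp add: alg_over_Rats)
  have "adj \<rat> c \<subseteq> adj \<rat> d" using d sd by (intro adj_subset subf_Rats Rats_subset)
  then show ?case using c d by (intro exI[of _ d]) auto
qed

section \<open>Link with the fields of HOL-Algebra\<close>

lemma complex_field_simps [simp]:
  "carrier complex_field = UNIV" "x \<otimes>\<^bsub>complex_field\<^esub> y = x * y" "x \<oplus>\<^bsub>complex_field\<^esub> y = x + y"
  "\<one>\<^bsub>complex_field\<^esub> = 1" "\<zero>\<^bsub>complex_field\<^esub> = 0"
  by (auto simp: ring_of_type_algebra_def)

lemma field_complex: "field complex_field" by (rule field_from_type_algebra)

interpretation CF: cring complex_field by (rule cring_from_type_algebra)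

lemma complex_field_inv: "x \<noteq> 0 \<Longrightarrow> inv\<^bsub>complex_field\<^esub> x = inverse x"
  by (rule CF.comm_inv_char) auto

lemma complex_field_a_inv: "\<ominus>\<^bsub>complex_field\<^esub> x = - x"
  by (rule CF.minus_equality) auto

lemma subfield_complex_iff: "subfield K complex_field \<longleftrightarrow> subf K"
proof
  assume K: "subfield K complex_field"
  note p = CF.subring_props[OF K]
  have inv: "inverse x \<in> K" if "x \<in> K" for x
    using CF.subfield_m_inv(1)[OF K, of x] that by (cases "x = 0") (auto simp: complex_field_inv)
  have neg: "- x \<in> K" if "x \<in> K" for x
    using p(5)[OF that] by (simp add: complex_field_a_inv)
  have "x - y \<in> K" if "x \<in> K" "y \<in> K" for x y
    using p(7)[of x "-y"] neg that by simp
  then show "subf K" using p inv by (auto simp: subf_def)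
next
  assume K: "subf K"
  show "subfield K complex_field"
  proof (rule field.subfieldI'[OF field_complex CF.subringI])
    show "inv\<^bsub>complex_field\<^esub> k \<in> K" if "k \<in> K - {\<zero>\<^bsub>complex_field\<^esub>}" for k
      using that K by (auto simp: complex_field_inv subfD)
  qed (use K in \<open>auto simp: subfD complex_field_a_inv\<close>)
qed

lemma Span_Rats: "CF.Span \<rat> Us = QV.span (set Us)"
proof (induction Us)
  case (Cons u Us)
  have "x \<in> CF.Span \<rat> (u # Us) \<longleftrightarrow> x \<in> QV.span (set (u # Us))" for x
  proof -
    have "x \<in> CF.Span \<rat> (u # Us) \<longleftrightarrow> (\<exists>k\<in>\<rat>. \<exists>v\<in>QV.span (set Us). x = k * u + v)"
      using CF.line_extension_mem_iff[of x \<rat> u "CF.Span \<rat> Us"] Cons by simp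
    also have "\<dots> \<longleftrightarrow> (\<exists>k. x - of_rat k * u \<in> QV.span (set Us))"
    proof safe
      fix k v assume "k \<in> \<rat>" "v \<in> QV.span (set Us)" "x = k * u + v"
      then obtain q where "k = of_rat q" by (auto elim: Rats_cases)
      then show "\<exists>q. k * u + v - of_rat q * u \<in> QV.span (set Us)"
        using \<open>v \<in> _\<close> by (intro exI[of _ q]) auto
    next
      fix k assume "x - of_rat k * u \<in> QV.span (set Us)"
      then show "\<exists>k\<in>\<rat>. \<exists>v\<in>QV.span (set Us). x = k * u + v"
        by (intro bexI[of _ "of_rat k"] bexI[of _ "x - of_rat k * u"]) auto
    qed
    finally show ?thesis by (simp add: QV.span_breakdown_eq)
  qed
  then show ?case by blast
qed auto

lemma number_field_Span:
  assumes "number_field K"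
  shows "\<exists>Us. CF.Span \<rat> Us = K"
proof -
  obtain n where "CF.dimension n \<rat> K"
    using assms by (auto simp: number_field_def CF.finite_dimension_def)
  then show ?thesis using CF.exists_base subf_Rats subfield_complex_iff by metis
qed

text \<open>A finite spanning list has a primitive element; conversely the powers of
  \<open>c\<close> below the degree of its minimal polynomial span. From here on number fields are
  handled as simple extensions of \<open>\<rat>\<close>.\<close>

lemma number_field_iff: "number_field K \<longleftrightarrow> (\<exists>c. algebraic c \<and> K = adj \<rat> c)"
proof
  assume K: "number_field K"
  then have sK: "subf K" by (simp add: number_field_def subfield_complex_iff)
  obtain Us where Us: "CF.Span \<rat> Us = K"
    using number_field_Span[OF K] by blast
  then have span: "QV.span (set Us) = K" using Span_Rats by metis
  have alg: "algebraic x" if "x \<in> K" for x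
    using that span subfD(9)[OF sK] by (intro algebraic_if_powers_span[of "set Us"]) auto
  have "set Us \<subseteq> K" using span QV.span_superset by blast
  then obtain c where c: "algebraic c" "set Us \<subseteq> adj \<rat> c" "\<And>A. subf A \<Longrightarrow> set Us \<subseteq> A \<Longrightarrow> c \<in> A"
    using primitive_element_set[of "set Us"] alg by auto
  have sc: "subf (adj \<rat> c)" using c(1) by (intro subf_adj subf_Rats) (simp add: alg_over_Rats)
  have "K \<subseteq> adj \<rat> c"
    unfolding span[symmetric]
    by (rule QV.span_minimal[OF c(2)]) (auto simp: QV.subspace_def subfD[OF sc] subsetD[OF Rats_subset[OF sc]])
  moreover have "adj \<rat> c \<subseteq> K"
    using c(3)[OF sK \<open>set Us \<subseteq> K\<close>] by (intro adj_subset sK subf_Rats Rats_subset)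
  ultimately show "\<exists>c. algebraic c \<and> K = adj \<rat> c" using c(1) by blast
next
  assume "\<exists>c. algebraic c \<and> K = adj \<rat> c"
  then obtain c where c: "algebraic c" "K = adj \<rat> c" by auto
  obtain m where m: "is_minpoly \<rat> c m" using c ex_minpoly[OF subf_Rats] by (auto simp: alg_over_Rats)
  have sK: "subf K" unfolding c(2) using c(1) by (intro subf_adj subf_Rats) (simp add: alg_over_Rats)
  define Us where "Us = map (\<lambda>k. c ^ k) [0..<degree m]"
  have set_Us: "set Us = (\<lambda>k. c ^ k) ` {..<degree m}" by (auto simp: Us_def)
  have cK: "c \<in> K" unfolding c(2) by (rule adj_contains(1)[OF subf_Rats])
  have "QV.span (set Us) = K"
  proof
    show "QV.span (set Us) \<subseteq> K"
      by (rule QV.span_minimal)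
        (auto simp: set_Us QV.subspace_def subfD[OF sK] cK subsetD[OF Rats_subset[OF sK]])
    show "K \<subseteq> QV.span (set Us)"
    proof
      fix x assume "x \<in> K"
      then obtain p where p: "p \<in> polys_over \<rat>" "x = poly p c" by (auto simp: c(2) adj_def)
      show "x \<in> QV.span (set Us)"
        unfolding p(2) poly_altdef set_Us using p(1)
        by (intro QV.span_sum QV_span_scale power_in_span[OF m]) (auto simp: polys_over_def)
    qed
  qed
  then have "CF.finite_dimension \<rat> K"
    using CF.Span_finite_dimension[of \<rat> Us] Span_Rats[of Us]
    by (simp del: CF.Span.simps add: subfield_complex_iff subf_Rats)
  then show "number_field K"
    using sK by (simp add: number_field_def subfield_complex_iff)
qed

lemma number_field_subf: "number_field K \<Longrightarrow> subf K"
  by (simp add: number_field_def subfield_complex_iff)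

lemma number_field_algebraic: "number_field K \<Longrightarrow> x \<in> K \<Longrightarrow> algebraic x"
proof -
  assume "number_field K" "x \<in> K"
  then obtain Us where Us: "CF.Span \<rat> Us = K"
    using number_field_Span by blast
  then show ?thesis
    using subfD(9)[OF number_field_subf[OF \<open>number_field K\<close>] \<open>x \<in> K\<close>]
    by (intro algebraic_if_powers_span[of "set Us"]) (simp_all del: CF.Span.simps add: Span_Rats[symmetric])
qed

lemma number_field_containing:
  assumes "finite S" "\<And>x. x \<in> S \<Longrightarrow> algebraic x"
  shows "\<exists>K. number_field K \<and> S \<subseteq> K"
  using primitive_element_set[OF assms] number_field_iff by auto

lemma number_field_extending:
  assumes "number_field k" "finite S" "\<And>x. x \<in> S \<Longrightarrow> algebraic x"
  shows "\<exists>K. number_field K \<and> k \<subseteq> K \<and> S \<subseteq> K"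
proof -
  obtain c where c: "algebraic c" "k = adj \<rat> c" using assms(1) number_field_iff by auto
  then obtain K where K: "number_field K" "insert c S \<subseteq> K"
    using number_field_containing[of "insert c S"] assms by auto
  then have "k \<subseteq> K"
    unfolding c(2) using number_field_subf[OF K(1)] by (intro adj_subset subf_Rats Rats_subset) auto
  then show ?thesis using K by auto
qed

lemma global_degree_pos:
  assumes "number_field K" shows "global_degree K > 0"
proof -
  have sf: "subfield \<rat> complex_field" by (simp add: subfield_complex_iff subf_Rats)
  have fd: "CF.finite_dimension \<rat> K" using assms by (simp add: number_field_def)
  have "CF.dimension (global_degree K) \<rat> K"
    using CF.finite_dimensionE[OF sf fd] by (simp add: over_def global_degree_def)
  moreover have "K \<noteq> {0}"
    using subfD(2)[OF number_field_subf[OF assms]] by auto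
  ultimately show ?thesis
    using CF.dimension_zero[of \<rat> K] sf by (metis complex_field_simps(5) gr0I)
qed

text \<open>The Galois group of \<open>L\<close> is present only as the set
  \<open>embs \<rat> L\<close>; stability makes its members automorphisms.\<close>

definition normal_over :: "complex set \<Rightarrow> complex set \<Rightarrow> bool" where
  "normal_over K L \<longleftrightarrow> (\<forall>\<sigma>\<in>embs \<rat> L. \<sigma> ` L \<subseteq> L) \<and> (\<forall>\<tau>\<in>embs \<rat> K. \<tau> ` K \<subseteq> L)"

lemma normal_closure:
  assumes "number_field K"
  shows "\<exists>L. number_field L \<and> K \<subseteq> L \<and> normal_over K L"
proof -
  obtain a where a: "algebraic a" "K = adj \<rat> a" using assms number_field_iff by auto
  obtain m where m: "is_minpoly \<rat> a m" using a ex_minpoly[OF subf_Rats] by (auto simp: alg_over_Rats)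
  define S where "S = {r. poly m r = 0}"
  have "algebraic r" if "r \<in> S" for r
    using that is_minpolyD[OF m] by (auto simp: S_def alg_over_Rats[symmetric] alg_over_def)
  moreover have finS: "finite S" unfolding S_def by (rule poly_roots_finite[OF is_minpolyD(4)[OF m]])
  ultimately obtain c where c: "algebraic c" "S \<subseteq> adj \<rat> c" "\<And>A. subf A \<Longrightarrow> S \<subseteq> A \<Longrightarrow> c \<in> A"
    using primitive_element_set[of S] by auto
  define L where "L = adj \<rat> c"
  have L: "number_field L" using c(1) number_field_iff L_def by auto
  have sL: "subf L" by (rule number_field_subf[OF L])
  have QL: "\<rat> \<subseteq> L" by (rule Rats_subset[OF sL])
  have aS: "a \<in> S" using is_minpolyD(3)[OF m] by (simp add: S_def)
  have KL: "K \<subseteq> L" unfolding a(2) using aS c(2) sL by (intro adj_subset subf_Rats Rats_subset) (auto simp: L_def)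
  have "\<sigma> ` L \<subseteq> L" if s: "\<sigma> \<in> embs \<rat> L" for \<sigma>
  proof -
    \<comment> \<open>A subfield that contains the conjugates in \<open>S\<close>, since
      \<open>\<sigma>\<close> sends roots of \<open>m\<close> to roots of \<open>m\<close>; so it
      contains the generator \<open>c\<close> and all of \<open>L\<close>.\<close>
    define A where "A = {x \<in> L. \<sigma> x \<in> L}"
    have "subf A"
      unfolding subf_def A_def using sL embsD[OF s] emb_simps[OF subf_Rats sL QL s] by (auto simp: subfD)
    moreover have "S \<subseteq> A"
    proof
      fix r assume r: "r \<in> S"
      have rL: "r \<in> L" using r c(2) by (auto simp: L_def)
      have "poly m (\<sigma> r) = 0"
        using emb_poly_over[OF subf_Rats sL QL s is_minpolyD(1)[OF m] rL] r emb_simps(1)[OF subf_Rats sL QL s]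
        by (simp add: S_def)
      then show "r \<in> A" using rL c(2) by (auto simp: A_def S_def L_def)
    qed
    ultimately have "c \<in> A" by (rule c(3))
    then have "L \<subseteq> A" unfolding L_def using \<open>subf A\<close> by (intro adj_subset subf_Rats Rats_subset)
    then show ?thesis by (auto simp: A_def)
  qed
  moreover have "\<tau> ` K \<subseteq> L" if t: "\<tau> \<in> embs \<rat> K" for \<tau>
  proof
    fix y assume "y \<in> \<tau> ` K"
    then obtain p where p: "p \<in> polys_over \<rat>" "y = \<tau> (poly p a)" by (auto simp: a(2) adj_def)
    have "\<tau> a \<in> S" using emb_root[OF subf_Rats m] t a(2) by (simp add: S_def)
    then have "\<tau> a \<in> L" using c(2) by (auto simp: L_def)
    moreover have "y = poly p (\<tau> a)" using emb_determined[OF subf_Rats m _ p(1)] t a(2) p(2) by simp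
    ultimately show "y \<in> L" using poly_in_subf[OF subf_Rats sL p(1) QL] by simp
  qed
  ultimately show ?thesis using L KL unfolding normal_over_def by blast
qed

section \<open>Weak approximation and conjugate absolute values\<close>

abbreviation absv :: "complex set \<Rightarrow> (complex \<Rightarrow> real) \<Rightarrow> bool" where
  "absv K w \<equiv> absolute_value (field_on K) w"

lemma eventually_sequentially_ex: "eventually P sequentially \<Longrightarrow> \<exists>r. P r"
  by (auto simp: eventually_sequentially)

lemma real_null_comparison:
  assumes "(g \<longlongrightarrow> (0::real)) F" "\<forall>\<^sub>F x in F. norm (f x) \<le> g x"
  shows "(f \<longlongrightarrow> (0::real)) F"
proof (rule tendsto_rabs_zero_cancel, rule tendsto_sandwich[where f = "\<lambda>_. 0" and h = g])
  show "\<forall>\<^sub>F x in F. \<bar>f x\<bar> \<le> g x" using assms(2) by simp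
qed (use assms(1) in auto)

lemma absv_iff:
  "absv K w \<longleftrightarrow> (\<forall>x\<in>K. 0 \<le> w x \<and> (w x = 0 \<longleftrightarrow> x = 0)) \<and> (\<forall>x\<in>K. \<forall>y\<in>K. w (x * y) = w x * w y) \<and>
     (\<forall>x\<in>K. \<forall>y\<in>K. w (x + y) \<le> w x + w y)"
  by (simp add: absolute_value_def ring_of_type_algebra_def)

context
  fixes K w assumes K: "subf K" and w: "absv K w"
begin

lemma absv_nonneg: "x \<in> K \<Longrightarrow> 0 \<le> w x"
  and absv_eq_0: "x \<in> K \<Longrightarrow> w x = 0 \<longleftrightarrow> x = 0"
  and absv_mult: "x \<in> K \<Longrightarrow> y \<in> K \<Longrightarrow> w (x * y) = w x * w y"
  and absv_add: "x \<in> K \<Longrightarrow> y \<in> K \<Longrightarrow> w (x + y) \<le> w x + w y"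
  using w by (auto simp: absv_iff)

lemma absv_pos: "x \<in> K \<Longrightarrow> x \<noteq> 0 \<Longrightarrow> 0 < w x"
  using absv_nonneg absv_eq_0 by (metis less_eq_real_def)

lemma absv_0: "w 0 = 0"
  using absv_eq_0 subfD(1)[OF K] by simp

lemma absv_1: "w 1 = 1"
  using absv_mult[of 1 1] absv_pos[of 1] subfD(2)[OF K] by simp

lemma absv_minus: "x \<in> K \<Longrightarrow> w (- x) = w x"
proof -
  have m: "- 1 \<in> K" using subfD(2,8)[OF K] by blast
  have "w (- 1) * w (- 1) = 1" using absv_mult[OF m m] absv_1 by simp
  then have "w (- 1) = 1" using absv_nonneg[OF m] by (metis abs_of_nonneg abs_square_eq_1 power2_eq_square)
  then show "w (- x) = w x" if "x \<in> K" for x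
    using absv_mult[OF m that] by simp
qed

lemma absv_diff: "x \<in> K \<Longrightarrow> y \<in> K \<Longrightarrow> w (x - y) \<le> w x + w y"
  using absv_add[of x "- y"] absv_minus[of y] subfD(8)[OF K] by simp

lemma absv_diff_commute: "x \<in> K \<Longrightarrow> y \<in> K \<Longrightarrow> w (x - y) = w (y - x)"
  using absv_minus[of "x - y"] subfD(5)[OF K, of x y] by simp

lemma absv_abs_diff: "x \<in> K \<Longrightarrow> y \<in> K \<Longrightarrow> \<bar>w x - w y\<bar> \<le> w (x - y)"
  using absv_add[of "x - y" y] absv_add[of "y - x" x] absv_diff_commute[of x y]
    subfD(5)[OF K, of x y] subfD(5)[OF K, of y x] by simp

lemma absv_inverse: "x \<in> K \<Longrightarrow> w (inverse x) = inverse (w x)"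
proof (cases "x = 0")
  case False
  assume x: "x \<in> K"
  have "w x * w (inverse x) = 1"
    using absv_mult[OF x subfD(6)[OF K x]] False absv_1 by simp
  then show ?thesis by (simp add: inverse_unique)
qed (simp add: absv_0)

lemma absv_divide: "x \<in> K \<Longrightarrow> y \<in> K \<Longrightarrow> w (x / y) = w x / w y"
  by (simp add: divide_inverse absv_mult absv_inverse subfD(6)[OF K])

lemma absv_power: "x \<in> K \<Longrightarrow> w (x ^ n) = w x ^ n"
  by (induction n) (auto simp: absv_1 absv_mult subfD(9)[OF K])

lemma absv_sum: "(\<And>i. i \<in> I \<Longrightarrow> f i \<in> K) \<Longrightarrow> w (sum f I) \<le> (\<Sum>i\<in>I. w (f i))"
proof (induction I rule: infinite_finite_induct)
  case (insert x F)
  have "w (f x + sum f F) \<le> w (f x) + w (sum f F)"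
    using insert by (intro absv_add subf_sum[OF K]) auto
  then show ?case using insert by auto
qed (auto simp: absv_0)

lemma absv_prod: "(\<And>i. i \<in> I \<Longrightarrow> f i \<in> K) \<Longrightarrow> w (prod f I) = (\<Prod>i\<in>I. w (f i))"
proof (induction I rule: infinite_finite_induct)
  case (insert x F)
  then show ?case using absv_mult[of "f x" "prod f F"] subf_prod[OF K, of F f] by simp
qed (auto simp: absv_1)

lemma powi_in: "x \<in> K \<Longrightarrow> x powi n \<in> K"
  by (auto simp: power_int_def intro: subfD(6,9)[OF K])

lemma absv_powi: "x \<in> K \<Longrightarrow> w (x powi n) = w x powi n"
  by (auto simp: power_int_def absv_power absv_inverse subfD(6)[OF K])

text \<open>The numbers \<open>z ^ r / (1 + z ^ r)\<close> tend to 0 where \<open>z\<close> is small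
  and to 1 where it is large (\<open>absv_quotient_large\<close>): they act as approximate
  characteristic functions.\<close>

lemma absv_quotient_small:
  assumes z: "z \<in> K" "w z < 1"
  shows "(\<lambda>r. w (z ^ r / (1 + z ^ r))) \<longlonglongrightarrow> 0"
proof (rule tendsto_sandwich[where f = "\<lambda>_. 0" and h = "\<lambda>r. w z ^ r / (1 - w z ^ r)"])
  have lim: "(\<lambda>r. w z ^ r) \<longlonglongrightarrow> 0"
    using z absv_nonneg by (intro LIMSEQ_realpow_zero) auto
  show "(\<lambda>r. w z ^ r / (1 - w z ^ r)) \<longlonglongrightarrow> 0"
    using tendsto_divide[OF lim tendsto_diff[OF tendsto_const[of 1] lim]] by simp
  have zr: "z ^ r \<in> K" "1 + z ^ r \<in> K" for r using z K by (auto simp: subfD)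
  show "\<forall>\<^sub>F r in sequentially. 0 \<le> w (z ^ r / (1 + z ^ r))"
    using zr absv_nonneg subfD(7)[OF K] by (intro always_eventually) blast
  show "\<forall>\<^sub>F r in sequentially. w (z ^ r / (1 + z ^ r)) \<le> w z ^ r / (1 - w z ^ r)"
    using order_tendstoD(2)[OF lim zero_less_one]
  proof eventually_elim
    case (elim r)
    have "1 - w z ^ r \<le> w (1 + z ^ r)"
      using absv_diff[OF zr(2) zr(1), of r r] absv_1 absv_power[OF z(1), of r] by simp
    then show ?case
      using elim absv_nonneg[OF z(1)] absv_divide[OF zr(1) zr(2), of r r] absv_power[OF z(1), of r]
      by (auto intro!: divide_left_mono mult_pos_pos)
  qed
qed auto

lemma absv_quotient_large:
  assumes z: "z \<in> K" "w z > 1"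
  shows "(\<lambda>r. w (z ^ r / (1 + z ^ r) - 1)) \<longlonglongrightarrow> 0"
proof (rule tendsto_sandwich[where f = "\<lambda>_. 0" and h = "\<lambda>r. inverse (- 1 + w z ^ r)"])
  have lim: "filterlim (\<lambda>r. w z ^ r) at_top sequentially"
    using z by (intro filterlim_at_infinity_imp_filterlim_at_top[OF filterlim_realpow_sequentially_gt1]) auto
  then have "filterlim (\<lambda>r. - 1 + w z ^ r) at_top sequentially"
    by (intro filterlim_tendsto_add_at_top[OF tendsto_const])
  then show "(\<lambda>r. inverse (- 1 + w z ^ r)) \<longlonglongrightarrow> 0"
    by (rule tendsto_inverse_0_at_top)
  have zr: "z ^ r \<in> K" "1 + z ^ r \<in> K" for r using z K by (auto simp: subfD)
  show "\<forall>\<^sub>F r in sequentially. 0 \<le> w (z ^ r / (1 + z ^ r) - 1)"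
    using absv_nonneg[OF subfD(5)[OF K subfD(7)[OF K zr(1) zr(2)] subfD(2)[OF K]]] by simp
  have "\<forall>\<^sub>F r in sequentially. 1 < w z ^ r"
    using lim by (simp add: filterlim_at_top_dense)
  then show "\<forall>\<^sub>F r in sequentially. w (z ^ r / (1 + z ^ r) - 1) \<le> inverse (- 1 + w z ^ r)"
  proof eventually_elim
    case (elim r)
    have b: "- 1 + w z ^ r \<le> w (1 + z ^ r)"
      using absv_diff[OF zr(2) subfD(2)[OF K], of r] absv_1 absv_power[OF z(1), of r] by simp
    then have ne: "1 + z ^ r \<noteq> 0" using elim absv_0 by fastforce
    then have "z ^ r / (1 + z ^ r) - 1 = - inverse (1 + z ^ r)"
      by (simp add: field_simps)
    then show ?case
      using b elim absv_inverse[OF zr(2)] absv_minus[OF subfD(6)[OF K zr(2)]]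
      by (auto intro!: le_imp_inverse_le)
  qed
qed auto

end

section \<open>Separating absolute values\<close>

lemma ln_powi: "(x::real) > 0 \<Longrightarrow> ln (x powi m) = of_int m * ln x"
  by (cases "m \<ge> 0") (auto simp: power_int_def ln_realpow ln_inverse)

text \<open>The common value at \<open>b\<close> does the work of inequivalence. After inversions,
  \<open>w1 x > w2 x\<close> and the value at \<open>b\<close> exceeds 1. For large \<open>n\<close>
  some multiple \<open>m\<close> of the logarithm at \<open>b\<close> falls between the
  \<open>n\<close>-fold logarithms of \<open>x\<close>, and \<open>x ^ n * b powi (- m)\<close>
  separates.\<close>

lemma absv_separate:
  assumes K: "subf K" and w1: "absv K w1" and w2: "absv K w2"
    and x: "x \<in> K" "w1 x \<noteq> w2 x" and b: "b \<in> K" "b \<noteq> 0" "w1 b = w2 b" "w1 b \<noteq> 1"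
  shows "\<exists>y\<in>K. w1 y > 1 \<and> w2 y < 1"
proof -
  have x0: "x \<noteq> 0" using x absv_0[OF K w1] absv_0[OF K w2] by auto
  obtain x where x: "x \<in> K" "x \<noteq> 0" "w1 x > w2 x"
  proof (cases "w1 x > w2 x")
    case True
    then show ?thesis using x x0 that by auto
  next
    case False
    then have "w1 (inverse x) > w2 (inverse x)"
      using x absv_inverse[OF K w1 x(1)] absv_inverse[OF K w2 x(1)] absv_pos[OF K w1 x(1) x0]
      by (auto intro: less_imp_inverse_less)
    then show ?thesis using x x0 that[of "inverse x"] subfD(6)[OF K] by auto
  qed
  obtain b where b: "b \<in> K" "b \<noteq> 0" "w1 b = w2 b" "w1 b > 1"
  proof (cases "w1 b > 1")
    case True
    then show ?thesis using b that by auto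
  next
    case False
    then have "w1 (inverse b) > 1"
      using b absv_inverse[OF K w1 b(1)] absv_pos[OF K w1 b(1,2)] by (auto simp: one_less_inverse_iff)
    then show ?thesis using b that[of "inverse b"] subfD(6)[OF K] absv_inverse[OF K w1] absv_inverse[OF K w2] by auto
  qed
  define s where "s = ln (w1 x)" define t where "t = ln (w2 x)" define c where "c = ln (w1 b)"
  have pos: "0 < w1 x" "0 < w2 x" using absv_pos[OF K w1] absv_pos[OF K w2] x by auto
  have st: "t < s" and c: "0 < c" using pos x b by (auto simp: s_def t_def c_def)
  obtain n where n: "c < real n * (s - t)" using reals_Archimedean3[of "s - t"] st by auto
  define m where "m = \<lfloor>real n * t / c\<rfloor> + 1"
  have "real n * t / c < m" "m \<le> real n * t / c + 1" by (auto simp: m_def)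
  then have m1: "real n * t < m * c" and m2: "m * c \<le> real n * t + c"
    using c by (auto simp: field_simps)
  define y where "y = x ^ n * b powi (- m)"
  have xn: "x ^ n \<in> K" and bm: "b powi (- m) \<in> K"
    using x b K powi_in[OF K w1] by (auto simp: subfD)
  have y: "y \<in> K" unfolding y_def using xn bm K by (simp add: subfD)
  have "ln (w1 y) = real n * s - m * c"
    using pos b x absv_mult[OF K w1 xn bm] absv_power[OF K w1 x(1)] absv_powi[OF K w1 b(1)]
    by (simp add: y_def s_def c_def ln_mult ln_powi ln_realpow zero_less_power_int)
  then have 1: "ln (w1 y) > 0" using m2 n by (simp add: algebra_simps)
  have "ln (w2 y) = real n * t - m * c"
    using pos b x absv_mult[OF K w2 xn bm] absv_power[OF K w2 x(1)] absv_powi[OF K w2 b(1)]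
    by (simp add: y_def t_def c_def ln_mult ln_powi ln_realpow zero_less_power_int)
  then have 2: "ln (w2 y) < 0" using m1 by simp
  have "y \<noteq> 0" using x b by (simp add: y_def)
  then have "w1 y > 0" "w2 y > 0" using absv_pos[OF K w1 y] absv_pos[OF K w2 y] by auto
  then show ?thesis using 1 2 y by auto
qed

text \<open>The induction of Artin and Whaples: if \<open>z\<close> works for \<open>W\<close> and
  \<open>y\<close> for the new \<open>w\<close>, then \<open>z\<close>, \<open>z ^ r * y\<close> or
  \<open>z ^ r / (1 + z ^ r) * y\<close> works for both, according as \<open>w z\<close> is below,
  equal to or above 1.\<close>

lemma absv_separate_set:
  assumes K: "subf K" and w0: "absv K w0" and b: "b \<in> K" "b \<noteq> 0" "w0 b \<noteq> 1"
    and "finite W" and W: "\<And>w. w \<in> W \<Longrightarrow> absv K w \<and> w b = w0 b \<and> (\<exists>x\<in>K. w x \<noteq> w0 x)"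
  shows "\<exists>y\<in>K. w0 y > 1 \<and> (\<forall>w\<in>W. w y < 1)"
  using assms(6) W
proof (induction W)
  case empty
  then show ?case
  proof (cases "w0 b > 1")
    case False
    then have "w0 (inverse b) > 1"
      using b absv_inverse[OF K w0 b(1)] absv_pos[OF K w0 b(1,2)] by (auto simp: one_less_inverse_iff)
    then show ?thesis using b subfD(6)[OF K] by auto
  qed (use b in auto)
next
  case (insert w W)
  obtain z where z: "z \<in> K" "w0 z > 1" "\<And>w'. w' \<in> W \<Longrightarrow> w' z < 1" using insert by auto
  have w: "absv K w" "w b = w0 b" "\<exists>x\<in>K. w x \<noteq> w0 x" using insert.prems by auto
  then obtain y where y: "y \<in> K" "w0 y > 1" "w y < 1"
    using absv_separate[OF K w0 w(1) _ _ b(1,2)] b(3) by metis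
  have aW: "absv K w'" if "w' \<in> W" for w' using insert.prems that by auto
  consider "w z < 1" | "w z = 1" | "w z > 1" by linarith
  then show ?case
  proof cases
    case 1
    then show ?thesis using z by auto
  next
    case 2
    have "\<forall>\<^sub>F r in sequentially. \<forall>w'\<in>W. w' z ^ r * w' y < 1"
    proof (intro eventually_ball_finite insert.hyps ballI)
      fix w' assume w': "w' \<in> W"
      have "(\<lambda>r. w' z ^ r * w' y) \<longlonglongrightarrow> 0 * w' y"
        using z w' absv_nonneg[OF K aW[OF w']] by (intro tendsto_intros LIMSEQ_realpow_zero) auto
      then show "\<forall>\<^sub>F r in sequentially. w' z ^ r * w' y < 1"
        by (rule order_tendstoD) auto
    qed
    then obtain r where r: "\<And>w'. w' \<in> W \<Longrightarrow> w' z ^ r * w' y < 1"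
      by (auto simp: eventually_sequentially)
    have zr: "z ^ r \<in> K" using z K by (simp add: subfD)
    have "w0 (z ^ r * y) > 1"
    proof -
      have "1 \<le> w0 z ^ r" using z(2) by (intro one_le_power) simp
      then have "1 * w0 y \<le> w0 z ^ r * w0 y" using y(2) by (intro mult_right_mono) auto
      then have "1 < w0 z ^ r * w0 y" using y(2) by linarith
      then show ?thesis using absv_mult[OF K w0 zr y(1)] absv_power[OF K w0 z(1), of r] by simp
    qed
    moreover have "w (z ^ r * y) < 1"
      using absv_mult[OF K w(1) zr y(1)] absv_power[OF K w(1) z(1)] 2 y by simp
    moreover have "w' (z ^ r * y) < 1" if "w' \<in> W" for w'
      using absv_mult[OF K aW[OF that] zr y(1)] absv_power[OF K aW[OF that] z(1)] r[OF that] by simp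
    ultimately show ?thesis using zr y K by (intro bexI[of _ "z ^ r * y"]) (auto simp: subfD)
  next
    case 3
    define t where "t = (\<lambda>r. z ^ r / (1 + z ^ r))"
    have t: "t r \<in> K" for r using z K by (auto simp: t_def subfD)
    have lim1: "(\<lambda>r. u (t r * y)) \<longlonglongrightarrow> u y" if u: "absv K u" "u z > 1" for u
    proof -
      have "(\<lambda>r. u (t r) - 1) \<longlonglongrightarrow> 0"
      proof (rule real_null_comparison)
        show "(\<lambda>r. u (t r - 1)) \<longlonglongrightarrow> 0"
          unfolding t_def by (rule absv_quotient_large[OF K u(1) z(1) u(2)])
        show "\<forall>\<^sub>F r in sequentially. norm (u (t r) - 1) \<le> u (t r - 1)"
          using absv_abs_diff[OF K u(1) t subfD(2)[OF K]] absv_1[OF K u(1)] by simp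
      qed
      then have "(\<lambda>r. (u (t r) - 1) * u y + u y) \<longlonglongrightarrow> 0 * u y + u y"
        by (intro tendsto_intros)
      then show ?thesis using absv_mult[OF K u(1) t y(1)] by (simp add: algebra_simps)
    qed
    have lim0: "(\<lambda>r. u (t r * y)) \<longlonglongrightarrow> 0" if u: "absv K u" "u z < 1" for u
      using tendsto_mult_right[OF absv_quotient_small[OF K u(1) z(1) u(2)], of "u y"]
        absv_mult[OF K u(1) t y(1)] by (simp add: t_def)
    have "\<forall>\<^sub>F r in sequentially. w0 (t r * y) > 1"
      using order_tendstoD(1)[OF lim1[OF w0 z(2)] y(2)] .
    moreover have "\<forall>\<^sub>F r in sequentially. w (t r * y) < 1"
      using order_tendstoD(2)[OF lim1[OF w(1) 3] y(3)] .
    moreover have "\<forall>\<^sub>F r in sequentially. \<forall>w'\<in>W. w' (t r * y) < 1"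
      using aW z(3) by (intro eventually_ball_finite insert.hyps ballI order_tendstoD(2)[OF lim0]) auto
    ultimately have "\<forall>\<^sub>F r in sequentially. w0 (t r * y) > 1 \<and> (\<forall>w'\<in>insert w W. w' (t r * y) < 1)"
      by eventually_elim auto
    then obtain r where "w0 (t r * y) > 1 \<and> (\<forall>w'\<in>insert w W. w' (t r * y) < 1)"
      using eventually_sequentially_ex by blast
    then show ?thesis using t y K by (intro bexI[of _ "t r * y"]) (auto simp: subfD)
  qed
qed

lemma weak_approximation:
  assumes K: "subf K" and w0: "absv K w0" and b: "b \<in> K" "b \<noteq> 0" "w0 b \<noteq> 1"
    and fin: "finite W" and W: "\<And>w. w \<in> W \<Longrightarrow> absv K w \<and> w b = w0 b \<and> (\<exists>x\<in>K. w x \<noteq> w0 x)"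
    and e: "e > (0::real)"
  shows "\<exists>t\<in>K. w0 (t - 1) < e \<and> (\<forall>w\<in>W. w t < e)"
proof -
  obtain z where z: "z \<in> K" "w0 z > 1" "\<And>w. w \<in> W \<Longrightarrow> w z < 1"
    using absv_separate_set[OF K w0 b fin W] by blast
  have "\<forall>\<^sub>F r in sequentially. w0 (z ^ r / (1 + z ^ r) - 1) < e"
    using order_tendstoD(2)[OF absv_quotient_large[OF K w0 z(1,2)] e] .
  moreover have "\<forall>\<^sub>F r in sequentially. \<forall>w\<in>W. w (z ^ r / (1 + z ^ r)) < e"
  proof (intro eventually_ball_finite fin ballI)
    fix w assume w: "w \<in> W"
    show "\<forall>\<^sub>F r in sequentially. w (z ^ r / (1 + z ^ r)) < e"
      using order_tendstoD(2)[OF absv_quotient_small[OF K conjunct1[OF W[OF w]] z(1) z(3)[OF w]] e] .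
  qed
  ultimately have "\<forall>\<^sub>F r in sequentially. w0 (z ^ r / (1 + z ^ r) - 1) < e \<and> (\<forall>w\<in>W. w (z ^ r / (1 + z ^ r)) < e)"
    by eventually_elim auto
  then obtain r where "w0 (z ^ r / (1 + z ^ r) - 1) < e \<and> (\<forall>w\<in>W. w (z ^ r / (1 + z ^ r)) < e)"
    using eventually_sequentially_ex by blast
  then show ?thesis using z K by (intro bexI[of _ "z ^ r / (1 + z ^ r)"]) (auto simp: subfD)
qed

section \<open>Towers of number fields, norms and traces\<close>

lemma absv_emb:
  assumes L: "subf L" and Q: "absv L Q" and K: "subf K" and B: "subf B" "B \<subseteq> K"
    and t: "\<tau> \<in> embs B K" "\<tau> ` K \<subseteq> L"
  shows "absv K (\<lambda>x. Q (\<tau> x))"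
  unfolding absv_iff
  using embsD(2,3)[OF t(1)] emb_simps(5)[OF B(1) K B(2) t(1)] t(2)
    absv_nonneg[OF L Q] absv_eq_0[OF L Q] absv_mult[OF L Q] absv_add[OF L Q]
  by (simp add: image_subset_iff)

text \<open>The sum of the values of the coefficients is submultiplicative, and a linear factor
  contributes \<open>1 + Q (a i)\<close>. The bound treats archimedean and non-archimedean
  \<open>Q\<close> alike.\<close>

lemma prod_linear_coeffs:
  assumes L: "subf L" and Q: "absv L Q" and I: "finite I" and a: "\<And>i. i \<in> I \<Longrightarrow> a i \<in> L"
  defines "p \<equiv> (\<Prod>i\<in>I. [:- a i, 1:])"
  shows "p \<in> polys_over L" and "degree p = card I" and "lead_coeff p = 1"
    and "(\<Sum>j\<le>card I. Q (coeff p j)) \<le> (\<Prod>i\<in>I. 1 + Q (a i))"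
proof -
  have "(\<Prod>i\<in>I. [:- a i, 1:]) \<in> polys_over L \<and> degree (\<Prod>i\<in>I. [:- a i, 1:]) = card I \<and>
    lead_coeff (\<Prod>i\<in>I. [:- a i, 1:]) = 1 \<and>
    (\<Sum>j\<le>card I. Q (coeff (\<Prod>i\<in>I. [:- a i, 1:]) j)) \<le> (\<Prod>i\<in>I. 1 + Q (a i))"
    using I a
  proof (induction I)
    case empty
    then show ?case by (auto simp: polys_over_1[OF L] absv_1[OF L Q])
  next
    case (insert x I)
    define q where "q = (\<Prod>i\<in>I. [:- a i, 1:])"
    have q: "q \<in> polys_over L" "degree q = card I" "lead_coeff q = 1"
      "(\<Sum>j\<le>card I. Q (coeff q j)) \<le> (\<Prod>i\<in>I. 1 + Q (a i))"
      using insert by (auto simp: q_def)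
    have qc: "coeff q j \<in> L" for j using q(1) by (auto simp: polys_over_def)
    have ax: "a x \<in> L" using insert by auto
    have "(\<Prod>i\<in>insert x I. [:- a i, 1:]) = [:- a x, 1:] * q"
      using insert by (simp add: q_def)
    moreover have "[:- a x, 1:] * q \<in> polys_over L"
      using q(1) ax by (intro polys_over_mult[OF L]) (auto simp: polys_over_pCons_iff[OF L] polys_over_0[OF L] subfD[OF L])
    moreover have "degree ([:- a x, 1:] * q) = Suc (card I)"
      using q(2,3) by (subst degree_mult_eq) auto
    moreover have "lead_coeff ([:- a x, 1:] * q) = 1"
      using q(3) by (subst lead_coeff_mult) auto
    moreover have "(\<Sum>j\<le>Suc (card I). Q (coeff ([:- a x, 1:] * q) j)) \<le> (1 + Q (a x)) * (\<Prod>i\<in>I. 1 + Q (a i))"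
    proof -
      have "(\<Sum>j\<le>Suc (card I). Q (coeff ([:- a x, 1:] * q) j)) \<le>
        (\<Sum>j\<le>Suc (card I). Q (a x) * Q (coeff q j) + (case j of 0 \<Rightarrow> 0 | Suc i \<Rightarrow> Q (coeff q i)))"
      proof (rule sum_mono)
        fix j
        have "coeff ([:- a x, 1:] * q) j = - (a x * coeff q j) + (case j of 0 \<Rightarrow> 0 | Suc i \<Rightarrow> coeff q i)"
          by (auto simp: coeff_pCons split: nat.splits)
        moreover have "Q (- (a x * coeff q j) + (case j of 0 \<Rightarrow> 0 | Suc i \<Rightarrow> coeff q i)) \<le>
          Q (- (a x * coeff q j)) + Q (case j of 0 \<Rightarrow> 0 | Suc i \<Rightarrow> coeff q i)"
          using ax qc subfD[OF L] by (intro absv_add[OF L Q]) (auto split: nat.splits)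
        moreover have "Q (- (a x * coeff q j)) = Q (a x) * Q (coeff q j)"
          using absv_minus[OF L Q, of "a x * coeff q j"] absv_mult[OF L Q ax qc] ax qc subfD[OF L] by simp
        ultimately show "Q (coeff ([:- a x, 1:] * q) j) \<le> Q (a x) * Q (coeff q j) + (case j of 0 \<Rightarrow> 0 | Suc i \<Rightarrow> Q (coeff q i))"
          using absv_0[OF L Q] by (auto split: nat.splits)
      qed
      also have "\<dots> = Q (a x) * (\<Sum>j\<le>Suc (card I). Q (coeff q j)) + (\<Sum>j\<le>card I. Q (coeff q j))"
        by (simp add: sum.distrib sum_distrib_left sum.atMost_Suc_shift distrib_left del: sum.atMost_Suc)
      also have "(\<Sum>j\<le>Suc (card I). Q (coeff q j)) = (\<Sum>j\<le>card I. Q (coeff q j))"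
        using q(2) absv_0[OF L Q] by (simp add: coeff_eq_0)
      also have "Q (a x) * (\<Sum>j\<le>card I. Q (coeff q j)) + (\<Sum>j\<le>card I. Q (coeff q j)) =
        (1 + Q (a x)) * (\<Sum>j\<le>card I. Q (coeff q j))" by (simp add: algebra_simps)
      also have "\<dots> \<le> (1 + Q (a x)) * (\<Prod>i\<in>I. 1 + Q (a i))"
        using q(4) absv_nonneg[OF L Q ax] by (intro mult_left_mono) auto
      finally show ?thesis .
    qed
    ultimately show ?case using insert by simp
  qed
  then show "p \<in> polys_over L" "degree p = card I" "lead_coeff p = 1"
    "(\<Sum>j\<le>card I. Q (coeff p j)) \<le> (\<Prod>i\<in>I. 1 + Q (a i))"
    unfolding p_def by auto
qed

text \<open>Instantiated with \<open>B = \<rat>\<close> for local degrees and the product formula,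
  and with \<open>B = k\<close> for embeddings into the completion at a place of \<open>k\<close>.
  Normality over \<open>\<rat>\<close> serves every base, since fixing \<open>B\<close> only
  restricts the embeddings.\<close>

locale number_tower =
  fixes B K L
  assumes nB: "number_field B" and nK: "number_field K" and nL: "number_field L"
    and BK: "B \<subseteq> K" and KL: "K \<subseteq> L" and normal: "normal_over K L"
begin

lemma sB: "subf B" and sK: "subf K" and sL: "subf L"
  using nB nK nL number_field_subf by auto

lemma QB: "\<rat> \<subseteq> B" and BL: "B \<subseteq> L"
  using Rats_subset[OF sB] BK KL by auto

lemma generator_exists:
  assumes "number_field M" "B \<subseteq> M"
  shows "\<exists>c m. M = adj B c \<and> is_minpoly B c m"
proof -
  obtain c where c: "algebraic c" "M = adj \<rat> c" using assms number_field_iff by auto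
  have cM: "c \<in> M" unfolding c(2) by (rule adj_contains(1)[OF subf_Rats])
  have alg: "alg_over B c" using c(1) alg_over_mono[OF _ QB] by (simp add: alg_over_Rats)
  have "adj B c \<subseteq> M" using cM assms number_field_subf by (intro adj_subset sB) auto
  moreover have "M \<subseteq> adj B c"
    unfolding c(2) using adj_contains[OF sB, of c] QB
    by (intro adj_subset subf_adj sB alg subf_Rats) auto
  ultimately show ?thesis using ex_minpoly[OF sB alg] by blast
qed

lemma finite_embs': "number_field M \<Longrightarrow> B \<subseteq> M \<Longrightarrow> finite (embs B M)"
  using generator_exists finite_embs[OF sB] by metis

lemma fixed_in_B:
  assumes "y \<in> L" and "\<And>\<sigma>. \<sigma> \<in> embs B L \<Longrightarrow> \<sigma> y = y"
  shows "y \<in> B"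
proof -
  obtain c m where "L = adj B c" "is_minpoly B c m" using generator_exists[OF nL BL] by blast
  then show ?thesis using fixed_in_base[OF sB] assms by blast
qed

lemma emb_L: "\<sigma> \<in> embs B L \<Longrightarrow> \<sigma> ` L \<subseteq> L" and emb_K: "\<tau> \<in> embs B K \<Longrightarrow> \<tau> ` K \<subseteq> L"
  using normal emb_mono[OF _ QB] by (auto simp: normal_over_def)

lemma emb_L_in: "\<sigma> \<in> embs B L \<Longrightarrow> x \<in> L \<Longrightarrow> \<sigma> x \<in> L" and emb_K_in: "\<tau> \<in> embs B K \<Longrightarrow> x \<in> K \<Longrightarrow> \<tau> x \<in> L"
  using emb_L emb_K by blast+

text \<open>Composition with \<open>\<sigma>\<close> is injective on a finite set of embeddings.
  Symmetric functions of the conjugates are therefore fixed by every \<open>\<sigma>\<close> and lie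
  in \<open>B\<close>; this is the pattern for \<open>charpoly_over\<close>,
  \<open>norm_in_B\<close> and \<open>trace_in_B\<close>.\<close>

lemma embs_permute:
  assumes s: "\<sigma> \<in> embs B L"
  shows "bij_betw (\<lambda>\<tau>. restrict (\<sigma> \<circ> \<tau>) K) (embs B K) (embs B K)"
proof -
  have into: "(\<lambda>\<tau>. restrict (\<sigma> \<circ> \<tau>) K) ` embs B K \<subseteq> embs B K"
    using emb_comp[OF sB sL BL s _ sK emb_K BK] by blast
  have inj: "inj_on (\<lambda>\<tau>. restrict (\<sigma> \<circ> \<tau>) K) (embs B K)"
  proof (rule inj_onI)
    fix \<tau> \<tau>' assume t: "\<tau> \<in> embs B K" "\<tau>' \<in> embs B K" and eq: "restrict (\<sigma> \<circ> \<tau>) K = restrict (\<sigma> \<circ> \<tau>') K"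
    show "\<tau> = \<tau>'"
    proof (rule extensionalityI[OF embsD(1)[OF t(1)] embsD(1)[OF t(2)]])
      fix x assume x: "x \<in> K"
      then have "\<sigma> (\<tau> x) = \<sigma> (\<tau>' x)" using fun_cong[OF eq, of x] by simp
      then show "\<tau> x = \<tau>' x"
        using emb_inj[OF sB sL BL s] emb_K_in[OF t(1) x] emb_K_in[OF t(2) x] by (meson inj_onD)
    qed
  qed
  show ?thesis
    using endo_inj_surj[OF finite_embs'[OF nK BK] into inj] inj by (simp add: bij_betw_def)
qed

definition charpoly :: "complex \<Rightarrow> complex poly" where
  "charpoly x = (\<Prod>\<tau>\<in>embs B K. [:- \<tau> x, 1:])"

lemma charpoly_over: assumes x: "x \<in> K" shows "charpoly x \<in> polys_over B"
proof -
  have t: "[:- \<tau> x, 1:] \<in> polys_over L" if "\<tau> \<in> embs B K" for \<tau>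
    using emb_K_in[OF that x] by (auto simp: polys_over_pCons_iff[OF sL] polys_over_0[OF sL] subfD[OF sL])
  have "charpoly x \<in> polys_over L"
    unfolding charpoly_def using t by (rule polys_over_prod[OF sL])
  then have cL: "coeff (charpoly x) j \<in> L" for j by (auto simp: polys_over_def)
  have "\<sigma> (coeff (charpoly x) j) = coeff (charpoly x) j" if s: "\<sigma> \<in> embs B L" for \<sigma> j
  proof -
    note e = emb_simps[OF sB sL BL s]
    have "map_poly \<sigma> (charpoly x) = (\<Prod>\<tau>\<in>embs B K. map_poly \<sigma> [:- \<tau> x, 1:])"
      unfolding charpoly_def by (rule emb_map_poly_prod[OF sB sL BL s t])
    also have "\<dots> = (\<Prod>\<tau>\<in>embs B K. [:- (restrict (\<sigma> \<circ> \<tau>) K) x, 1:])"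
      using x emb_K_in e by (intro prod.cong) (auto simp: map_poly_pCons)
    also have "\<dots> = charpoly x"
      unfolding charpoly_def by (rule prod.reindex_bij_betw[OF embs_permute[OF s], of "\<lambda>\<tau>. [:- \<tau> x, 1:]"])
    finally have "coeff (map_poly \<sigma> (charpoly x)) j = coeff (charpoly x) j" by simp
    then show ?thesis by (simp add: coeff_map_poly e(1))
  qed
  then show ?thesis using fixed_in_B[OF cL] by (auto simp: polys_over_def)
qed

lemma charpoly_root: "x \<in> K \<Longrightarrow> poly (charpoly x) x = 0"
proof -
  assume "x \<in> K"
  then have "poly [:- (restrict id K) x, 1:] x = 0" by simp
  then show "poly (charpoly x) x = 0"
    unfolding charpoly_def poly_prod using emb_id[OF sK BK] finite_embs'[OF nK BK]
    by (intro prod_zero bexI)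
qed

lemma norm_in_B: assumes x: "x \<in> K" shows "(\<Prod>\<tau>\<in>embs B K. \<tau> x) \<in> B"
proof (rule fixed_in_B)
  show "(\<Prod>\<tau>\<in>embs B K. \<tau> x) \<in> L" using emb_K_in x by (intro subf_prod[OF sL])
  fix \<sigma> assume s: "\<sigma> \<in> embs B L"
  have "\<sigma> (\<Prod>\<tau>\<in>embs B K. \<tau> x) = (\<Prod>\<tau>\<in>embs B K. (restrict (\<sigma> \<circ> \<tau>) K) x)"
    using x emb_K_in by (subst emb_prod[OF sB sL BL s]) auto
  also have "\<dots> = (\<Prod>\<tau>\<in>embs B K. \<tau> x)"
    by (rule prod.reindex_bij_betw[OF embs_permute[OF s], of "\<lambda>\<tau>. \<tau> x"])
  finally show "\<sigma> (\<Prod>\<tau>\<in>embs B K. \<tau> x) = (\<Prod>\<tau>\<in>embs B K. \<tau> x)" .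
qed

lemma trace_in_B: assumes x: "x \<in> K" shows "(\<Sum>\<tau>\<in>embs B K. \<tau> x) \<in> B"
proof (rule fixed_in_B)
  show "(\<Sum>\<tau>\<in>embs B K. \<tau> x) \<in> L" using emb_K_in x by (intro subf_sum[OF sL])
  fix \<sigma> assume s: "\<sigma> \<in> embs B L"
  have "\<sigma> (\<Sum>\<tau>\<in>embs B K. \<tau> x) = (\<Sum>\<tau>\<in>embs B K. (restrict (\<sigma> \<circ> \<tau>) K) x)"
    using x emb_K_in by (subst emb_sum[OF sB sL BL s]) auto
  also have "\<dots> = (\<Sum>\<tau>\<in>embs B K. \<tau> x)"
    by (rule sum.reindex_bij_betw[OF embs_permute[OF s], of "\<lambda>\<tau>. \<tau> x"])
  finally show "\<sigma> (\<Sum>\<tau>\<in>embs B K. \<tau> x) = (\<Sum>\<tau>\<in>embs B K. \<tau> x)" .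
qed

lemma absv_conj: "absv L Q \<Longrightarrow> \<tau> \<in> embs B K \<Longrightarrow> absv K (\<lambda>x. Q (\<tau> x))"
  using absv_emb[OF sL _ sK sB BK _ emb_K] by blast

text \<open>If \<open>w\<close> differed from all conjugates of \<open>Q\<close>, some \<open>y\<close> would satisfy \<open>w y > 1\<close> while all
  its conjugates are small for \<open>Q\<close>; then all lower coefficients of its characteristic polynomial
  are small, a contradiction.\<close>

lemma absv_is_conjugate:
  assumes Q: "absv L Q" and w: "absv K w" and wQ: "\<And>b. b \<in> B \<Longrightarrow> w b = Q b"
    and b: "b \<in> B" "b \<noteq> 0" "w b \<noteq> 1"
  shows "\<exists>\<tau>\<in>embs B K. \<forall>x\<in>K. w x = Q (\<tau> x)"
proof (rule ccontr)
  assume "\<not> ?thesis"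
  then have ne: "\<exists>x\<in>K. Q (\<tau> x) \<noteq> w x" if "\<tau> \<in> embs B K" for \<tau> using that by metis
  have finE: "finite (embs B K)" by (rule finite_embs'[OF nK BK])
  define W where "W = (\<lambda>\<tau> x. Q (\<tau> x)) ` embs B K"
  have "\<exists>y\<in>K. w y > 1 \<and> (\<forall>w'\<in>W. w' y < 1)"
  proof (rule absv_separate_set[OF sK w, of b])
    show "b \<in> K" "b \<noteq> 0" "w b \<noteq> 1" using b BK by auto
    show "finite W" using finE by (simp add: W_def)
    fix w' assume "w' \<in> W"
    then obtain \<tau> where t: "\<tau> \<in> embs B K" "w' = (\<lambda>x. Q (\<tau> x))" by (auto simp: W_def)
    then show "absv K w' \<and> w' b = w b \<and> (\<exists>x\<in>K. w' x \<noteq> w x)"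
      using absv_conj[OF Q] ne wQ[OF b(1)] embsD(4)[OF t(1) b(1)] by auto
  qed
  then obtain x where x: "x \<in> K" "w x > 1" "\<And>\<tau>. \<tau> \<in> embs B K \<Longrightarrow> Q (\<tau> x) < 1"
    by (auto simp: W_def)
  \<comment> \<open>A high power of \<open>x\<close> keeps \<open>w\<close> above 1 and pushes the
    bound for the sum of the coefficients below 2; the leading coefficient alone accounts for
    1.\<close>
  have "(\<lambda>r. \<Prod>\<tau>\<in>embs B K. 1 + Q (\<tau> x) ^ r) \<longlonglongrightarrow> (\<Prod>\<tau>\<in>embs B K. 1 + 0)"
    using x absv_nonneg[OF sL Q emb_K_in[OF _ x(1)]] by (intro tendsto_intros LIMSEQ_realpow_zero) auto
  then have "\<forall>\<^sub>F r in sequentially. (\<Prod>\<tau>\<in>embs B K. 1 + Q (\<tau> x) ^ r) < 2"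
    by (intro order_tendstoD) auto
  then have "\<forall>\<^sub>F r in sequentially. (\<Prod>\<tau>\<in>embs B K. 1 + Q (\<tau> x) ^ r) < 2 \<and> r > 0"
    using eventually_gt_at_top[of 0] by eventually_elim auto
  then obtain r where r: "(\<Prod>\<tau>\<in>embs B K. 1 + Q (\<tau> x) ^ r) < 2" "r > 0"
    using eventually_sequentially_ex by blast
  define y where "y = x ^ r"
  have y: "y \<in> K" "w y > 1"
    using x r sK absv_power[OF sK w x(1)] by (auto simp: y_def subfD one_less_power)
  have Qy: "Q (\<tau> y) = Q (\<tau> x) ^ r" if t: "\<tau> \<in> embs B K" for \<tau>
    using emb_simps(7)[OF sB sK BK t x(1)] absv_power[OF sL Q emb_K_in[OF t x(1)]] by (simp add: y_def)
  define n where "n = card (embs B K)"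
  define c where "c = coeff (charpoly y)"
  have ty: "\<tau> y \<in> L" if "\<tau> \<in> embs B K" for \<tau> using emb_K_in[OF that y(1)] .
  have pl: "degree (charpoly y) = card (embs B K)" "lead_coeff (charpoly y) = 1"
    "(\<Sum>j\<le>card (embs B K). Q (coeff (charpoly y) j)) \<le> (\<Prod>\<tau>\<in>embs B K. 1 + Q (\<tau> y))"
    unfolding charpoly_def using prod_linear_coeffs(2-4)[OF sL Q finE, of "\<lambda>\<tau>. \<tau> y"] ty by auto
  have cB: "c j \<in> B" for j using charpoly_over[OF y(1)] by (auto simp: c_def polys_over_def)
  have cn: "c n = 1" using pl(1,2) by (simp add: c_def n_def)
  have "(\<Sum>j\<le>n. Q (c j)) \<le> (\<Prod>\<tau>\<in>embs B K. 1 + Q (\<tau> y))"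
    using pl(3) by (simp add: c_def n_def)
  also have "\<dots> = (\<Prod>\<tau>\<in>embs B K. 1 + Q (\<tau> x) ^ r)"
    using Qy by (intro prod.cong) auto
  also have "\<dots> < 2" by (rule r)
  finally have small: "(\<Sum>j<n. Q (c j)) < 1"
    using cn absv_1[OF sL Q] by (simp add: lessThan_Suc_atMost[symmetric])
  have "0 = (\<Sum>j\<le>n. c j * y ^ j)"
    using charpoly_root[OF y(1)] pl(1) by (simp add: poly_altdef c_def n_def)
  then have "y ^ n = - (\<Sum>j<n. c j * y ^ j)"
    using cn by (simp add: lessThan_Suc_atMost[symmetric] eq_neg_iff_add_eq_0 add.commute)
  moreover have cy: "c j * y ^ j \<in> K" for j
    using cB[of j] BK y(1) by (intro subfD[OF sK]) auto
  ultimately have yn: "y ^ n = - (\<Sum>j<n. c j * y ^ j)" by blast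
  have "w y ^ n = w (- (\<Sum>j<n. c j * y ^ j))"
    unfolding yn[symmetric] by (rule absv_power[OF sK w y(1), symmetric])
  also have "\<dots> = w (\<Sum>j<n. c j * y ^ j)"
    by (rule absv_minus[OF sK w subf_sum[OF sK cy]])
  also have "\<dots> \<le> (\<Sum>j<n. w (c j * y ^ j))" by (rule absv_sum[OF sK w cy])
  also have "\<dots> = (\<Sum>j<n. Q (c j) * w y ^ j)"
  proof (rule sum.cong[OF refl])
    fix j
    have "c j \<in> K" using cB BK by auto
    then show "w (c j * y ^ j) = Q (c j) * w y ^ j"
      using absv_mult[OF sK w, of "c j" "y ^ j"] absv_power[OF sK w y(1)] y sK wQ[OF cB[of j]] by (simp add: subfD)
  qed
  also have "\<dots> \<le> (\<Sum>j<n. Q (c j) * w y ^ n)"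
  proof (intro sum_mono mult_left_mono)
    fix j assume j: "j \<in> {..<n}"
    show "w y ^ j \<le> w y ^ n" using y j by (intro power_increasing) auto
    show "0 \<le> Q (c j)" using cB[of j] BL by (intro absv_nonneg[OF sL Q]) auto
  qed
  also have "\<dots> = (\<Sum>j<n. Q (c j)) * w y ^ n" by (simp add: sum_distrib_right)
  also have "\<dots> < 1 * w y ^ n" using small y by (intro mult_strict_right_mono) auto
  finally show False by simp
qed

lemma number_tower_top: "number_tower B L L"
  using nB nL BL normal by unfold_locales (auto simp: normal_over_def)

text \<open>With \<open>z\<close> close to \<open>y\<close> for \<open>Q\<close> and small for the other conjugates of \<open>Q\<close>, the trace of \<open>z\<close> is
  close to a multiple of \<open>y\<close>.\<close>

lemma decomposition_fixed_approx:
  assumes Q: "absv L Q" and b: "b \<in> B" "b \<noteq> 0" "Q b \<noteq> 1" and y: "y \<in> L"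
    and fx: "\<And>\<sigma>. \<sigma> \<in> embs B L \<Longrightarrow> (\<And>x. x \<in> L \<Longrightarrow> Q (\<sigma> x) = Q x) \<Longrightarrow> \<sigma> y = y" and e: "e > 0"
  shows "\<exists>q\<in>B. Q (y - q) < e"
proof -
  interpret T: number_tower B L L by (rule number_tower_top)
  define G where "G = embs B L"
  \<comment> \<open>The decomposition group of \<open>Q\<close>; the hypothesis places
    \<open>y\<close> in its fixed field.\<close>
  define D where "D = {\<sigma>\<in>G. \<forall>x\<in>L. Q (\<sigma> x) = Q x}"
  have finG: "finite G" unfolding G_def by (rule finite_embs'[OF nL BL])
  have idD: "restrict id L \<in> D" using emb_id[OF sL BL] by (simp add: D_def G_def)
  have finD: "finite D" using finG by (simp add: D_def)
  define d where "d = (of_nat (card D) :: complex)"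
  have d: "d \<in> L" "d \<noteq> 0" using idD finD sL by (auto simp: d_def subf_of_nat)
  define M where "M = (\<Sum>\<sigma>\<in>G. Q (\<sigma> y))"
  have M: "M \<ge> 0" unfolding M_def G_def using T.emb_L_in y absv_nonneg[OF sL Q] by (intro sum_nonneg) auto
  \<comment> \<open>Makes the final error \<open>e' * M / Q d\<close> smaller than \<open>e\<close>;
    the summand 1 covers \<open>M = 0\<close>.\<close>
  define e' where "e' = e * Q d / (M + 1)"
  have e': "e' > 0" using e M absv_pos[OF sL Q d] by (simp add: e'_def)
  define W where "W = (\<lambda>\<sigma> x. Q (\<sigma> x)) ` (G - D)"
  have "\<exists>t\<in>L. Q (t - 1) < e' \<and> (\<forall>w\<in>W. w t < e')"
  proof (rule weak_approximation[OF sL Q, of b])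
    show "b \<in> L" "b \<noteq> 0" "Q b \<noteq> 1" using b BL by auto
    show "finite W" using finG by (simp add: W_def)
    fix w assume "w \<in> W"
    then obtain \<sigma> where s: "\<sigma> \<in> G" "\<sigma> \<notin> D" "w = (\<lambda>x. Q (\<sigma> x))" by (auto simp: W_def)
    then show "absv L w \<and> w b = Q b \<and> (\<exists>x\<in>L. w x \<noteq> Q x)"
      using T.absv_conj[OF Q] embsD(4)[of \<sigma> B L, OF _ b(1)] by (auto simp: G_def D_def)
  qed (rule e')
  then obtain t where t: "t \<in> L" "Q (t - 1) < e'" "\<And>\<sigma>. \<sigma> \<in> G - D \<Longrightarrow> Q (\<sigma> t) < e'"
    by (auto simp: W_def)
  define z where "z = t * y"
  have z: "z \<in> L" using t y sL by (simp add: z_def subfD)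
  define S where "S = (\<Sum>\<sigma>\<in>G. \<sigma> z)"
  have SB: "S \<in> B" unfolding S_def G_def by (rule T.trace_in_B[OF z])
  \<comment> \<open>The copies of \<open>y\<close> are distributed over the terms of the trace that
    belong to \<open>D\<close>, where \<open>\<sigma> z\<close> is close to \<open>y\<close>; the
    other terms are small by themselves.\<close>
  have "S - d * y = (\<Sum>\<sigma>\<in>G. \<sigma> z - (if \<sigma> \<in> D then y else 0))"
    using finG by (simp add: S_def d_def sum_subtractf sum.If_cases D_def Int_def)
  also have "Q \<dots> \<le> (\<Sum>\<sigma>\<in>G. Q (\<sigma> z - (if \<sigma> \<in> D then y else 0)))"
    using T.emb_L_in z y sL by (intro absv_sum[OF sL Q]) (auto simp: G_def subfD)
  also have "\<dots> \<le> (\<Sum>\<sigma>\<in>G. e' * Q (\<sigma> y))"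
  proof (rule sum_mono)
    fix \<sigma> assume s: "\<sigma> \<in> G"
    then have s': "\<sigma> \<in> embs B L" by (simp add: G_def)
    have zs: "\<sigma> z = \<sigma> t * \<sigma> y" using embsD(3)[OF s' t(1) y] by (simp add: z_def)
    have sy: "\<sigma> y \<in> L" and st: "\<sigma> t \<in> L" using T.emb_L_in[OF s'] y t by auto
    show "Q (\<sigma> z - (if \<sigma> \<in> D then y else 0)) \<le> e' * Q (\<sigma> y)"
    proof (cases "\<sigma> \<in> D")
      case True
      then have "\<sigma> y = y" using fx s' by (auto simp: D_def)
      then have "\<sigma> z - y = \<sigma> (t - 1) * \<sigma> y"
        using zs emb_simps(2)[OF sB sL BL s'] emb_simps(4)[OF sB sL BL s' t(1) subfD(2)[OF sL]]
        by (simp add: left_diff_distrib)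
      moreover have "Q (\<sigma> (t - 1)) < e'" using True t sL by (auto simp: D_def subfD)
      moreover have "\<sigma> (t - 1) \<in> L" using T.emb_L_in[OF s'] t sL by (simp add: subfD)
      ultimately show ?thesis
        using True absv_mult[OF sL Q _ sy] absv_nonneg[OF sL Q sy] by (simp add: mult_right_mono)
    next
      case False
      then show ?thesis
        using zs t(3)[of \<sigma>] s absv_mult[OF sL Q st sy] absv_nonneg[OF sL Q sy] by (simp add: mult_right_mono)
    qed
  qed
  also have "\<dots> = e' * M" by (simp add: M_def sum_distrib_left)
  also have "\<dots> < e * Q d"
    using e M absv_pos[OF sL Q d] unfolding e'_def by (simp add: field_simps)
  finally have lt: "Q (S - d * y) < e * Q d" .
  have SL: "S \<in> L" using SB BL by auto
  have "y - S / d = - ((S - d * y) / d)" using d by (simp add: field_simps)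
  moreover have "(S - d * y) / d \<in> L" "S - d * y \<in> L" using SL d y sL by (auto simp: subfD)
  ultimately have "Q (y - S / d) = Q (S - d * y) / Q d"
    using absv_minus[OF sL Q, of "(S - d * y) / d"] absv_divide[OF sL Q _ d(1), of "S - d * y"] by simp
  also have "\<dots> < e" using lt absv_pos[OF sL Q d] by (simp add: field_simps)
  finally show ?thesis
    using SB sB by (intro bexI[of _ "S / d"]) (auto simp: d_def subfD subf_of_nat)
qed

end

section \<open>Completions\<close>

locale valued_field = field R for R (structure) +
  fixes \<nu> :: "'a \<Rightarrow> real"
  assumes abs: "absolute_value R \<nu>"
begin

lemma v_nonneg: "x \<in> carrier R \<Longrightarrow> 0 \<le> \<nu> x"
  and v_eq_0: "x \<in> carrier R \<Longrightarrow> \<nu> x = 0 \<longleftrightarrow> x = \<zero>"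
  and v_mult: "x \<in> carrier R \<Longrightarrow> y \<in> carrier R \<Longrightarrow> \<nu> (x \<otimes> y) = \<nu> x * \<nu> y"
  and v_add: "x \<in> carrier R \<Longrightarrow> y \<in> carrier R \<Longrightarrow> \<nu> (x \<oplus> y) \<le> \<nu> x + \<nu> y"
  using abs by (auto simp: absolute_value_def)

lemma v_pos: "x \<in> carrier R \<Longrightarrow> x \<noteq> \<zero> \<Longrightarrow> 0 < \<nu> x"
  using v_nonneg v_eq_0 by (metis less_eq_real_def)

lemma v_0: "\<nu> \<zero> = 0"
  using v_eq_0 by simp

lemma v_1: "\<nu> \<one> = 1"
  using v_mult[of \<one> \<one>] v_pos[of \<one>] one_not_zero by simp

lemma v_minus: assumes "x \<in> carrier R" shows "\<nu> (\<ominus> x) = \<nu> x"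
proof -
  have "\<nu> (\<ominus> \<one>) * \<nu> (\<ominus> \<one>) = 1"
    using v_mult[of "\<ominus> \<one>" "\<ominus> \<one>"] v_1 by (simp add: l_minus r_minus)
  then have "\<nu> (\<ominus> \<one>) = 1"
    using v_nonneg[of "\<ominus> \<one>"] by (metis abs_of_nonneg abs_square_eq_1 power2_eq_square add.inv_closed one_closed)
  then show ?thesis
    using v_mult[of "\<ominus> \<one>" x] assms by (simp add: l_minus)
qed

lemma v_diff: "x \<in> carrier R \<Longrightarrow> y \<in> carrier R \<Longrightarrow> \<nu> (x \<ominus> y) \<le> \<nu> x + \<nu> y"
  using v_add[of x "\<ominus> y"] v_minus[of y] by (simp add: a_minus_def)

lemma v_diff_commute: "x \<in> carrier R \<Longrightarrow> y \<in> carrier R \<Longrightarrow> \<nu> (x \<ominus> y) = \<nu> (y \<ominus> x)"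
  using v_minus[of "x \<ominus> y"] by (simp add: a_minus_def minus_add add.m_comm)

lemma v_abs_diff: assumes "x \<in> carrier R" "y \<in> carrier R" shows "\<bar>\<nu> x - \<nu> y\<bar> \<le> \<nu> (x \<ominus> y)"
proof -
  have "(x \<ominus> y) \<oplus> y = x" "(y \<ominus> x) \<oplus> x = y"
    using assms by (simp_all add: a_minus_def add.m_assoc l_neg)
  then have "\<nu> x \<le> \<nu> (x \<ominus> y) + \<nu> y" "\<nu> y \<le> \<nu> (y \<ominus> x) + \<nu> x"
    using v_add[of "x \<ominus> y" y] v_add[of "y \<ominus> x" x] assms by auto
  then show ?thesis using v_diff_commute[OF assms] by linarith
qed

lemma v_inv: "x \<in> carrier R \<Longrightarrow> x \<noteq> \<zero> \<Longrightarrow> \<nu> (inv x) = inverse (\<nu> x)"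
  using v_mult[of x "inv x"] v_1 field_Units by (simp add: inverse_unique)

section \<open>The ring of Cauchy sequences\<close>

abbreviation CR where "CR \<equiv> cauchy_ring R \<nu>"

lemma CR_simps:
  "s \<otimes>\<^bsub>CR\<^esub> t = (\<lambda>i. s i \<otimes> t i)" "s \<oplus>\<^bsub>CR\<^esub> t = (\<lambda>i. s i \<oplus> t i)"
  "\<one>\<^bsub>CR\<^esub> = (\<lambda>i. \<one>)" "\<zero>\<^bsub>CR\<^esub> = (\<lambda>i. \<zero>)"
  by (simp_all add: cauchy_ring_def)

lemma CR_carrier:
  "s \<in> carrier CR \<longleftrightarrow> (\<forall>i. s i \<in> carrier R) \<and> (\<forall>e>0. \<exists>N. \<forall>i\<ge>N. \<forall>j\<ge>N. \<nu> (s i \<ominus> s j) < e)"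
  by (auto simp: cauchy_ring_def)

lemma CRD: "s \<in> carrier CR \<Longrightarrow> s i \<in> carrier R"
  by (simp add: CR_carrier)

lemma CR_Cauchy: "s \<in> carrier CR \<Longrightarrow> e > 0 \<Longrightarrow> \<exists>N. \<forall>i\<ge>N. \<forall>j\<ge>N. \<nu> (s i \<ominus> s j) < e"
  by (simp add: CR_carrier)

lemma CR_convergent: assumes s: "s \<in> carrier CR" shows "convergent (\<lambda>i. \<nu> (s i))"
proof -
  have "Cauchy (\<lambda>i. \<nu> (s i))"
  proof (rule metric_CauchyI)
    fix e :: real assume "e > 0"
    then obtain N where N: "\<And>i j. i \<ge> N \<Longrightarrow> j \<ge> N \<Longrightarrow> \<nu> (s i \<ominus> s j) < e"
      using CR_Cauchy[OF s] by meson
    have "dist (\<nu> (s m)) (\<nu> (s n)) < e" if "m \<ge> N" "n \<ge> N" for m n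
      using le_less_trans[OF v_abs_diff[OF CRD[OF s] CRD[OF s]] N[OF that]] by (simp add: dist_real_def)
    then show "\<exists>M. \<forall>m\<ge>M. \<forall>n\<ge>M. dist (\<nu> (s m)) (\<nu> (s n)) < e" by blast
  qed
  then show ?thesis by (rule Cauchy_convergent)
qed

lemma CR_bounded: assumes s: "s \<in> carrier CR" shows "\<exists>M>0. \<forall>i. \<nu> (s i) \<le> M"
proof -
  obtain M where "M > 0" "\<forall>i. norm (\<nu> (s i)) \<le> M"
    using convergent_imp_Bseq[OF CR_convergent[OF s]] by (auto simp: Bseq_def)
  then show ?thesis by (intro exI[of _ M]) (auto simp: abs_le_iff)
qed

lemma CR_const: "x \<in> carrier R \<Longrightarrow> (\<lambda>i. x) \<in> carrier CR"
  by (auto simp: CR_carrier a_minus_def r_neg v_0)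

lemma CR_add: assumes s: "s \<in> carrier CR" and t: "t \<in> carrier CR" shows "(\<lambda>i. s i \<oplus> t i) \<in> carrier CR"
  unfolding CR_carrier
proof (intro conjI allI impI)
  fix e :: real assume "e > 0"
  then have e: "e / 2 > 0" by simp
  obtain N where N: "\<And>i j. i \<ge> N \<Longrightarrow> j \<ge> N \<Longrightarrow> \<nu> (s i \<ominus> s j) < e / 2" using CR_Cauchy[OF s e] by meson
  obtain M where M: "\<And>i j. i \<ge> M \<Longrightarrow> j \<ge> M \<Longrightarrow> \<nu> (t i \<ominus> t j) < e / 2" using CR_Cauchy[OF t e] by meson
  show "\<exists>N. \<forall>i\<ge>N. \<forall>j\<ge>N. \<nu> ((s i \<oplus> t i) \<ominus> (s j \<oplus> t j)) < e"
  proof (intro exI[of _ "max N M"] allI impI)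
    fix i j assume ij: "i \<ge> max N M" "j \<ge> max N M"
    have "(s i \<oplus> t i) \<ominus> (s j \<oplus> t j) = (s i \<ominus> s j) \<oplus> (t i \<ominus> t j)"
      using CRD[OF s] CRD[OF t] by (simp add: a_minus_def minus_add a_ac)
    then have "\<nu> ((s i \<oplus> t i) \<ominus> (s j \<oplus> t j)) \<le> \<nu> (s i \<ominus> s j) + \<nu> (t i \<ominus> t j)"
      using CRD[OF s] CRD[OF t] v_add[of "s i \<ominus> s j" "t i \<ominus> t j"] by simp
    also have "\<dots> < e / 2 + e / 2" using N M ij by (intro add_strict_mono) auto
    finally show "\<nu> ((s i \<oplus> t i) \<ominus> (s j \<oplus> t j)) < e" by simp
  qed
qed (use CRD[OF s] CRD[OF t] in simp)

lemma CR_neg: assumes s: "s \<in> carrier CR" shows "(\<lambda>i. \<ominus> s i) \<in> carrier CR"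
proof -
  have "\<ominus> s i \<ominus> \<ominus> s j = \<ominus> (s i \<ominus> s j)" for i j
    using CRD[OF s] by (simp add: a_minus_def minus_add)
  then have "\<nu> (\<ominus> s i \<ominus> \<ominus> s j) = \<nu> (s i \<ominus> s j)" for i j
    using v_minus[of "s i \<ominus> s j"] CRD[OF s] by simp
  then show ?thesis using s by (simp add: CR_carrier)
qed

lemma CR_mult: assumes s: "s \<in> carrier CR" and t: "t \<in> carrier CR" shows "(\<lambda>i. s i \<otimes> t i) \<in> carrier CR"
  unfolding CR_carrier
proof (intro conjI allI impI)
  fix e :: real assume e: "e > 0"
  obtain S where S: "S > 0" "\<And>i. \<nu> (s i) \<le> S" using CR_bounded[OF s] by auto
  obtain T where T: "T > 0" "\<And>i. \<nu> (t i) \<le> T" using CR_bounded[OF t] by auto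
  have e1: "e / (2 * T) > 0" and e2: "e / (2 * S) > 0" using e S T by auto
  obtain N where N: "\<And>i j. i \<ge> N \<Longrightarrow> j \<ge> N \<Longrightarrow> \<nu> (s i \<ominus> s j) < e / (2 * T)" using CR_Cauchy[OF s e1] by meson
  obtain M where M: "\<And>i j. i \<ge> M \<Longrightarrow> j \<ge> M \<Longrightarrow> \<nu> (t i \<ominus> t j) < e / (2 * S)" using CR_Cauchy[OF t e2] by meson
  show "\<exists>N. \<forall>i\<ge>N. \<forall>j\<ge>N. \<nu> ((s i \<otimes> t i) \<ominus> (s j \<otimes> t j)) < e"
  proof (intro exI[of _ "max N M"] allI impI)
    fix i j assume ij: "i \<ge> max N M" "j \<ge> max N M"
    note c = CRD[OF s, of i] CRD[OF t, of i] CRD[OF s, of j] CRD[OF t, of j]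
    have "(s i \<ominus> s j) \<otimes> t i \<oplus> s j \<otimes> (t i \<ominus> t j) = s i \<otimes> t i \<oplus> (\<ominus> (s j \<otimes> t i) \<oplus> (s j \<otimes> t i \<oplus> \<ominus> (s j \<otimes> t j)))"
      using c by (simp add: a_minus_def l_distr r_distr l_minus r_minus a_assoc)
    also have "\<dots> = (s i \<otimes> t i) \<ominus> (s j \<otimes> t j)"
      using c by (simp add: a_minus_def r_neg1 r_neg2)
    finally have "\<nu> ((s i \<otimes> t i) \<ominus> (s j \<otimes> t j)) \<le> \<nu> ((s i \<ominus> s j) \<otimes> t i) + \<nu> (s j \<otimes> (t i \<ominus> t j))"
      using c v_add[of "(s i \<ominus> s j) \<otimes> t i" "s j \<otimes> (t i \<ominus> t j)"] by simp
    also have "\<dots> = \<nu> (s i \<ominus> s j) * \<nu> (t i) + \<nu> (s j) * \<nu> (t i \<ominus> t j)"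
      using c by (simp add: v_mult)
    also have "\<dots> < e / (2 * T) * T + S * (e / (2 * S))"
    proof (rule add_less_le_mono)
      have "\<nu> (s i \<ominus> s j) * \<nu> (t i) \<le> \<nu> (s i \<ominus> s j) * T"
        using T c v_nonneg by (intro mult_left_mono) auto
      also have "\<dots> < e / (2 * T) * T" using N ij T by (intro mult_strict_right_mono) auto
      finally show "\<nu> (s i \<ominus> s j) * \<nu> (t i) < e / (2 * T) * T" .
      show "\<nu> (s j) * \<nu> (t i \<ominus> t j) \<le> S * (e / (2 * S))"
        using S M[of i j] ij c v_nonneg by (intro mult_mono) auto
    qed
    also have "\<dots> = e" using S T by simp
    finally show "\<nu> ((s i \<otimes> t i) \<ominus> (s j \<otimes> t j)) < e" .
  qed
qed (use CRD[OF s] CRD[OF t] in simp)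

lemma CR_cring: "cring CR"
proof (rule cringI)
  show "abelian_group CR"
  proof (rule abelian_groupI)
    fix s assume "s \<in> carrier CR"
    then show "\<exists>t\<in>carrier CR. t \<oplus>\<^bsub>CR\<^esub> s = \<zero>\<^bsub>CR\<^esub>"
      using CR_neg CRD by (intro bexI[of _ "\<lambda>i. \<ominus> s i"]) (auto simp: CR_simps l_neg)
  qed (auto simp: CR_simps CR_add CR_const CRD a_ac fun_eq_iff)
  show "comm_monoid CR"
    by (rule comm_monoidI) (auto simp: CR_simps CR_mult CR_const CRD m_ac fun_eq_iff)
qed (auto simp: CR_simps CRD l_distr fun_eq_iff)

lemma CR_a_inv: "s \<in> carrier CR \<Longrightarrow> \<ominus>\<^bsub>CR\<^esub> s = (\<lambda>i. \<ominus> s i)"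
proof -
  interpret C: cring CR by (rule CR_cring)
  assume s: "s \<in> carrier CR"
  show ?thesis
    by (rule C.minus_equality) (use s CR_neg CRD in \<open>auto simp: CR_simps l_neg\<close>)
qed

lemma CR_minus: "s \<in> carrier CR \<Longrightarrow> t \<in> carrier CR \<Longrightarrow> s \<ominus>\<^bsub>CR\<^esub> t = (\<lambda>i. s i \<ominus> t i)"
  unfolding a_minus_def[of CR] by (simp add: CR_a_inv CR_simps) (simp add: a_minus_def)

section \<open>The quotient by null sequences and its absolute value\<close>

abbreviation NS where "NS \<equiv> null_sequences R \<nu>"

lemma NS_iff: "s \<in> NS \<longleftrightarrow> s \<in> carrier CR \<and> (\<lambda>i. \<nu> (s i)) \<longlonglongrightarrow> 0"
  by (simp add: null_sequences_def)

lemma NS_ideal: "ideal NS CR"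
proof (rule idealI)
  interpret C: cring CR by (rule CR_cring)
  show "ring CR" ..
  show "subgroup NS (add_monoid CR)"
  proof (rule C.add.subgroupI)
    show "NS \<subseteq> carrier CR" by (auto simp: NS_iff)
    have "(\<lambda>i. \<zero>) \<in> NS" by (simp add: NS_iff CR_const v_0)
    then show "NS \<noteq> {}" by blast
    show "\<ominus>\<^bsub>CR\<^esub> s \<in> NS" if "s \<in> NS" for s
      using that CRD by (auto simp: NS_iff CR_a_inv CR_neg v_minus)
    fix s t assume st: "s \<in> NS" "t \<in> NS"
    have "(\<lambda>i. \<nu> (s i \<oplus> t i)) \<longlonglongrightarrow> 0"
    proof (rule real_null_comparison)
      show "(\<lambda>i. \<nu> (s i) + \<nu> (t i)) \<longlonglongrightarrow> 0"
        using tendsto_add[of "\<lambda>i. \<nu> (s i)" 0 sequentially "\<lambda>i. \<nu> (t i)" 0] st by (simp add: NS_iff)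
      show "\<forall>\<^sub>F i in sequentially. norm (\<nu> (s i \<oplus> t i)) \<le> \<nu> (s i) + \<nu> (t i)"
        using st v_add v_nonneg CRD by (auto simp: NS_iff)
    qed
    then show "s \<oplus>\<^bsub>CR\<^esub> t \<in> NS"
      using st by (simp add: NS_iff CR_simps CR_add)
  qed
  fix a x assume ax: "a \<in> NS" "x \<in> carrier CR"
  obtain M where M: "\<And>i. \<nu> (x i) \<le> M" using CR_bounded[OF ax(2)] by auto
  have lim: "(\<lambda>i. \<nu> (x i \<otimes> a i)) \<longlonglongrightarrow> 0"
  proof (rule real_null_comparison)
    show "(\<lambda>i. M * \<nu> (a i)) \<longlonglongrightarrow> 0" using ax(1) by (auto simp: NS_iff intro: tendsto_mult_right_zero)
    have c: "x i \<in> carrier R" "a i \<in> carrier R" for i using ax CRD by (auto simp: NS_iff)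
    have "norm (\<nu> (x i \<otimes> a i)) \<le> M * \<nu> (a i)" for i
      using c[of i] v_nonneg M[of i] by (simp add: v_mult abs_mult mult_right_mono)
    then show "\<forall>\<^sub>F i in sequentially. norm (\<nu> (x i \<otimes> a i)) \<le> M * \<nu> (a i)" by simp
  qed
  then show "x \<otimes>\<^bsub>CR\<^esub> a \<in> NS" using ax by (simp add: NS_iff CR_simps CR_mult)
  then show "a \<otimes>\<^bsub>CR\<^esub> x \<in> NS" using C.m_comm ax by (simp add: NS_iff)
qed

definition cls where "cls s = NS +>\<^bsub>CR\<^esub> s"

abbreviation CC where "CC \<equiv> completion R \<nu>"

lemma cls_hom: "cls \<in> ring_hom CR CC"
  unfolding cls_def[abs_def] completion_def by (rule ideal.rcos_ring_hom[OF NS_ideal])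

lemma cls_add: "s \<in> carrier CR \<Longrightarrow> t \<in> carrier CR \<Longrightarrow> cls s \<oplus>\<^bsub>CC\<^esub> cls t = cls (\<lambda>i. s i \<oplus> t i)"
  and cls_mult: "s \<in> carrier CR \<Longrightarrow> t \<in> carrier CR \<Longrightarrow> cls s \<otimes>\<^bsub>CC\<^esub> cls t = cls (\<lambda>i. s i \<otimes> t i)"
  and cls_one: "\<one>\<^bsub>CC\<^esub> = cls (\<lambda>i. \<one>)"
  and cls_closed: "s \<in> carrier CR \<Longrightarrow> cls s \<in> carrier CC"
  using ring_hom_add[OF cls_hom, of s t] ring_hom_mult[OF cls_hom, of s t] ring_hom_one[OF cls_hom]
    ring_hom_closed[OF cls_hom, of s] by (simp_all add: CR_simps)

lemma CC_carrier: "carrier CC = cls ` carrier CR"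
  by (auto simp: completion_def FactRing_def A_RCOSETS_def' cls_def)

lemma CC_cases: assumes "C \<in> carrier CC" obtains s where "s \<in> carrier CR" "C = cls s"
  using assms CC_carrier by blast

lemma cls_eq_iff: "s \<in> carrier CR \<Longrightarrow> t \<in> carrier CR \<Longrightarrow> cls s = cls t \<longleftrightarrow> (\<lambda>i. \<nu> (s i \<ominus> t i)) \<longlonglongrightarrow> 0"
proof -
  interpret C: cring CR by (rule CR_cring)
  assume st: "s \<in> carrier CR" "t \<in> carrier CR"
  have "(\<lambda>i. s i \<ominus> t i) \<in> carrier CR"
    using C.minus_closed[OF st] CR_minus[OF st] by simp
  then show ?thesis
    using C.quotient_eq_iff_same_a_r_cos[OF NS_ideal st] by (simp add: cls_def NS_iff CR_minus[OF st])
qed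

lemma CC_cring: "cring CC"
  unfolding completion_def by (rule ideal.quotient_is_cring[OF NS_ideal CR_cring])

lemma cls_zero: "\<zero>\<^bsub>CC\<^esub> = cls (\<lambda>i. \<zero>)"
proof -
  interpret C: cring CR by (rule CR_cring)
  interpret D: cring CC by (rule CC_cring)
  show ?thesis
    using ring_hom_zero[OF cls_hom C.ring_axioms D.ring_axioms] by (simp add: CR_simps)
qed

lemma cls_eq_0_iff: "s \<in> carrier CR \<Longrightarrow> cls s = \<zero>\<^bsub>CC\<^esub> \<longleftrightarrow> (\<lambda>i. \<nu> (s i)) \<longlonglongrightarrow> 0"
  using cls_eq_iff[of s "\<lambda>i. \<zero>"] CRD by (simp add: cls_zero CR_const a_minus_def)

lemma cls_minus: assumes s: "s \<in> carrier CR" "t \<in> carrier CR" shows "cls s \<ominus>\<^bsub>CC\<^esub> cls t = cls (\<lambda>i. s i \<ominus> t i)"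
proof -
  interpret C: cring CR by (rule CR_cring)
  interpret D: cring CC by (rule CC_cring)
  interpret H: ring_hom_ring CR CC cls
    using cls_hom by (intro ring_hom_ringI2 C.ring_axioms D.ring_axioms)
  have "cls (s \<ominus>\<^bsub>CR\<^esub> t) = cls s \<ominus>\<^bsub>CC\<^esub> cls t"
    using s by (simp add: a_minus_def)
  then show ?thesis using CR_minus[OF s] by simp
qed

lemma CC_field: "field CC"
proof (rule cring.cring_fieldI2[OF CC_cring])
  show "\<zero>\<^bsub>CC\<^esub> \<noteq> \<one>\<^bsub>CC\<^esub>"
  proof
    assume "\<zero>\<^bsub>CC\<^esub> = \<one>\<^bsub>CC\<^esub>"
    then have "(\<lambda>i::nat. 1::real) \<longlonglongrightarrow> 0"
      using cls_eq_0_iff[of "\<lambda>i. \<one>"] CR_const[OF one_closed] v_1 cls_one by simp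
    then show False using LIMSEQ_unique[OF tendsto_const] by fastforce
  qed
  fix a assume a: "a \<in> carrier CC" "a \<noteq> \<zero>\<^bsub>CC\<^esub>"
  obtain s where s: "s \<in> carrier CR" "a = cls s" using CC_cases[OF a(1)] .
  obtain l where l: "(\<lambda>i. \<nu> (s i)) \<longlonglongrightarrow> l" using CR_convergent[OF s(1)] by (auto simp: convergent_def)
  have "l \<noteq> 0" using a s l cls_eq_0_iff by auto
  moreover have "l \<ge> 0" using l v_nonneg CRD[OF s(1)] by (intro LIMSEQ_le_const[OF l]) auto
  ultimately have "l / 2 < l" "l > 0" by auto
  then obtain N where N: "\<And>i. i \<ge> N \<Longrightarrow> l / 2 < \<nu> (s i)"
    using order_tendstoD(1)[OF l] by (meson eventually_sequentially)
  \<comment> \<open>From \<open>N\<close> on the values exceed \<open>l / 2\<close> and inversion is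
    possible; earlier entries may vanish and are replaced by 1.\<close>
  define t where "t = (\<lambda>i. if i \<ge> N then inv (s i) else \<one>)"
  have nz: "s i \<noteq> \<zero>" if "i \<ge> N" for i using N[OF that] \<open>l > 0\<close> v_0 by auto
  have invc: "inv (s i) \<in> carrier R" "s i \<otimes> inv (s i) = \<one>" "inv (s i) \<otimes> s i = \<one>" if "i \<ge> N" for i
    using nz[OF that] CRD[OF s(1), of i] field_Units by auto
  have tR: "t i \<in> carrier R" for i using invc by (auto simp: t_def)
  have "t \<in> carrier CR"
    unfolding CR_carrier
  proof (intro conjI allI impI tR)
    fix e :: real assume e: "e > 0"
    \<comment> \<open>A difference of inverses is the difference divided by a product of two values,
      each above \<open>l / 2\<close>.\<close>
    then have "e * (l / 2)\<^sup>2 > 0" using \<open>l > 0\<close> by simp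
    then obtain M where M: "\<And>i j. i \<ge> M \<Longrightarrow> j \<ge> M \<Longrightarrow> \<nu> (s i \<ominus> s j) < e * (l / 2)\<^sup>2"
      using CR_Cauchy[OF s(1)] by meson
    show "\<exists>N. \<forall>i\<ge>N. \<forall>j\<ge>N. \<nu> (t i \<ominus> t j) < e"
    proof (intro exI[of _ "max N M"] allI impI)
      fix i j assume ij: "i \<ge> max N M" "j \<ge> max N M"
      then have iN: "i \<ge> N" "j \<ge> N" by auto
      note c = CRD[OF s(1), of i] CRD[OF s(1), of j] invc[OF iN(1)] invc[OF iN(2)]
      have "inv (s i) \<otimes> ((s j \<ominus> s i) \<otimes> inv (s j)) = inv (s i) \<ominus> inv (s j)"
      proof -
        have "(s j \<ominus> s i) \<otimes> inv (s j) = \<one> \<ominus> s i \<otimes> inv (s j)"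
          using c by (simp add: a_minus_def l_distr l_minus)
        then have "inv (s i) \<otimes> ((s j \<ominus> s i) \<otimes> inv (s j)) = inv (s i) \<ominus> inv (s i) \<otimes> (s i \<otimes> inv (s j))"
          using c by (simp add: a_minus_def r_distr r_minus)
        then show ?thesis using c by (simp add: m_assoc[symmetric])
      qed
      then have eq: "\<nu> (t i \<ominus> t j) = inverse (\<nu> (s i)) * (\<nu> (s j \<ominus> s i) * inverse (\<nu> (s j)))"
        using iN c v_inv nz v_mult[of "inv (s i)" "(s j \<ominus> s i) \<otimes> inv (s j)"] v_mult[of "s j \<ominus> s i" "inv (s j)"]
        by (simp add: t_def)
      have "\<dots> = \<nu> (s j \<ominus> s i) / (\<nu> (s i) * \<nu> (s j))" by (simp add: field_simps)
      also have "\<dots> < e * (l / 2)\<^sup>2 / (l / 2)\<^sup>2"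
      proof (rule frac_less)
        show "0 \<le> \<nu> (s j \<ominus> s i)" using c v_nonneg by simp
        show "\<nu> (s j \<ominus> s i) < e * (l / 2)\<^sup>2" using M ij by simp
        show "0 < (l / 2)\<^sup>2" using \<open>l > 0\<close> by simp
        show "(l / 2)\<^sup>2 \<le> \<nu> (s i) * \<nu> (s j)"
          unfolding power2_eq_square using N[OF iN(1)] N[OF iN(2)] \<open>l > 0\<close> by (intro mult_mono) auto
      qed
      also have "\<dots> = e" using \<open>l > 0\<close> by simp
      finally show "\<nu> (t i \<ominus> t j) < e" using eq by simp
    qed
  qed
  moreover have "cls (\<lambda>i. s i \<otimes> t i) = cls (\<lambda>i. \<one>)"
  proof (subst cls_eq_iff)
    show "(\<lambda>i. s i \<otimes> t i) \<in> carrier CR" "(\<lambda>i. \<one>) \<in> carrier CR"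
      using CR_mult s \<open>t \<in> carrier CR\<close> CR_const by auto
    have "\<forall>\<^sub>F i in sequentially. \<nu> (s i \<otimes> t i \<ominus> \<one>) = 0"
      using eventually_ge_at_top[of N] by eventually_elim (auto simp: t_def invc a_minus_def r_neg v_0)
    then show "(\<lambda>i. \<nu> (s i \<otimes> t i \<ominus> \<one>)) \<longlonglongrightarrow> 0" by (rule tendsto_eventually)
  qed
  ultimately show "\<exists>b\<in>carrier CC. a \<otimes>\<^bsub>CC\<^esub> b = \<one>\<^bsub>CC\<^esub>"
    using s cls_mult cls_closed by (intro bexI[of _ "cls t"]) (auto simp: cls_one)
qed

abbreviation cabs where "cabs \<equiv> completion_abs \<nu>"

text \<open>\<open>completion_abs\<close> evaluates an arbitrary member of the class; it differs
  from \<open>s\<close> by a null sequence, so the limit is the same.\<close>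

lemma cabs_lim: assumes s: "s \<in> carrier CR" shows "(\<lambda>i. \<nu> (s i)) \<longlonglongrightarrow> cabs (cls s)"
proof -
  interpret C: cring CR by (rule CR_cring)
  define t where "t = (SOME t. t \<in> cls s)"
  have "s \<in> cls s"
  proof -
    have "(\<lambda>i. \<zero>) \<in> NS" by (simp add: NS_iff CR_const v_0)
    moreover have "s = (\<lambda>i. \<zero>) \<oplus>\<^bsub>CR\<^esub> s" using CRD[OF s] by (simp add: CR_simps)
    ultimately show ?thesis unfolding cls_def a_r_coset_def' by blast
  qed
  then have "t \<in> cls s" unfolding t_def by (rule someI[where P = "\<lambda>t. t \<in> cls s"])
  then obtain n where n: "n \<in> NS" "t = n \<oplus>\<^bsub>CR\<^esub> s" by (auto simp: cls_def a_r_coset_def')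
  obtain l where l: "(\<lambda>i. \<nu> (s i)) \<longlonglongrightarrow> l" using CR_convergent[OF s] by (auto simp: convergent_def)
  have "(\<lambda>i. \<nu> (t i) - \<nu> (s i)) \<longlonglongrightarrow> 0"
  proof (rule real_null_comparison)
    show "(\<lambda>i. \<nu> (n i)) \<longlonglongrightarrow> 0" using n by (simp add: NS_iff)
    have "t i \<ominus> s i = n i" for i
      using n s CRD by (simp add: CR_simps NS_iff a_minus_def a_assoc r_neg)
    moreover have "t \<in> carrier CR" using n s by (simp add: NS_iff C.add.m_closed)
    ultimately have "norm (\<nu> (t i) - \<nu> (s i)) \<le> \<nu> (n i)" for i
      using v_abs_diff[OF CRD CRD[OF s], of t i i] by simp
    then show "\<forall>\<^sub>F i in sequentially. norm (\<nu> (t i) - \<nu> (s i)) \<le> \<nu> (n i)" by simp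
  qed
  then have "(\<lambda>i. \<nu> (t i)) \<longlonglongrightarrow> l" using Lim_transform[OF l] by simp
  then have "cabs (cls s) = l" by (simp add: completion_abs_def t_def limI)
  then show ?thesis using l by simp
qed

lemma cabs_eqI: "s \<in> carrier CR \<Longrightarrow> (\<lambda>i. \<nu> (s i)) \<longlonglongrightarrow> l \<Longrightarrow> cabs (cls s) = l"
  using cabs_lim LIMSEQ_unique by blast

lemma cabs_absolute_value: "absolute_value CC cabs"
  unfolding absolute_value_def
proof (intro conjI ballI)
  fix a assume "a \<in> carrier CC"
  then obtain s where s: "s \<in> carrier CR" "a = cls s" using CC_cases by blast
  show "0 \<le> cabs a"
    unfolding s(2) by (rule LIMSEQ_le_const[OF cabs_lim[OF s(1)]]) (use v_nonneg CRD s in auto)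
  show "cabs a = 0 \<longleftrightarrow> a = \<zero>\<^bsub>CC\<^esub>"
    unfolding s(2) cls_eq_0_iff[OF s(1)] using cabs_lim[OF s(1)] cabs_eqI[OF s(1), of 0] by metis
  fix b assume "b \<in> carrier CC"
  then obtain t where t: "t \<in> carrier CR" "b = cls t" using CC_cases by blast
  show "cabs (a \<otimes>\<^bsub>CC\<^esub> b) = cabs a * cabs b"
    unfolding s(2) t(2) cls_mult[OF s(1) t(1)]
    using tendsto_mult[OF cabs_lim[OF s(1)] cabs_lim[OF t(1)]] v_mult CRD s t
    by (intro cabs_eqI CR_mult) auto
  show "cabs (a \<oplus>\<^bsub>CC\<^esub> b) \<le> cabs a + cabs b"
    unfolding s(2) t(2) cls_add[OF s(1) t(1)]
    by (rule LIMSEQ_le[OF cabs_lim[OF CR_add[OF s(1) t(1)]] tendsto_add[OF cabs_lim[OF s(1)] cabs_lim[OF t(1)]]])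
      (use v_add CRD s t in auto)
qed

lemma completion_valued: "valued_field CC cabs"
  using CC_field cabs_absolute_value by (simp add: valued_field_def valued_field_axioms_def)

abbreviation cmap where "cmap \<equiv> completion_map R \<nu>"

lemma cmap_cls: "cmap x = cls (\<lambda>i. x)"
  by (simp add: completion_map_def cls_def)

lemma cmap_hom: "cmap \<in> ring_hom R CC"
  by (rule ring_hom_memI) (auto simp: cmap_cls cls_closed CR_const cls_mult cls_add cls_one)

lemma cmap_closed: "x \<in> carrier R \<Longrightarrow> cmap x \<in> carrier CC"
  using cmap_hom by (rule ring_hom_closed)

lemma cmap_abs: "x \<in> carrier R \<Longrightarrow> cabs (cmap x) = \<nu> x"
  unfolding cmap_cls by (intro cabs_eqI CR_const) auto

text \<open>The entries of a representative approximate its class: the difference is the class of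
  the sequence shifted by \<open>s i\<close>, whose tail is small once \<open>i\<close> is in the
  Cauchy range.\<close>

lemma cmap_dense:
  assumes s: "s \<in> carrier CR"
  shows "(\<lambda>i. cabs (cls s \<ominus>\<^bsub>CC\<^esub> cmap (s i))) \<longlonglongrightarrow> 0"
proof (rule metric_LIMSEQ_I)
  fix e :: real assume "e > 0"
  then have e: "e / 2 > 0" by simp
  obtain N where N: "\<And>i j. i \<ge> N \<Longrightarrow> j \<ge> N \<Longrightarrow> \<nu> (s i \<ominus> s j) < e / 2" using CR_Cauchy[OF s e] by meson
  interpret C: cring CR by (rule CR_cring)
  show "\<exists>N. \<forall>i\<ge>N. dist (cabs (cls s \<ominus>\<^bsub>CC\<^esub> cmap (s i))) 0 < e"
  proof (intro exI[of _ N] allI impI)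
    fix i assume i: "i \<ge> N"
    have c: "(\<lambda>j. s i) \<in> carrier CR" using CR_const CRD[OF s] by simp
    have d: "(\<lambda>j. s j \<ominus> s i) \<in> carrier CR" using C.minus_closed[OF s c] CR_minus[OF s c] by simp
    have eq: "cls s \<ominus>\<^bsub>CC\<^esub> cmap (s i) = cls (\<lambda>j. s j \<ominus> s i)"
      unfolding cmap_cls by (rule cls_minus[OF s c])
    have "cabs (cls (\<lambda>j. s j \<ominus> s i)) \<le> e / 2"
      by (rule LIMSEQ_le_const2[OF cabs_lim[OF d]]) (use N i in \<open>auto intro!: exI[of _ N] less_imp_le\<close>)
    moreover have "0 \<le> cabs (cls (\<lambda>j. s j \<ominus> s i))"
      using cabs_absolute_value cls_closed[OF d] by (simp add: absolute_value_def)
    ultimately show "dist (cabs (cls s \<ominus>\<^bsub>CC\<^esub> cmap (s i))) 0 < e" using eq \<open>e > 0\<close> by simp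
  qed
qed

end

section \<open>Extension of non-archimedean absolute values\<close>

text \<open>\<open>A\<close> stands for a maximal subring containing the valuation ring of \<open>\<nu>\<close> but not \<open>inv \<pi>\<close>.\<close>

locale nonarch_ext = field F for F (structure) +
  fixes k :: "'a set" and \<nu> :: "'a \<Rightarrow> real" and \<pi> :: 'a
  assumes k: "subfield k F"
    and abs: "absolute_value (F\<lparr>carrier := k\<rparr>) \<nu>"
    and ultra: "x \<in> k \<Longrightarrow> y \<in> k \<Longrightarrow> \<nu> (x \<oplus> y) \<le> max (\<nu> x) (\<nu> y)"
    and pi: "\<pi> \<in> k" "0 < \<nu> \<pi>" "\<nu> \<pi> < 1"
begin

lemma k_carrier: "x \<in> k \<Longrightarrow> x \<in> carrier F"
  using subfieldE(3)[OF k] by blast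

lemma k_simps: "\<zero> \<in> k" "\<one> \<in> k" "x \<in> k \<Longrightarrow> y \<in> k \<Longrightarrow> x \<oplus> y \<in> k"
  "x \<in> k \<Longrightarrow> y \<in> k \<Longrightarrow> x \<otimes> y \<in> k" "x \<in> k \<Longrightarrow> \<ominus> x \<in> k"
  "x \<in> k \<Longrightarrow> x \<noteq> \<zero> \<Longrightarrow> inv x \<in> k"
  using subring_props[OF k] subfield_m_inv(1)[OF k] by auto

lemma k_pow: "x \<in> k \<Longrightarrow> x [^] (n::nat) \<in> k"
  by (induction n) (auto simp: k_simps)

lemma n_nonneg: "x \<in> k \<Longrightarrow> 0 \<le> \<nu> x"
  and n_eq_0: "x \<in> k \<Longrightarrow> \<nu> x = 0 \<longleftrightarrow> x = \<zero>"
  and n_mult: "x \<in> k \<Longrightarrow> y \<in> k \<Longrightarrow> \<nu> (x \<otimes> y) = \<nu> x * \<nu> y"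
  using abs by (auto simp: absolute_value_def)

lemma n_pos: "x \<in> k \<Longrightarrow> x \<noteq> \<zero> \<Longrightarrow> 0 < \<nu> x"
  using n_nonneg n_eq_0 by (metis less_eq_real_def)

lemma n_1: "\<nu> \<one> = 1"
  using n_mult[of \<one> \<one>] n_pos[of \<one>] k_simps by simp

lemma n_minus: assumes "x \<in> k" shows "\<nu> (\<ominus> x) = \<nu> x"
proof -
  have m: "\<ominus> \<one> \<in> k" using k_simps by blast
  have "\<nu> (\<ominus> \<one>) * \<nu> (\<ominus> \<one>) = 1"
    using n_mult[OF m m] n_1 by (simp add: l_minus r_minus)
  then have "\<nu> (\<ominus> \<one>) = 1"
    using n_nonneg[OF m] by (metis abs_of_nonneg abs_square_eq_1 power2_eq_square)
  then show ?thesis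
    using n_mult[OF m assms] k_carrier[OF assms] by (simp add: l_minus)
qed

lemma n_pow: "x \<in> k \<Longrightarrow> \<nu> (x [^] (n::nat)) = \<nu> x ^ n"
  by (induction n) (auto simp: n_1 n_mult k_pow)

lemma n_inv: "x \<in> k \<Longrightarrow> x \<noteq> \<zero> \<Longrightarrow> \<nu> (inv x) = inverse (\<nu> x)"
proof -
  assume x: "x \<in> k" "x \<noteq> \<zero>"
  then have "x \<otimes> inv x = \<one>" using k_carrier field_Units by auto
  then show ?thesis using n_mult[OF x(1) k_simps(6)[OF x]] n_1 by (simp add: inverse_unique)
qed

lemma inv_closed: "x \<in> carrier F \<Longrightarrow> x \<noteq> \<zero> \<Longrightarrow> inv x \<in> carrier F"
  and r_inverse: "x \<in> carrier F \<Longrightarrow> x \<noteq> \<zero> \<Longrightarrow> x \<otimes> inv x = \<one>"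
  and l_inverse: "x \<in> carrier F \<Longrightarrow> x \<noteq> \<zero> \<Longrightarrow> inv x \<otimes> x = \<one>"
  using field_Units by auto

lemma inv_nonzero: "x \<in> carrier F \<Longrightarrow> x \<noteq> \<zero> \<Longrightarrow> inv x \<noteq> \<zero>"
  using r_inverse[of x] by auto

lemma pi_facts: "\<pi> \<in> carrier F" "\<pi> \<noteq> \<zero>" "inv \<pi> \<in> carrier F" "inv \<pi> \<otimes> \<pi> = \<one>" "\<pi> \<otimes> inv \<pi> = \<one>" "inv \<pi> \<noteq> \<zero>"
proof -
  show *: "\<pi> \<in> carrier F" "\<pi> \<noteq> \<zero>" using k_carrier pi n_eq_0[OF pi(1)] by auto
  then show "inv \<pi> \<in> carrier F" "inv \<pi> \<otimes> \<pi> = \<one>" "\<pi> \<otimes> inv \<pi> = \<one>" "inv \<pi> \<noteq> \<zero>"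
    using inv_closed l_inverse r_inverse inv_nonzero by auto
qed

definition VO where "VO = {x \<in> k. \<nu> x \<le> 1}"

definition good where "good A \<longleftrightarrow> subring A F \<and> VO \<subseteq> A \<and> inv \<pi> \<notin> A"

lemma subring_VO: "subring VO F"
proof (rule subringI)
  show "VO \<subseteq> carrier F" using k_carrier by (auto simp: VO_def)
  fix x y assume "x \<in> VO" "y \<in> VO"
  then show "x \<otimes> y \<in> VO" "x \<oplus> y \<in> VO"
    using ultra[of x y] n_nonneg by (auto simp: VO_def k_simps n_mult mult_le_one)
qed (auto simp: VO_def k_simps n_1 n_minus)

lemma good_VO: "good VO"
  using subring_VO n_inv[OF pi(1) pi_facts(2)] pi
  by (auto simp: good_def VO_def inverse_le_1_iff)

text \<open>Zorn's lemma: the union of a chain of such subrings still omits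
  \<open>inv \<pi>\<close>.\<close>

lemma maximal_exists: "\<exists>A. good A \<and> (\<forall>B. good B \<longrightarrow> A \<subseteq> B \<longrightarrow> B = A)"
proof -
  have "\<exists>M\<in>Collect good. \<forall>Y\<in>Collect good. M \<subseteq> Y \<longrightarrow> Y = M"
  proof (rule subset_Zorn_nonempty)
    show "Collect good \<noteq> {}" using good_VO by blast
    fix C assume C: "C \<noteq> {}" "subset.chain (Collect good) C"
    then have g: "\<And>A. A \<in> C \<Longrightarrow> good A" and ch: "\<And>A B. A \<in> C \<Longrightarrow> B \<in> C \<Longrightarrow> A \<subseteq> B \<or> B \<subseteq> A"
      by (auto simp: subset.chain_def)
    have sr: "subring A F" if "A \<in> C" for A using g[OF that] by (simp add: good_def)
    have both: "\<exists>A\<in>C. x \<in> A \<and> y \<in> A" if "x \<in> \<Union>C" "y \<in> \<Union>C" for x y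
      using that ch by blast
    have "subring (\<Union>C) F"
    proof (rule subringI)
      show "\<Union>C \<subseteq> carrier F" using subringE(1)[OF sr] by blast
      show "\<one> \<in> \<Union>C" using C(1) subringE(3)[OF sr] by blast
      show "\<ominus> x \<in> \<Union>C" if "x \<in> \<Union>C" for x using that subringE(5)[OF sr] by blast
      fix x y assume "x \<in> \<Union>C" "y \<in> \<Union>C"
      then obtain A where A: "A \<in> C" "x \<in> A" "y \<in> A" using both by blast
      then show "x \<otimes> y \<in> \<Union>C" "x \<oplus> y \<in> \<Union>C"
        using subringE(6,7)[OF sr[OF A(1)]] by blast+
    qed
    then show "\<Union>C \<in> Collect good" using C(1) g by (auto simp: good_def)
  qed
  then show ?thesis by auto
qed

end

locale maximal_subring = nonarch_ext +
  fixes A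
  assumes A: "good A" and Amax: "good B \<Longrightarrow> A \<subseteq> B \<Longrightarrow> B = A"
begin

lemma A_carrier: "x \<in> A \<Longrightarrow> x \<in> carrier F"
  and A_0: "\<zero> \<in> A" and A_1: "\<one> \<in> A"
  and A_add: "x \<in> A \<Longrightarrow> y \<in> A \<Longrightarrow> x \<oplus> y \<in> A"
  and A_mult: "x \<in> A \<Longrightarrow> y \<in> A \<Longrightarrow> x \<otimes> y \<in> A"
  and A_neg: "x \<in> A \<Longrightarrow> \<ominus> x \<in> A"
  and A_VO: "x \<in> VO \<Longrightarrow> x \<in> A" and A_pi: "inv \<pi> \<notin> A"
  using A subringE[of A F] by (auto simp: good_def)

lemma A_minus: "x \<in> A \<Longrightarrow> y \<in> A \<Longrightarrow> x \<ominus> y \<in> A"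
  by (simp add: a_minus_def A_add A_neg)

lemma A_pow: "x \<in> A \<Longrightarrow> x [^] (n::nat) \<in> A"
  by (induction n) (auto simp: A_1 A_mult)

lemma pi_A: "\<pi> \<in> A"
  using pi by (intro A_VO) (simp add: VO_def)

text \<open>\<open>A\<close> adds nothing of \<open>k\<close> to the valuation ring: if
  \<open>\<nu> c > 1\<close>, a power of \<open>c\<close> outweighs \<open>inv \<pi>\<close>, and
  \<open>inv \<pi>\<close> would be that power times an element of \<open>VO\<close>.\<close>

lemma A_k: assumes c: "c \<in> k" "c \<in> A" shows "\<nu> c \<le> 1"
proof (rule ccontr)
  assume "\<not> \<nu> c \<le> 1"
  then have c1: "\<nu> c > 1" by simp
  then have c0: "c \<noteq> \<zero>" using n_eq_0[OF c(1)] by auto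
  obtain m where m: "inverse (\<nu> \<pi>) < \<nu> c ^ m" using real_arch_pow[OF c1] by blast
  have cm1: "c [^] m \<in> k" by (rule k_pow[OF c(1)])
  have "\<nu> (c [^] m) \<noteq> 0" using n_pow[OF c(1), of m] c1 by simp
  then have cm: "c [^] m \<in> k" "c [^] m \<in> carrier F" "c [^] m \<noteq> \<zero>"
    using cm1 k_carrier[OF cm1] n_eq_0[OF cm1] by auto
  define d where "d = inv \<pi> \<otimes> inv (c [^] m)"
  have dk: "d \<in> k" unfolding d_def
    by (rule k_simps(4)[OF k_simps(6)[OF pi(1) pi_facts(2)] k_simps(6)[OF cm(1,3)]])
  have "\<nu> d = inverse (\<nu> \<pi>) * inverse (\<nu> c ^ m)"
    unfolding d_def
    using n_mult[OF k_simps(6)[OF pi(1) pi_facts(2)] k_simps(6)[OF cm(1,3)]] n_inv[OF pi(1) pi_facts(2)]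
      n_inv[OF cm(1,3)] n_pow[OF c(1), of m] by simp
  also have "\<dots> \<le> 1"
  proof -
    have "1 \<le> \<nu> \<pi> * \<nu> c ^ m" using m pi(2) by (simp add: field_simps less_imp_le)
    then show ?thesis by (simp add: inverse_mult_distrib[symmetric] inverse_le_1_iff del: inverse_mult_distrib)
  qed
  finally have "d \<in> A" using dk by (intro A_VO) (simp add: VO_def)
  then have "d \<otimes> c [^] m \<in> A" using A_mult A_pow c by blast
  moreover have "d \<otimes> c [^] m = inv \<pi>"
    unfolding d_def using pi_facts cm inv_closed l_inverse by (simp add: m_assoc)
  ultimately show False using A_pi by simp
qed

text \<open>Polynomials in \<open>x\<close> of degree at most \<open>n\<close> with coefficients in
  \<open>A\<close>, built by Horner's rule; the union over \<open>n\<close> is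
  \<open>A[x]\<close>.\<close>

fun SS :: "'a \<Rightarrow> nat \<Rightarrow> 'a set" where
  "SS x 0 = A"
| "SS x (Suc n) = {a \<oplus> x \<otimes> z | a z. a \<in> A \<and> z \<in> SS x n}"

context fixes x assumes x: "x \<in> carrier F" begin

lemma SS_carrier: "z \<in> SS x n \<Longrightarrow> z \<in> carrier F"
  using x by (induction n arbitrary: z) (auto simp: A_carrier)

lemma SS_0: "\<zero> \<in> SS x n"
proof (induction n)
  case (Suc n)
  show ?case using Suc A_0 x by (auto intro!: exI[of _ \<zero>])
qed (simp add: A_0)

lemma SS_A: "a \<in> A \<Longrightarrow> a \<in> SS x n"
proof (cases n)
  case (Suc m)
  assume "a \<in> A"
  moreover have "a = a \<oplus> x \<otimes> \<zero>" using x A_carrier[OF \<open>a \<in> A\<close>] by simp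
  ultimately show ?thesis using SS_0 Suc by fastforce
qed simp

lemma SS_x: "z \<in> SS x n \<Longrightarrow> x \<otimes> z \<in> SS x (Suc n)"
proof -
  assume z: "z \<in> SS x n"
  have "x \<otimes> z = \<zero> \<oplus> x \<otimes> z" using x SS_carrier[OF z] by simp
  then show ?thesis using z A_0 by fastforce
qed

lemma SS_add: "z \<in> SS x n \<Longrightarrow> z' \<in> SS x n \<Longrightarrow> z \<oplus> z' \<in> SS x n"
proof (induction n arbitrary: z z')
  case (Suc n)
  then obtain a y a' y' where *: "a \<in> A" "y \<in> SS x n" "z = a \<oplus> x \<otimes> y" "a' \<in> A" "y' \<in> SS x n" "z' = a' \<oplus> x \<otimes> y'"
    by auto
  then have "z \<oplus> z' = (a \<oplus> a') \<oplus> x \<otimes> (y \<oplus> y')"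
    using x SS_carrier A_carrier by (simp add: r_distr a_ac)
  then show ?case using * Suc.IH A_add by fastforce
qed (simp add: A_add)

lemma SS_smult: "b \<in> A \<Longrightarrow> z \<in> SS x n \<Longrightarrow> b \<otimes> z \<in> SS x n"
proof (induction n arbitrary: z)
  case (Suc n)
  then obtain a y where *: "a \<in> A" "y \<in> SS x n" "z = a \<oplus> x \<otimes> y" by auto
  then have "b \<otimes> z = b \<otimes> a \<oplus> x \<otimes> (b \<otimes> y)"
    using x SS_carrier A_carrier Suc.prems(1) by (simp add: r_distr m_ac)
  then show ?case using * Suc A_mult by fastforce
qed (simp add: A_mult)

lemma SS_mono: "n \<le> m \<Longrightarrow> z \<in> SS x n \<Longrightarrow> z \<in> SS x m"
proof (induction n arbitrary: m z)
  case (Suc n)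
  then obtain m' where m': "m = Suc m'" "n \<le> m'" by (cases m) auto
  obtain a y where "a \<in> A" "y \<in> SS x n" "z = a \<oplus> x \<otimes> y" using Suc.prems(2) by auto
  then show ?case using Suc.IH[OF m'(2)] m'(1) by auto
qed (simp add: SS_A)

lemma SS_mult: "z \<in> SS x n \<Longrightarrow> y \<in> SS x m \<Longrightarrow> z \<otimes> y \<in> SS x (n + m)"
proof (induction n arbitrary: z)
  case (Suc n)
  then obtain a z' where *: "a \<in> A" "z' \<in> SS x n" "z = a \<oplus> x \<otimes> z'" by auto
  have "z \<otimes> y = a \<otimes> y \<oplus> x \<otimes> (z' \<otimes> y)"
    using * x SS_carrier A_carrier Suc.prems(2) by (simp add: l_distr m_assoc)
  moreover have "a \<otimes> y \<in> SS x (Suc n + m)"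
    using SS_mono[of m "Suc n + m"] SS_smult[OF *(1) Suc.prems(2)] by simp
  moreover have "x \<otimes> (z' \<otimes> y) \<in> SS x (Suc n + m)"
    using SS_x[OF Suc.IH[OF *(2) Suc.prems(2)]] by simp
  ultimately show ?case using SS_add by metis
qed (simp add: SS_smult)

lemma SS_top: "z \<in> SS x (Suc n) \<Longrightarrow> \<exists>a\<in>A. \<exists>z'\<in>SS x n. z = z' \<oplus> a \<otimes> x [^] Suc n"
proof (induction n arbitrary: z)
  case 0
  then obtain a y where "a \<in> A" "y \<in> A" "z = a \<oplus> x \<otimes> y" by auto
  then show ?case using x A_carrier m_comm by fastforce
next
  case (Suc n)
  then obtain a y where *: "a \<in> A" "y \<in> SS x (Suc n)" "z = a \<oplus> x \<otimes> y" using SS.simps(2) by blast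
  then obtain b z' where b: "b \<in> A" "z' \<in> SS x n" "y = z' \<oplus> b \<otimes> x [^] Suc n" using Suc.IH by blast
  have c: "a \<in> carrier F" "b \<in> carrier F" "z' \<in> carrier F" using * b A_carrier SS_carrier by auto
  have "z = (a \<oplus> x \<otimes> z') \<oplus> b \<otimes> x [^] Suc (Suc n)"
  proof -
    define p where "p = x [^] Suc n"
    have p: "p \<in> carrier F" using x by (simp add: p_def)
    have "x \<otimes> (b \<otimes> p) = b \<otimes> (p \<otimes> x)"
      using m_lcomm[OF x c(2) p] m_comm[OF x p] by simp
    then have "a \<oplus> x \<otimes> (z' \<oplus> b \<otimes> p) = (a \<oplus> x \<otimes> z') \<oplus> b \<otimes> (p \<otimes> x)"
      using c x p by (simp add: r_distr a_assoc)
    then show ?thesis unfolding *(3) b(3) p_def by simp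
  qed
  moreover have "a \<oplus> x \<otimes> z' \<in> SS x (Suc n)" using * b by auto
  ultimately show ?case using b(1) by blast
qed

text \<open>For \<open>x\<close> outside \<open>A\<close> the ring \<open>A[x]\<close> is strictly
  larger, so by maximality it is not \<open>good\<close>; it can fail only by containing
  \<open>inv \<pi>\<close>.\<close>

lemma inv_pi_in_SS:
  assumes "x \<notin> A" shows "\<exists>n. inv \<pi> \<in> SS x n"
proof (rule ccontr)
  assume none: "\<not> ?thesis"
  define B where "B = (\<Union>n. SS x n)"
  have "subring B F"
  proof (rule subringI)
    show "B \<subseteq> carrier F" using SS_carrier by (auto simp: B_def)
    show "\<one> \<in> B" using SS_A[OF A_1] by (auto simp: B_def)
    show "\<ominus> z \<in> B" if z: "z \<in> B" for z
    proof -
      obtain n where n: "z \<in> SS x n" using z by (auto simp: B_def)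
      have "\<ominus> \<one> \<otimes> z \<in> SS x n" using A_neg[OF A_1] n by (rule SS_smult)
      then show ?thesis using SS_carrier[OF n] by (auto simp: B_def l_minus)
    qed
    fix z y assume "z \<in> B" "y \<in> B"
    then obtain n m where nm: "z \<in> SS x n" "y \<in> SS x m" by (auto simp: B_def)
    then show "z \<otimes> y \<in> B" using SS_mult[OF nm] by (auto simp: B_def)
    have "z \<in> SS x (max n m)" "y \<in> SS x (max n m)" using nm SS_mono by (meson max.cobounded1 max.cobounded2)+
    then have "z \<oplus> y \<in> SS x (max n m)" by (rule SS_add)
    then show "z \<oplus> y \<in> B" by (auto simp: B_def)
  qed
  then have "good B"
    using none A_VO SS_A by (auto simp: good_def B_def)
  moreover have "A \<subseteq> B" using SS_A by (auto simp: B_def)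
  ultimately have "B = A" by (rule Amax)
  moreover have "x \<in> SS x (Suc 0)" using SS_x[of \<one> 0] A_1 x by simp
  then have "x \<in> B" unfolding B_def by blast
  ultimately show False using assms by simp
qed

end

text \<open>\<open>\<pi>\<close> lies in the Jacobson radical of \<open>A\<close>. Without
  \<open>inv e\<close> in \<open>A\<close>, \<open>inv \<pi>\<close> would be a polynomial in
  \<open>inv e\<close>; clearing denominators with
  \<open>e [^] n = \<one> \<oplus> \<pi> \<otimes> b\<close> would put
  \<open>inv \<pi> \<oplus> b\<close> into \<open>A\<close>.\<close>

lemma one_minus_pi_unit:
  assumes a: "a \<in> A"
  shows "\<exists>u\<in>A. u \<otimes> (\<one> \<ominus> \<pi> \<otimes> a) = \<one>"
proof -
  define e where "e = \<one> \<ominus> \<pi> \<otimes> a"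
  have c: "a \<in> carrier F" "e \<in> carrier F" using a A_carrier pi_facts by (auto simp: e_def)
  have eA: "e \<in> A" unfolding e_def using A_minus A_1 A_mult pi_A a by blast
  have e0: "e \<noteq> \<zero>"
  proof
    assume "e = \<zero>"
    then have "\<pi> \<otimes> a = \<one>" using c pi_facts by (simp add: e_def r_right_minus_eq)
    then have "inv \<pi> = a" using pi_facts c by (metis comm_inv_char)
    then show False using a A_pi by simp
  qed
  have "inv e \<in> A"
  proof (rule ccontr)
    assume "inv e \<notin> A"
    then obtain n where n: "inv \<pi> \<in> SS (inv e) n" using inv_pi_in_SS inv_closed c e0 by blast
    have clear: "z \<in> SS (inv e) n \<Longrightarrow> e [^] n \<otimes> z \<in> A" for z n
    proof (induction n arbitrary: z)
      case (Suc n)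
      then obtain b y where b: "b \<in> A" "y \<in> SS (inv e) n" "z = b \<oplus> inv e \<otimes> y" by auto
      have yc: "y \<in> carrier F" using SS_carrier[OF inv_closed[OF c(2) e0] b(2)] .
      have "e [^] Suc n \<otimes> z = e [^] Suc n \<otimes> b \<oplus> e [^] n \<otimes> (e \<otimes> inv e \<otimes> y)"
        unfolding b(3) using c yc A_carrier[OF b(1)] inv_closed[OF c(2) e0] by (simp add: r_distr m_assoc)
      also have "\<dots> = e [^] Suc n \<otimes> b \<oplus> e [^] n \<otimes> y"
        using r_inverse[OF c(2) e0] yc by simp
      also have "\<dots> \<in> A" using Suc.IH[OF b(2)] A_pow[OF eA, of "Suc n"] b(1) A_add A_mult by blast
      finally show ?case .
    qed (simp add: A_carrier)
    have expand: "\<exists>b\<in>A. e [^] n = \<one> \<oplus> \<pi> \<otimes> b" for n :: nat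
    proof (induction n)
      case 0
      show ?case using A_0 pi_facts by (intro bexI[of _ \<zero>]) auto
    next
      case (Suc n)
      then obtain b where b: "b \<in> A" "e [^] n = \<one> \<oplus> \<pi> \<otimes> b" by auto
      have bc: "b \<in> carrier F" using A_carrier b by blast
      have "e [^] Suc n = (\<one> \<oplus> \<pi> \<otimes> b) \<otimes> e" using b by simp
      also have "\<dots> = e \<oplus> \<pi> \<otimes> (b \<otimes> e)" using bc c pi_facts by (simp add: l_distr m_assoc)
      also have "\<dots> = \<one> \<oplus> \<pi> \<otimes> (b \<otimes> e \<ominus> a)"
        using bc c pi_facts by (simp add: e_def a_minus_def r_distr r_minus a_ac)
      finally show ?case using A_minus[OF A_mult[OF b(1) eA] a] by blast
    qed
    obtain b where b: "b \<in> A" "e [^] n = \<one> \<oplus> \<pi> \<otimes> b" using expand by blast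
    have bc: "b \<in> carrier F" using A_carrier b by blast
    have "e [^] n \<otimes> inv \<pi> = inv \<pi> \<oplus> b"
      unfolding b(2) using pi_facts bc by (simp add: l_distr m_comm[of \<pi> b] m_assoc)
    then have "inv \<pi> \<oplus> b \<in> A" using clear[OF n] by simp
    then have "inv \<pi> \<oplus> b \<ominus> b \<in> A" using A_minus b by blast
    then show False using A_pi pi_facts bc by (simp add: a_minus_def a_assoc r_neg)
  qed
  then show ?thesis using l_inverse[OF c(2) e0] unfolding e_def by blast
qed

text \<open>Multiplying a polynomial in \<open>x\<close> of degree at most \<open>n\<close> by
  \<open>y [^] n\<close> reverses its coefficients, \<open>y\<close> being the inverse of
  \<open>x\<close>.\<close>

lemma SS_flip:
  assumes x: "x \<in> carrier F" "y \<in> carrier F" "x \<otimes> y = \<one>" and z: "z \<in> SS x n"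
  shows "y [^] n \<otimes> z \<in> SS y n"
  using z
proof (induction n arbitrary: z)
  case (Suc n)
  then obtain a z' where *: "a \<in> A" "z' \<in> SS x n" "z = a \<oplus> x \<otimes> z'" by auto
  have c: "a \<in> carrier F" "z' \<in> carrier F" using * A_carrier SS_carrier[OF x(1)] by auto
  have "y [^] Suc n \<otimes> z = a \<otimes> y [^] Suc n \<oplus> y [^] n \<otimes> (x \<otimes> y \<otimes> z')"
    unfolding *(3) using c x(1,2) by (simp add: r_distr m_ac)
  also have "\<dots> = a \<otimes> y [^] Suc n \<oplus> y [^] n \<otimes> z'" using x(3) c by simp
  finally have eq: "y [^] Suc n \<otimes> z = a \<otimes> y [^] Suc n \<oplus> y [^] n \<otimes> z'" .
  have pw: "y [^] m \<in> SS y m" for m :: nat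
  proof (induction m)
    case (Suc m)
    then show ?case using SS_x[OF x(2) Suc] x(2) m_comm[of y "y [^] m"] by simp
  qed (simp add: A_1)
  have "a \<otimes> y [^] Suc n \<in> SS y (Suc n)" using SS_smult[OF x(2) *(1) pw] .
  moreover have "y [^] n \<otimes> z' \<in> SS y (Suc n)" using SS_mono[OF x(2) _ Suc.IH[OF *(2)], of "Suc n"] by simp
  ultimately show ?case unfolding eq by (rule SS_add[OF x(2)])
qed (use x in \<open>auto simp: A_carrier\<close>)

text \<open>Multiply \<open>inv \<pi> = a \<oplus> x \<otimes> z\<close> by \<open>\<pi>\<close> and
  the power of \<open>y\<close>. The factor \<open>\<one> \<ominus> \<pi> \<otimes> a\<close> that
  appears is a unit, so the power is a polynomial in \<open>y\<close> of lower degree.\<close>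

lemma pow_reduces:
  assumes x: "x \<in> carrier F" "y \<in> carrier F" "x \<otimes> y = \<one>" and N: "inv \<pi> \<in> SS x (Suc N)"
  shows "y [^] Suc N \<in> SS y N"
proof -
  obtain a z where az: "a \<in> A" "z \<in> SS x N" "inv \<pi> = a \<oplus> x \<otimes> z" using N by auto
  have c: "a \<in> carrier F" "z \<in> carrier F" using az A_carrier SS_carrier[OF x(1)] by auto
  define Y where "Y = y [^] Suc N"
  have Yc: "Y \<in> carrier F" using x by (simp add: Y_def)
  have zN: "y [^] N \<otimes> z \<in> SS y N" by (rule SS_flip[OF x az(2)])
  have "Y = Y \<otimes> (\<pi> \<otimes> inv \<pi>)" using Yc pi_facts by simp
  also have "\<dots> = \<pi> \<otimes> a \<otimes> Y \<oplus> \<pi> \<otimes> (Y \<otimes> x \<otimes> z)"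
    unfolding az(3) using c x pi_facts Yc by (simp add: r_distr m_ac)
  also have "Y \<otimes> x \<otimes> z = y [^] N \<otimes> (x \<otimes> y \<otimes> z)"
    using c x(1,2) by (simp add: Y_def m_ac)
  also have "\<dots> = y [^] N \<otimes> z" using x c by simp
  finally have Y: "Y = \<pi> \<otimes> a \<otimes> Y \<oplus> \<pi> \<otimes> (y [^] N \<otimes> z)" .
  have e: "(\<one> \<ominus> \<pi> \<otimes> a) \<otimes> Y = \<pi> \<otimes> (y [^] N \<otimes> z)"
  proof -
    have "(\<one> \<ominus> \<pi> \<otimes> a) \<otimes> Y = Y \<ominus> \<pi> \<otimes> a \<otimes> Y"
      using c pi_facts Yc by (simp add: a_minus_def l_distr l_minus)
    also have "\<dots> = (\<pi> \<otimes> a \<otimes> Y \<oplus> \<pi> \<otimes> (y [^] N \<otimes> z)) \<ominus> \<pi> \<otimes> a \<otimes> Y" using Y by simp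
    also have "\<dots> = \<pi> \<otimes> (y [^] N \<otimes> z)"
      using c x(2) pi_facts Yc by (simp add: a_minus_def a_ac r_neg2 r_neg)
    finally show ?thesis .
  qed
  obtain u where u: "u \<in> A" "u \<otimes> (\<one> \<ominus> \<pi> \<otimes> a) = \<one>" using one_minus_pi_unit[OF az(1)] by blast
  have "Y = u \<otimes> (\<one> \<ominus> \<pi> \<otimes> a) \<otimes> Y" using u Yc by simp
  also have "\<dots> = u \<otimes> ((\<one> \<ominus> \<pi> \<otimes> a) \<otimes> Y)" using A_carrier[OF u(1)] c pi_facts Yc by (simp add: m_assoc)
  also have "\<dots> = u \<otimes> (\<pi> \<otimes> (y [^] N \<otimes> z))" by (simp only: e)
  also have "\<dots> \<in> SS y N" by (intro SS_smult[OF x(2)] u(1) pi_A zN)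
  finally show ?thesis by (simp add: Y_def)
qed

lemma SS_lower:
  assumes y: "y \<in> carrier F" and r: "y [^] Suc N \<in> SS y N" and z: "z \<in> SS y (Suc N + d)"
  shows "z \<in> SS y (N + d)"
proof -
  obtain a z' where a: "a \<in> A" "z' \<in> SS y (N + d)" "z = z' \<oplus> a \<otimes> y [^] Suc (N + d)"
    using SS_top[OF y, of z "N + d"] z by auto
  have pw: "y [^] m \<in> SS y m" for m :: nat
  proof (induction m)
    case (Suc m)
    then show ?case using SS_x[OF y Suc] y m_comm[of y "y [^] m"] by simp
  qed (simp add: A_1)
  have "y [^] Suc N \<otimes> y [^] d \<in> SS y (N + d)" by (rule SS_mult[OF y r pw])
  moreover have "y [^] Suc N \<otimes> y [^] d = y [^] Suc (N + d)" using y by (simp only: nat_pow_mult) simp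
  ultimately have "y [^] Suc (N + d) \<in> SS y (N + d)" by (simp only:)
  then show ?thesis unfolding a(3) by (intro SS_add[OF y] SS_smult[OF y] a(1,2))
qed

text \<open>Chevalley's argument. Were both missing, write \<open>inv \<pi>\<close> as a polynomial
  of least degree in \<open>x\<close> and likewise in \<open>y\<close>. Each expression makes a
  power of the other element reducible, so the larger of the two degrees can be lowered.\<close>

lemma valuation_ring:
  assumes x: "x \<in> carrier F" "y \<in> carrier F" "x \<otimes> y = \<one>"
  shows "x \<in> A \<or> y \<in> A"
proof (rule ccontr)
  assume "\<not> ?thesis"
  then have n: "x \<notin> A" "y \<notin> A" by auto
  have yx: "y \<otimes> x = \<one>" using x m_comm by simp
  define P where "P = (\<lambda>x n. inv \<pi> \<in> SS x n)"
  obtain N where N: "P x N" "\<And>n. P x n \<Longrightarrow> N \<le> n"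
    using inv_pi_in_SS[OF x(1) n(1)] exists_least_iff[of "P x"] unfolding P_def by (meson linorder_not_less)
  obtain M where M: "P y M" "\<And>n. P y n \<Longrightarrow> M \<le> n"
    using inv_pi_in_SS[OF x(2) n(2)] exists_least_iff[of "P y"] unfolding P_def by (meson linorder_not_less)
  have "\<not> P x 0" "\<not> P y 0" using A_pi by (simp_all add: P_def)
  then have "N \<noteq> 0" "M \<noteq> 0" using N(1) M(1) by metis+
  then obtain N' M' where NM: "N = Suc N'" "M = Suc M'" using not0_implies_Suc by blast
  have rx: "x [^] Suc M' \<in> SS x M'" using pow_reduces[OF x(2,1) yx] M NM by (simp add: P_def)
  have ry: "y [^] Suc N' \<in> SS y N'" using pow_reduces[OF x] N NM by (simp add: P_def)
  consider "M' \<le> N'" | "N' \<le> M'" by linarith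
  then show False
  proof cases
    case 1
    then have "inv \<pi> \<in> SS x (M' + (N' - M'))"
      using SS_lower[OF x(1) rx, of "inv \<pi>" "N' - M'"] N NM by (simp add: P_def)
    then show False using N(2)[of N'] 1 NM by (simp add: P_def)
  next
    case 2
    then have "inv \<pi> \<in> SS y (N' + (M' - N'))"
      using SS_lower[OF x(2) ry, of "inv \<pi>" "M' - N'"] M NM by (simp add: P_def)
    then show False using M(2)[of M'] 2 NM by (simp add: P_def)
  qed
qed

text \<open>A case of integral closedness: if \<open>inv x\<close> is in \<open>A\<close>, then
  \<open>x\<close> is a power of \<open>inv x\<close> times the given power of
  \<open>x\<close>.\<close>

lemma A_pow_root:
  assumes x: "x \<in> carrier F" "x \<noteq> \<zero>" and u: "x [^] Suc n \<in> A"
  shows "x \<in> A"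
proof (rule ccontr)
  assume n: "x \<notin> A"
  then have i: "inv x \<in> A" using valuation_ring[OF x(1) inv_closed[OF x] r_inverse[OF x]] by blast
  have "inv x [^] n \<otimes> x [^] Suc n = x"
  proof (induction n)
    case (Suc n)
    have c: "inv x \<in> carrier F" using inv_closed[OF x] .
    have "inv x [^] Suc n \<otimes> x [^] Suc (Suc n) = inv x [^] n \<otimes> x [^] Suc n \<otimes> (inv x \<otimes> x)"
      using c x(1) by (simp add: m_ac)
    then show ?case using Suc l_inverse[OF x] x by simp
  qed (use x in auto)
  moreover have "inv x [^] n \<otimes> x [^] Suc n \<in> A" using A_mult A_pow i u by blast
  ultimately show False using n by simp
qed

text \<open>The non-units, which form the maximal ideal of the valuation ring.\<close>

definition MM where "MM = {x \<in> A. x = \<zero> \<or> inv x \<notin> A}"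

lemma MM_mult: assumes "x \<in> MM" "a \<in> A" shows "a \<otimes> x \<in> MM"
proof (cases "a \<otimes> x = \<zero>")
  case True
  then show ?thesis using A_0 by (simp add: MM_def)
next
  case False
  have c: "a \<in> carrier F" "x \<in> carrier F" using assms A_carrier by (auto simp: MM_def)
  have nz: "a \<noteq> \<zero>" "x \<noteq> \<zero>" using False c by auto
  have "inv x = a \<otimes> inv (a \<otimes> x)"
  proof -
    have "x \<otimes> (a \<otimes> inv (a \<otimes> x)) = \<one>"
      using r_inverse[of "a \<otimes> x"] inv_closed[of "a \<otimes> x"] False c by (simp add: m_lcomm[of x a] m_assoc)
    then show ?thesis using c False inv_closed[of "a \<otimes> x"] comm_inv_char[of x "a \<otimes> inv (a \<otimes> x)"] by simp
  qed
  then have "inv (a \<otimes> x) \<notin> A" using assms nz A_mult by (auto simp: MM_def)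
  then show ?thesis using assms A_mult by (auto simp: MM_def)
qed

lemma MM_add: assumes "x \<in> MM" "y \<in> MM" shows "x \<oplus> y \<in> MM"
proof -
  have *: "x \<oplus> y \<in> MM" if xy: "x \<in> MM" "y \<in> MM" "x \<noteq> \<zero>" "y \<otimes> inv x \<in> A" for x y
  proof -
    have c: "x \<in> carrier F" "y \<in> carrier F" using xy A_carrier by (auto simp: MM_def)
    have "(\<one> \<oplus> y \<otimes> inv x) \<otimes> x = x \<oplus> y"
      using c inv_closed[OF c(1) xy(3)] l_inverse[OF c(1) xy(3)] by (simp add: l_distr m_assoc)
    then show ?thesis using MM_mult[OF xy(1), of "\<one> \<oplus> y \<otimes> inv x"] A_add A_1 xy(4) by simp
  qed
  have c: "x \<in> carrier F" "y \<in> carrier F" using assms A_carrier by (auto simp: MM_def)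
  show ?thesis
  proof (cases "x = \<zero> \<or> y = \<zero>")
    case True
    then show ?thesis using assms c by auto
  next
    case False
    have "(y \<otimes> inv x) \<otimes> (x \<otimes> inv y) = \<one>"
    proof -
      have "(y \<otimes> inv x) \<otimes> (x \<otimes> inv y) = (y \<otimes> inv y) \<otimes> (inv x \<otimes> x)"
        using c inv_closed False by (simp add: m_ac)
      then show ?thesis using False c l_inverse r_inverse by simp
    qed
    then have "y \<otimes> inv x \<in> A \<or> x \<otimes> inv y \<in> A"
      using c inv_closed False by (intro valuation_ring) auto
    then show ?thesis using *[of x y] *[of y x] assms False c a_comm by auto
  qed
qed

lemma MM_sum: "finite I \<Longrightarrow> (\<And>i. i \<in> I \<Longrightarrow> t i \<in> MM) \<Longrightarrow> finsum F t I \<in> MM"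
proof (induction I rule: finite_induct)
  case (insert i I)
  have "t \<in> insert i I \<rightarrow> carrier F" using insert.prems A_carrier by (auto simp: MM_def)
  then show ?case using insert MM_add by simp
qed (simp add: MM_def A_0)

text \<open>The order of the value group: \<open>x\<close> has at most the value of
  \<open>y\<close>. It never holds for \<open>y = \<zero>\<close>.\<close>

definition lee where "lee x y \<longleftrightarrow> y \<noteq> \<zero> \<and> x \<otimes> inv y \<in> A"

lemma lee_total: assumes "x \<in> carrier F" "y \<in> carrier F" "x \<noteq> \<zero>" "y \<noteq> \<zero>" shows "lee x y \<or> lee y x"
proof -
  have "(y \<otimes> inv x) \<otimes> (x \<otimes> inv y) = (y \<otimes> inv y) \<otimes> (inv x \<otimes> x)"
    using assms inv_closed by (simp add: m_ac)
  then have "(y \<otimes> inv x) \<otimes> (x \<otimes> inv y) = \<one>" using assms l_inverse r_inverse by simp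
  then show ?thesis
    using assms inv_closed valuation_ring[of "y \<otimes> inv x" "x \<otimes> inv y"] by (auto simp: lee_def)
qed

lemma lee_trans:
  assumes "x \<in> carrier F" "y \<in> carrier F" "z \<in> carrier F" "lee x y" "lee y z" shows "lee x z"
proof -
  have y0: "y \<noteq> \<zero>" and z0: "z \<noteq> \<zero>" using assms by (auto simp: lee_def)
  have "(x \<otimes> inv y) \<otimes> (y \<otimes> inv z) = x \<otimes> inv z \<otimes> (inv y \<otimes> y)"
    using assms(1-3) inv_closed y0 z0 by (simp add: m_ac)
  then have "(x \<otimes> inv y) \<otimes> (y \<otimes> inv z) = x \<otimes> inv z"
    using assms(1-3) inv_closed z0 l_inverse[OF assms(2) y0] by simp
  then show ?thesis using assms(4,5) A_mult z0 unfolding lee_def by metis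
qed

lemma lee_max:
  assumes "finite I" "I \<noteq> {}" "\<And>i. i \<in> I \<Longrightarrow> t i \<in> carrier F \<and> t i \<noteq> \<zero>"
  shows "\<exists>m\<in>I. \<forall>i\<in>I. lee (t i) (t m)"
  using assms
proof (induction I rule: finite_ne_induct)
  case (singleton i)
  then have "lee (t i) (t i)" using lee_total by blast
  then show ?case by simp
next
  case (insert i I)
  then obtain m where m: "m \<in> I" "\<And>j. j \<in> I \<Longrightarrow> lee (t j) (t m)" by auto
  have c: "t j \<in> carrier F" "t j \<noteq> \<zero>" if "j \<in> insert i I" for j using insert.prems[OF that] by auto
  consider "lee (t i) (t m)" | "lee (t m) (t i)" using lee_total[of "t i" "t m"] c m(1) by blast
  then show ?case
  proof cases
    case 1
    then show ?thesis using m by auto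
  next
    case 2
    have "lee (t j) (t i)" if "j \<in> I" for j
      using lee_trans[OF _ _ _ m(2)[OF that] 2] c m(1) that by blast
    moreover have "lee (t i) (t i)" using lee_total[of "t i" "t i"] c by blast
    ultimately show ?thesis by auto
  qed
qed

text \<open>Divide by a term of largest value. If all other terms were strictly smaller, their
  quotients would lie in \<open>MM\<close>, and so would the sum of these, which is
  \<open>\<ominus> \<one>\<close>.\<close>

lemma two_maxima:
  assumes fin: "finite I" and t: "\<And>i. i \<in> I \<Longrightarrow> t i \<in> carrier F" and sum0: "finsum F t I = \<zero>"
    and ne: "\<exists>i\<in>I. t i \<noteq> \<zero>"
  shows "\<exists>i\<in>I. \<exists>j\<in>I. i \<noteq> j \<and> t i \<noteq> \<zero> \<and> t j \<noteq> \<zero> \<and> lee (t i) (t j) \<and> lee (t j) (t i)"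
proof (rule ccontr)
  assume no: "\<not> ?thesis"
  define J where "J = {i \<in> I. t i \<noteq> \<zero>}"
  have "finite J" "J \<noteq> {}" "\<And>i. i \<in> J \<Longrightarrow> t i \<in> carrier F \<and> t i \<noteq> \<zero>"
    using fin ne t by (auto simp: J_def)
  then obtain m where m: "m \<in> J" "\<And>i. i \<in> J \<Longrightarrow> lee (t i) (t m)"
    using lee_max[of J t] by blast
  have mc: "t m \<in> carrier F" "t m \<noteq> \<zero>" "m \<in> I" using m t by (auto simp: J_def)
  have ic: "inv (t m) \<in> carrier F" using inv_closed mc by blast
  have small: "t i \<otimes> inv (t m) \<in> MM" if i: "i \<in> I - {m}" for i
  proof (cases "t i = \<zero>")
    case True
    then show ?thesis using ic A_0 by (simp add: MM_def)
  next
    case False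
    then have iJ: "i \<in> J" using i by (simp add: J_def)
    have tc: "t i \<in> carrier F" using t i by blast
    have "\<not> lee (t m) (t i)" using no i mc False m(2)[OF iJ] by blast
    moreover have "inv (t i \<otimes> inv (t m)) = t m \<otimes> inv (t i)"
    proof (rule comm_inv_char)
      have "t i \<otimes> inv (t m) \<otimes> (t m \<otimes> inv (t i)) = (t i \<otimes> inv (t i)) \<otimes> (inv (t m) \<otimes> t m)"
        using tc mc ic inv_closed[OF tc False] by (simp add: m_ac)
      then show "t i \<otimes> inv (t m) \<otimes> (t m \<otimes> inv (t i)) = \<one>"
        using r_inverse[OF tc False] l_inverse[OF mc(1,2)] by simp
    qed (use tc mc ic inv_closed[OF tc False] in auto)
    ultimately show ?thesis using m(2)[OF iJ] False by (simp add: MM_def lee_def)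
  qed
  have "finsum F t I = t m \<oplus> finsum F t (I - {m})"
    using finsum_insert[of "I - {m}" m t] fin t mc by (simp add: insert_absorb)
  then have "t m \<oplus> finsum F t (I - {m}) = \<zero>" using sum0 by simp
  then have "(t m \<oplus> finsum F t (I - {m})) \<otimes> inv (t m) = \<zero>" using ic by simp
  moreover have sc: "finsum F t (I - {m}) \<in> carrier F" using t by (intro finsum_closed) auto
  moreover have "finsum F t (I - {m}) \<otimes> inv (t m) = finsum F (\<lambda>i. t i \<otimes> inv (t m)) (I - {m})"
    using finsum_ldistr[of "I - {m}" "inv (t m)" t] fin t ic by auto
  ultimately have "\<one> \<oplus> finsum F (\<lambda>i. t i \<otimes> inv (t m)) (I - {m}) = \<zero>"
    using r_inverse[OF mc(1,2)] mc ic by (simp add: l_distr)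
  moreover have S: "finsum F (\<lambda>i. t i \<otimes> inv (t m)) (I - {m}) \<in> MM"
    using fin small by (intro MM_sum) auto
  moreover have "finsum F (\<lambda>i. t i \<otimes> inv (t m)) (I - {m}) \<in> carrier F"
    using S A_carrier by (auto simp: MM_def)
  ultimately have "finsum F (\<lambda>i. t i \<otimes> inv (t m)) (I - {m}) = \<ominus> \<one>"
    using minus_equality[of _ \<one>] a_comm by (metis one_closed)
  then have "\<ominus> \<one> \<otimes> \<ominus> \<one> \<in> MM" using MM_mult[OF S A_neg[OF A_1]] by simp
  then have "\<one> \<in> MM" by (simp add: l_minus r_minus)
  then show False using A_1 by (simp add: MM_def)
qed

definition assoc where "assoc x y \<longleftrightarrow> lee x y \<and> lee y x"

lemma lee_mult:
  assumes "x \<in> carrier F" "y \<in> carrier F" "x' \<in> carrier F" "y' \<in> carrier F" "lee x y" "lee x' y'"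
  shows "lee (x \<otimes> x') (y \<otimes> y')"
proof -
  have nz: "y \<noteq> \<zero>" "y' \<noteq> \<zero>" using assms by (auto simp: lee_def)
  have ic: "inv y \<in> carrier F" "inv y' \<in> carrier F" using inv_closed assms(2,4) nz by auto
  have "(y \<otimes> y') \<otimes> (inv y \<otimes> inv y') = (y \<otimes> inv y) \<otimes> (y' \<otimes> inv y')"
    using assms(2,4) ic by (simp add: m_ac)
  then have "inv (y \<otimes> y') = inv y \<otimes> inv y'"
    using assms(2,4) ic r_inverse nz by (intro comm_inv_char) auto
  then have "(x \<otimes> x') \<otimes> inv (y \<otimes> y') = (x \<otimes> inv y) \<otimes> (x' \<otimes> inv y')"
    using assms(1-4) ic by (simp add: m_ac)
  moreover have "(x \<otimes> inv y) \<otimes> (x' \<otimes> inv y') \<in> A" using assms(5,6) A_mult unfolding lee_def by blast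
  ultimately show ?thesis using nz integral[OF _ assms(2,4)] by (auto simp: lee_def)
qed

lemma lee_pow: "x \<in> carrier F \<Longrightarrow> y \<in> carrier F \<Longrightarrow> lee x y \<Longrightarrow> lee (x [^] (n::nat)) (y [^] n)"
proof (induction n)
  case 0
  then show ?case using one_not_zero by (simp add: lee_def A_1)
qed (simp add: lee_mult)

lemma lee_cancel:
  assumes "x \<in> carrier F" "y \<in> carrier F" "z \<in> carrier F" "z \<noteq> \<zero>" "lee (x \<otimes> z) (y \<otimes> z)"
  shows "lee x y"
proof -
  have ic: "inv z \<in> carrier F" by (rule inv_closed[OF assms(3,4)])
  have "lee (inv z) (inv z)"
    using lee_total[OF ic ic] inv_nonzero[OF assms(3,4)] by blast
  then have "lee (x \<otimes> z \<otimes> inv z) (y \<otimes> z \<otimes> inv z)"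
    by (rule lee_mult[OF m_closed[OF assms(1,3)] m_closed[OF assms(2,3)] ic ic assms(5)])
  then show ?thesis using assms(1-3) ic r_inverse[OF assms(3,4)] by (simp add: m_assoc)
qed

lemma lee_k: "c \<in> k \<Longrightarrow> d \<in> k \<Longrightarrow> lee c d \<longleftrightarrow> d \<noteq> \<zero> \<and> \<nu> c \<le> \<nu> d"
proof (cases "d = \<zero>")
  case False
  assume cd: "c \<in> k" "d \<in> k"
  have q: "c \<otimes> inv d \<in> k" by (rule k_simps(4)[OF cd(1) k_simps(6)[OF cd(2) False]])
  have "\<nu> (c \<otimes> inv d) = \<nu> c / \<nu> d"
    using n_mult[OF cd(1) k_simps(6)[OF cd(2) False]] n_inv[OF cd(2) False] by (simp add: divide_inverse)
  moreover have "c \<otimes> inv d \<in> A \<longleftrightarrow> \<nu> (c \<otimes> inv d) \<le> 1"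
    using A_k[OF q] A_VO[of "c \<otimes> inv d"] q by (auto simp: VO_def)
  ultimately show ?thesis using False n_pos[OF cd(2) False] by (simp add: lee_def)
qed (simp add: lee_def)

definition algebraic_elt where
  "algebraic_elt x \<longleftrightarrow> (\<exists>a n. (\<forall>i\<le>(n::nat). a i \<in> k) \<and> (\<exists>i\<le>n. a i \<noteq> \<zero>) \<and> (\<Oplus>i\<in>{..n}. a i \<otimes> x [^] i) = \<zero>)"

lemma pow_nonzero: "x \<in> carrier F \<Longrightarrow> x \<noteq> \<zero> \<Longrightarrow> x [^] (n::nat) \<noteq> \<zero>"
  by (induction n) (auto simp: integral_iff)

text \<open>In an algebraic equation for \<open>x\<close> two terms have equal value, and their
  quotient compares a power of \<open>x\<close> with an element of \<open>k\<close>: the value group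
  of \<open>A\<close> is torsion over that of \<open>k\<close>.\<close>

lemma value_exists:
  assumes x: "x \<in> carrier F" "x \<noteq> \<zero>" and alg: "algebraic_elt x"
  shows "\<exists>n c. n > 0 \<and> c \<in> k \<and> c \<noteq> \<zero> \<and> assoc (x [^] (n::nat)) c"
proof -
  obtain a and n :: nat where an: "(\<forall>i\<le>n. a i \<in> k) \<and> (\<exists>i\<le>n. a i \<noteq> \<zero>) \<and> (\<Oplus>i\<in>{..n}. a i \<otimes> x [^] i) = \<zero>"
    using alg unfolding algebraic_elt_def by blast
  then have a: "\<And>i. i \<le> n \<Longrightarrow> a i \<in> k" "\<exists>i\<le>n. a i \<noteq> \<zero>" "(\<Oplus>i\<in>{..n}. a i \<otimes> x [^] i) = \<zero>"
    by blast+
  have "\<exists>i\<in>{..n}. \<exists>j\<in>{..n}. i \<noteq> j \<and> a i \<otimes> x [^] i \<noteq> \<zero> \<and> a j \<otimes> x [^] j \<noteq> \<zero> \<and>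
      lee (a i \<otimes> x [^] i) (a j \<otimes> x [^] j) \<and> lee (a j \<otimes> x [^] j) (a i \<otimes> x [^] i)"
  proof (rule two_maxima)
    show "\<exists>i\<in>{..n}. a i \<otimes> x [^] i \<noteq> \<zero>"
      using a(1,2) pow_nonzero[OF x] k_carrier x(1) by (metis atMost_iff integral nat_pow_closed)
  qed (use a k_carrier x in auto)
  then obtain i j where ij: "i \<le> n" "j \<le> n" "i < j" "a i \<noteq> \<zero>" "a j \<noteq> \<zero>"
      "lee (a i \<otimes> x [^] i) (a j \<otimes> x [^] j)" "lee (a j \<otimes> x [^] j) (a i \<otimes> x [^] i)"
    using x(1) by (metis (no_types, lifting) atMost_iff l_null linorder_neqE_nat nat_pow_closed)
  have c: "a i \<in> carrier F" "a j \<in> carrier F" using a(1) ij k_carrier by auto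
  define d where "d = j - i"
  have xj: "x [^] j = x [^] d \<otimes> x [^] i" using ij x by (simp add: d_def nat_pow_mult)
  have 1: "lee (a i) (a j \<otimes> x [^] d)" "lee (a j \<otimes> x [^] d) (a i)"
    using ij(6,7) lee_cancel[of "a i" "a j \<otimes> x [^] d" "x [^] i"] lee_cancel[of "a j \<otimes> x [^] d" "a i" "x [^] i"]
      c x pow_nonzero[OF x] unfolding xj by (auto simp: m_assoc)
  define b where "b = a i \<otimes> inv (a j)"
  have bk: "b \<in> k" "b \<noteq> \<zero>"
  proof -
    show "b \<in> k" unfolding b_def by (rule k_simps(4)[OF a(1)[OF ij(1)] k_simps(6)[OF a(1)[OF ij(2)] ij(5)]])
    show "b \<noteq> \<zero>"
      unfolding b_def using integral[OF _ c(1) inv_closed[OF c(2) ij(5)]] inv_nonzero[OF c(2) ij(5)] ij(4) by blast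
  qed
  have b: "b \<otimes> a j = a i" using c ij inv_closed l_inverse by (simp add: b_def m_assoc)
  have xd: "x [^] d \<otimes> a j = a j \<otimes> x [^] d" using c x m_comm by simp
  have "lee b (x [^] d)" "lee (x [^] d) b"
    using 1 lee_cancel[of b "x [^] d" "a j"] lee_cancel[of "x [^] d" b "a j"] c x ij k_carrier[OF bk(1)]
    unfolding b xd by auto
  then show ?thesis using bk ij(3) by (intro exI[of _ d] exI[of _ b]) (auto simp: d_def assoc_def)
qed

lemma assoc_value_unique:
  assumes x: "x \<in> carrier F" and n: "n > 0" "c \<in> k" "c \<noteq> \<zero>" "assoc (x [^] (n::nat)) c"
    and m: "m > 0" "d \<in> k" "d \<noteq> \<zero>" "assoc (x [^] (m::nat)) d"
  shows "\<nu> c powr (1 / n) = \<nu> d powr (1 / m)"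
proof -
  have cc: "c \<in> carrier F" "d \<in> carrier F" using n m k_carrier by auto
  have "lee (c [^] m) (x [^] (n * m))" "lee (x [^] (n * m)) (c [^] m)"
    using lee_pow[of c "x [^] n" m] lee_pow[of "x [^] n" c m] n(4) cc x by (auto simp: assoc_def nat_pow_pow)
  moreover have "lee (d [^] n) (x [^] (n * m))" "lee (x [^] (n * m)) (d [^] n)"
    using lee_pow[of d "x [^] m" n] lee_pow[of "x [^] m" d n] m(4) cc x
    by (auto simp: assoc_def nat_pow_pow mult.commute)
  ultimately have "lee (c [^] m) (d [^] n)" "lee (d [^] n) (c [^] m)"
    using lee_trans[of "c [^] m" "x [^] (n * m)" "d [^] n"] lee_trans[of "d [^] n" "x [^] (n * m)" "c [^] m"] cc x by auto
  then have eq: "\<nu> c ^ m = \<nu> d ^ n"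
    using lee_k[OF k_pow k_pow] n m by (simp add: n_pow)
  have pos: "\<nu> c > 0" "\<nu> d > 0" using n_pos n m by auto
  have "\<nu> c powr (1 / n) = (\<nu> c ^ m) powr (1 / (n * m))"
    using pos n m by (simp add: powr_realpow[symmetric] powr_powr)
  also have "\<dots> = \<nu> d powr (1 / m)"
    unfolding eq using pos n m by (simp add: powr_realpow[symmetric] powr_powr)
  finally show ?thesis .
qed

lemma extension:
  assumes alg: "\<And>x. x \<in> carrier F \<Longrightarrow> algebraic_elt x"
  shows "\<exists>\<mu>. absolute_value F \<mu> \<and> (\<forall>x\<in>k. \<mu> x = \<nu> x)"
proof -
  \<comment> \<open>When \<open>x [^] n\<close> has the value of \<open>c\<close> in
    \<open>k\<close>, the extension is forced to be the \<open>n\<close>-th root of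
    \<open>\<nu> c\<close> at \<open>x\<close>.\<close>
  define V where "V x r \<longleftrightarrow> (\<exists>n c. n > 0 \<and> c \<in> k \<and> c \<noteq> \<zero> \<and> assoc (x [^] (n::nat)) c \<and> r = \<nu> c powr (1 / n))" for x r
  define \<mu> where "\<mu> x = (if x = \<zero> then 0 else THE r. V x r)" for x
  have ex: "\<exists>r. V x r" if "x \<in> carrier F" "x \<noteq> \<zero>" for x
    using value_exists[OF that alg[OF that(1)]] unfolding V_def by blast
  have un: "r = s" if "x \<in> carrier F" "V x r" "V x s" for x r s
    using that assoc_value_unique unfolding V_def by metis
  have mu: "\<mu> x = r" if "x \<in> carrier F" "x \<noteq> \<zero>" "V x r" for x r
    unfolding \<mu>_def using that un by (auto intro: the_equality)
  have V_pos: "r > 0" if "V x r" for x r using that n_eq_0 by (auto simp: V_def)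
  have V_k: "V c (\<nu> c)" if "c \<in> k" "c \<noteq> \<zero>" for c
    unfolding V_def using that lee_k[OF that(1) that(1)] k_carrier[OF that(1)] n_pos[OF that]
    by (intro exI[of _ 1] exI[of _ c]) (auto simp: assoc_def)
  have V_mult: "V (x \<otimes> y) (r * s)" if xy: "x \<in> carrier F" "y \<in> carrier F" "V x r" "V y s" for x y r s
  proof -
    obtain n c where n: "n > 0" "c \<in> k" "c \<noteq> \<zero>" "assoc (x [^] (n::nat)) c" "r = \<nu> c powr (1 / n)"
      using xy(3) by (auto simp: V_def)
    obtain m d where m: "m > 0" "d \<in> k" "d \<noteq> \<zero>" "assoc (y [^] (m::nat)) d" "s = \<nu> d powr (1 / m)"
      using xy(4) by (auto simp: V_def)
    have cc: "c \<in> carrier F" "d \<in> carrier F" using n m k_carrier by auto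
    define e where "e = c [^] m \<otimes> d [^] n"
    have ek: "e \<in> k" "e \<noteq> \<zero>"
    proof -
      show "e \<in> k" unfolding e_def by (rule k_simps(4)[OF k_pow[OF n(2)] k_pow[OF m(2)]])
      show "e \<noteq> \<zero>"
        unfolding e_def using integral[of "c [^] m" "d [^] n"] pow_nonzero[OF cc(1) n(3)] pow_nonzero[OF cc(2) m(3)] cc by blast
    qed
    have pw: "(x \<otimes> y) [^] (n * m) = (x [^] n) [^] m \<otimes> (y [^] m) [^] n"
      using xy(1,2) by (simp add: nat_pow_distrib nat_pow_pow mult.commute)
    have "assoc ((x \<otimes> y) [^] (n * m)) e"
      unfolding assoc_def pw e_def using n(4) m(4) cc xy(1,2)
      by (auto simp: assoc_def intro!: lee_mult lee_pow)
    moreover have "r * s = \<nu> e powr (1 / (n * m))"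
    proof -
      have "\<nu> e = \<nu> c ^ m * \<nu> d ^ n"
        unfolding e_def using n_mult[OF k_pow k_pow] n_pow n m by simp
      then show ?thesis
        using n m n_pos by (simp add: powr_mult powr_realpow[symmetric] powr_powr)
    qed
    ultimately show ?thesis
      unfolding V_def using n m ek by (intro exI[of _ "n * m"] exI[of _ e]) simp
  qed
  \<comment> \<open>Identifies \<open>A\<close> with the unit ball of \<open>\<mu>\<close>; the
    triangle inequality then comes from \<open>A\<close> being closed under addition.\<close>
  have V_A: "r \<le> 1 \<longleftrightarrow> x \<in> A" if x: "x \<in> carrier F" "x \<noteq> \<zero>" "V x r" for x r
  proof -
    obtain n c where n: "n > 0" "c \<in> k" "c \<noteq> \<zero>" "assoc (x [^] (n::nat)) c" "r = \<nu> c powr (1 / n)"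
      using x(3) by (auto simp: V_def)
    have cc: "c \<in> carrier F" using n k_carrier by auto
    have cp: "\<nu> c > 0" using n n_pos by auto
    have "r \<le> 1 \<longleftrightarrow> \<nu> c \<le> 1"
      unfolding n(5) using n(1) cp powr_le_cancel_iff[of 1] by (cases "\<nu> c \<le> 1") (auto simp: powr_le1 gr_one_powr not_le)
    also have "\<dots> \<longleftrightarrow> lee c \<one>" using lee_k[OF n(2) k_simps(2)] n_1 one_not_zero by simp
    also have "\<dots> \<longleftrightarrow> lee (x [^] n) \<one>"
      using n(4) lee_trans[of c "x [^] n" \<one>] lee_trans[of "x [^] n" c \<one>] cc x by (auto simp: assoc_def)
    also have "\<dots> \<longleftrightarrow> x [^] n \<in> A"
      using x one_not_zero by (simp add: lee_def)
    also have "\<dots> \<longleftrightarrow> x \<in> A"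
      using A_pow_root[OF x(1,2), of "n - 1"] A_pow[of x n] n(1) by auto
    finally show ?thesis .
  qed
  have mult: "\<mu> (x \<otimes> y) = \<mu> x * \<mu> y" if xy: "x \<in> carrier F" "y \<in> carrier F" for x y
  proof (cases "x = \<zero> \<or> y = \<zero>")
    case True
    then show ?thesis using xy by (auto simp: \<mu>_def)
  next
    case False
    obtain r s where rs: "V x r" "V y s" using ex xy False by blast
    have "x \<otimes> y \<noteq> \<zero>" using False xy integral by blast
    then show ?thesis using mu V_mult[OF xy rs] rs xy False by simp
  qed
  have nonneg: "0 \<le> \<mu> x \<and> (\<mu> x = 0 \<longleftrightarrow> x = \<zero>)" if x: "x \<in> carrier F" for x
    using ex[OF x] mu[OF x] V_pos by (cases "x = \<zero>") (auto simp: \<mu>_def, fastforce+)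
  have le1: "\<mu> x \<le> 1" if "x \<in> A" for x
    using that ex[OF A_carrier[OF that]] mu[OF A_carrier[OF that]] V_A[OF A_carrier[OF that]]
    by (cases "x = \<zero>") (auto simp: \<mu>_def)
  have add1: "\<mu> (x \<oplus> y) \<le> \<mu> x" if xy: "x \<in> carrier F" "y \<in> carrier F" "lee y x" for x y
  proof -
    have x0: "x \<noteq> \<zero>" and yA: "y \<otimes> inv x \<in> A" using xy by (auto simp: lee_def)
    have eq: "x \<oplus> y = (\<one> \<oplus> y \<otimes> inv x) \<otimes> x"
      using xy inv_closed[OF xy(1) x0] l_inverse[OF xy(1) x0] by (simp add: l_distr m_assoc)
    have uA: "\<one> \<oplus> y \<otimes> inv x \<in> A" using A_add[OF A_1 yA] .
    have "\<mu> (x \<oplus> y) = \<mu> (\<one> \<oplus> y \<otimes> inv x) * \<mu> x" unfolding eq by (rule mult[OF A_carrier[OF uA] xy(1)])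
    also have "\<dots> \<le> 1 * \<mu> x" using le1[OF uA] nonneg[OF xy(1)] by (intro mult_right_mono) auto
    finally show ?thesis by simp
  qed
  have add: "\<mu> (x \<oplus> y) \<le> \<mu> x + \<mu> y" if xy: "x \<in> carrier F" "y \<in> carrier F" for x y
  proof (cases "x = \<zero> \<or> y = \<zero>")
    case True
    then show ?thesis using xy nonneg by (auto simp: \<mu>_def)
  next
    case False
    then have "lee y x \<or> lee x y" using lee_total xy by blast
    then show ?thesis
      using add1[OF xy] add1[OF xy(2,1)] a_comm[OF xy] nonneg[OF xy(1)] nonneg[OF xy(2)] by auto
  qed
  have "\<mu> c = \<nu> c" if "c \<in> k" for c
    using mu[OF k_carrier[OF that] _ V_k[OF that]] n_eq_0[OF that] by (cases "c = \<zero>") (auto simp: \<mu>_def)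
  then show ?thesis
    using mult nonneg add unfolding absolute_value_def by (intro exI[of _ \<mu>]) auto
qed

end

context nonarch_ext
begin

lemma nonarch_extension:
  assumes "\<And>x. x \<in> carrier F \<Longrightarrow> \<exists>a n. (\<forall>i\<le>(n::nat). a i \<in> k) \<and> (\<exists>i\<le>n. a i \<noteq> \<zero>) \<and> (\<Oplus>i\<in>{..n}. a i \<otimes> x [^] i) = \<zero>"
  shows "\<exists>\<mu>. absolute_value F \<mu> \<and> (\<forall>x\<in>k. \<mu> x = \<nu> x)"
proof -
  obtain A where A: "good A" "\<And>B. good B \<Longrightarrow> A \<subseteq> B \<Longrightarrow> B = A" using maximal_exists by blast
  interpret M: maximal_subring F k \<nu> \<pi> A
    by (intro maximal_subring.intro maximal_subring_axioms.intro nonarch_ext_axioms A)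
  show ?thesis by (rule M.extension) (use assms in \<open>auto simp: M.algebraic_elt_def\<close>)
qed

end

section \<open>Places of number fields\<close>

lemma field_on_simps [simp]:
  "carrier (field_on K) = K" "x \<otimes>\<^bsub>field_on K\<^esub> y = x * y" "x \<oplus>\<^bsub>field_on K\<^esub> y = x + y"
  "\<one>\<^bsub>field_on K\<^esub> = 1" "\<zero>\<^bsub>field_on K\<^esub> = 0"
  by (auto simp: ring_of_type_algebra_def)

lemma field_on_field: "subf K \<Longrightarrow> field (field_on K)"
  using CF.subfield_iff(2) by (simp add: subfield_complex_iff)

lemma field_on_a_inv: assumes "subf K" "x \<in> K" shows "\<ominus>\<^bsub>field_on K\<^esub> x = - x"
proof -
  interpret F: cring "field_on K" using field_on_field[OF assms(1)] by (simp add: field.axioms domain.axioms(1))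
  show ?thesis using assms by (intro F.minus_equality) (auto simp: subfD)
qed

lemma field_on_minus: "subf K \<Longrightarrow> x \<in> K \<Longrightarrow> y \<in> K \<Longrightarrow> x \<ominus>\<^bsub>field_on K\<^esub> y = x - y"
  by (simp add: a_minus_def field_on_a_inv)

lemma field_on_pow: "subf K \<Longrightarrow> x \<in> K \<Longrightarrow> x [^]\<^bsub>field_on K\<^esub> (n::nat) = x ^ n"
proof (induction n)
  case (Suc n)
  interpret F: cring "field_on K" using field_on_field[OF Suc(2)] by (simp add: field.axioms domain.axioms(1))
  show ?case using Suc by simp
qed (simp add: nat_pow_def)

lemma field_on_finsum:
  assumes "subf K" "finite I" "\<And>i. i \<in> I \<Longrightarrow> f i \<in> K"
  shows "finsum (field_on K) f I = sum f I"
proof -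
  interpret F: cring "field_on K" using field_on_field[OF assms(1)] by (simp add: field.axioms domain.axioms(1))
  show ?thesis using assms(2,3)
  proof (induction I rule: finite_induct)
    case (insert i I)
    then have "f \<in> insert i I \<rightarrow> carrier (field_on K)" by auto
    then show ?case using insert by simp
  qed simp
qed

lemma valued_field_on: "subf K \<Longrightarrow> absv K w \<Longrightarrow> valued_field (field_on K) w"
  by (simp add: valued_field_def valued_field_axioms_def field_on_field)

lemma subfield_field_on: "subf K \<Longrightarrow> subf B \<Longrightarrow> B \<subseteq> K \<Longrightarrow> subfield B (field_on K)"
proof -
  assume K: "subf K" and B: "subf B" and BK: "B \<subseteq> K"
  interpret F: cring "field_on K" using field_on_field[OF K] by (simp add: field.axioms domain.axioms(1))
  show ?thesis
  proof (rule field.subfieldI'[OF field_on_field[OF K] F.subringI])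
    fix x assume x: "x \<in> B - {\<zero>\<^bsub>field_on K\<^esub>}"
    then have "inv\<^bsub>field_on K\<^esub> x = inverse x"
      using BK subfD(6)[OF K] by (intro F.comm_inv_char) auto
    then show "inv\<^bsub>field_on K\<^esub> x \<in> B" using x B by (simp add: subfD)
  qed (use B BK in \<open>auto simp: subfD field_on_a_inv[OF K]\<close>)
qed

text \<open>The definition goes through the reduced fraction; additivity of multiplicities makes
  every fraction admissible.\<close>

lemma padic_abs_fraction:
  assumes p: "prime p" and ab: "a \<noteq> 0" "b \<noteq> 0"
  shows "padic_abs p (of_int a / of_int b) = real p powi (int (multiplicity (int p) b) - int (multiplicity (int p) a))"
proof -
  define q where "q = (of_int a / of_int b :: rat)"
  obtain c d where cd: "quotient_of q = (c, d)" by (cases "quotient_of q")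
  have d: "d > 0" using quotient_of_denom_pos[OF cd] .
  have q: "q = of_int c / of_int d" using quotient_of_div[OF cd] .
  have q0: "q \<noteq> 0" using ab by (simp add: q_def)
  then have c: "c \<noteq> 0" using q by auto
  have "of_int (a * d) = (of_int (c * b) :: rat)"
    using q d ab unfolding q_def by (simp add: field_simps)
  then have "a * d = c * b" by linarith
  moreover have pp: "prime_elem (int p)" using p by simp
  have "multiplicity (int p) (a * d) = multiplicity (int p) a + multiplicity (int p) d"
    "multiplicity (int p) (c * b) = multiplicity (int p) c + multiplicity (int p) b"
    using ab c d by (simp_all add: prime_elem_multiplicity_mult_distrib[OF pp])
  ultimately have "int (multiplicity (int p) d) - int (multiplicity (int p) c) =
    int (multiplicity (int p) b) - int (multiplicity (int p) a)" by simp
  then show ?thesis using q0 cd by (simp add: padic_abs_def q_def)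
qed

lemma rat_fraction:
  fixes q :: rat
  obtains a b :: int where "q = of_int a / of_int b" "b \<noteq> 0" "q \<noteq> 0 \<longrightarrow> a \<noteq> 0"
proof -
  obtain c d where cd: "quotient_of q = (c, d)" by (cases "quotient_of q")
  show ?thesis
    using that[of c d] quotient_of_div[OF cd] quotient_of_denom_pos[OF cd] by auto
qed

lemma padic_abs_0 [simp]: "padic_abs p 0 = 0"
  by (simp add: padic_abs_def)

lemma padic_abs_pos: "prime p \<Longrightarrow> q \<noteq> 0 \<Longrightarrow> padic_abs p q > 0"
  by (auto simp: padic_abs_def prime_gt_0_nat split: prod.splits)

lemma padic_abs_mult: assumes p: "prime p" shows "padic_abs p (x * y) = padic_abs p x * padic_abs p y"
proof (cases "x = 0 \<or> y = 0")
  case False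
  obtain a b where ab: "x = of_int a / of_int b" "b \<noteq> 0" "a \<noteq> 0" using rat_fraction[of x] False by metis
  obtain c d where cd: "y = of_int c / of_int d" "d \<noteq> 0" "c \<noteq> 0" using rat_fraction[of y] False by metis
  have pp: "prime_elem (int p)" using p by simp
  have "x * y = of_int (a * c) / of_int (b * d)" by (simp add: ab cd)
  moreover have "real p \<noteq> 0" using p by auto
  ultimately show ?thesis
    using padic_abs_fraction[OF p ab(3,2)] padic_abs_fraction[OF p cd(3,2)]
      padic_abs_fraction[OF p, of "a * c" "b * d"] ab cd
    by (simp add: prime_elem_multiplicity_mult_distrib[OF pp] power_int_add[symmetric])
      (simp add: algebra_simps)
qed auto

lemma padic_abs_int_le:
  assumes p: "prime p" and "p ^ k dvd nat \<bar>a\<bar>"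
  shows "padic_abs p (of_int a) \<le> real p powi (- int k)"
proof (cases "a = 0")
  case False
  have "int p ^ k dvd a" using assms(2) by (simp add: int_dvd_int_iff[symmetric])
  then have "k \<le> multiplicity (int p) a"
    using False p by (subst power_dvd_iff_le_multiplicity[symmetric]) (auto simp: prime_gt_1_nat)
  moreover have "1 \<le> real p" using prime_gt_0_nat[OF p] by linarith
  ultimately show ?thesis
    using padic_abs_fraction[OF p False, of 1] power_int_increasing[of "- int (multiplicity (int p) a)" "- int k" "real p"]
    by simp
qed (use p in simp)

lemma padic_abs_of_int_le_1: "prime p \<Longrightarrow> padic_abs p (of_int a) \<le> 1"
  using padic_abs_int_le[of p 0 a] by simp

lemma padic_abs_add_le:
  assumes p: "prime p" shows "padic_abs p (x + y) \<le> max (padic_abs p x) (padic_abs p y)"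
proof (cases "x = 0 \<or> y = 0 \<or> x + y = 0")
  case True
  then show ?thesis using padic_abs_pos[OF p, of x] by (cases "x = 0") (auto simp: less_imp_le)
next
  case False
  obtain a b where ab: "x = of_int a / of_int b" "b \<noteq> 0" "a \<noteq> 0" using rat_fraction[of x] False by metis
  obtain c d where cd: "y = of_int c / of_int d" "d \<noteq> 0" "c \<noteq> 0" using rat_fraction[of y] False by metis
  define A B D where "A = a * d" and "B = c * b" and "D = b * d"
  have xy: "x = of_int A / of_int D" "y = of_int B / of_int D" "x + y = of_int (A + B) / of_int D"
    using ab cd by (simp_all add: A_def B_def D_def field_simps)
  have nz: "A \<noteq> 0" "B \<noteq> 0" "D \<noteq> 0" "A + B \<noteq> 0"
  proof -
    show "A \<noteq> 0" "B \<noteq> 0" "D \<noteq> 0" using ab cd by (auto simp: A_def B_def D_def)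
    show "A + B \<noteq> 0" using False unfolding xy(3) by force
  qed
  define k where "k = min (multiplicity (int p) A) (multiplicity (int p) B)"
  have "int p ^ k dvd A" "int p ^ k dvd B"
    unfolding k_def by (meson le_imp_power_dvd min.cobounded1 min.cobounded2 multiplicity_dvd dvd_trans)+
  then have "int p ^ k dvd A + B" by simp
  then have "k \<le> multiplicity (int p) (A + B)"
    using nz p by (subst power_dvd_iff_le_multiplicity[symmetric]) (auto simp: prime_gt_1_nat)
  then have "padic_abs p (x + y) \<le> real p powi (int (multiplicity (int p) D) - int k)"
    unfolding xy(3) padic_abs_fraction[OF p nz(4,3)] using prime_gt_0_nat[OF p]
    by (intro power_int_increasing) (simp_all add: Suc_le_eq)
  also have "\<dots> \<le> max (padic_abs p x) (padic_abs p y)"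
    unfolding xy(1,2) padic_abs_fraction[OF p nz(1,3)] padic_abs_fraction[OF p nz(2,3)]
    by (auto simp: k_def min_def)
  finally show ?thesis .
qed

lemma padic_abs_p: assumes p: "prime p" shows "padic_abs p (of_nat p) = inverse (real p)"
proof -
  have "multiplicity (int p) (int p) = 1" using p by (intro multiplicity_self) auto
  then show ?thesis
    using padic_abs_fraction[OF p, of "int p" 1] p prime_gt_0_nat[OF p] by (simp add: power_int_minus)
qed

lemma padic_abs_other: assumes "prime p" "\<not> p dvd n" "n \<noteq> 0" shows "padic_abs p (of_nat n) = 1"
proof -
  have "multiplicity (int p) (int n) = 0" using assms by (intro not_dvd_imp_multiplicity_0) auto
  then show ?thesis using padic_abs_fraction[OF assms(1), of "int n" 1] assms by simp
qed

lemma padic_abs_eq_1_almost_all: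
  assumes "q \<noteq> 0"
  shows "finite {p. prime p \<and> padic_abs p q \<noteq> 1}"
proof -
  obtain a b where ab: "q = of_int a / of_int b" "b \<noteq> 0" "a \<noteq> 0" using rat_fraction[of q] assms by metis
  have "{p. prime p \<and> padic_abs p q \<noteq> 1} \<subseteq> {p. p dvd nat \<bar>a * b\<bar>}"
  proof safe
    fix p assume p: "prime p" "padic_abs p q \<noteq> 1"
    show "p dvd nat \<bar>a * b\<bar>"
    proof (rule ccontr)
      assume "\<not> ?thesis"
      then have "\<not> int p dvd a * b" by (simp add: int_dvd_int_iff[symmetric])
      then have "multiplicity (int p) a = 0" "multiplicity (int p) b = 0"
        by (auto intro!: not_dvd_imp_multiplicity_0)
      then show False using p padic_abs_fraction[OF p(1) ab(3,2)] ab(1) by simp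
    qed
  qed
  moreover have "nat \<bar>a * b\<bar> > 0" using ab by simp
  ultimately show ?thesis using finite_divisors_nat finite_subset by blast
qed

lemma multiplicity_int_nat:
  assumes "prime p" "n > 0"
  shows "multiplicity (int p) (int n) = multiplicity p n"
proof -
  have "k \<le> multiplicity (int p) (int n) \<longleftrightarrow> k \<le> multiplicity p n" for k
  proof -
    have "k \<le> multiplicity (int p) (int n) \<longleftrightarrow> int p ^ k dvd int n"
      using assms prime_gt_1_nat[OF assms(1)] by (intro power_dvd_iff_le_multiplicity[symmetric]) auto
    also have "\<dots> \<longleftrightarrow> p ^ k dvd n" by (simp add: int_dvd_int_iff[symmetric])
    also have "\<dots> \<longleftrightarrow> k \<le> multiplicity p n"
      using assms prime_gt_1_nat[OF assms(1)] by (intro power_dvd_iff_le_multiplicity) auto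
    finally show ?thesis .
  qed
  then show ?thesis by (meson le_antisym order_refl)
qed

lemma rational_product_formula_nat:
  assumes "n > 0" "finite P" "\<And>p. p \<in> P \<Longrightarrow> prime p" "prime_factors n \<subseteq> P"
  shows "real n * (\<Prod>p\<in>P. padic_abs p (of_nat n)) = 1"
proof -
  have "padic_abs p (of_nat n) = inverse (real p ^ multiplicity p n)" if "p \<in> P" for p
  proof -
    have "multiplicity (int p) (int n) = multiplicity p n"
      using that assms(1,3) by (intro multiplicity_int_nat)
    then show ?thesis
      using padic_abs_fraction[of p "int n" 1] assms(1,3) that by (simp add: power_int_minus)
  qed
  then have "(\<Prod>p\<in>P. padic_abs p (of_nat n)) = inverse (\<Prod>p\<in>P. real p ^ multiplicity p n)"
    by (simp add: prod_inversef[symmetric] o_def)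
  also have "(\<Prod>p\<in>P. real p ^ multiplicity p n) = (\<Prod>p\<in>prime_factors n. real p ^ multiplicity p n)"
    using assms by (intro prod.mono_neutral_right) (auto simp: prime_factors_multiplicity)
  also have "\<dots> = real (\<Prod>p\<in>prime_factors n. p ^ multiplicity p n)" by simp
  also have "\<dots> = real n" using prod_prime_factors[of n] assms(1) by simp
  finally show ?thesis using assms(1) by simp
qed

lemma rational_product_formula:
  assumes "q \<noteq> 0" "finite P" "\<And>p. p \<in> P \<Longrightarrow> prime p" "\<And>p. prime p \<Longrightarrow> padic_abs p q \<noteq> 1 \<Longrightarrow> p \<in> P"
  shows "\<bar>real_of_rat q\<bar> * (\<Prod>p\<in>P. padic_abs p q) = 1"
proof -
  obtain a b where ab: "q = of_int a / of_int b" "b \<noteq> 0" "a \<noteq> 0" using rat_fraction[of q] assms by metis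
  define n m where "n = nat \<bar>a\<bar>" and "m = nat \<bar>b\<bar>"
  have nm: "n > 0" "m > 0" "int n = \<bar>a\<bar>" "int m = \<bar>b\<bar>" using ab by (auto simp: n_def m_def)
  \<comment> \<open>The primes of numerator and denominator are added separately, since the fraction
    at hand need not be reduced.\<close>
  define P' where "P' = P \<union> prime_factors n \<union> prime_factors m"
  have P': "finite P'" "\<And>p. p \<in> P' \<Longrightarrow> prime p" using assms by (auto simp: P'_def)
  have ab': "a = int n \<or> a = - int n" "b = int m \<or> b = - int m" using nm by linarith+
  have neg: "padic_abs p (- x) = padic_abs p x" if "p \<in> P'" for p x
  proof -
    have "padic_abs p (- 1) = 1" using padic_abs_fraction[OF P'(2)[OF that], of "- 1" 1] by simp
    then show ?thesis using padic_abs_mult[OF P'(2)[OF that], of "- 1" x] by simp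
  qed
  have sgn: "padic_abs p (of_int a) = padic_abs p (of_nat n)" "padic_abs p (of_int b) = padic_abs p (of_nat m)"
    if "p \<in> P'" for p
    using ab' neg[OF that] by auto
  have "padic_abs p q * padic_abs p (of_nat m) = padic_abs p (of_nat n)" if "p \<in> P'" for p
    using padic_abs_mult[OF P'(2)[OF that], of q "of_int b"] sgn[OF that] ab by simp
  then have "(\<Prod>p\<in>P'. padic_abs p q) * (\<Prod>p\<in>P'. padic_abs p (of_nat m)) = (\<Prod>p\<in>P'. padic_abs p (of_nat n))"
    unfolding prod.distrib[symmetric] by (intro prod.cong) auto
  moreover have "real n * (\<Prod>p\<in>P'. padic_abs p (of_nat n)) = 1" "real m * (\<Prod>p\<in>P'. padic_abs p (of_nat m)) = 1"
    using nm P' by (auto intro!: rational_product_formula_nat simp: P'_def)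
  ultimately have "real n / real m * (\<Prod>p\<in>P'. padic_abs p q) = 1"
  proof -
    assume h: "(\<Prod>p\<in>P'. padic_abs p q) * (\<Prod>p\<in>P'. padic_abs p (of_nat m)) = (\<Prod>p\<in>P'. padic_abs p (of_nat n))"
      "real n * (\<Prod>p\<in>P'. padic_abs p (of_nat n)) = 1" "real m * (\<Prod>p\<in>P'. padic_abs p (of_nat m)) = 1"
    have "(\<Prod>p\<in>P'. padic_abs p (of_nat n)) = 1 / n" "(\<Prod>p\<in>P'. padic_abs p (of_nat m)) = 1 / m"
      using h(2,3) nm(1,2) by (simp_all add: field_simps)
    then have "(\<Prod>p\<in>P'. padic_abs p q) * (1 / m) = 1 / n" using h(1) by (simp only:)
    then have "(\<Prod>p\<in>P'. padic_abs p q) = real m / real n" using nm(2) by (simp add: field_simps)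
    then show ?thesis using nm(1,2) by simp
  qed
  moreover have "\<bar>real_of_rat q\<bar> = real n / real m"
  proof -
    have "real n = \<bar>of_int a\<bar>" "real m = \<bar>of_int b\<bar>" using nm by (metis of_int_abs of_int_of_nat_eq)+
    then show ?thesis unfolding ab(1) by (simp add: of_rat_divide)
  qed
  moreover have "(\<Prod>p\<in>P'. padic_abs p q) = (\<Prod>p\<in>P. padic_abs p q)"
    using P' assms(4) by (intro prod.mono_neutral_right) (auto simp: P'_def)
  ultimately show ?thesis by (simp only:)
qed

text \<open>Supplies above each prime the reference absolute value that \<open>cmod\<close> supplies
  above infinity. It comes from \<open>nonarch_extension\<close> over \<open>\<rat>\<close>, with
  the prime as \<open>\<pi>\<close>.\<close>

lemma padic_extension:
  assumes p: "prime p" and nL: "number_field L"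
  shows "\<exists>Q. absv L Q \<and> (\<forall>q. Q (of_rat q) = padic_abs p q)"
proof -
  have sL: "subf L" by (rule number_field_subf[OF nL])
  define \<nu> where "\<nu> = (\<lambda>x::complex. padic_abs p (THE q. x = of_rat q))"
  have nu: "\<nu> (of_rat q) = padic_abs p q" for q by (simp add: \<nu>_def)
  interpret N: nonarch_ext "field_on L" \<rat> \<nu> "of_nat p"
  proof (intro nonarch_ext.intro field_on_field[OF sL] nonarch_ext_axioms.intro)
    show "subfield \<rat> (field_on L)" by (intro subfield_field_on sL subf_Rats Rats_subset)
    show "absolute_value (field_on L\<lparr>carrier := \<rat>\<rparr>) \<nu>"
    proof -
      have "absv \<rat> \<nu>"
        unfolding absv_iff
      proof (intro conjI ballI)
        fix x :: complex assume "x \<in> \<rat>"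
        then obtain q where q: "x = of_rat q" by (auto elim: Rats_cases)
        show "0 \<le> \<nu> x" "\<nu> x = 0 \<longleftrightarrow> x = 0"
          unfolding q nu using padic_abs_pos[OF p, of q] by (cases "q = 0"; simp)+
        fix y :: complex assume "y \<in> \<rat>"
        then obtain r where r: "y = of_rat r" by (auto elim: Rats_cases)
        show "\<nu> (x * y) = \<nu> x * \<nu> y"
          unfolding q r of_rat_mult[symmetric] nu by (rule padic_abs_mult[OF p])
        have "\<nu> (x + y) \<le> max (padic_abs p q) (padic_abs p r)"
          unfolding q r of_rat_add[symmetric] nu by (rule padic_abs_add_le[OF p])
        also have "\<dots> \<le> padic_abs p q + padic_abs p r"
          using padic_abs_pos[OF p, of q] padic_abs_pos[OF p, of r] by (cases "q = 0"; cases "r = 0") auto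
        finally show "\<nu> (x + y) \<le> \<nu> x + \<nu> y" by (simp add: q r nu)
      qed
      then show ?thesis by simp
    qed
    show "of_nat p \<in> \<rat>" by simp
    have "\<nu> (of_nat p) = inverse (real p)" using nu[of "of_nat p"] padic_abs_p[OF p] by simp
    then show "0 < \<nu> (of_nat p)" "\<nu> (of_nat p) < 1"
      using prime_gt_1_nat[OF p] by (auto simp: inverse_less_1_iff)
    fix x y :: complex assume "x \<in> \<rat>" "y \<in> \<rat>"
    then obtain q r where "x = of_rat q" "y = of_rat r" by (auto elim!: Rats_cases)
    then show "\<nu> (x \<oplus>\<^bsub>field_on L\<^esub> y) \<le> max (\<nu> x) (\<nu> y)"
      using padic_abs_add_le[OF p, of q r] by (simp add: nu of_rat_add[symmetric])
  qed
  have "\<exists>\<mu>. absolute_value (field_on L) \<mu> \<and> (\<forall>x\<in>\<rat>. \<mu> x = \<nu> x)"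
  proof (rule N.nonarch_extension)
    fix x assume "x \<in> carrier (field_on L)"
    then have xL: "x \<in> L" by simp
    then have "alg_over \<rat> x" using number_field_algebraic[OF nL] by (simp add: alg_over_Rats)
    then obtain g where g: "g \<in> polys_over \<rat>" "g \<noteq> 0" "poly g x = 0" by (auto simp: alg_over_def)
    have gL: "coeff g i \<in> L" for i using g(1) Rats_subset[OF sL] by (auto simp: polys_over_def)
    show "\<exists>a n. (\<forall>i\<le>(n::nat). a i \<in> \<rat>) \<and> (\<exists>i\<le>n. a i \<noteq> \<zero>\<^bsub>field_on L\<^esub>) \<and>
      (\<Oplus>\<^bsub>field_on L\<^esub>i\<in>{..n}. a i \<otimes>\<^bsub>field_on L\<^esub> x [^]\<^bsub>field_on L\<^esub> i) = \<zero>\<^bsub>field_on L\<^esub>"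
    proof (rule exI[of _ "coeff g"], rule exI[of _ "degree g"], intro conjI)
      show "\<forall>i\<le>degree g. coeff g i \<in> \<rat>" using g(1) by (simp add: polys_over_def)
      show "\<exists>i\<le>degree g. coeff g i \<noteq> \<zero>\<^bsub>field_on L\<^esub>" using g(2) by (intro exI[of _ "degree g"]) simp
      have "finsum (field_on L) (\<lambda>i. coeff g i * x ^ i) {..degree g} = (\<Sum>i\<le>degree g. coeff g i * x ^ i)"
        using gL xL sL by (intro field_on_finsum) (auto simp: subfD)
      then show "(\<Oplus>\<^bsub>field_on L\<^esub>i\<in>{..degree g}. coeff g i \<otimes>\<^bsub>field_on L\<^esub> x [^]\<^bsub>field_on L\<^esub> i) = \<zero>\<^bsub>field_on L\<^esub>"
        using g(3) by (simp add: field_on_pow[OF sL xL] poly_altdef)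
    qed
  qed
  then show ?thesis using nu by (metis Rats_of_rat)
qed

text \<open>By the binomial theorem \<open>w (x + y) ^ n\<close> is at most
  \<open>real (Suc n) * M ^ n\<close>; if \<open>w (x + y)\<close> exceeded \<open>M\<close>, the
  left side would win by exponential growth.\<close>

lemma absv_nonarch:
  assumes K: "subf K" and w: "absv K w" and int: "\<And>n::nat. w (of_nat n) \<le> 1"
    and xy: "x \<in> K" "y \<in> K"
  shows "w (x + y) \<le> max (w x) (w y)"
proof (rule ccontr)
  assume "\<not> ?thesis"
  then have lt: "max (w x) (w y) < w (x + y)" by linarith
  define M where "M = max (w x) (w y)"
  have M0: "M \<ge> 0" using absv_nonneg[OF K w] xy by (auto simp: M_def le_max_iff_disj)
  have bound: "w (x + y) ^ n \<le> real (Suc n) * M ^ n" for n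
  proof -
    have in': "of_nat (n choose k) * x ^ k * y ^ (n - k) \<in> K" for k
      using K xy by (auto simp: subfD subf_of_nat)
    have "w (x + y) ^ n = w ((x + y) ^ n)" using absv_power[OF K w] xy K by (simp add: subfD)
    also have "\<dots> = w (\<Sum>k\<le>n. of_nat (n choose k) * x ^ k * y ^ (n - k))" by (simp add: binomial_ring)
    also have "\<dots> \<le> (\<Sum>k\<le>n. w (of_nat (n choose k) * x ^ k * y ^ (n - k)))"
      by (rule absv_sum[OF K w in'])
    also have "\<dots> \<le> (\<Sum>k\<le>n. M ^ n)"
    proof (rule sum_mono)
      fix k assume k: "k \<in> {..n}"
      have c: "of_nat (n choose k) \<in> K" "x ^ k \<in> K" "y ^ (n - k) \<in> K" "of_nat (n choose k) * x ^ k \<in> K"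
        using K xy by (auto simp: subfD subf_of_nat)
      have "w (of_nat (n choose k) * x ^ k * y ^ (n - k)) = w (of_nat (n choose k)) * w x ^ k * w y ^ (n - k)"
        using absv_mult[OF K w c(4,3)] absv_mult[OF K w c(1,2)] absv_power[OF K w] xy by simp
      also have "\<dots> \<le> 1 * M ^ k * M ^ (n - k)"
        using int absv_nonneg[OF K w] xy M0 c
        by (intro mult_mono power_mono) (auto simp: M_def)
      also have "\<dots> = M ^ n" using k by (simp add: power_add[symmetric])
      finally show "w (of_nat (n choose k) * x ^ k * y ^ (n - k)) \<le> M ^ n" .
    qed
    finally show ?thesis by simp
  qed
  show False
  proof (cases "M = 0")
    case True
    then show False using bound[of 1] lt absv_nonneg[OF K w, of "x + y"] by (simp add: M_def)
  next
    case False
    then have M: "M > 0" using M0 by simp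
    define c where "c = w (x + y) / M"
    have c1: "c > 1" using lt M by (simp add: c_def M_def)
    have cb: "c ^ n \<le> real (Suc n)" for n
      using bound[of n] M by (simp add: c_def power_divide field_simps)
    define h where "h = c - 1"
    have h: "h > 0" using c1 by (simp add: h_def)
    \<comment> \<open>The 3 is there for \<open>2 * n + 1 \<le> 3 * n\<close> at the end;
      Bernoulli's inequality is squared below to obtain quadratic growth against this linear
      bound.\<close>
    obtain n :: nat where n: "real n * (h * h) > 3" using reals_Archimedean3[of "h * h"] h by auto
    have n1: "n > 0" using n by (cases n) auto
    have "(real n * h) ^ 2 \<le> (1 + real n * h) ^ 2" using h by (intro power_mono) auto
    also have "\<dots> \<le> (c ^ n) ^ 2"
      using Bernoulli_inequality[of h n] h by (intro power_mono) (auto simp: h_def)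
    also have "\<dots> = c ^ (n * 2)" by (simp add: power_mult)
    also have "\<dots> \<le> real (Suc (n * 2))" by (rule cb)
    finally have "real n * (real n * (h * h)) \<le> 2 * real n + 1" by (simp add: power2_eq_square algebra_simps)
    moreover have "real n * 3 < real n * (real n * (h * h))" using n n1 by (intro mult_strict_left_mono) auto
    ultimately show False using n1 by simp
  qed
qed

section \<open>Elementary properties of places\<close>

lemma place_absv: "w \<in> places K \<Longrightarrow> absv K w"
  by (simp add: places_def)

lemma archimedean_of_rat: "archimedean w \<Longrightarrow> w (of_rat q) = \<bar>real_of_rat q\<bar>"
  by (simp add: archimedean_def)

lemma padic_not_archimedean:
  assumes "prime p" "\<And>q. w (of_rat q) = padic_abs p q"
  shows "\<not> archimedean w"
proof
  assume "archimedean w"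
  then have "padic_abs p (of_nat p) = real p"
    using assms(2)[of "of_nat p"] archimedean_of_rat[of w "of_nat p"] by simp
  then have "inverse (real p) = real p" using padic_abs_p[OF assms(1)] by simp
  moreover have "inverse (real p) < 1" "1 < real p" using prime_gt_1_nat[OF assms(1)] by (auto simp: inverse_less_1_iff)
  ultimately show False by simp
qed

lemma padic_place_prime_unique:
  assumes "prime p" "\<And>q. w (of_rat q) = padic_abs p q" "prime p'" "\<And>q. w (of_rat q) = padic_abs p' q"
  shows "p = p'"
proof (rule ccontr)
  assume "p \<noteq> p'"
  then have "padic_abs p' (of_nat p) = 1"
    using assms(1,3) by (intro padic_abs_other) (auto dest: primes_dvd_imp_eq)
  then have "inverse (real p) = 1" using assms(2,4)[of "of_nat p"] padic_abs_p[OF assms(1)] by simp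
  then show False using prime_gt_1_nat[OF assms(1)] by simp
qed

lemma place_cases:
  assumes "w \<in> places K"
  obtains "archimedean w" | p where "prime p" "\<And>q. w (of_rat q) = padic_abs p q" "\<not> archimedean w"
  using assms padic_not_archimedean unfolding places_def by blast

lemma nonarch_place_add:
  assumes K: "subf K" and w: "w \<in> places K" "\<not> archimedean w" and xy: "x \<in> K" "y \<in> K"
  shows "w (x + y) \<le> max (w x) (w y)"
proof -
  obtain p where p: "prime p" "\<And>q. w (of_rat q) = padic_abs p q"
    using w by (elim place_cases) auto
  have "w (of_nat n) \<le> 1" for n
    using p(2)[of "of_nat n"] padic_abs_of_int_le_1[OF p(1), of "int n"] by simp
  then show ?thesis using absv_nonarch[OF K place_absv[OF w(1)] _ xy] by blast
qed

text \<open>Provides the rational \<open>b\<close> on which the separation lemmas rest: absolute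
  values above the same place of \<open>\<rat>\<close> share its value.\<close>

lemma place_nontrivial:
  assumes "w \<in> places K"
  shows "\<exists>b\<in>\<rat>. b \<noteq> 0 \<and> w b \<noteq> 1"
  using assms
proof (cases rule: place_cases)
  case 1
  then have "w 2 = 2" using archimedean_of_rat[OF 1, of 2] by simp
  then show ?thesis by (intro bexI[of _ 2]) auto
next
  case (2 p)
  have "w (of_nat p) = inverse (real p)" using 2(2)[of "of_nat p"] padic_abs_p[OF 2(1)] by simp
  then show ?thesis using prime_gt_1_nat[OF 2(1)] by (intro bexI[of _ "of_nat p"]) auto
qed

lemma place_restrict:
  assumes "w \<in> places K" "subf k" "k \<subseteq> K"
  shows "restrict w k \<in> places k" "archimedean (restrict w k) \<longleftrightarrow> archimedean w"
proof -
  have q: "of_rat q \<in> k" for q using Rats_subset[OF assms(2)] by auto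
  have "absv k (restrict w k)"
    using place_absv[OF assms(1)] assms(2,3) by (auto simp: absv_iff subfD subset_iff)
  then show "restrict w k \<in> places k"
    using assms(1) q by (auto simp: places_def archimedean_def)
  show "archimedean (restrict w k) \<longleftrightarrow> archimedean w" using q by (simp add: archimedean_def)
qed

section \<open>Local degrees and the product formula\<close>

context valued_field
begin

lemma combine_min:
  "combine Ks Us = combine (take (min (length Ks) (length Us)) Ks) (take (min (length Ks) (length Us)) Us)"
  by (induction Ks Us rule: combine.induct) auto

lemma CR_perturb:
  assumes s: "s \<in> carrier CR" and y: "\<And>i. y i \<in> carrier R" and lim: "(\<lambda>i. \<nu> (s i \<ominus> y i)) \<longlonglongrightarrow> 0"
  shows "y \<in> carrier CR" "cls y = cls s"
proof -
  have sc: "s i \<in> carrier R" for i using CRD[OF s] .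
  show yc: "y \<in> carrier CR"
    unfolding CR_carrier
  proof (intro conjI allI impI y)
    fix e :: real assume "e > 0"
    then have e: "e / 3 > 0" by simp
    obtain N where N: "\<And>i j. i \<ge> N \<Longrightarrow> j \<ge> N \<Longrightarrow> \<nu> (s i \<ominus> s j) < e / 3" using CR_Cauchy[OF s e] by meson
    obtain M where M: "\<And>i. i \<ge> M \<Longrightarrow> \<nu> (s i \<ominus> y i) < e / 3"
      using order_tendstoD(2)[OF lim e] by (auto simp: eventually_sequentially)
    show "\<exists>N. \<forall>i\<ge>N. \<forall>j\<ge>N. \<nu> (y i \<ominus> y j) < e"
    proof (intro exI[of _ "max N M"] allI impI)
      fix i j assume ij: "i \<ge> max N M" "j \<ge> max N M"
      have "y i \<ominus> y j = (\<ominus> (s i \<ominus> y i) \<oplus> (s i \<ominus> s j)) \<oplus> (s j \<ominus> y j)"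
        using y sc by (simp add: a_minus_def minus_add a_ac r_neg1 r_neg2 r_neg l_neg)
      then have "\<nu> (y i \<ominus> y j) \<le> \<nu> (\<ominus> (s i \<ominus> y i) \<oplus> (s i \<ominus> s j)) + \<nu> (s j \<ominus> y j)"
        using y sc v_add[of "\<ominus> (s i \<ominus> y i) \<oplus> (s i \<ominus> s j)" "s j \<ominus> y j"] by simp
      also have "\<dots> \<le> \<nu> (s i \<ominus> y i) + \<nu> (s i \<ominus> s j) + \<nu> (s j \<ominus> y j)"
        using y sc v_add[of "\<ominus> (s i \<ominus> y i)" "s i \<ominus> s j"] v_minus[of "s i \<ominus> y i"] by simp
      also have "\<dots> < e" using N[of i j] M[of i] M[of j] ij by simp
      finally show "\<nu> (y i \<ominus> y j) < e" .
    qed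
  qed
  show "cls y = cls s"
    using lim v_diff_commute[OF sc y] by (simp add: cls_eq_iff[OF yc s])
qed

lemma CR_sum:
  assumes "finite I" "\<And>i. i \<in> I \<Longrightarrow> s i \<in> carrier CR"
  shows "(\<lambda>n. \<Oplus>i\<in>I. s i n) \<in> carrier CR"
  using assms
proof (induction I rule: finite_induct)
  case (insert i I)
  have "(\<lambda>j. s j n) \<in> insert i I \<rightarrow> carrier R" for n using insert.prems CRD by auto
  then have "(\<lambda>n. \<Oplus>j\<in>insert i I. s j n) = (\<lambda>n. s i n \<oplus> (\<Oplus>j\<in>I. s j n))"
    using insert by (intro ext finsum_insert) auto
  then show ?case using insert CR_add by simp
qed (simp add: CR_const)

lemma closure_subfield:
  assumes S: "subfield S R"
  shows "subfield (closure_in R \<nu> S) R"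
proof (rule subfieldI'[OF subringI])
  have Sc: "x \<in> carrier R" if "x \<in> S" for x using that subfieldE(3)[OF S] by blast
  note Sp = subring_props[OF S]
  have inS: "x \<in> closure_in R \<nu> S" if "x \<in> S" for x
    using that Sc[OF that] unfolding closure_in_def by (auto intro!: bexI[of _ x] simp: a_minus_def r_neg v_0)
  show "closure_in R \<nu> S \<subseteq> carrier R" by (auto simp: closure_in_def)
  show "\<one> \<in> closure_in R \<nu> S" using inS Sp by blast
  {
  fix x assume x: "x \<in> closure_in R \<nu> S"
  then have xc: "x \<in> carrier R" and xa: "\<And>e. e > 0 \<Longrightarrow> \<exists>y\<in>S. \<nu> (x \<ominus> y) < e" by (auto simp: closure_in_def)
  show "\<ominus> x \<in> closure_in R \<nu> S"
    unfolding closure_in_def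
  proof (intro CollectI conjI allI impI)
    fix e :: real assume "e > 0"
    then obtain y where y: "y \<in> S" "\<nu> (x \<ominus> y) < e" using xa by blast
    have "\<ominus> x \<ominus> \<ominus> y = \<ominus> (x \<ominus> y)" using xc Sc[OF y(1)] by (simp add: a_minus_def minus_add)
    then have "\<nu> (\<ominus> x \<ominus> \<ominus> y) < e" using y v_minus[of "x \<ominus> y"] xc Sc[OF y(1)] by simp
    then show "\<exists>y\<in>S. \<nu> (\<ominus> x \<ominus> y) < e" using Sp(5)[OF y(1)] by blast
  qed (use xc in simp)
  {
    fix y assume y: "y \<in> closure_in R \<nu> S"
    then have yc: "y \<in> carrier R" and ya: "\<And>e. e > 0 \<Longrightarrow> \<exists>z\<in>S. \<nu> (y \<ominus> z) < e" by (auto simp: closure_in_def)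
    show "x \<oplus> y \<in> closure_in R \<nu> S"
      unfolding closure_in_def
    proof (intro CollectI conjI allI impI)
      fix e :: real assume "e > 0"
      then have e: "e / 2 > 0" by simp
      obtain u where u: "u \<in> S" "\<nu> (x \<ominus> u) < e / 2" using xa[OF e] by blast
      obtain v where v: "v \<in> S" "\<nu> (y \<ominus> v) < e / 2" using ya[OF e] by blast
      have "(x \<oplus> y) \<ominus> (u \<oplus> v) = (x \<ominus> u) \<oplus> (y \<ominus> v)"
        using xc yc Sc[OF u(1)] Sc[OF v(1)] by (simp add: a_minus_def minus_add a_ac)
      then have "\<nu> ((x \<oplus> y) \<ominus> (u \<oplus> v)) \<le> \<nu> (x \<ominus> u) + \<nu> (y \<ominus> v)"
        using v_add[of "x \<ominus> u" "y \<ominus> v"] xc yc Sc[OF u(1)] Sc[OF v(1)] by simp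
      then have "\<nu> ((x \<oplus> y) \<ominus> (u \<oplus> v)) < e" using u v by simp
      then show "\<exists>z\<in>S. \<nu> ((x \<oplus> y) \<ominus> z) < e" using Sp(7)[OF u(1) v(1)] by blast
    qed (use xc yc in simp)
    show "x \<otimes> y \<in> closure_in R \<nu> S"
      unfolding closure_in_def
    proof (intro CollectI conjI allI impI)
      fix e :: real assume e: "e > 0"
      define Mx My where "Mx = \<nu> x + 1" and "My = \<nu> y + 1"
      have M: "Mx > 0" "My > 0" using v_nonneg xc yc by (auto simp: Mx_def My_def add_nonneg_pos)
      have "e / (2 * My) > 0" "min 1 (e / (2 * Mx)) > 0" using e M by auto
      obtain v where v: "v \<in> S" "\<nu> (y \<ominus> v) < min 1 (e / (2 * Mx))" using ya[OF \<open>min 1 _ > 0\<close>] by blast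
      obtain u where u: "u \<in> S" "\<nu> (x \<ominus> u) < e / (2 * My)" using xa[OF \<open>e / (2 * My) > 0\<close>] by blast
      have uc: "u \<in> carrier R" and vc: "v \<in> carrier R" using u v Sc by auto
      have vM: "\<nu> v \<le> My"
      using v_abs_diff[OF yc vc] v(2) unfolding My_def by linarith
      have "x \<otimes> y \<ominus> u \<otimes> v = x \<otimes> (y \<ominus> v) \<oplus> (x \<ominus> u) \<otimes> v"
      proof -
        have "x \<otimes> (y \<ominus> v) \<oplus> (x \<ominus> u) \<otimes> v = x \<otimes> y \<oplus> (\<ominus> (x \<otimes> v) \<oplus> (x \<otimes> v \<oplus> \<ominus> (u \<otimes> v)))"
          using xc yc uc vc by (simp add: a_minus_def r_distr l_distr l_minus r_minus a_assoc)
        then show ?thesis using xc yc uc vc by (simp add: a_minus_def r_neg1)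
      qed
      then have "\<nu> (x \<otimes> y \<ominus> u \<otimes> v) \<le> \<nu> x * \<nu> (y \<ominus> v) + \<nu> (x \<ominus> u) * \<nu> v"
        using v_add[of "x \<otimes> (y \<ominus> v)" "(x \<ominus> u) \<otimes> v"] xc yc uc vc by (simp add: v_mult)
      also have "\<dots> \<le> Mx * \<nu> (y \<ominus> v) + \<nu> (x \<ominus> u) * My"
        using xc yc uc vc v_nonneg vM by (intro add_mono mult_mono) (auto simp: Mx_def)
      also have "\<dots> < Mx * (e / (2 * Mx)) + e / (2 * My) * My"
        using M u v by (intro add_strict_mono mult_strict_left_mono mult_strict_right_mono) auto
      also have "\<dots> = e" using M by simp
      finally show "\<exists>z\<in>S. \<nu> (x \<otimes> y \<ominus> z) < e" using Sp(6)[OF u(1) v(1)] by blast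
    qed (use xc yc in simp)
  }
  }
  fix x assume x: "x \<in> closure_in R \<nu> S - {\<zero>}"
  then have xc: "x \<in> carrier R" and xa: "\<And>e. e > 0 \<Longrightarrow> \<exists>y\<in>S. \<nu> (x \<ominus> y) < e" by (auto simp: closure_in_def)
  have x0: "x \<noteq> \<zero>" using x by simp
  then have nx: "\<nu> x > 0" using v_pos xc by blast
  have xi: "inv x \<in> carrier R" "x \<otimes> inv x = \<one>" using xc x0 field_Units by auto
  show "inv x \<in> closure_in R \<nu> S"
    unfolding closure_in_def
  proof (intro CollectI conjI allI impI xi)
    fix e :: real assume e: "e > 0"
    \<comment> \<open>The first bound keeps \<open>\<nu> y\<close> above \<open>\<nu> x / 2\<close>,
      the second makes the difference of the inverses smaller than \<open>e\<close>.\<close>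
    define d where "d = min (\<nu> x / 2) (e * (\<nu> x * \<nu> x) / 2)"
    have d: "d > 0" using e nx by (simp add: d_def)
    obtain y where y: "y \<in> S" "\<nu> (x \<ominus> y) < d" using xa[OF d] by blast
    have yc: "y \<in> carrier R" using Sc[OF y(1)] .
    have "\<nu> (x \<ominus> y) < \<nu> x / 2" using y(2) by (simp add: d_def)
    then have ny: "\<nu> y > \<nu> x / 2" using v_abs_diff[OF xc yc] by linarith
    then have y0: "y \<noteq> \<zero>" using nx v_0 by auto
    have yi: "inv y \<in> carrier R" "inv y \<otimes> y = \<one>" using yc y0 field_Units by auto
    have "inv x \<otimes> ((y \<ominus> x) \<otimes> inv y) = inv x \<ominus> inv y"
    proof -
      have "inv x \<otimes> ((y \<ominus> x) \<otimes> inv y) = inv x \<otimes> (inv y \<otimes> y) \<ominus> (x \<otimes> inv x) \<otimes> inv y"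
        using xc yc xi(1) yi(1) by (simp add: a_minus_def r_distr l_distr l_minus r_minus m_ac)
      then show ?thesis using xi yi by simp
    qed
    then have "\<nu> (inv x \<ominus> inv y) = \<nu> (inv x \<otimes> ((y \<ominus> x) \<otimes> inv y))" by simp
    also have "\<dots> = inverse (\<nu> x) * (\<nu> (x \<ominus> y) * inverse (\<nu> y))"
      using xc yc xi yi v_inv[OF xc x0] v_inv[OF yc y0] v_diff_commute[OF xc yc] by (simp add: v_mult)
    also have "\<dots> = \<nu> (x \<ominus> y) / (\<nu> x * \<nu> y)" by (simp add: field_simps)
    also have "\<dots> < (e * (\<nu> x * \<nu> x) / 2) / (\<nu> x * (\<nu> x / 2))"
    proof (rule frac_less)
      show "0 \<le> \<nu> (x \<ominus> y)" using xc yc v_nonneg by simp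
      show "\<nu> (x \<ominus> y) < e * (\<nu> x * \<nu> x) / 2" using y(2) by (simp add: d_def)
      show "0 < \<nu> x * (\<nu> x / 2)" using nx by simp
      show "\<nu> x * (\<nu> x / 2) \<le> \<nu> x * \<nu> y" using nx ny by (intro mult_left_mono) auto
    qed
    also have "\<dots> = e" using nx by simp
    finally have "\<nu> (inv x \<ominus> inv y) < e" .
    moreover have "inv y \<in> S" using subfield_m_inv(1)[OF S, of y] y y0 by simp
    ultimately show "\<exists>z\<in>S. \<nu> (inv x \<ominus> z) < e" by blast
  qed
qed

end

lemma lagrange_basis:
  assumes L: "subf L" and R: "finite R" "R \<subseteq> L"
  shows "\<exists>lb. \<forall>r\<in>R. lb r \<in> polys_over L \<and> degree (lb r) < card R \<and> (\<forall>s\<in>R. poly (lb r) s = (if r = s then 1 else 0))"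
proof -
  define lb where "lb r = (\<Prod>s\<in>R - {r}. smult (1 / (r - s)) [:- s, 1:])" for r
  have "lb r \<in> polys_over L \<and> degree (lb r) < card R \<and> (\<forall>s\<in>R. poly (lb r) s = (if r = s then 1 else 0))" if r: "r \<in> R" for r
  proof (intro conjI ballI)
    show "lb r \<in> polys_over L"
      unfolding lb_def using r R(2) L
      by (intro polys_over_prod polys_over_smult subfD(7)[OF L]) (auto simp: polys_over_pCons_iff polys_over_0 subfD subset_iff)
    have "degree (lb r) \<le> sum (degree \<circ> (\<lambda>s. smult (1 / (r - s)) [:- s, 1:])) (R - {r})"
      unfolding lb_def using R by (intro degree_prod_sum_le) auto
    also have "\<dots> \<le> (\<Sum>s\<in>R - {r}. 1)" by (intro sum_mono) auto
    also have "\<dots> < card R" using r R(1) by (simp add: card_gt_0_iff) (metis Suc_pred card_gt_0_iff empty_iff lessI)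
    finally show "degree (lb r) < card R" .
    fix s assume s: "s \<in> R"
    show "poly (lb r) s = (if r = s then 1 else 0)"
    proof (cases "r = s")
      case True
      then show ?thesis unfolding lb_def poly_prod by (auto intro!: prod.neutral simp: diff_divide_distrib[symmetric] split: if_splits)
    next
      case False
      then have "s \<in> R - {r}" using s by auto
      then have "(\<Prod>s'\<in>R - {r}. poly (smult (1 / (r - s')) [:- s', 1:]) s) = 0"
        using R by (intro prod_zero) auto
      then show ?thesis using False by (simp add: lb_def poly_prod)
    qed
  qed
  then show ?thesis by blast
qed

lemma poly_eq_on_points:
  fixes p q :: "complex poly"
  assumes "finite R" "degree p < card R" "degree q < card R" "\<And>r. r \<in> R \<Longrightarrow> poly p r = poly q r"
  shows "p = q"
proof (rule ccontr)
  assume "p \<noteq> q"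
  then have ne: "p - q \<noteq> 0" by simp
  have "R \<subseteq> {r. poly (p - q) r = 0}" using assms(4) by auto
  then have "card R \<le> degree (p - q)"
    using card_mono[OF poly_roots_finite[OF ne]] card_poly_roots_bound[OF ne] by (meson le_trans)
  also have "\<dots> < card R" using degree_diff_le_max[of p q] assms(2,3) by linarith
  finally show False by simp
qed

lemma poly_as_sum_lt: "degree p < n \<Longrightarrow> poly p x = (\<Sum>j<n. coeff p j * x ^ j)" for p :: "complex poly"
proof -
  assume "degree p < n"
  then have "(\<Sum>j<n. coeff p j * x ^ j) = (\<Sum>j\<le>degree p. coeff p j * x ^ j)"
    by (intro sum.mono_neutral_right) (auto simp: coeff_eq_0)
  then show ?thesis by (simp add: poly_altdef)
qed

lemma number_field_Rats: "number_field \<rat>"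
proof -
  have "adj \<rat> 0 = \<rat>"
    using adj_subset[OF subf_Rats subf_Rats order_refl Rats_0] adj_contains(2)[OF subf_Rats] by blast
  then show ?thesis using number_field_iff algebraic_0 by metis
qed

text \<open>\<open>w\<close> on \<open>K\<close> and \<open>Q\<close> on the normal closure lie
  above the same place of \<open>\<rat>\<close>; the aim is to read off the local degree of
  \<open>w\<close> from the embeddings that carry \<open>w\<close> to \<open>Q\<close>.\<close>

locale place_over = number_tower \<rat> K L for K L +
  fixes Q w
  assumes Q: "absv L Q" and w: "absv K w" and wQ: "q \<in> \<rat> \<Longrightarrow> w q = Q q"
    and nontriv: "\<exists>b\<in>\<rat>. b \<noteq> 0 \<and> Q b \<noteq> 1"
begin

text \<open>The embeddings inducing \<open>w\<close>; their number turns out to be the local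
  degree.\<close>

definition T where "T = {\<tau> \<in> embs \<rat> K. \<forall>x\<in>K. w x = Q (\<tau> x)}"

lemma T_embs: "\<tau> \<in> T \<Longrightarrow> \<tau> \<in> embs \<rat> K" and T_w: "\<tau> \<in> T \<Longrightarrow> x \<in> K \<Longrightarrow> Q (\<tau> x) = w x"
  by (auto simp: T_def)

lemma T_nonempty: "T \<noteq> {}"
  using absv_is_conjugate[OF Q w wQ] nontriv wQ unfolding T_def by fastforce

lemma finite_T: "finite T"
  using finite_embs'[OF nK BK] by (simp add: T_def)

definition gen where "gen = (SOME c. algebraic c \<and> K = adj \<rat> c)"

lemma gen: "algebraic gen" "K = adj \<rat> gen"
proof -
  have "\<exists>c. algebraic c \<and> K = adj \<rat> c" using nK by (simp only: number_field_iff)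
  then have "algebraic gen \<and> K = adj \<rat> gen" unfolding gen_def by (rule someI_ex)
  then show "algebraic gen" "K = adj \<rat> gen" by auto
qed

lemma gen_K: "gen \<in> K"
  using adj_contains(1)[OF subf_Rats, of gen] gen(2)[symmetric] by (simp only:)

text \<open>The roots of the minimal polynomial of \<open>gen\<close> over the completion of
  \<open>\<rat>\<close>, that is, of the local factor belonging to \<open>w\<close>.\<close>

definition RR where "RR = (\<lambda>\<tau>. \<tau> gen) ` T"

lemma card_RR: "card RR = card T"
proof -
  obtain m where m: "is_minpoly \<rat> gen m" using gen(1) ex_minpoly[OF subf_Rats] by (auto simp: alg_over_Rats)
  have "inj_on (\<lambda>\<tau>. \<tau> gen) (embs \<rat> K)"
    using embs_bij[OF subf_Rats m] gen(2)[symmetric] by (simp add: bij_betw_def)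
  then have "inj_on (\<lambda>\<tau>. \<tau> gen) T" using T_embs by (meson inj_on_subset subsetI)
  then show ?thesis by (simp add: RR_def card_image)
qed

lemma finite_RR: "finite RR" and RR_L: "RR \<subseteq> L"
  using finite_T emb_K_in[OF T_embs gen_K] by (auto simp: RR_def)

definition ell where
  "ell = (SOME lb. \<forall>r\<in>RR. lb r \<in> polys_over L \<and> degree (lb r) < card RR \<and> (\<forall>s\<in>RR. poly (lb r) s = (if r = s then 1 else 0)))"

lemma ell: "r \<in> RR \<Longrightarrow> ell r \<in> polys_over L" "r \<in> RR \<Longrightarrow> degree (ell r) < card RR"
  "r \<in> RR \<Longrightarrow> s \<in> RR \<Longrightarrow> poly (ell r) s = (if r = s then 1 else 0)"
  using someI_ex[OF lagrange_basis[OF sL finite_RR RR_L]] unfolding ell_def[symmetric] by auto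

text \<open>The remainder of \<open>p\<close> modulo the local factor with root set
  \<open>RR\<close>, written by Lagrange's formula so that its coefficients are linear in the values
  of \<open>p\<close> on \<open>RR\<close>.\<close>

definition interp where "interp p = (\<Sum>r\<in>RR. smult (poly p r) (ell r))"

lemma interp_degree: "degree (interp p) < card RR"
proof -
  have "degree (interp p) \<le> card RR - 1"
    unfolding interp_def using ell(2) by (intro degree_sum_le finite_RR) (fastforce intro: order_trans[OF degree_smult_le])
  moreover have "card RR > 0" using T_nonempty finite_T card_RR by (simp add: card_gt_0_iff)
  ultimately show ?thesis by simp
qed

lemma interp_poly: "r \<in> RR \<Longrightarrow> poly (interp p) r = poly p r"
proof -
  assume r: "r \<in> RR"
  have "poly (interp p) r = (\<Sum>k\<in>RR. if k = r then poly p k else 0)"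
    unfolding interp_def poly_sum using ell(3)[OF _ r] by (intro sum.cong) auto
  then show ?thesis using finite_RR r by simp
qed

lemma interp_unique: "degree p < card RR \<Longrightarrow> p = interp p"
  using poly_eq_on_points[OF finite_RR _ interp_degree] interp_poly by metis

lemma interp_coeff: "coeff (interp p) j = (\<Sum>r\<in>RR. poly p r * coeff (ell r) j)"
  by (simp add: interp_def coeff_sum)

lemma ell_coeff: "r \<in> RR \<Longrightarrow> coeff (ell r) j \<in> L"
  using ell(1) by (auto simp: polys_over_def)

lemma QL: "\<rat> \<subseteq> L" by (rule Rats_subset[OF sL])

lemma rat_poly_L: "p \<in> polys_over \<rat> \<Longrightarrow> r \<in> L \<Longrightarrow> poly p r \<in> L"
  using poly_in_subf[OF subf_Rats sL _ QL] by blast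

lemma T_poly: "\<tau> \<in> T \<Longrightarrow> p \<in> polys_over \<rat> \<Longrightarrow> \<tau> (poly p gen) = poly p (\<tau> gen)"
  using emb_poly_over[OF subf_Rats sK BK T_embs _ gen_K] by blast

lemma Q_poly: assumes "r \<in> RR" "p \<in> polys_over \<rat>" shows "Q (poly p r) = w (poly p gen)"
proof -
  obtain \<tau> where t: "\<tau> \<in> T" "r = \<tau> gen" using assms(1) by (auto simp: RR_def)
  have "poly p gen \<in> K" using poly_in_subf[OF subf_Rats sK assms(2) BK gen_K] .
  then show ?thesis using T_poly[OF t(1) assms(2)] T_w[OF t(1)] t(2) by metis
qed

text \<open>The decomposition group permutes \<open>RR\<close> and commutes with rational
  polynomials, so the transformed interpolation polynomial takes the same values on
  \<open>RR\<close>. By \<open>decomposition_fixed_approx\<close> the coefficients are then limits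
  of rational numbers.\<close>

lemma interp_coeff_fixed:
  assumes p: "p \<in> polys_over \<rat>" and s: "\<sigma> \<in> embs \<rat> L" and sQ: "\<And>x. x \<in> L \<Longrightarrow> Q (\<sigma> x) = Q x"
  shows "\<sigma> (coeff (interp p) j) = coeff (interp p) j"
proof -
  note e = emb_simps[OF subf_Rats sL QL s]
  have pr: "poly p r \<in> L" if "r \<in> RR" for r using that RR_L rat_poly_L[OF p] by blast
  have iL: "interp p \<in> polys_over L"
    unfolding interp_def using pr ell(1) by (intro polys_over_sum[OF sL] polys_over_smult[OF sL])
  have sR: "\<sigma> r \<in> RR" if r: "r \<in> RR" for r
  proof -
    obtain \<tau> where t: "\<tau> \<in> T" "r = \<tau> gen" using r by (auto simp: RR_def)
    have "restrict (\<sigma> \<circ> \<tau>) K \<in> embs \<rat> K"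
      using emb_comp[OF subf_Rats sL QL s T_embs[OF t(1)] sK emb_K[OF T_embs[OF t(1)]] BK] .
    moreover have "w x = Q (restrict (\<sigma> \<circ> \<tau>) K x)" if "x \<in> K" for x
      using that sQ[OF emb_K_in[OF T_embs[OF t(1)] that]] T_w[OF t(1) that] by simp
    ultimately have "restrict (\<sigma> \<circ> \<tau>) K \<in> T" by (simp add: T_def)
    then show ?thesis using t gen_K unfolding RR_def by (intro image_eqI[of _ _ "restrict (\<sigma> \<circ> \<tau>) K"]) auto
  qed
  have "inj_on \<sigma> RR" using emb_inj[OF subf_Rats sL QL s] RR_L by (rule inj_on_subset)
  then have surj: "\<sigma> ` RR = RR" using sR finite_RR by (intro endo_inj_surj) auto
  have "map_poly \<sigma> (interp p) = interp p"
  proof (rule poly_eq_on_points[OF finite_RR _ interp_degree])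
    show "degree (map_poly \<sigma> (interp p)) < card RR"
    proof (rule le_less_trans[OF degree_le interp_degree[of p]])
      show "\<forall>i>degree (interp p). coeff (map_poly \<sigma> (interp p)) i = 0"
        by (simp add: coeff_map_poly e(1) coeff_eq_0)
    qed
    fix r' assume "r' \<in> RR"
    then obtain r where r: "r \<in> RR" "r' = \<sigma> r" using surj by blast
    have rL: "r \<in> L" using r RR_L by blast
    have "poly (map_poly \<sigma> (interp p)) (\<sigma> r) = \<sigma> (poly (interp p) r)"
      using emb_poly[OF subf_Rats sL QL s iL rL] by simp
    also have "\<dots> = poly p (\<sigma> r)"
      unfolding interp_poly[OF r(1)] by (rule emb_poly_over[OF subf_Rats sL QL s p rL])
    also have "\<dots> = poly (interp p) (\<sigma> r)" using interp_poly[OF sR[OF r(1)]] by simp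
    finally show "poly (map_poly \<sigma> (interp p)) r' = poly (interp p) r'" using r by simp
  qed
  then have "coeff (map_poly \<sigma> (interp p)) j = coeff (interp p) j" by simp
  then show ?thesis by (simp add: coeff_map_poly e(1))
qed

lemma interp_coeff_L: "p \<in> polys_over \<rat> \<Longrightarrow> coeff (interp p) j \<in> L"
  unfolding interp_coeff using rat_poly_L RR_L ell_coeff by (intro subf_sum[OF sL] subfD(4)[OF sL]) auto

lemma interp_coeff_approx:
  assumes p: "p \<in> polys_over \<rat>" and e: "e > 0"
  shows "\<exists>q\<in>\<rat>. Q (coeff (interp p) j - q) < e"
proof -
  obtain b where "b \<in> \<rat>" "b \<noteq> 0" "Q b \<noteq> 1" using nontriv by blast
  then show ?thesis
    using decomposition_fixed_approx[OF Q _ _ _ interp_coeff_L[OF p] _ e] interp_coeff_fixed[OF p] by blast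
qed

sublocale VK: valued_field "field_on K" w
  by (rule valued_field_on[OF sK w])

sublocale VL: valued_field "field_on L" Q
  by (rule valued_field_on[OF sL Q])

lemma Rats_Cauchy: "(\<And>i. q i \<in> \<rat>) \<Longrightarrow> q \<in> carrier VK.CR \<longleftrightarrow> q \<in> carrier VL.CR"
proof -
  assume q: "\<And>i. q i \<in> \<rat>"
  have "w (q i - q j) = Q (q i - q j)" for i j using wQ q by simp
  then show ?thesis
    using q BK QL unfolding VK.CR_carrier VL.CR_carrier
    by (simp add: field_on_minus[OF sK] field_on_minus[OF sL] subset_iff)
qed

lemma kv_is: "kv_field K w = VK.CC" "kv_abs w = VK.cabs" "k_to_kv K w = VK.cmap"
  by (auto simp: kv_field_def kv_abs_def k_to_kv_def)

sublocale VC: valued_field VK.CC VK.cabs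
  by (rule VK.completion_valued)

lemma Rats_image_subfield: "subfield (VK.cmap ` \<rat>) VK.CC"
proof -
  interpret H: ring_hom_ring "field_on K" VK.CC VK.cmap
    by (intro ring_hom_ringI2 VK.ring_axioms VC.ring_axioms VK.cmap_hom)
  show ?thesis
    by (rule H.img_is_subfield(2)[OF subfield_field_on[OF sK subf_Rats BK] VC.one_not_zero])
qed

lemma Qv_eq: "Qv K w = closure_in VK.CC VK.cabs (VK.cmap ` \<rat>)"
  by (simp add: Qv_def kv_is)

lemma Qv_subfield: "subfield (Qv K w) VK.CC"
  unfolding Qv_eq by (rule VC.closure_subfield[OF Rats_image_subfield])

text \<open>Rational numbers within \<open>inverse (real (Suc i))\<close> of \<open>c\<close> form a
  sequence whose distance to any representative of \<open>c\<close> tends to 0, hence one in the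
  same class.\<close>

lemma Qv_rational_seq:
  assumes c: "c \<in> Qv K w"
  shows "\<exists>q. (\<forall>i. q i \<in> \<rat>) \<and> q \<in> carrier VK.CR \<and> c = VK.cls q"
proof -
  have cc: "c \<in> carrier VK.CC" and ap: "\<And>e. e > 0 \<Longrightarrow> \<exists>y\<in>\<rat>. VK.cabs (c \<ominus>\<^bsub>VK.CC\<^esub> VK.cmap y) < e"
    using c by (auto simp: Qv_eq closure_in_def)
  obtain s where s: "s \<in> carrier VK.CR" "c = VK.cls s" using VK.CC_cases[OF cc] .
  have "\<forall>i. \<exists>y\<in>\<rat>. VK.cabs (c \<ominus>\<^bsub>VK.CC\<^esub> VK.cmap y) < inverse (real (Suc i))" using ap by simp
  then obtain q where q: "\<And>i. q i \<in> \<rat>" "\<And>i. VK.cabs (c \<ominus>\<^bsub>VK.CC\<^esub> VK.cmap (q i)) < inverse (real (Suc i))" by metis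
  have qK: "q i \<in> carrier (field_on K)" for i using q(1) BK by auto
  have sc: "s i \<in> carrier (field_on K)" for i using VK.CRD[OF s(1)] .
  have "(\<lambda>i. w (s i \<ominus>\<^bsub>field_on K\<^esub> q i)) \<longlonglongrightarrow> 0"
  proof (rule real_null_comparison)
    show "(\<lambda>i. VK.cabs (c \<ominus>\<^bsub>VK.CC\<^esub> VK.cmap (s i)) + inverse (real (Suc i))) \<longlonglongrightarrow> 0"
      using tendsto_add[OF VK.cmap_dense[OF s(1)] LIMSEQ_inverse_real_of_nat] s(2) by simp
    show "\<forall>\<^sub>F i in sequentially. norm (w (s i \<ominus>\<^bsub>field_on K\<^esub> q i)) \<le> VK.cabs (c \<ominus>\<^bsub>VK.CC\<^esub> VK.cmap (s i)) + inverse (real (Suc i))"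
    proof (intro always_eventually allI)
      fix i
      interpret H: ring_hom_ring "field_on K" VK.CC VK.cmap
        by (intro ring_hom_ringI2 VK.ring_axioms VC.ring_axioms VK.cmap_hom)
      have mc: "VK.cmap (s i) \<in> carrier VK.CC" "VK.cmap (q i) \<in> carrier VK.CC" using VK.cmap_closed sc qK by auto
      have "s i \<ominus>\<^bsub>field_on K\<^esub> q i \<in> carrier (field_on K)" using VK.minus_closed[OF sc qK] .
      then have "norm (w (s i \<ominus>\<^bsub>field_on K\<^esub> q i)) = VK.cabs (VK.cmap (s i \<ominus>\<^bsub>field_on K\<^esub> q i))"
        using VK.cmap_abs VK.v_nonneg by simp
      also have "VK.cmap (s i \<ominus>\<^bsub>field_on K\<^esub> q i) = VK.cmap (s i) \<ominus>\<^bsub>VK.CC\<^esub> VK.cmap (q i)"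
        using sc[of i] qK[of i] by (simp only: a_minus_def H.hom_add H.hom_a_inv VK.add.inv_closed)
      also have "\<dots> = (c \<ominus>\<^bsub>VK.CC\<^esub> VK.cmap (q i)) \<ominus>\<^bsub>VK.CC\<^esub> (c \<ominus>\<^bsub>VK.CC\<^esub> VK.cmap (s i))"
        using cc mc by (simp add: a_minus_def VC.minus_add VC.a_ac VC.r_neg1 VC.r_neg2)
      also have "VK.cabs \<dots> \<le> VK.cabs (c \<ominus>\<^bsub>VK.CC\<^esub> VK.cmap (q i)) + VK.cabs (c \<ominus>\<^bsub>VK.CC\<^esub> VK.cmap (s i))"
        using cc mc by (intro VC.v_diff) auto
      finally show "norm (w (s i \<ominus>\<^bsub>field_on K\<^esub> q i)) \<le> VK.cabs (c \<ominus>\<^bsub>VK.CC\<^esub> VK.cmap (s i)) + inverse (real (Suc i))"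
        using q(2)[of i] by simp
    qed
  qed
  then have "q \<in> carrier VK.CR" "VK.cls q = VK.cls s" using VK.CR_perturb[OF s(1) qK] by auto
  then show ?thesis using q(1) s(2) by metis
qed

lemma rational_seq_Qv:
  assumes q: "\<And>i. q i \<in> \<rat>" "q \<in> carrier VK.CR"
  shows "VK.cls q \<in> Qv K w"
  unfolding Qv_eq closure_in_def
proof (intro CollectI conjI allI impI VK.cls_closed q(2))
  fix e :: real assume "e > 0"
  then obtain i where "VK.cabs (VK.cls q \<ominus>\<^bsub>VK.CC\<^esub> VK.cmap (q i)) < e"
    using order_tendstoD(2)[OF VK.cmap_dense[OF q(2)]] eventually_sequentially_ex by blast
  then show "\<exists>y\<in>VK.cmap ` \<rat>. VK.cabs (VK.cls q \<ominus>\<^bsub>VK.CC\<^esub> y) < e" using q(1) by blast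
qed

lemma combine_cls:
  assumes "length qs = length us" "\<And>q. q \<in> set qs \<Longrightarrow> q \<in> carrier VK.CR" "set us \<subseteq> K"
  shows "(\<lambda>n. \<Sum>j<length us. (qs ! j) n * us ! j) \<in> carrier VK.CR \<and>
    VC.combine (map VK.cls qs) (map VK.cmap us) = VK.cls (\<lambda>n. \<Sum>j<length us. (qs ! j) n * us ! j)"
  using assms
proof (induction qs us rule: list_induct2)
  case Nil
  show ?case using VK.cls_zero VK.CR_const[of 0] sK by (simp add: subfD)
next
  case (Cons q qs u us)
  have q: "q \<in> carrier VK.CR" and u: "(\<lambda>i. u) \<in> carrier VK.CR" using Cons.prems VK.CR_const[of u] by auto
  have IH: "(\<lambda>n. \<Sum>j<length us. (qs ! j) n * us ! j) \<in> carrier VK.CR"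
    "VC.combine (map VK.cls qs) (map VK.cmap us) = VK.cls (\<lambda>n. \<Sum>j<length us. (qs ! j) n * us ! j)"
    using Cons by auto
  have m: "(\<lambda>n. q n * u) \<in> carrier VK.CR" using VK.CR_mult[OF q u] by simp
  have eq: "(\<lambda>n. \<Sum>j<length (u # us). ((q # qs) ! j) n * (u # us) ! j) =
    (\<lambda>n. q n * u + (\<Sum>j<length us. (qs ! j) n * us ! j))"
    by (simp add: sum.lessThan_Suc_shift del: sum.lessThan_Suc)
  have "VC.combine (map VK.cls (q # qs)) (map VK.cmap (u # us)) =
    VK.cls q \<otimes>\<^bsub>VK.CC\<^esub> VK.cls (\<lambda>i. u) \<oplus>\<^bsub>VK.CC\<^esub> VK.cls (\<lambda>n. \<Sum>j<length us. (qs ! j) n * us ! j)"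
    using IH(2) by (simp add: VK.cmap_cls)
  also have "\<dots> = VK.cls (\<lambda>n. q n * u + (\<Sum>j<length us. (qs ! j) n * us ! j))"
    using VK.cls_mult[OF q u] VK.cls_add[OF m IH(1)] by simp
  finally show ?case
    unfolding eq using VK.CR_add[OF m IH(1)] by simp
qed

definition Us where "Us = map (\<lambda>j. VK.cmap (gen ^ j)) [0..<card T]"

lemma Us_carrier: "set Us \<subseteq> carrier VK.CC"
  using gen_K sK VK.cmap_closed by (auto simp: Us_def subfD)

text \<open>A vanishing combination is a sequence of rational polynomials of degree below
  \<open>card RR\<close> whose values at \<open>gen\<close> tend to 0. By \<open>Q_poly\<close>
  their values on \<open>RR\<close> have the same size, and Lagrange's formula bounds every
  coefficient by a constant times it.\<close>

lemma Us_independent: "VC.independent (Qv K w) Us"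
proof (rule VC.trivial_combine_imp_independent[OF Qv_subfield Us_carrier])
  fix Ks assume Ks: "set Ks \<subseteq> Qv K w" "VC.combine Ks Us = \<zero>\<^bsub>VK.CC\<^esub>"
  \<comment> \<open>\<open>combine\<close> stops at the end of the shorter list, so only the first
    \<open>d\<close> scalars count.\<close>
  define d where "d = min (length Ks) (card T)"
  define Ks' where "Ks' = take d Ks"
  define us where "us = map (\<lambda>j. gen ^ j) [0..<d]"
  have Us': "take d Us = map VK.cmap us" by (simp add: Us_def us_def d_def take_map)
  have "VC.combine Ks' (take d Us) = VC.combine Ks Us"
    using VC.combine_min[of Ks Us] by (simp add: Ks'_def d_def Us_def)
  then have comb: "VC.combine Ks' (map VK.cmap us) = \<zero>\<^bsub>VK.CC\<^esub>" using Ks(2) Us' by simp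
  define qs where "qs = map (\<lambda>c. SOME q. (\<forall>i. q i \<in> \<rat>) \<and> q \<in> carrier VK.CR \<and> c = VK.cls q) Ks'"
  have q: "(\<forall>i. (qs ! j) i \<in> \<rat>) \<and> qs ! j \<in> carrier VK.CR \<and> Ks' ! j = VK.cls (qs ! j)" if "j < d" for j
  proof -
    have j: "j < length Ks'" "Ks' ! j \<in> set Ks" using that by (auto simp: Ks'_def d_def)
    then have "Ks' ! j \<in> Qv K w" using Ks(1) by blast
    from someI_ex[OF Qv_rational_seq[OF this]] show ?thesis using j(1) by (simp add: qs_def)
  qed
  have len: "length qs = d" "length us = d" "length Ks' = d" by (auto simp: qs_def us_def Ks'_def d_def)
  have map_qs: "map VK.cls qs = Ks'" using q len by (intro nth_equalityI) auto
  have uK: "set us \<subseteq> K" using gen_K sK by (auto simp: us_def subfD)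
  have qsC: "\<And>q'. q' \<in> set qs \<Longrightarrow> q' \<in> carrier VK.CR" using q len by (metis in_set_conv_nth)
  define S where "S n = (\<Sum>j<d. (qs ! j) n * gen ^ j)" for n
  have S: "S \<in> carrier VK.CR" "VK.cls S = \<zero>\<^bsub>VK.CC\<^esub>"
  proof -
    have "(\<lambda>n. \<Sum>j<length us. (qs ! j) n * us ! j) = S"
      unfolding len S_def by (intro ext sum.cong) (auto simp: us_def)
    then show "S \<in> carrier VK.CR" "VK.cls S = \<zero>\<^bsub>VK.CC\<^esub>"
      using combine_cls[OF _ qsC uK] len comb map_qs by auto
  qed
  then have lim: "(\<lambda>n. w (S n)) \<longlonglongrightarrow> 0" using VK.cls_eq_0_iff by blast
  define P where "P n = (\<Sum>j<d. monom ((qs ! j) n) j)" for n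
  have cP: "coeff (P n) j = (if j < d then (qs ! j) n else 0)" for n j
    by (simp add: P_def coeff_sum)
  have P: "P n \<in> polys_over \<rat>" for n using q by (auto simp: polys_over_def cP)
  have Pgen: "poly (P n) gen = S n" for n by (simp add: P_def S_def poly_sum poly_monom)
  have degP: "degree (P n) < card RR" for n
  proof -
    have "card RR > 0" using T_nonempty finite_T card_RR by (simp add: card_gt_0_iff)
    moreover have "degree (P n) \<le> card RR - 1"
      by (rule degree_le) (auto simp: cP d_def card_RR)
    ultimately show ?thesis by simp
  qed
  have "VK.cls (qs ! j) = \<zero>\<^bsub>VK.CC\<^esub>" if j: "j < d" for j
  proof (subst VK.cls_eq_0_iff)
    show "qs ! j \<in> carrier VK.CR" using q[OF j] by blast
    show "(\<lambda>n. w ((qs ! j) n)) \<longlonglongrightarrow> 0"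
    proof (rule real_null_comparison)
      have "(\<lambda>n. w (S n) * (\<Sum>r\<in>RR. Q (coeff (ell r) j))) \<longlonglongrightarrow> 0 * (\<Sum>r\<in>RR. Q (coeff (ell r) j))"
        by (intro tendsto_intros lim)
      then show "(\<lambda>n. w (S n) * (\<Sum>r\<in>RR. Q (coeff (ell r) j))) \<longlonglongrightarrow> 0" by simp
      show "\<forall>\<^sub>F n in sequentially. norm (w ((qs ! j) n)) \<le> w (S n) * (\<Sum>r\<in>RR. Q (coeff (ell r) j))"
      proof (intro always_eventually allI)
        fix n
        have qn: "(qs ! j) n \<in> \<rat>" using q[OF j] by blast
        have prL: "poly (P n) r \<in> L" if "r \<in> RR" for r using that RR_L rat_poly_L[OF P] by blast
        have "(qs ! j) n = coeff (interp (P n)) j"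
          using interp_unique[OF degP, of n] cP[of n j] j by simp
        then have "w ((qs ! j) n) = Q (\<Sum>r\<in>RR. poly (P n) r * coeff (ell r) j)"
          using wQ[OF qn] by (simp add: interp_coeff)
        also have "\<dots> \<le> (\<Sum>r\<in>RR. Q (poly (P n) r * coeff (ell r) j))"
          using prL ell_coeff sL by (intro absv_sum[OF sL Q]) (auto simp: subfD)
        also have "\<dots> = (\<Sum>r\<in>RR. w (S n) * Q (coeff (ell r) j))"
          using absv_mult[OF sL Q prL ell_coeff] Q_poly[OF _ P] Pgen by (intro sum.cong) auto
        finally show "norm (w ((qs ! j) n)) \<le> w (S n) * (\<Sum>r\<in>RR. Q (coeff (ell r) j))"
          using absv_nonneg[OF sK w, of "(qs ! j) n"] qn BK by (simp add: sum_distrib_left subset_iff)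
      qed
    qed
  qed
  then have "Ks' ! j = \<zero>\<^bsub>VK.CC\<^esub>" if "j < d" for j using q that by simp
  then have "set Ks' \<subseteq> {\<zero>\<^bsub>VK.CC\<^esub>}" using len by (metis in_set_conv_nth singletonI subsetI)
  moreover have "take (length Us) Ks = Ks'" by (simp add: Ks'_def d_def Us_def min_def)
  ultimately show "set (take (length Us) Ks) \<subseteq> {\<zero>\<^bsub>VK.CC\<^esub>}" by simp
qed

text \<open>Write the entries of a Cauchy sequence as \<open>poly (p n) gen\<close> and reduce
  \<open>p n\<close> by \<open>interp\<close> to degree below \<open>card T\<close>. The
  coefficients are Cauchy sequences for \<open>Q\<close>, and rational numbers replace them with an
  error tending to 0; these sequences are the coordinates.\<close>

lemma Us_spans: "VC.Span (Qv K w) Us = carrier VK.CC"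
proof
  show "VC.Span (Qv K w) Us \<subseteq> carrier VK.CC"
    using VC.Span_in_carrier[OF subfieldE(3)[OF Qv_subfield] Us_carrier] .
  show "carrier VK.CC \<subseteq> VC.Span (Qv K w) Us"
  proof
    fix x assume "x \<in> carrier VK.CC"
    then obtain s where s: "s \<in> carrier VK.CR" "x = VK.cls s" using VK.CC_cases by blast
    have sK': "s n \<in> K" for n using VK.CRD[OF s(1)] by simp
    have "s n \<in> adj \<rat> gen" for n using sK'[of n] gen(2)[symmetric] by (simp only:)
    then have "\<forall>n. \<exists>p\<in>polys_over \<rat>. s n = poly p gen" by (auto simp: adj_def)
    then obtain p where p: "\<And>n. p n \<in> polys_over \<rat>" "\<And>n. s n = poly (p n) gen" by metis
    define c where "c j n = coeff (interp (p n)) j" for j n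
    have cL: "c j n \<in> L" for j n unfolding c_def by (rule interp_coeff_L[OF p(1)])
    have prL: "poly (p n) r \<in> L" if "r \<in> RR" for r n using that RR_L rat_poly_L[OF p(1)] by blast
    have cC: "c j \<in> carrier VL.CR" for j
    proof -
      have "(\<lambda>n. poly (p n) r) \<in> carrier VL.CR" if r: "r \<in> RR" for r
        unfolding VL.CR_carrier
      proof (intro conjI allI impI)
        show "poly (p n) r \<in> carrier (field_on L)" for n using prL[OF r] by simp
        fix e :: real assume "e > 0"
        then obtain N where N: "\<And>i j. i \<ge> N \<Longrightarrow> j \<ge> N \<Longrightarrow> w (s i \<ominus>\<^bsub>field_on K\<^esub> s j) < e"
          using VK.CR_Cauchy[OF s(1)] by meson
        have "Q (poly (p i) r \<ominus>\<^bsub>field_on L\<^esub> poly (p j) r) = w (s i \<ominus>\<^bsub>field_on K\<^esub> s j)" for i j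
          using Q_poly[OF r polys_over_diff[OF subf_Rats p(1) p(1)], of i j]
          unfolding field_on_minus[OF sL prL[OF r] prL[OF r]] field_on_minus[OF sK sK' sK']
          by (simp add: p(2))
        then show "\<exists>N. \<forall>i\<ge>N. \<forall>j\<ge>N. Q (poly (p i) r \<ominus>\<^bsub>field_on L\<^esub> poly (p j) r) < e"
          using N by (intro exI[of _ N]) auto
      qed
      then have "(\<lambda>n. poly (p n) r * coeff (ell r) j) \<in> carrier VL.CR" if "r \<in> RR" for r
        using VL.CR_mult[OF _ VL.CR_const[of "coeff (ell r) j"]] ell_coeff[OF that] that by simp
      then have "(\<lambda>n. finsum (field_on L) (\<lambda>r. poly (p n) r * coeff (ell r) j) RR) \<in> carrier VL.CR"
        by (intro VL.CR_sum finite_RR)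
      moreover have "finsum (field_on L) (\<lambda>r. poly (p n) r * coeff (ell r) j) RR = c j n" for n
        unfolding c_def interp_coeff using prL ell_coeff
        by (intro field_on_finsum[OF sL finite_RR]) (auto simp: subfD[OF sL])
      ultimately show ?thesis by simp
    qed
    have "\<forall>j n. \<exists>q\<in>\<rat>. Q (c j n - q) < inverse (real (Suc n))"
      using interp_coeff_approx[OF p(1)] by (simp add: c_def)
    then obtain q where q: "\<And>j n. q j n \<in> \<rat>" "\<And>j n. Q (c j n - q j n) < inverse (real (Suc n))" by metis
    have qL: "q j n \<in> L" for j n using q(1) QL by blast
    have lim: "(\<lambda>n. Q (c j n - q j n)) \<longlonglongrightarrow> 0" for j
    proof (rule real_null_comparison[OF LIMSEQ_inverse_real_of_nat])
      show "\<forall>\<^sub>F n in sequentially. norm (Q (c j n - q j n)) \<le> inverse (real (Suc n))"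
        using q(2) absv_nonneg[OF sL Q subfD(5)[OF sL cL qL]] by (simp add: less_imp_le)
    qed
    have "q j \<in> carrier VL.CR" for j
      using VL.CR_perturb(1)[OF cC, of "q j" j] qL lim by (simp add: field_on_minus[OF sL cL qL])
    then have qC: "q j \<in> carrier VK.CR" for j using Rats_Cauchy[of "q j"] q(1) by blast
    define qs where "qs = map q [0..<card T]"
    define us where "us = map (\<lambda>j. gen ^ j) [0..<card T]"
    define S where "S n = (\<Sum>j<card T. q j n * gen ^ j)" for n
    have SK: "S n \<in> K" for n
      unfolding S_def using q(1) BK gen_K by (intro subf_sum[OF sK] subfD(4)[OF sK] subfD(9)[OF sK]) auto
    have Seq: "(\<lambda>n. \<Sum>j<length us. (qs ! j) n * us ! j) = S"
      unfolding S_def by (intro ext sum.cong) (auto simp: us_def qs_def)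
    have uK: "set us \<subseteq> K" using gen_K sK by (auto simp: us_def subfD)
    have comb: "VC.combine (map VK.cls qs) Us = VK.cls S"
    proof -
      have "Us = map VK.cmap us" by (simp add: Us_def us_def)
      moreover have "length qs = length us" by (simp add: qs_def us_def)
      moreover have "\<And>q. q \<in> set qs \<Longrightarrow> q \<in> carrier VK.CR" using qC by (auto simp: qs_def)
      ultimately show ?thesis using combine_cls[of qs us] uK Seq by simp
    qed
    \<comment> \<open>A single member of \<open>RR\<close> measures the error, because
      \<open>Q\<close> at it agrees with \<open>w\<close> at \<open>gen\<close>.\<close>
    obtain \<tau> where t: "\<tau> \<in> T" using T_nonempty by blast
    define r where "r = \<tau> gen"
    have r: "r \<in> RR" "r \<in> L" using t RR_L by (auto simp: r_def RR_def)
    have "(\<lambda>n. w (s n \<ominus>\<^bsub>field_on K\<^esub> S n)) \<longlonglongrightarrow> 0"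
    proof (rule real_null_comparison)
      have "(\<lambda>n. \<Sum>j<card T. Q (c j n - q j n) * Q r ^ j) \<longlonglongrightarrow> (\<Sum>j<card T. 0 * Q r ^ j)"
        by (intro tendsto_intros lim)
      then show "(\<lambda>n. \<Sum>j<card T. Q (c j n - q j n) * Q r ^ j) \<longlonglongrightarrow> 0" by simp
      show "\<forall>\<^sub>F n in sequentially. norm (w (s n \<ominus>\<^bsub>field_on K\<^esub> S n)) \<le> (\<Sum>j<card T. Q (c j n - q j n) * Q r ^ j)"
      proof (intro always_eventually allI)
        fix n
        define P where "P = p n - (\<Sum>j<card T. monom (q j n) j)"
        have P: "P \<in> polys_over \<rat>"
          unfolding P_def using q(1) by (intro polys_over_diff polys_over_sum polys_over_monom subf_Rats p(1))
        have Pg: "poly P gen = s n - S n" by (simp add: P_def S_def p(2) poly_sum poly_monom)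
        have "poly (p n) r = (\<Sum>j<card T. c j n * r ^ j)"
          using poly_as_sum_lt[OF interp_degree, of "p n" r] interp_poly[OF r(1)] by (simp add: c_def card_RR)
        then have Pr: "poly P r = (\<Sum>j<card T. (c j n - q j n) * r ^ j)"
          by (simp add: P_def poly_sum poly_monom left_diff_distrib sum_subtractf)
        have "w (s n \<ominus>\<^bsub>field_on K\<^esub> S n) = Q (poly P r)"
          using Q_poly[OF r(1) P] Pg by (simp add: field_on_minus[OF sK sK' SK])
        also have "\<dots> \<le> (\<Sum>j<card T. Q ((c j n - q j n) * r ^ j))"
          unfolding Pr using cL qL r(2) sL by (intro absv_sum[OF sL Q]) (auto simp: subfD)
        also have "\<dots> = (\<Sum>j<card T. Q (c j n - q j n) * Q r ^ j)"
          using cL qL r(2) sL by (intro sum.cong) (auto simp: absv_mult[OF sL Q] absv_power[OF sL Q] subfD)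
        finally show "norm (w (s n \<ominus>\<^bsub>field_on K\<^esub> S n)) \<le> (\<Sum>j<card T. Q (c j n - q j n) * Q r ^ j)"
          using absv_nonneg[OF sK w subfD(5)[OF sK sK' SK]] by (simp add: field_on_minus[OF sK sK' SK])
      qed
    qed
    then have "VK.cls S = VK.cls s" using VK.CR_perturb(2)[OF s(1)] SK by simp
    then have "x = VC.combine (map VK.cls qs) Us" using comb s(2) by simp
    moreover have "set (map VK.cls qs) \<subseteq> Qv K w" using rational_seq_Qv[OF q(1) qC] by (auto simp: qs_def)
    ultimately show "x \<in> VC.Span (Qv K w) Us"
      unfolding VC.Span_eq_combine_set[OF Qv_subfield Us_carrier] by blast
  qed
qed

theorem local_degree_eq: "local_degree K w = card T"
proof -
  have "VC.dimension (length Us) (Qv K w) (carrier VK.CC)"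
    using VC.dimension_independent[OF Us_independent] unfolding Us_spans .
  then have "VC.dim (Qv K w) (carrier VK.CC) = length Us"
    using VC.dimI[OF Qv_subfield] by (simp add: over_def)
  then show ?thesis by (simp add: local_degree_def kv_is Us_def)
qed

lemma local_degree_positive: "local_degree K w > 0"
  using local_degree_eq T_nonempty finite_T by (simp add: card_gt_0_iff)

end

text \<open>Sort the embeddings by the absolute value they induce on \<open>K\<close>. The induced
  ones are exactly the members of \<open>P\<close>, and the fibre over \<open>w\<close> is
  \<open>T\<close>, of size \<open>local_degree K w\<close>; so the value of the norm splits into a
  product over \<open>P\<close>.\<close>

lemma local_product:
  assumes tower: "number_tower \<rat> K L" and Q: "absv L Q" and nt: "\<exists>b\<in>\<rat>. b \<noteq> 0 \<and> Q b \<noteq> 1" and x: "x \<in> K"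
  defines "P \<equiv> {w \<in> extensional K. absv K w \<and> (\<forall>q\<in>\<rat>. w q = Q q)}"
  shows "finite P" and "(\<Prod>w\<in>P. w x ^ local_degree K w) = Q (\<Prod>\<tau>\<in>embs \<rat> K. \<tau> x)"
    and "\<And>w. w \<in> P \<Longrightarrow> local_degree K w > 0"
proof -
  interpret number_tower \<rat> K L by (rule tower)
  define g where "g \<tau> = restrict (\<lambda>x. Q (\<tau> x)) K" for \<tau>
  have fin: "finite (embs \<rat> K)" by (rule finite_embs'[OF nK BK])
  have over: "place_over K L Q w" if "w \<in> P" for w
    using that Q nt by unfold_locales (auto simp: P_def)
  have fib: "{\<tau> \<in> embs \<rat> K. g \<tau> = w} = place_over.T K Q w" if w: "w \<in> P" for w
  proof -
    have "g \<tau> = w \<longleftrightarrow> (\<forall>x\<in>K. w x = Q (\<tau> x))" for \<tau>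
      using w by (auto simp: g_def P_def intro!: extensionalityI[of _ K] dest: fun_cong)
    then show ?thesis by (simp add: place_over.T_def[OF over[OF w]])
  qed
  have P: "P = g ` embs \<rat> K"
  proof
    show "P \<subseteq> g ` embs \<rat> K"
    proof
      fix w assume "w \<in> P"
      then have "{\<tau> \<in> embs \<rat> K. g \<tau> = w} \<noteq> {}" using fib place_over.T_nonempty[OF over] by simp
      then show "w \<in> g ` embs \<rat> K" by blast
    qed
    show "g ` embs \<rat> K \<subseteq> P"
    proof safe
      fix \<tau> assume t: "\<tau> \<in> embs \<rat> K"
      have "absv K (g \<tau>)" using absv_conj[OF Q t] sK by (simp add: absv_iff g_def subfD)
      then show "g \<tau> \<in> P" using embsD(4)[OF t] BK by (auto simp: P_def g_def)
    qed
  qed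
  show "finite P" using fin P by simp
  have "Q (\<Prod>\<tau>\<in>embs \<rat> K. \<tau> x) = (\<Prod>\<tau>\<in>embs \<rat> K. Q (\<tau> x))"
    using emb_K_in x by (intro absv_prod[OF sL Q]) auto
  also have "\<dots> = (\<Prod>w\<in>P. \<Prod>\<tau>\<in>{\<tau> \<in> embs \<rat> K. g \<tau> = w}. Q (\<tau> x))"
    unfolding P by (rule prod.image_gen[OF fin])
  also have "\<dots> = (\<Prod>w\<in>P. w x ^ local_degree K w)"
  proof (rule prod.cong[OF refl])
    fix w assume w: "w \<in> P"
    have "(\<Prod>\<tau>\<in>{\<tau> \<in> embs \<rat> K. g \<tau> = w}. Q (\<tau> x)) = (\<Prod>\<tau>\<in>{\<tau> \<in> embs \<rat> K. g \<tau> = w}. w x)"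
      using x by (intro prod.cong) (auto simp: g_def)
    then show "(\<Prod>\<tau>\<in>{\<tau> \<in> embs \<rat> K. g \<tau> = w}. Q (\<tau> x)) = w x ^ local_degree K w"
      using place_over.local_degree_eq[OF over[OF w]] fib[OF w] by simp
  qed
  finally show "(\<Prod>w\<in>P. w x ^ local_degree K w) = Q (\<Prod>\<tau>\<in>embs \<rat> K. \<tau> x)" by simp
  show "local_degree K w > 0" if "w \<in> P" for w
    using place_over.local_degree_positive[OF over[OF that]] .
qed

section \<open>Assembling the product formula\<close>

lemma norm_of_rat: "cmod (of_rat q) = \<bar>real_of_rat q\<bar>"
proof -
  obtain a b :: int where "q = of_int a / of_int b" using rat_fraction[of q] by metis
  then show ?thesis by (simp add: of_rat_divide norm_divide)
qed

lemma absv_cmod: "absv L cmod"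
  by (auto simp: absv_iff norm_mult norm_triangle_ineq)

definition arch_places where "arch_places K = {w \<in> places K. archimedean w}"

definition padic_places where "padic_places K p = {w \<in> places K. \<forall>q. w (of_rat q) = padic_abs p q}"

lemma places_decomp: "places K = arch_places K \<union> (\<Union>p\<in>{p. prime p}. padic_places K p)"
  by (auto simp: places_def arch_places_def padic_places_def)

lemma arch_padic_disjoint: "prime p \<Longrightarrow> arch_places K \<inter> padic_places K p = {}"
  using padic_not_archimedean by (auto simp: arch_places_def padic_places_def)

lemma padic_padic_disjoint: "prime p \<Longrightarrow> prime p' \<Longrightarrow> p \<noteq> p' \<Longrightarrow> padic_places K p \<inter> padic_places K p' = {}"
  using padic_place_prime_unique unfolding padic_places_def by blast

lemma tower_exists:
  assumes "number_field K" shows "\<exists>L. number_tower \<rat> K L"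
proof -
  obtain L where L: "number_field L" "K \<subseteq> L" "normal_over K L" using normal_closure[OF assms] by blast
  then show ?thesis
    using number_field_Rats Rats_subset[OF number_field_subf[OF assms]] assms
    by (intro exI[of _ L]) (unfold_locales, auto)
qed

lemma arch_product:
  assumes K: "number_tower \<rat> K L" and x: "x \<in> K"
  shows "finite (arch_places K)" "(\<Prod>w\<in>arch_places K. w x ^ local_degree K w) = cmod (\<Prod>\<tau>\<in>embs \<rat> K. \<tau> x)"
    "\<And>w. w \<in> arch_places K \<Longrightarrow> local_degree K w > 0"
proof -
  have "w (of_rat q) = \<bar>of_rat q\<bar> \<longleftrightarrow> w (of_rat q) = cmod (of_rat q)" for w :: "complex \<Rightarrow> real" and q
    by (simp add: norm_of_rat)
  then have eq: "arch_places K = {w \<in> extensional K. absv K w \<and> (\<forall>q\<in>\<rat>. w q = cmod q)}"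
    by (auto simp: arch_places_def places_def archimedean_def elim!: Rats_cases)
  have nt: "\<exists>b\<in>\<rat>. b \<noteq> 0 \<and> cmod b \<noteq> 1" by (intro bexI[of _ 2]) auto
  show "finite (arch_places K)" "(\<Prod>w\<in>arch_places K. w x ^ local_degree K w) = cmod (\<Prod>\<tau>\<in>embs \<rat> K. \<tau> x)"
    "\<And>w. w \<in> arch_places K \<Longrightarrow> local_degree K w > 0"
    unfolding eq using local_product[OF K absv_cmod nt x] by auto
qed

lemma padic_product:
  assumes K: "number_tower \<rat> K L" and x: "x \<in> K" and p: "prime p" and N: "(\<Prod>\<tau>\<in>embs \<rat> K. \<tau> x) = of_rat n"
  shows "finite (padic_places K p)" "(\<Prod>w\<in>padic_places K p. w x ^ local_degree K w) = padic_abs p n"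
    "\<And>w. w \<in> padic_places K p \<Longrightarrow> local_degree K w > 0"
proof -
  interpret number_tower \<rat> K L by (rule K)
  obtain Q where Q: "absv L Q" "\<And>q. Q (of_rat q) = padic_abs p q" using padic_extension[OF p nL] by blast
  have eq: "padic_places K p = {w \<in> extensional K. absv K w \<and> (\<forall>q\<in>\<rat>. w q = Q q)}"
    using p Q(2) by (auto simp: padic_places_def places_def elim!: Rats_cases)
  have "Q (of_nat p) = inverse (real p)" using Q(2)[of "of_nat p"] padic_abs_p[OF p] by simp
  then have nt: "\<exists>b\<in>\<rat>. b \<noteq> 0 \<and> Q b \<noteq> 1"
    using prime_gt_1_nat[OF p] by (intro bexI[of _ "of_nat p"]) auto
  show "finite (padic_places K p)" "(\<Prod>w\<in>padic_places K p. w x ^ local_degree K w) = padic_abs p n"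
    "\<And>w. w \<in> padic_places K p \<Longrightarrow> local_degree K w > 0"
    unfolding eq using local_product[OF K Q(1) nt x] N Q(2) by auto
qed

text \<open>If \<open>w x > 1\<close>, the leading term of the monic equation would strictly
  dominate the others.\<close>

lemma absv_le_1_integral:
  assumes K: "subf K" and w: "w \<in> places K" "\<not> archimedean w" and x: "x \<in> K"
    and f: "f \<in> polys_over K" "lead_coeff f = 1" "poly f x = 0" "\<And>j. w (coeff f j) \<le> 1"
  shows "w x \<le> 1"
proof (rule ccontr)
  assume "\<not> w x \<le> 1"
  then have gt: "w x > 1" by simp
  note a = place_absv[OF w(1)]
  have fc: "coeff f j \<in> K" for j using f(1) by (auto simp: polys_over_def)
  have small: "w (\<Sum>j<m. coeff f j * x ^ j) \<le> w x ^ (m - 1)" if "m > 0" for m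
    using that
  proof (induction m)
    case (Suc m)
    have sK: "(\<Sum>j<m. coeff f j * x ^ j) \<in> K" using fc x K by (intro subf_sum) (auto simp: subfD)
    have tK: "coeff f m * x ^ m \<in> K" using fc x K by (simp add: subfD)
    have "w (coeff f m * x ^ m) = w (coeff f m) * w x ^ m"
      using absv_mult[OF K a fc subfD(9)[OF K x]] absv_power[OF K a x] by simp
    also have "\<dots> \<le> 1 * w x ^ m" using f(4) gt by (intro mult_right_mono) auto
    finally have t: "w (coeff f m * x ^ m) \<le> w x ^ m" by simp
    have s: "w (\<Sum>j<m. coeff f j * x ^ j) \<le> w x ^ m"
    proof (cases "m = 0")
      case False
      then have "w (\<Sum>j<m. coeff f j * x ^ j) \<le> w x ^ (m - 1)" using Suc.IH by simp
      also have "\<dots> \<le> w x ^ m" using gt by (intro power_increasing) auto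
      finally show ?thesis .
    qed (use absv_0[OF K a] in simp)
    show ?case using nonarch_place_add[OF K w sK tK] s t by simp
  qed simp
  define n where "n = degree f"
  have "0 = (\<Sum>j<n. coeff f j * x ^ j) + x ^ n"
    using f(2,3) by (simp add: poly_altdef n_def lessThan_Suc_atMost[symmetric])
  then have xn: "x ^ n = - (\<Sum>j<n. coeff f j * x ^ j)" by (simp add: eq_neg_iff_add_eq_0 add.commute)
  have sK: "(\<Sum>j<n. coeff f j * x ^ j) \<in> K" using fc x K by (intro subf_sum) (auto simp: subfD)
  have "w x ^ n = w (\<Sum>j<n. coeff f j * x ^ j)"
    using absv_power[OF K a x, of n] absv_minus[OF K a sK] unfolding xn by simp
  moreover have "n > 0"
  proof (rule ccontr)
    assume "\<not> n > 0"
    then show False using xn by simp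
  qed
  ultimately have "w x ^ n \<le> w x ^ (n - 1)" using small by metis
  moreover have "w x ^ (n - 1) < w x ^ n" using gt \<open>n > 0\<close> by (intro power_strict_increasing) auto
  ultimately show False by simp
qed

lemma almost_all_le_1:
  assumes K: "number_field K" and x: "x \<in> K"
  shows "\<exists>S. finite S \<and> (\<forall>p. prime p \<longrightarrow> p \<notin> S \<longrightarrow> (\<forall>w\<in>padic_places K p. w x \<le> 1))"
proof -
  have sK: "subf K" by (rule number_field_subf[OF K])
  have "alg_over \<rat> x" using number_field_algebraic[OF K x] by (simp add: alg_over_Rats)
  then obtain m where m: "is_minpoly \<rat> x m" using ex_minpoly[OF subf_Rats] by blast
  have "\<forall>j. \<exists>q. coeff m j = of_rat q" using is_minpolyD(1)[OF m] by (auto simp: polys_over_def elim: Rats_cases)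
  then obtain c where c: "\<And>j. coeff m j = of_rat (c j)" by metis
  \<comment> \<open>Zero coefficients are left out: their value 0 differs from 1 at every prime and
    would make the set infinite.\<close>
  define S where "S = (\<Union>j\<le>degree m. if c j = 0 then {} else {p. prime p \<and> padic_abs p (c j) \<noteq> 1})"
  have "finite S" unfolding S_def using padic_abs_eq_1_almost_all by (intro finite_UN_I) auto
  moreover have "w x \<le> 1" if p: "prime p" "p \<notin> S" and w: "w \<in> padic_places K p" for p w
  proof (rule absv_le_1_integral[OF sK _ _ x])
    show w': "w \<in> places K" using w by (simp add: padic_places_def)
    show "\<not> archimedean w" using w padic_not_archimedean[OF p(1)] by (auto simp: padic_places_def)
    show "m \<in> polys_over K" using is_minpolyD(1)[OF m] polys_over_mono[OF Rats_subset[OF sK]] by auto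
    show "lead_coeff m = 1" "poly m x = 0" using is_minpolyD[OF m] by auto
    show "w (coeff m j) \<le> 1" for j
    proof (cases "c j = 0 \<or> j > degree m")
      case True
      then have "coeff m j = 0" using c[of j] by (auto simp: coeff_eq_0)
      then show ?thesis using absv_0[OF sK place_absv[OF w']] by simp
    next
      case False
      then have "padic_abs p (c j) = 1" using p by (auto simp: S_def split: if_splits)
      then show ?thesis using w c[of j] by (simp add: padic_places_def)
    qed
  qed
  ultimately show ?thesis by blast
qed

text \<open>The norm of \<open>x\<close> is rational, and grouping the places above each place of
  \<open>\<rat>\<close> turns its product formula into that of \<open>K\<close>. Almost all values
  are 1 because \<open>x\<close> and \<open>inverse x\<close> are both integral above almost all
  primes. The free set \<open>S\<close> lets later estimates compare products over a common index
  set.\<close>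

theorem product_formula:
  assumes K: "number_field K" and x: "x \<in> K" "x \<noteq> 0"
  shows "finite {w \<in> places K. w x \<noteq> 1}"
    and "finite S \<Longrightarrow> S \<subseteq> places K \<Longrightarrow> {w \<in> places K. w x \<noteq> 1} \<subseteq> S \<Longrightarrow> (\<Prod>w\<in>S. w x ^ local_degree K w) = 1"
proof -
  obtain L where L: "number_tower \<rat> K L" using tower_exists[OF K] by blast
  interpret number_tower \<rat> K L by (rule L)
  have xi: "inverse x \<in> K" using sK x by (simp add: subfD)
  obtain S1 where S1: "finite S1" "\<And>p w. prime p \<Longrightarrow> p \<notin> S1 \<Longrightarrow> w \<in> padic_places K p \<Longrightarrow> w x \<le> 1"
    using almost_all_le_1[OF K x(1)] by blast
  obtain S2 where S2: "finite S2" "\<And>p w. prime p \<Longrightarrow> p \<notin> S2 \<Longrightarrow> w \<in> padic_places K p \<Longrightarrow> w (inverse x) \<le> 1"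
    using almost_all_le_1[OF K xi] by blast
  have "(\<Prod>\<tau>\<in>embs \<rat> K. \<tau> x) \<in> \<rat>" by (rule norm_in_B[OF x(1)])
  then obtain n where n: "(\<Prod>\<tau>\<in>embs \<rat> K. \<tau> x) = of_rat n" by (auto elim: Rats_cases)
  have "(\<Prod>\<tau>\<in>embs \<rat> K. \<tau> x) \<noteq> 0"
    using x emb_simps(5)[OF sB sK BK] finite_embs'[OF nK BK] by auto
  then have n0: "n \<noteq> 0" using n by auto
  define Ps where "Ps = {p \<in> S1 \<union> S2. prime p} \<union> {p. prime p \<and> padic_abs p n \<noteq> 1}"
  have Ps: "finite Ps" "\<And>p. p \<in> Ps \<Longrightarrow> prime p" "\<And>p. prime p \<Longrightarrow> padic_abs p n \<noteq> 1 \<Longrightarrow> p \<in> Ps"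
    using S1 S2 padic_abs_eq_1_almost_all[OF n0] by (auto simp: Ps_def)
  define U where "U = arch_places K \<union> (\<Union>p\<in>Ps. padic_places K p)"
  have finU: "finite U"
    unfolding U_def using arch_product(1)[OF L x(1)] padic_product(1)[OF L x(1) _ n] Ps by auto
  have Upl: "U \<subseteq> places K" using Ps by (auto simp: U_def places_decomp)
  have sub: "{w \<in> places K. w x \<noteq> 1} \<subseteq> U"
  proof (rule ccontr)
    assume "\<not> ?thesis"
    then obtain w where w: "w \<in> places K" "w x \<noteq> 1" "w \<notin> U" by blast
    then obtain p where p: "prime p" "w \<in> padic_places K p" by (auto simp: places_decomp U_def)
    then have pn: "p \<notin> Ps" using w(3) by (auto simp: U_def)
    have "p \<notin> S1" "p \<notin> S2" using pn p(1) by (auto simp: Ps_def)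
    then have "w x \<le> 1" "w (inverse x) \<le> 1" using S1(2) S2(2) p by auto
    moreover have "w (inverse x) = inverse (w x)" "w x > 0"
      using absv_inverse[OF sK place_absv[OF w(1)] x(1)] absv_pos[OF sK place_absv[OF w(1)] x] by auto
    ultimately show False using w(2) by (simp add: inverse_le_1_iff)
  qed
  show "finite {w \<in> places K. w x \<noteq> 1}" using finite_subset[OF sub finU] .
  have "(\<Prod>w\<in>U. w x ^ local_degree K w) =
    (\<Prod>w\<in>arch_places K. w x ^ local_degree K w) * (\<Prod>w\<in>(\<Union>p\<in>Ps. padic_places K p). w x ^ local_degree K w)"
    unfolding U_def
  proof (rule prod.union_disjoint)
    show "finite (arch_places K)" by (rule arch_product(1)[OF L x(1)])
    show "finite (\<Union>p\<in>Ps. padic_places K p)" using padic_product(1)[OF L x(1) _ n] Ps by auto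
    show "arch_places K \<inter> (\<Union>p\<in>Ps. padic_places K p) = {}" using arch_padic_disjoint Ps(2) by blast
  qed
  also have "(\<Prod>w\<in>(\<Union>p\<in>Ps. padic_places K p). w x ^ local_degree K w) =
    (\<Prod>p\<in>Ps. \<Prod>w\<in>padic_places K p. w x ^ local_degree K w)"
    using Ps padic_product(1)[OF L x(1) _ n] padic_padic_disjoint by (intro prod.UNION_disjoint) auto
  also have "\<dots> = (\<Prod>p\<in>Ps. padic_abs p n)"
    using padic_product(2)[OF L x(1) _ n] Ps by (intro prod.cong) auto
  also have "(\<Prod>w\<in>arch_places K. w x ^ local_degree K w) = \<bar>real_of_rat n\<bar>"
    using arch_product(2)[OF L x(1)] n by (simp add: norm_of_rat)
  also have "\<bar>real_of_rat n\<bar> * (\<Prod>p\<in>Ps. padic_abs p n) = 1"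
    by (rule rational_product_formula[OF n0 Ps])
  finally have U1: "(\<Prod>w\<in>U. w x ^ local_degree K w) = 1" .
  assume S: "finite S" "S \<subseteq> places K" "{w \<in> places K. w x \<noteq> 1} \<subseteq> S"
  have "(\<Prod>w\<in>S. w x ^ local_degree K w) = (\<Prod>w\<in>{w \<in> places K. w x \<noteq> 1}. w x ^ local_degree K w)"
    using S by (intro prod.mono_neutral_right) auto
  also have "\<dots> = (\<Prod>w\<in>U. w x ^ local_degree K w)"
    using finU sub Upl by (intro prod.mono_neutral_left) auto
  finally show "(\<Prod>w\<in>S. w x ^ local_degree K w) = 1" using U1 by simp
qed

lemma local_degree_pos:
  assumes K: "number_field K" and w: "w \<in> places K"
  shows "local_degree K w > 0"
proof -
  obtain L where L: "number_tower \<rat> K L" using tower_exists[OF K] by blast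
  interpret number_tower \<rat> K L by (rule L)
  have "1 \<in> K" using sK by (simp add: subfD)
  moreover have "(\<Prod>\<tau>\<in>embs \<rat> K. \<tau> 1) = of_rat 1"
    using emb_simps(2)[OF sB sK BK] by (simp add: prod.neutral)
  ultimately show ?thesis
    using w arch_product(3)[OF L] padic_product(3)[OF L] unfolding places_decomp by blast
qed

section \<open>Evaluation of polynomials in an extension field\<close>

text \<open>Horner evaluation at a point of a ring with carrier, the complex coefficients being
  moved by \<open>j\<close>; it lets minimal polynomials be solved in an algebraic closure.\<close>

definition ev :: "('b, 'c) ring_scheme \<Rightarrow> (complex \<Rightarrow> 'b) \<Rightarrow> 'b \<Rightarrow> complex poly \<Rightarrow> 'b" where
  "ev R j r p = foldr (\<lambda>a acc. j a \<oplus>\<^bsub>R\<^esub> r \<otimes>\<^bsub>R\<^esub> acc) (coeffs p) \<zero>\<^bsub>R\<^esub>"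

context
  fixes R :: "('b, 'c) ring_scheme" and j B r
  assumes R: "field R" and B: "subf B" and j: "j \<in> ring_hom (field_on B) R" and r: "r \<in> carrier R"
begin

interpretation R: cring R using R by (simp add: field.axioms domain.axioms(1))

lemma j_simps: "a \<in> B \<Longrightarrow> j a \<in> carrier R" "a \<in> B \<Longrightarrow> b \<in> B \<Longrightarrow> j (a + b) = j a \<oplus>\<^bsub>R\<^esub> j b"
  "a \<in> B \<Longrightarrow> b \<in> B \<Longrightarrow> j (a * b) = j a \<otimes>\<^bsub>R\<^esub> j b" "j 1 = \<one>\<^bsub>R\<^esub>" "j 0 = \<zero>\<^bsub>R\<^esub>"
proof -
  interpret F: cring "field_on B" using field_on_field[OF B] by (simp add: field.axioms domain.axioms(1))
  show "a \<in> B \<Longrightarrow> j a \<in> carrier R" "a \<in> B \<Longrightarrow> b \<in> B \<Longrightarrow> j (a + b) = j a \<oplus>\<^bsub>R\<^esub> j b"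
    "a \<in> B \<Longrightarrow> b \<in> B \<Longrightarrow> j (a * b) = j a \<otimes>\<^bsub>R\<^esub> j b" "j 1 = \<one>\<^bsub>R\<^esub>"
    using ring_hom_closed[OF j, of a] ring_hom_add[OF j, of a b] ring_hom_mult[OF j, of a b] ring_hom_one[OF j] by auto
  show "j 0 = \<zero>\<^bsub>R\<^esub>" using ring_hom_zero[OF j F.ring_axioms R.ring_axioms] by simp
qed

lemma ev_0: "ev R j r 0 = \<zero>\<^bsub>R\<^esub>"
  by (simp add: ev_def)

lemma ev_pCons: "ev R j r (pCons a p) = j a \<oplus>\<^bsub>R\<^esub> r \<otimes>\<^bsub>R\<^esub> ev R j r p"
  using r by (cases "a = 0 \<and> p = 0") (auto simp: ev_def cCons_def j_simps(5))

lemma ev_closed: "p \<in> polys_over B \<Longrightarrow> ev R j r p \<in> carrier R"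
  using r by (induction p) (auto simp: ev_0 ev_pCons polys_over_pCons_iff[OF B] j_simps)

lemma ev_const: "a \<in> B \<Longrightarrow> ev R j r [:a:] = j a"
  using r by (simp add: ev_pCons ev_0 j_simps)

lemma ev_add: "p \<in> polys_over B \<Longrightarrow> q \<in> polys_over B \<Longrightarrow> ev R j r (p + q) = ev R j r p \<oplus>\<^bsub>R\<^esub> ev R j r q"
proof (induction p q rule: poly_induct2)
  case (pCons a p b q)
  have c: "a \<in> B" "b \<in> B" "p \<in> polys_over B" "q \<in> polys_over B"
    using pCons.prems by (auto simp: polys_over_pCons_iff[OF B])
  have "ev R j r (pCons a p + pCons b q) = (j a \<oplus>\<^bsub>R\<^esub> j b) \<oplus>\<^bsub>R\<^esub> r \<otimes>\<^bsub>R\<^esub> (ev R j r p \<oplus>\<^bsub>R\<^esub> ev R j r q)"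
    using pCons.IH c by (simp add: ev_pCons j_simps)
  then show ?case using c r ev_closed j_simps(1) by (simp add: ev_pCons R.r_distr R.a_ac)
qed (simp add: ev_0)

lemma ev_smult: "a \<in> B \<Longrightarrow> p \<in> polys_over B \<Longrightarrow> ev R j r (smult a p) = j a \<otimes>\<^bsub>R\<^esub> ev R j r p"
proof (induction p)
  case (pCons b p)
  have c: "b \<in> B" "p \<in> polys_over B" using pCons.prems by (auto simp: polys_over_pCons_iff[OF B])
  then show ?case
    using pCons.IH pCons.prems(1) r ev_closed j_simps(1)
    by (simp add: ev_pCons j_simps R.r_distr R.m_lcomm)
qed (simp add: ev_0 j_simps)

lemma ev_mult: "p \<in> polys_over B \<Longrightarrow> q \<in> polys_over B \<Longrightarrow> ev R j r (p * q) = ev R j r p \<otimes>\<^bsub>R\<^esub> ev R j r q"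
proof (induction p)
  case (pCons a p)
  have c: "a \<in> B" "p \<in> polys_over B" using pCons.prems by (auto simp: polys_over_pCons_iff[OF B])
  have pq: "p * q \<in> polys_over B" "pCons 0 (p * q) \<in> polys_over B" "smult a q \<in> polys_over B"
    using c pCons.prems(2) by (auto simp: polys_over_mult[OF B] polys_over_pCons_iff[OF B] subfD[OF B] polys_over_smult[OF B])
  have "ev R j r (pCons a p * q) = j a \<otimes>\<^bsub>R\<^esub> ev R j r q \<oplus>\<^bsub>R\<^esub> r \<otimes>\<^bsub>R\<^esub> (ev R j r p \<otimes>\<^bsub>R\<^esub> ev R j r q)"
    using pCons.IH c pCons.prems(2) pq r ev_closed
    by (simp add: ev_add ev_smult ev_pCons j_simps)
  then show ?case
    using c pCons.prems(2) r ev_closed j_simps(1) by (simp add: ev_pCons R.l_distr R.m_assoc)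
qed (use ev_closed in \<open>simp add: ev_0\<close>)

lemma eval_ev: "p \<in> polys_over B \<Longrightarrow> ring.eval R (map j (rev (coeffs p))) r = ev R j r p"
proof (induction p)
  case (pCons a p)
  have c: "a \<in> B" "p \<in> polys_over B" using pCons.prems by (auto simp: polys_over_pCons_iff[OF B])
  have "set (coeffs p) \<subseteq> B" using c(2) by (auto simp: polys_over_def coeffs_def)
  then have s: "set (map j (rev (coeffs p))) \<subseteq> carrier R" using j_simps(1) by auto
  have "coeffs (pCons a p) = a # coeffs p" using pCons.hyps by (auto simp: cCons_def)
  then show ?case
    using R.eval_append_aux[OF s j_simps(1)[OF c(1)] r] pCons.IH[OF c(2)] ev_closed[OF c(2)] r j_simps(1)[OF c(1)]
    by (simp add: ev_pCons R.m_comm R.a_comm)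
qed (simp add: ev_0)

text \<open>Sending \<open>poly p c\<close> to the value of \<open>p\<close> at \<open>r\<close> is
  well defined: a polynomial vanishing at \<open>c\<close> is a multiple of \<open>m\<close>, which
  vanishes at \<open>r\<close>.\<close>

lemma extend_hom:
  assumes m: "is_minpoly B c m" and root: "ev R j r m = \<zero>\<^bsub>R\<^esub>"
  shows "\<exists>h. h \<in> ring_hom (field_on (adj B c)) R \<and> (\<forall>b\<in>B. h b = j b)"
proof -
  define h where "h y = ev R j r (SOME p. p \<in> polys_over B \<and> poly p c = y)" for y
  have h: "h (poly p c) = ev R j r p" if pB: "p \<in> polys_over B" for p
  proof -
    define q where "q = (SOME q. q \<in> polys_over B \<and> poly q c = poly p c)"
    have q: "q \<in> polys_over B" "poly q c = poly p c"
      using someI_ex[of "\<lambda>q. q \<in> polys_over B \<and> poly q c = poly p c"] that unfolding q_def by auto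
    obtain s where s: "s \<in> polys_over B" "q - p = m * s"
      using minpoly_dvd[OF B m polys_over_diff[OF B q(1) pB]] q by auto
    then have "q = p + m * s" by (simp add: algebra_simps)
    then have "ev R j r q = ev R j r p \<oplus>\<^bsub>R\<^esub> (ev R j r m \<otimes>\<^bsub>R\<^esub> ev R j r s)"
      using that s(1) is_minpolyD(1)[OF m] polys_over_mult[OF B] by (simp add: ev_add ev_mult)
    then have "ev R j r q = ev R j r p"
      using root ev_closed[OF s(1)] ev_closed[OF that] by simp
    then show ?thesis by (simp add: h_def q_def)
  qed
  have "h \<in> ring_hom (field_on (adj B c)) R"
  proof (rule ring_hom_memI)
    fix x assume "x \<in> carrier (field_on (adj B c))"
    then obtain p where p: "p \<in> polys_over B" "x = poly p c" by (auto simp: adj_def)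
    then show "h x \<in> carrier R" using h ev_closed by simp
    fix y assume "y \<in> carrier (field_on (adj B c))"
    then obtain q where q: "q \<in> polys_over B" "y = poly q c" by (auto simp: adj_def)
    show "h (x \<otimes>\<^bsub>field_on (adj B c)\<^esub> y) = h x \<otimes>\<^bsub>R\<^esub> h y"
      using h[OF p(1)] h[OF q(1)] h[OF polys_over_mult[OF B p(1) q(1)]] p q by (simp add: ev_mult)
    show "h (x \<oplus>\<^bsub>field_on (adj B c)\<^esub> y) = h x \<oplus>\<^bsub>R\<^esub> h y"
      using h[OF p(1)] h[OF q(1)] h[OF polys_over_add[OF B p(1) q(1)]] p q by (simp add: ev_add)
  next
    show "h \<one>\<^bsub>field_on (adj B c)\<^esub> = \<one>\<^bsub>R\<^esub>"
      using h[OF polys_over_1[OF B]] ev_const[OF subfD(2)[OF B]] by (simp add: j_simps one_pCons)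
  qed
  moreover have "h b = j b" if "b \<in> B" for b
    using h[OF polys_over_const[OF B that]] ev_const[OF that] by simp
  ultimately show ?thesis by blast
qed

end

text \<open>As \<open>j\<close> is injective, the reversed and transported coefficient list is a
  polynomial of the same degree, and over an algebraically closed field it has that many
  roots.\<close>

lemma ev_root_exists:
  assumes R: "algebraically_closed R" and B: "subf B" and j: "j \<in> ring_hom (field_on B) R"
    and g: "g \<in> polys_over B" "degree g > 0"
  shows "\<exists>r\<in>carrier R. ev R j r g = \<zero>\<^bsub>R\<^esub>"
proof -
  interpret R: algebraically_closed R by (rule R)
  have fR: "field R" by (rule R.field_axioms)
  define p where "p = map j (rev (coeffs g))"
  have g0: "g \<noteq> 0" using g(2) by auto
  have gB: "set (coeffs g) \<subseteq> B" using g(1) by (auto simp: polys_over_def coeffs_def)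
  have inj: "j x \<noteq> \<zero>\<^bsub>R\<^esub>" if "x \<in> B" "x \<noteq> 0" for x
  proof
    assume z: "j x = \<zero>\<^bsub>R\<^esub>"
    have "j (x * inverse x) = j x \<otimes>\<^bsub>R\<^esub> j (inverse x)"
      using that by (intro j_simps(3)[OF fR B j R.zero_closed] subfD(6)[OF B]) auto
    then have "\<one>\<^bsub>R\<^esub> = \<zero>\<^bsub>R\<^esub>"
      using z that j_simps(1,4)[OF fR B j R.zero_closed] subfD(6)[OF B] by simp
    then show False using R.one_not_zero by simp
  qed
  have len: "length p = Suc (degree g)" using g0 by (simp add: p_def length_coeffs)
  have "hd (rev (coeffs g)) = lead_coeff g"
    using g0 by (simp add: hd_rev last_coeffs_eq_coeff_degree)
  then have hd: "hd p = j (lead_coeff g)" using g0 by (simp add: p_def hd_map)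
  have "lead_coeff g \<in> B" using g(1) by (simp add: polys_over_def)
  then have "polynomial\<^bsub>R\<^esub> (carrier R) p"
    using inj[of "lead_coeff g"] g0 hd gB j_simps(1)[OF fR B j R.zero_closed]
    by (auto simp: polynomial_def p_def)
  then have pc: "p \<in> carrier (poly_ring R)" by (simp add: univ_poly_carrier)
  have "size (R.roots p) = length p - 1"
    using R.roots_over_carrier[OF pc] by (simp add: R.splitted_def)
  then have "R.roots p \<noteq> {#}" using len g(2) by auto
  then obtain r where "r \<in># R.roots p" by auto
  then have r: "r \<in> carrier R" "R.eval p r = \<zero>\<^bsub>R\<^esub>"
    using R.roots_mem_iff_is_root[OF pc] by (auto simp: R.is_root_def)
  then show ?thesis using eval_ev[OF fR B j r(1) g(1)] by (auto simp: p_def)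
qed

text \<open>Brings a root of a coefficient list into the form of relation that
  \<open>nonarch_extension\<close> expects.\<close>

lemma (in ring) eval_as_finsum:
  assumes "set p \<subseteq> carrier R" "x \<in> carrier R"
  shows "eval p x = (\<Oplus>i\<in>{..<length p}. rev p ! i \<otimes> x [^] i)"
  using assms(1)
proof (induction p)
  case (Cons a p)
  have rc: "rev p ! i \<in> carrier R" if "i < length p" for i
    using that Cons.prems by (metis length_rev nth_mem set_rev set_subset_Cons subset_code(1))
  have "(\<Oplus>i\<in>{..<length p}. rev (a # p) ! i \<otimes> x [^] i) = (\<Oplus>i\<in>{..<length p}. rev p ! i \<otimes> x [^] i)"
    using rc assms(2) by (intro finsum_cong') (auto simp: nth_append)
  moreover have "(\<Oplus>i\<in>{..<Suc (length p)}. rev (a # p) ! i \<otimes> x [^] i) =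
    rev (a # p) ! length p \<otimes> x [^] length p \<oplus> (\<Oplus>i\<in>{..<length p}. rev (a # p) ! i \<otimes> x [^] i)"
    unfolding lessThan_Suc
    by (rule finsum_insert) (use rc Cons.prems assms(2) in \<open>auto simp: nth_append\<close>)
  ultimately show ?case using Cons by (simp add: nth_append)
qed simp

section \<open>The fields \<open>k\<^sub>v\<close>, its algebraic closure, and \<open>\<complex>\<^sub>v\<close>\<close>

lemma hom_comp: "f \<in> ring_hom R S \<Longrightarrow> g \<in> ring_hom S T \<Longrightarrow> (\<lambda>x. g (f x)) \<in> ring_hom R T"
  using ring_hom_trans[of f R S g T] by (simp add: comp_def)

lemma hom_field_inj:
  assumes "field R" "field S" "h \<in> ring_hom R S"
  shows "inj_on h (carrier R)" "x \<in> carrier R \<Longrightarrow> h x = \<zero>\<^bsub>S\<^esub> \<longleftrightarrow> x = \<zero>\<^bsub>R\<^esub>"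
proof -
  interpret R: field R by fact
  interpret S: field S by fact
  interpret H: ring_hom_ring R S h
    by (intro ring_hom_ringI2 R.ring_axioms S.ring_axioms assms(3))
  have z: "h x = \<zero>\<^bsub>S\<^esub> \<longleftrightarrow> x = \<zero>\<^bsub>R\<^esub>" if x: "x \<in> carrier R" for x
  proof
    assume hx: "h x = \<zero>\<^bsub>S\<^esub>"
    show "x = \<zero>\<^bsub>R\<^esub>"
    proof (rule ccontr)
      assume "x \<noteq> \<zero>\<^bsub>R\<^esub>"
      then have "x \<otimes>\<^bsub>R\<^esub> inv\<^bsub>R\<^esub> x = \<one>\<^bsub>R\<^esub>" "inv\<^bsub>R\<^esub> x \<in> carrier R" using x R.field_Units by auto
      then have "h x \<otimes>\<^bsub>S\<^esub> h (inv\<^bsub>R\<^esub> x) = \<one>\<^bsub>S\<^esub>" "h (inv\<^bsub>R\<^esub> x) \<in> carrier S"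
        using H.hom_mult[OF x, symmetric] H.hom_one by auto
      then show False using hx S.one_not_zero by simp
    qed
  qed (use H.hom_zero in simp)
  show "x \<in> carrier R \<Longrightarrow> h x = \<zero>\<^bsub>S\<^esub> \<longleftrightarrow> x = \<zero>\<^bsub>R\<^esub>" by (rule z)
  show "inj_on h (carrier R)"
  proof (rule inj_onI)
    fix x y assume xy: "x \<in> carrier R" "y \<in> carrier R" "h x = h y"
    have "h (x \<ominus>\<^bsub>R\<^esub> y) = h x \<ominus>\<^bsub>S\<^esub> h y" using xy by (simp add: a_minus_def)
    also have "\<dots> = \<zero>\<^bsub>S\<^esub>" using xy H.hom_closed by (simp add: a_minus_def S.r_neg)
    finally show "x = y" using z[of "x \<ominus>\<^bsub>R\<^esub> y"] xy R.r_right_minus_eq by simp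
  qed
qed

lemma hom_absolute_value:
  assumes "field R" "valued_field S \<mu>" "h \<in> ring_hom R S"
  shows "absolute_value R (\<lambda>x. \<mu> (h x))"
proof -
  interpret S: valued_field S \<mu> by fact
  show ?thesis
    unfolding absolute_value_def
    using hom_field_inj(2)[OF assms(1) S.field_axioms assms(3)] S.v_nonneg S.v_eq_0 S.v_mult S.v_add
      ring_hom_closed[OF assms(3)] ring_hom_mult[OF assms(3)] ring_hom_add[OF assms(3)] by simp
qed

locale number_field_place =
  fixes k v
  assumes nk: "number_field k" and v: "v \<in> places k"
begin

lemma sk: "subf k" by (rule number_field_subf[OF nk])

sublocale F: valued_field "field_on k" v
  by (rule valued_field_on[OF sk place_absv[OF v]])

lemma kv_def': "kv_field k v = F.CC" "kv_abs v = F.cabs" "k_to_kv k v = F.cmap"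
  by (auto simp: kv_field_def kv_abs_def k_to_kv_def)

lemma kv_valued: "valued_field (kv_field k v) (kv_abs v)"
  unfolding kv_def' by (rule F.completion_valued)

lemma kv_is_field: "field (kv_field k v)"
  using kv_valued by (simp add: valued_field_def)

lemma k_to_kv: "k_to_kv k v \<in> ring_hom (field_on k) (kv_field k v)" "x \<in> k \<Longrightarrow> kv_abs v (k_to_kv k v x) = v x"
  unfolding kv_def' using F.cmap_hom F.cmap_abs by auto

lemma kv_bar: "algebraic_closure (kv_bar_field k v) (kv_to_bar k v ` carrier (kv_field k v))"
  "kv_to_bar k v \<in> ring_hom (kv_field k v) (kv_bar_field k v)"
  unfolding kv_bar_field_def kv_to_bar_def using field.alg_closureE[OF kv_is_field] by auto

lemma kv_bar_closed: "algebraically_closed (kv_bar_field k v)"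
proof -
  interpret algebraic_closure "kv_bar_field k v" "kv_to_bar k v ` carrier (kv_field k v)" by (rule kv_bar(1))
  show ?thesis by unfold_locales
qed

lemma kv_bar_is_field: "field (kv_bar_field k v)"
  using kv_bar_closed by (simp add: algebraically_closed_def)

lemma kv_bar_subfield: "subfield (kv_to_bar k v ` carrier (kv_field k v)) (kv_bar_field k v)"
  using kv_bar(1) by (simp add: algebraic_closure_def)

lemma kv_bar_algebraic:
  assumes y: "y \<in> carrier (kv_bar_field k v)"
  shows "\<exists>p. set p \<subseteq> kv_to_bar k v ` carrier (kv_field k v) \<and> p \<noteq> [] \<and> hd p \<noteq> \<zero>\<^bsub>kv_bar_field k v\<^esub> \<and>
    ring.eval (kv_bar_field k v) p y = \<zero>\<^bsub>kv_bar_field k v\<^esub>"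
proof -
  interpret A: algebraic_closure "kv_bar_field k v" "kv_to_bar k v ` carrier (kv_field k v)" by (rule kv_bar(1))
  obtain p where p: "p \<in> carrier ((kv_to_bar k v ` carrier (kv_field k v))[X]\<^bsub>kv_bar_field k v\<^esub>)" "p \<noteq> []"
    "A.eval p y = \<zero>\<^bsub>kv_bar_field k v\<^esub>"
    using A.algebraicE[OF subfieldE(1)[OF kv_bar_subfield] y A.algebraic_extension[OF y]] by blast
  then show ?thesis by (auto simp: univ_poly_carrier[symmetric] polynomial_def)
qed

lemma kv_ultrametric:
  assumes na: "\<not> archimedean v" and xy: "x \<in> carrier (kv_field k v)" "y \<in> carrier (kv_field k v)"
  shows "kv_abs v (x \<oplus>\<^bsub>kv_field k v\<^esub> y) \<le> max (kv_abs v x) (kv_abs v y)"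
proof -
  obtain s where s: "s \<in> carrier F.CR" "x = F.cls s" using F.CC_cases xy(1) unfolding kv_def' by blast
  obtain t where t: "t \<in> carrier F.CR" "y = F.cls t" using F.CC_cases xy(2) unfolding kv_def' by blast
  have "F.cabs (F.cls (\<lambda>i. s i \<oplus>\<^bsub>field_on k\<^esub> t i)) \<le> max (F.cabs (F.cls s)) (F.cabs (F.cls t))"
  proof (rule LIMSEQ_le[OF F.cabs_lim[OF F.CR_add[OF s(1) t(1)]] tendsto_max[OF F.cabs_lim[OF s(1)] F.cabs_lim[OF t(1)]]])
    show "\<exists>N. \<forall>n\<ge>N. v (s n \<oplus>\<^bsub>field_on k\<^esub> t n) \<le> max (v (s n)) (v (t n))"
      using nonarch_place_add[OF sk v na] F.CRD[OF s(1)] F.CRD[OF t(1)] by simp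
  qed
  then show ?thesis unfolding s(2) t(2) kv_def' F.cls_add[OF s(1) t(1)] .
qed

text \<open>\<open>nonarch_extension\<close> applied to the image of \<open>kv_field k v\<close> in
  its algebraic closure, with \<open>\<nu>\<close> transported along the injective embedding and the
  image of the prime below \<open>v\<close> as \<open>\<pi>\<close>.\<close>

lemma kv_bar_abs_exists_nonarch:
  assumes na: "\<not> archimedean v"
  shows "\<exists>\<mu>. absolute_value (kv_bar_field k v) \<mu> \<and> (\<forall>x\<in>carrier (kv_field k v). \<mu> (kv_to_bar k v x) = kv_abs v x)"
proof -
  define R where "R = kv_field k v"
  define S where "S = kv_bar_field k v"
  define h where "h = kv_to_bar k v"
  have R: "field R" and S: "field S" and h: "h \<in> ring_hom R S"
    using kv_is_field kv_bar_is_field kv_bar(2) by (auto simp: R_def S_def h_def)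
  interpret V: valued_field R "kv_abs v" unfolding R_def by (rule kv_valued)
  have inj: "inj_on h (carrier R)" by (rule hom_field_inj(1)[OF R S h])
  define \<nu> where "\<nu> y = kv_abs v (inv_into (carrier R) h y)" for y
  have nu: "\<nu> (h x) = kv_abs v x" if "x \<in> carrier R" for x
    using inv_into_f_f[OF inj that] by (simp add: \<nu>_def)
  obtain p where p: "prime p" "\<And>q. v (of_rat q) = padic_abs p q"
    using v na by (elim place_cases) auto
  define \<pi> where "\<pi> = h (k_to_kv k v (of_nat p))"
  have pk: "of_nat p \<in> k" using sk by (rule subf_of_nat)
  have pR: "k_to_kv k v (of_nat p) \<in> carrier R"
    using ring_hom_closed[OF k_to_kv(1)] pk by (simp add: R_def)
  interpret N: nonarch_ext S "h ` carrier R" \<nu> \<pi>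
  proof (intro nonarch_ext.intro S nonarch_ext_axioms.intro)
    show "subfield (h ` carrier R) S" using kv_bar_subfield by (simp add: R_def S_def h_def)
    show "absolute_value (S\<lparr>carrier := h ` carrier R\<rparr>) \<nu>"
    proof -
      have z: "h x = \<zero>\<^bsub>S\<^esub> \<longleftrightarrow> x = \<zero>\<^bsub>R\<^esub>" if "x \<in> carrier R" for x
        using hom_field_inj(2)[OF R S h that] .
      have m: "h x \<otimes>\<^bsub>S\<^esub> h y = h (x \<otimes>\<^bsub>R\<^esub> y)" "h x \<oplus>\<^bsub>S\<^esub> h y = h (x \<oplus>\<^bsub>R\<^esub> y)" if "x \<in> carrier R" "y \<in> carrier R" for x y
        using ring_hom_mult[OF h that] ring_hom_add[OF h that] by auto
      show ?thesis
        unfolding absolute_value_def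
        by (auto simp: nu z m V.v_nonneg V.v_eq_0 V.v_mult V.v_add)
    qed
    show "\<pi> \<in> h ` carrier R" using pR by (simp add: \<pi>_def)
    have "\<nu> \<pi> = inverse (real p)"
      using nu[OF pR] k_to_kv(2)[OF pk] p(2)[of "of_nat p"] padic_abs_p[OF p(1)] by (simp add: \<pi>_def)
    then show "0 < \<nu> \<pi>" "\<nu> \<pi> < 1" using prime_gt_1_nat[OF p(1)] by (auto simp: inverse_less_1_iff)
    fix x y assume "x \<in> h ` carrier R" "y \<in> h ` carrier R"
    then obtain a b where ab: "a \<in> carrier R" "b \<in> carrier R" "x = h a" "y = h b" by blast
    have "x \<oplus>\<^bsub>S\<^esub> y = h (a \<oplus>\<^bsub>R\<^esub> b)" using ring_hom_add[OF h ab(1,2)] ab by simp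
    then show "\<nu> (x \<oplus>\<^bsub>S\<^esub> y) \<le> max (\<nu> x) (\<nu> y)" using kv_ultrametric[OF na ab(1,2)[unfolded R_def]] nu[OF V.a_closed[OF ab(1,2)]] nu ab
      by (simp add: R_def)
  qed
  have "\<exists>\<mu>. absolute_value S \<mu> \<and> (\<forall>x\<in>h ` carrier R. \<mu> x = \<nu> x)"
  proof (rule N.nonarch_extension)
    fix y assume y: "y \<in> carrier S"
    obtain q where q: "set q \<subseteq> h ` carrier R" "q \<noteq> []" "hd q \<noteq> \<zero>\<^bsub>S\<^esub>" "ring.eval S q y = \<zero>\<^bsub>S\<^esub>"
      using kv_bar_algebraic y unfolding R_def S_def h_def by blast
    have qS: "set q \<subseteq> carrier S" using q(1) N.k_carrier by blast
    define n where "n = length q - 1"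
    have len: "length q = Suc n" using q(2) by (simp add: n_def)
    show "\<exists>a n. (\<forall>i\<le>(n::nat). a i \<in> h ` carrier R) \<and> (\<exists>i\<le>n. a i \<noteq> \<zero>\<^bsub>S\<^esub>) \<and>
      (\<Oplus>\<^bsub>S\<^esub>i\<in>{..n}. a i \<otimes>\<^bsub>S\<^esub> y [^]\<^bsub>S\<^esub> i) = \<zero>\<^bsub>S\<^esub>"
    proof (rule exI[of _ "\<lambda>i. rev q ! i"], rule exI[of _ n], intro conjI allI impI)
      fix i assume "i \<le> n"
      then have "rev q ! i \<in> set (rev q)" using len by (intro nth_mem) simp
      then show "rev q ! i \<in> h ` carrier R" using q(1) by auto
    next
      have "rev q ! n = hd q" using len q(2) by (simp add: rev_nth hd_conv_nth)
      then show "\<exists>i\<le>n. rev q ! i \<noteq> \<zero>\<^bsub>S\<^esub>" using q(3) by auto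
    next
      show "(\<Oplus>\<^bsub>S\<^esub>i\<in>{..n}. rev q ! i \<otimes>\<^bsub>S\<^esub> y [^]\<^bsub>S\<^esub> i) = \<zero>\<^bsub>S\<^esub>"
        using N.eval_as_finsum[OF qS y] q(4) len by (simp add: lessThan_Suc_atMost)
    qed
  qed
  then show ?thesis using nu unfolding R_def S_def h_def by auto
qed

end

text \<open>Since \<open>Im b \<noteq> 0\<close>, the numbers 1 and \<open>b\<close> form a real
  basis of the complex plane; both real coordinates of \<open>z\<close> are approximated by
  rationals.\<close>

lemma dense_Rats_span:
  assumes "Im b \<noteq> 0" "e > 0"
  shows "\<exists>p q :: rat. cmod (z - (of_rat p + of_rat q * b)) < e"
proof -
  define y where "y = Im z / Im b"
  define e' where "e' = e / (2 * (cmod b + 1))"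
  have bp: "cmod b + 1 > 0" by (simp add: add_nonneg_pos)
  have e': "e' > 0" "e / 2 > 0" using assms bp by (auto simp: e'_def)
  have dense: "\<exists>q::rat. \<bar>x - of_rat q\<bar> < d" if d: "d > 0" for x d :: real
  proof -
    have "x - d < x + d" using d by simp
    then obtain q where "x - d < of_rat q" "of_rat q < x + d" using of_rat_dense by blast
    then show ?thesis by (intro exI[of _ q]) auto
  qed
  obtain q where q: "\<bar>y - of_rat q\<bar> < e'" using dense[OF e'(1)] by blast
  obtain p where p: "\<bar>(Re z - y * Re b) - of_rat p\<bar> < e / 2" using dense[OF e'(2)] by blast
  have rr: "complex_of_real (of_rat r) = of_rat r" for r
  proof -
    obtain a b :: int where "r = of_int a / of_int b" using rat_fraction[of r] by metis
    then show ?thesis by (simp add: of_rat_divide)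
  qed
  have "z = of_real (Re z - y * Re b) + of_real y * b"
    using assms(1) by (simp add: complex_eq_iff y_def)
  then have "z - (of_rat p + of_rat q * b) = of_real ((Re z - y * Re b) - of_rat p) + of_real (y - of_rat q) * b"
    by (simp add: rr[symmetric] algebra_simps)
  also have "cmod \<dots> \<le> \<bar>(Re z - y * Re b) - of_rat p\<bar> + \<bar>y - of_rat q\<bar> * cmod b"
    by (rule order_trans[OF norm_triangle_ineq]) (simp only: norm_mult norm_of_real)
  also have "\<dots> < e / 2 + e' * (cmod b + 1)"
    using p q bp by (intro add_less_le_mono mult_mono) auto
  also have "e' * (cmod b + 1) = e / 2"
    using nonzero_mult_div_cancel_right[of "cmod b + 1" e] bp unfolding e'_def
    by (metis divide_divide_eq_left' less_irrefl times_divide_eq_left nonzero_mult_div_cancel_right)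
  also have "e / 2 + e / 2 = e" by simp
  finally show ?thesis by blast
qed

context number_field_place
begin

text \<open>At an archimedean place of a totally imaginary field \<open>k\<close> the completion is \<open>\<complex>\<close>, so
  it is its own algebraic closure.\<close>

lemma kv_complex:
  assumes ar: "archimedean v" and im: "\<exists>b\<in>k. \<forall>\<tau>\<in>embs \<rat> k. Im (\<tau> b) \<noteq> 0"
  shows "\<exists>\<phi>. \<phi> \<in> ring_hom (kv_field k v) complex_field \<and> bij_betw \<phi> (carrier (kv_field k v)) UNIV \<and>
    (\<forall>x\<in>carrier (kv_field k v). cmod (\<phi> x) = kv_abs v x)"
proof -
  obtain L where L: "number_tower \<rat> k L" using tower_exists[OF nk] by blast
  interpret T: number_tower \<rat> k L by (rule L)
  have vq: "v b = cmod b" if b: "b \<in> \<rat>" for b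
    using that archimedean_of_rat[OF ar] by (auto elim!: Rats_cases simp: norm_of_rat)
  \<comment> \<open>By conjugacy of absolute values \<open>v\<close> is \<open>cmod\<close> after an
    embedding; \<open>\<phi>\<close> will be the continuous extension of that embedding.\<close>
  have "\<exists>\<tau>\<in>embs \<rat> k. \<forall>x\<in>k. v x = cmod (\<tau> x)"
    using vq[of 2] by (intro T.absv_is_conjugate[OF absv_cmod place_absv[OF v] vq, of 2]) auto
  then obtain \<tau> where t: "\<tau> \<in> embs \<rat> k" "\<And>x. x \<in> k \<Longrightarrow> v x = cmod (\<tau> x)" by blast
  note e = embsD[OF t(1)] and es = emb_simps[OF T.sB sk T.BK t(1)]
  have in_k: "s i \<in> k" if "s \<in> carrier F.CR" for s i using F.CRD[OF that] by simp
  have conv: "convergent (\<lambda>i. \<tau> (s i))" if s: "s \<in> carrier F.CR" for s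
  proof (rule Cauchy_convergent, rule CauchyI)
    fix d :: real assume "d > 0"
    then obtain N where N: "\<And>i j. i \<ge> N \<Longrightarrow> j \<ge> N \<Longrightarrow> v (s i \<ominus>\<^bsub>field_on k\<^esub> s j) < d" using F.CR_Cauchy[OF s] by meson
    have "cmod (\<tau> (s m) - \<tau> (s n)) < d" if "m \<ge> N" "n \<ge> N" for m n
      using N[OF that] t(2)[OF subfD(5)[OF sk in_k[OF s] in_k[OF s]], of m n] es(4)[OF in_k[OF s] in_k[OF s]]
      by (simp add: field_on_minus[OF sk in_k[OF s] in_k[OF s]])
    then show "\<exists>M. \<forall>m\<ge>M. \<forall>n\<ge>M. cmod (\<tau> (s m) - \<tau> (s n)) < d" by blast
  qed
  define \<phi> where "\<phi> C = lim (\<lambda>i. \<tau> ((SOME s. s \<in> carrier F.CR \<and> C = F.cls s) i))" for C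
  have phi: "(\<lambda>i. \<tau> (s i)) \<longlonglongrightarrow> \<phi> (F.cls s)" if s: "s \<in> carrier F.CR" for s
  proof -
    define s' where "s' = (SOME s'. s' \<in> carrier F.CR \<and> F.cls s = F.cls s')"
    have s': "s' \<in> carrier F.CR" "F.cls s = F.cls s'"
      using someI_ex[of "\<lambda>s'. s' \<in> carrier F.CR \<and> F.cls s = F.cls s'"] s unfolding s'_def by auto
    obtain l where l: "(\<lambda>i. \<tau> (s' i)) \<longlonglongrightarrow> l" using conv[OF s'(1)] by (auto simp: convergent_def)
    have "(\<lambda>i. v (s i \<ominus>\<^bsub>field_on k\<^esub> s' i)) \<longlonglongrightarrow> 0" using F.cls_eq_iff[OF s s'(1)] s'(2) by simp
    moreover have "v (s i \<ominus>\<^bsub>field_on k\<^esub> s' i) = cmod (\<tau> (s i) - \<tau> (s' i))" for i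
      using t(2)[OF subfD(5)[OF sk in_k[OF s] in_k[OF s'(1)]], of i i] es(4)[OF in_k[OF s] in_k[OF s'(1)]]
      by (simp add: field_on_minus[OF sk in_k[OF s] in_k[OF s'(1)]])
    ultimately have "(\<lambda>i. \<tau> (s i) - \<tau> (s' i)) \<longlonglongrightarrow> 0" by (simp add: tendsto_norm_zero_iff)
    then have "(\<lambda>i. \<tau> (s i)) \<longlonglongrightarrow> l" using Lim_transform[OF l] by simp
    moreover have "\<phi> (F.cls s) = l" unfolding \<phi>_def s'_def[symmetric] using l by (rule limI)
    ultimately show ?thesis by simp
  qed
  have phiI: "\<phi> (F.cls s) = l" if "s \<in> carrier F.CR" "(\<lambda>i. \<tau> (s i)) \<longlonglongrightarrow> l" for s l
    using LIMSEQ_unique[OF phi[OF that(1)] that(2)] .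
  have nrm: "cmod (\<phi> x) = kv_abs v x" if x: "x \<in> carrier (kv_field k v)" for x
  proof -
    obtain s where s: "s \<in> carrier F.CR" "x = F.cls s" using F.CC_cases x unfolding kv_def' by blast
    have "(\<lambda>i. v (s i)) \<longlonglongrightarrow> cmod (\<phi> (F.cls s))"
      using tendsto_norm[OF phi[OF s(1)]] t(2)[OF in_k[OF s(1)]] by simp
    then show ?thesis unfolding s(2) kv_def' using F.cabs_eqI[OF s(1)] by simp
  qed
  have hom: "\<phi> \<in> ring_hom (kv_field k v) complex_field"
  proof (rule ring_hom_memI)
    fix x assume "x \<in> carrier (kv_field k v)"
    then obtain s where s: "s \<in> carrier F.CR" "x = F.cls s" using F.CC_cases unfolding kv_def' by blast
    show "\<phi> x \<in> carrier complex_field" by simp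
    fix y assume "y \<in> carrier (kv_field k v)"
    then obtain r where r: "r \<in> carrier F.CR" "y = F.cls r" using F.CC_cases unfolding kv_def' by blast
    have "\<phi> (F.cls (\<lambda>i. s i \<otimes>\<^bsub>field_on k\<^esub> r i)) = \<phi> (F.cls s) * \<phi> (F.cls r)"
      using tendsto_mult[OF phi[OF s(1)] phi[OF r(1)]] e(3)[OF in_k[OF s(1)] in_k[OF r(1)]]
      by (intro phiI F.CR_mult s r) simp
    then show "\<phi> (x \<otimes>\<^bsub>kv_field k v\<^esub> y) = \<phi> x \<otimes>\<^bsub>complex_field\<^esub> \<phi> y"
      unfolding s(2) r(2) kv_def' F.cls_mult[OF s(1) r(1)] by simp
    have "\<phi> (F.cls (\<lambda>i. s i \<oplus>\<^bsub>field_on k\<^esub> r i)) = \<phi> (F.cls s) + \<phi> (F.cls r)"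
      using tendsto_add[OF phi[OF s(1)] phi[OF r(1)]] e(2)[OF in_k[OF s(1)] in_k[OF r(1)]]
      by (intro phiI F.CR_add s r) simp
    then show "\<phi> (x \<oplus>\<^bsub>kv_field k v\<^esub> y) = \<phi> x \<oplus>\<^bsub>complex_field\<^esub> \<phi> y"
      unfolding s(2) r(2) kv_def' F.cls_add[OF s(1) r(1)] by simp
  next
    show "\<phi> \<one>\<^bsub>kv_field k v\<^esub> = \<one>\<^bsub>complex_field\<^esub>"
      unfolding kv_def' F.cls_one using phiI[OF F.CR_const[of 1], of 1] es(2) subfD(2)[OF sk] by simp
  qed
  have "inj_on \<phi> (carrier (kv_field k v))"
    by (rule hom_field_inj(1)[OF kv_is_field field_complex hom])
  moreover have "\<exists>x\<in>carrier (kv_field k v). \<phi> x = z" for z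
  proof -
    \<comment> \<open>Surjectivity: as \<open>\<tau> b\<close> is not real, the image of
      \<open>k\<close> is already dense.\<close>
    obtain b where b: "b \<in> k" "Im (\<tau> b) \<noteq> 0" using im t(1) by blast
    have "\<exists>y\<in>k. cmod (z - \<tau> y) < inverse (real (Suc n))" for n
    proof -
      obtain p q :: rat where pq: "cmod (z - (of_rat p + of_rat q * \<tau> b)) < inverse (real (Suc n))"
        using dense_Rats_span[OF b(2), of "inverse (real (Suc n))" z] by auto
      have rk: "of_rat p \<in> k" "of_rat q \<in> k" using T.BK by auto
      have "\<tau> (of_rat p + of_rat q * b) = of_rat p + of_rat q * \<tau> b"
        using e(2)[OF rk(1) subfD(4)[OF sk rk(2) b(1)]] e(3)[OF rk(2) b(1)] e(4) by simp
      then show ?thesis using pq rk b sk by (intro bexI[of _ "of_rat p + of_rat q * b"]) (auto simp: subfD)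
    qed
    then obtain s where s: "\<And>n. s n \<in> k" "\<And>n. cmod (z - \<tau> (s n)) < inverse (real (Suc n))" by metis
    have lim: "(\<lambda>n. \<tau> (s n)) \<longlonglongrightarrow> z"
    proof -
      have "(\<lambda>n. cmod (z - \<tau> (s n))) \<longlonglongrightarrow> 0"
        by (rule real_null_comparison[OF LIMSEQ_inverse_real_of_nat]) (use s(2) in \<open>auto intro!: always_eventually less_imp_le\<close>)
      then have "(\<lambda>n. z - \<tau> (s n)) \<longlonglongrightarrow> 0" by (simp add: tendsto_norm_zero_iff)
      then show ?thesis using tendsto_diff[OF tendsto_const[of z]] by fastforce
    qed
    have "s \<in> carrier F.CR"
      unfolding F.CR_carrier
    proof (intro conjI allI impI)
      show "s i \<in> carrier (field_on k)" for i using s(1) by simp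
      fix d :: real assume "d > 0"
      then obtain M where M: "\<And>m n. m \<ge> M \<Longrightarrow> n \<ge> M \<Longrightarrow> cmod (\<tau> (s m) - \<tau> (s n)) < d"
        using CauchyD[OF LIMSEQ_imp_Cauchy[OF lim]] by blast
      have "v (s m \<ominus>\<^bsub>field_on k\<^esub> s n) = cmod (\<tau> (s m) - \<tau> (s n))" for m n
        using t(2)[OF subfD(5)[OF sk s(1) s(1)], of m n] es(4)[OF s(1) s(1)]
        by (simp add: field_on_minus[OF sk s(1) s(1)])
      then show "\<exists>N. \<forall>i\<ge>N. \<forall>j\<ge>N. v (s i \<ominus>\<^bsub>field_on k\<^esub> s j) < d" using M by (intro exI[of _ M]) simp
    qed
    then show ?thesis
      using phiI[OF _ lim] F.cls_closed unfolding kv_def' by blast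
  qed
  then have "\<phi> ` carrier (kv_field k v) = UNIV" by (metis UNIV_eq_I image_eqI)
  ultimately have "bij_betw \<phi> (carrier (kv_field k v)) UNIV" by (simp add: bij_betw_def)
  then show ?thesis using hom nrm by blast
qed

lemma field_on_UNIV: "field_on UNIV = complex_field"
  by (simp add: ring_of_type_algebra_def)

text \<open>\<open>kv_field k v\<close> is a copy of the complex numbers, over which every
  polynomial splits into linear factors; so each algebraic element is already in
  \<open>range j\<close>. The closure is then the same copy and inherits
  \<open>cmod\<close>.\<close>

lemma kv_bar_abs_exists_arch:
  assumes ar: "archimedean v" and im: "\<exists>b\<in>k. \<forall>\<tau>\<in>embs \<rat> k. Im (\<tau> b) \<noteq> 0"
  shows "\<exists>\<mu>. absolute_value (kv_bar_field k v) \<mu> \<and> (\<forall>x\<in>carrier (kv_field k v). \<mu> (kv_to_bar k v x) = kv_abs v x)"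
proof -
  define R where "R = kv_field k v"
  define S where "S = kv_bar_field k v"
  define h where "h = kv_to_bar k v"
  have R: "field R" and S: "field S" and h: "h \<in> ring_hom R S"
    using kv_is_field kv_bar_is_field kv_bar(2) by (auto simp: R_def S_def h_def)
  interpret R: field R by (rule R)
  interpret S: field S by (rule S)
  obtain \<phi> where phi: "\<phi> \<in> ring_hom R complex_field" "bij_betw \<phi> (carrier R) UNIV"
    "\<And>x. x \<in> carrier R \<Longrightarrow> cmod (\<phi> x) = kv_abs v x"
    using kv_complex[OF assms] unfolding R_def by blast
  define \<psi> where "\<psi> = inv_into (carrier R) \<phi>"
  have psi: "\<psi> z \<in> carrier R" "\<phi> (\<psi> z) = z" for z
    using phi(2) by (auto simp: \<psi>_def bij_betw_def intro: inv_into_into f_inv_into_f)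
  have psiI: "\<psi> z = x" if "x \<in> carrier R" "\<phi> x = z" for x z
    using phi(2) that psi[of z] by (auto simp: bij_betw_def inj_on_def)
  define j where "j z = h (\<psi> z)" for z
  have psi_hom: "\<psi> \<in> ring_hom (field_on UNIV) R"
    unfolding field_on_UNIV
  proof (rule ring_hom_memI)
    show "\<psi> x \<in> carrier R" for x by (rule psi)
    show "\<psi> (x \<otimes>\<^bsub>complex_field\<^esub> y) = \<psi> x \<otimes>\<^bsub>R\<^esub> \<psi> y" for x y
      using ring_hom_mult[OF phi(1) psi(1) psi(1), of x y] psi by (intro psiI) auto
    show "\<psi> (x \<oplus>\<^bsub>complex_field\<^esub> y) = \<psi> x \<oplus>\<^bsub>R\<^esub> \<psi> y" for x y
      using ring_hom_add[OF phi(1) psi(1) psi(1), of x y] psi by (intro psiI) auto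
    show "\<psi> \<one>\<^bsub>complex_field\<^esub> = \<one>\<^bsub>R\<^esub>" using ring_hom_one[OF phi(1)] by (intro psiI) auto
  qed
  have j: "j \<in> ring_hom (field_on UNIV) S" unfolding j_def[abs_def] by (rule hom_comp[OF psi_hom h])
  have sU: "subf UNIV" by (simp add: subf_def)
  have jc: "j z \<in> carrier S" for z using ring_hom_closed[OF j] by simp
  have hj: "h x = j (\<phi> x)" if "x \<in> carrier R" for x using psiI[OF that refl] by (simp add: j_def)
  have all: "p \<in> polys_over UNIV" for p by (simp add: polys_over_def)
  \<comment> \<open>Induction on the degree: a complex root \<open>z\<close> of \<open>P\<close> is
    split off, and \<open>y\<close> is either \<open>j z\<close> or a root of the cofactor.\<close>
  have root: "y \<in> range j" if y: "y \<in> carrier S" "P \<noteq> 0" "ev S j y P = \<zero>\<^bsub>S\<^esub>" for y P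
    using y(2,3)
  proof (induction "degree P" arbitrary: P rule: less_induct)
    case less
    note j' = j_simps[OF S sU j y(1)]
    show ?case
    proof (cases "degree P = 0")
      case True
      then obtain c where c: "P = [:c:]" by (metis degree_eq_zeroE)
      have "j c = \<zero>\<^bsub>S\<^esub>" using less.prems(2) ev_const[OF S sU j y(1), of c] c by simp
      then have "c = 0" using hom_field_inj(2)[OF field_on_field[OF sU] S j, of c] by simp
      then show ?thesis using less.prems(1) c by simp
    next
      case False
      then obtain z where "poly P z = 0"
        using fundamental_theorem_of_algebra[of P] constant_degree[of P] False by auto
      then obtain P' where P': "P = [:- z, 1:] * P'" by (metis poly_eq_0_iff_dvd dvdE)
      have P'0: "P' \<noteq> 0" using less.prems(1) P' by auto
      then have "degree P = 1 + degree P'" unfolding P' by (subst degree_mult_eq) auto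
      then have P0: "P' \<noteq> 0" "degree P' < degree P" using P'0 by auto
      have c1: "ev S j y [:- z, 1:] \<in> carrier S" "ev S j y P' \<in> carrier S"
        using ev_closed[OF S sU j y(1) all] by auto
      have "ev S j y [:- z, 1:] \<otimes>\<^bsub>S\<^esub> ev S j y P' = \<zero>\<^bsub>S\<^esub>"
        using ev_mult[OF S sU j y(1) all all, of "[:- z, 1:]" P'] less.prems(2) P' by (simp del: mult_pCons_left)
      then consider "ev S j y [:- z, 1:] = \<zero>\<^bsub>S\<^esub>" | "ev S j y P' = \<zero>\<^bsub>S\<^esub>"
        using S.integral c1 by blast
      then show ?thesis
      proof cases
        case 1
        have "j (- z) \<oplus>\<^bsub>S\<^esub> y = \<zero>\<^bsub>S\<^esub>"
          using 1 y(1) jc[of "- z"] by (simp add: ev_pCons[OF S sU j y(1)] ev_0[OF S sU j y(1)] j')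
        moreover have "j (- z) \<oplus>\<^bsub>S\<^esub> j z = \<zero>\<^bsub>S\<^esub>" using j'(2)[of "- z" z] j'(5) by simp
        ultimately have "y = j z" using jc[of z] jc[of "- z"] y(1) S.add.l_cancel by metis
        then show ?thesis by blast
      next
        case 2
        then show ?thesis using less.hyps P0 by blast
      qed
    qed
  qed
  have surj: "carrier S \<subseteq> range j"
  proof
    fix y assume y: "y \<in> carrier S"
    obtain q where q: "set q \<subseteq> h ` carrier R" "q \<noteq> []" "hd q \<noteq> \<zero>\<^bsub>S\<^esub>" "ring.eval S q y = \<zero>\<^bsub>S\<^esub>"
      using kv_bar_algebraic y unfolding R_def S_def h_def by blast
    define cs where "cs = map (\<lambda>x. SOME z. x = j z) q"
    have ex: "\<exists>z. x = j z" if "x \<in> set q" for x using that q(1) hj by auto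
    have jcs: "map j cs = q"
      unfolding cs_def map_map comp_def
    proof (rule map_idI)
      fix x assume "x \<in> set q"
      from someI_ex[OF ex[OF this]] show "j (SOME z. x = j z) = x" by simp
    qed
    \<comment> \<open>The leading entry of \<open>cs\<close> is nonzero, so \<open>Poly\<close>
      strips nothing and the coefficients of \<open>P\<close> return the list.\<close>
    define P where "P = Poly (rev cs)"
    have "hd cs \<noteq> 0"
    proof
      assume "hd cs = 0"
      then have "hd q = j 0" using jcs q(2) by (metis hd_map list.map_disc_iff)
      then show False using q(3) j_simps(5)[OF S sU j y] by simp
    qed
    moreover have "cs \<noteq> []" using q(2) by (simp add: cs_def)
    ultimately have "coeffs P = rev cs"
      by (cases cs) (auto simp: P_def strip_while_def)
    then have cf: "rev (coeffs P) = cs" by simp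
    have "P \<noteq> 0" using cf \<open>cs \<noteq> []\<close> by auto
    moreover have "ev S j y P = \<zero>\<^bsub>S\<^esub>" using eval_ev[OF S sU j y all, of P] cf jcs q(4) by simp
    ultimately show "y \<in> range j" using root[OF y] by blast
  qed
  have inj: "inj_on j UNIV" using hom_field_inj(1)[OF field_on_field[OF sU] S j] by simp
  define \<mu> where "\<mu> y = cmod (inv_into UNIV j y)" for y
  have mu: "\<mu> (j z) = cmod z" for z using inj by (simp add: \<mu>_def)
  have "absolute_value S \<mu>"
    unfolding absolute_value_def
  proof (intro conjI ballI)
    note j' = j_simps[OF S sU j S.zero_closed]
    fix x assume "x \<in> carrier S"
    then obtain a where a: "x = j a" using surj by blast
    show "0 \<le> \<mu> x" by (simp add: \<mu>_def)
    show "\<mu> x = 0 \<longleftrightarrow> x = \<zero>\<^bsub>S\<^esub>"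
      unfolding a mu using hom_field_inj(2)[OF field_on_field[OF sU] S j, of a] by simp
    fix y assume "y \<in> carrier S"
    then obtain b where b: "y = j b" using surj by blast
    show "\<mu> (x \<otimes>\<^bsub>S\<^esub> y) = \<mu> x * \<mu> y" unfolding a b using j'(3)[of a b, symmetric] by (simp add: mu norm_mult)
    show "\<mu> (x \<oplus>\<^bsub>S\<^esub> y) \<le> \<mu> x + \<mu> y" unfolding a b using j'(2)[of a b, symmetric] by (simp add: mu norm_triangle_ineq)
  qed
  moreover have "\<mu> (h x) = kv_abs v x" if "x \<in> carrier R" for x
    using hj[OF that] mu phi(3)[OF that] by simp
  ultimately show ?thesis unfolding R_def S_def h_def by blast
qed

end

text \<open>One element whose conjugates are all non-real; if no embedding is real, any generator of
  \<open>k\<close> is one.\<close>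

definition totally_imaginary where
  "totally_imaginary k \<longleftrightarrow> (\<exists>b\<in>k. \<forall>\<tau>\<in>embs \<rat> k. Im (\<tau> b) \<noteq> 0)"

locale imaginary_place = number_field_place +
  assumes im: "totally_imaginary k"
begin

lemma kv_bar_abs: "absolute_value (kv_bar_field k v) (kv_bar_abs k v)"
  "x \<in> carrier (kv_field k v) \<Longrightarrow> kv_bar_abs k v (kv_to_bar k v x) = kv_abs v x"
proof -
  have "\<exists>\<mu>. absolute_value (kv_bar_field k v) \<mu> \<and> (\<forall>x\<in>carrier (kv_field k v). \<mu> (kv_to_bar k v x) = kv_abs v x)"
    using kv_bar_abs_exists_nonarch kv_bar_abs_exists_arch im unfolding totally_imaginary_def by blast
  from someI_ex[OF this]
  show "absolute_value (kv_bar_field k v) (kv_bar_abs k v)"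
    "x \<in> carrier (kv_field k v) \<Longrightarrow> kv_bar_abs k v (kv_to_bar k v x) = kv_abs v x"
    unfolding kv_bar_abs_def[symmetric] by auto
qed

lemma kv_bar_valued: "valued_field (kv_bar_field k v) (kv_bar_abs k v)"
  using kv_bar_is_field kv_bar_abs(1) by (simp add: valued_field_def valued_field_axioms_def)

lemma Cv_valued: "valued_field (Cv_field k v) (Cv_abs k v)"
  unfolding Cv_field_def Cv_abs_def by (rule valued_field.completion_valued[OF kv_bar_valued])

lemma Cv_is_field: "field (Cv_field k v)"
  using Cv_valued by (simp add: valued_field_def)

lemma kv_to_Cv: "kv_to_Cv k v \<in> ring_hom (kv_field k v) (Cv_field k v)"
  unfolding kv_to_Cv_def[abs_def] Cv_field_def
  by (rule hom_comp[OF kv_bar(2) valued_field.cmap_hom[OF kv_bar_valued]])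

lemma k_to_Cv: "k_to_Cv k v \<in> ring_hom (field_on k) (Cv_field k v)"
  unfolding k_to_Cv_def[abs_def] by (rule hom_comp[OF k_to_kv(1) kv_to_Cv])

end

text \<open>The choice in \<open>place_embedding\<close> succeeds: extend the map from
  \<open>k\<close> into the algebraic closure to the normal closure \<open>L\<close> and pull the
  absolute value back to \<open>Q\<close>. Since \<open>w\<close> and \<open>Q\<close> agree on
  \<open>k\<close>, \<open>w\<close> is \<open>Q\<close> after some \<open>\<tau>\<close>, and the
  extension after \<open>\<tau>\<close> is the embedding sought.\<close>

lemma place_embedding:
  assumes k: "number_field k" "totally_imaginary k" and K: "number_field K" "k \<subseteq> K" and w: "w \<in> places K"
  shows "place_embedding k K w \<in> ring_hom (field_on K) (Cv_field k (restrict w k))"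
    and "x \<in> k \<Longrightarrow> place_embedding k K w x = k_to_Cv k (restrict w k) x"
    and "x \<in> K \<Longrightarrow> Cv_abs k (restrict w k) (place_embedding k K w x) = w x"
proof -
  define v where "v = restrict w k"
  have sk: "subf k" and sK: "subf K" using k K number_field_subf by auto
  have vp: "v \<in> places k" unfolding v_def using place_restrict(1)[OF w sk K(2)] .
  interpret I: imaginary_place k v
    by unfold_locales (use k vp in auto)
  obtain L where L: "number_field L" "K \<subseteq> L" "normal_over K L" using normal_closure[OF K(1)] by blast
  interpret T: number_tower k K L
    by unfold_locales (use k K L in auto)
  obtain c m where c: "L = adj k c" "is_minpoly k c m" using T.generator_exists[OF L(1) T.BL] by blast
  define S where "S = kv_bar_field k v"
  define j where "j x = kv_to_bar k v (k_to_kv k v x)" for x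
  have j: "j \<in> ring_hom (field_on k) S"
    unfolding j_def[abs_def] S_def by (rule hom_comp[OF I.k_to_kv(1) I.kv_bar(2)])
  obtain r where r: "r \<in> carrier S" "ev S j r m = \<zero>\<^bsub>S\<^esub>"
    using ev_root_exists[OF I.kv_bar_closed sk _ is_minpolyD(1,5)[OF c(2)]] j unfolding S_def by blast
  have fS: "field S" unfolding S_def by (rule I.kv_bar_is_field)
  obtain h where h: "h \<in> ring_hom (field_on L) S" "\<And>b. b \<in> k \<Longrightarrow> h b = j b"
    using extend_hom[OF fS sk j r(1) c(2) r(2)] unfolding c(1)[symmetric] by blast
  define Q where "Q x = kv_bar_abs k v (h x)" for x
  have Q: "absv L Q"
    unfolding Q_def[abs_def]
    by (rule hom_absolute_value[OF field_on_field[OF T.sL] I.kv_bar_valued h(1)[unfolded S_def]])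
  have Qk: "w b = Q b" if b: "b \<in> k" for b
  proof -
    have "Q b = kv_abs v (k_to_kv k v b)"
      unfolding Q_def h(2)[OF b] j_def
      using ring_hom_closed[OF I.k_to_kv(1)] b by (intro I.kv_bar_abs(2)) simp
    then show ?thesis using I.k_to_kv(2)[OF b] b by (simp add: v_def)
  qed
  obtain b where b: "b \<in> \<rat>" "b \<noteq> 0" "w b \<noteq> 1" using place_nontrivial[OF w] by blast
  then obtain \<tau> where t: "\<tau> \<in> embs k K" "\<And>x. x \<in> K \<Longrightarrow> w x = Q (\<tau> x)"
    using T.absv_is_conjugate[OF Q place_absv[OF w] Qk _ b(2,3)] T.QB by blast
  define \<sigma> where "\<sigma> x = completion_map (kv_bar_field k v) (kv_bar_abs k v) (h (\<tau> x))" for x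
  interpret V: valued_field "kv_bar_field k v" "kv_bar_abs k v" by (rule I.kv_bar_valued)
  have tau: "\<tau> \<in> ring_hom (field_on K) (field_on L)"
    using T.emb_K_in[OF t(1)] embsD[OF t(1)] emb_simps(2)[OF T.sB sK T.BK t(1)] by (intro ring_hom_memI) auto
  have "\<sigma> \<in> ring_hom (field_on K) (Cv_field k v) \<and> (\<forall>x\<in>k. \<sigma> x = k_to_Cv k v x) \<and> (\<forall>x\<in>K. Cv_abs k v (\<sigma> x) = w x)"
  proof (intro conjI ballI)
    show "\<sigma> \<in> ring_hom (field_on K) (Cv_field k v)"
      unfolding \<sigma>_def[abs_def] Cv_field_def
      by (rule hom_comp[OF hom_comp[OF tau h(1)[unfolded S_def]] V.cmap_hom])
    show "\<sigma> x = k_to_Cv k v x" if "x \<in> k" for x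
      using embsD(4)[OF t(1) that] h(2)[OF that] by (simp add: \<sigma>_def k_to_Cv_def kv_to_Cv_def j_def)
    show "Cv_abs k v (\<sigma> x) = w x" if x: "x \<in> K" for x
    proof -
      have "h (\<tau> x) \<in> carrier (kv_bar_field k v)"
        using ring_hom_closed[OF h(1)] T.emb_K_in[OF t(1) x] by (simp add: S_def)
      then show ?thesis using V.cmap_abs t(2)[OF x] by (simp add: \<sigma>_def Cv_abs_def Q_def)
    qed
  qed
  then have "\<exists>\<sigma>. \<sigma> \<in> ring_hom (field_on K) (Cv_field k v) \<and> (\<forall>x\<in>k. \<sigma> x = k_to_Cv k v x) \<and> (\<forall>x\<in>K. Cv_abs k v (\<sigma> x) = w x)"
    by blast
  from someI_ex[OF this]
  show "place_embedding k K w \<in> ring_hom (field_on K) (Cv_field k (restrict w k))"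
    "x \<in> k \<Longrightarrow> place_embedding k K w x = k_to_Cv k (restrict w k) x"
    "x \<in> K \<Longrightarrow> Cv_abs k (restrict w k) (place_embedding k K w x) = w x"
    unfolding place_embedding_def[of k K w] v_def by auto
qed

section \<open>Tensor products of coordinate spaces\<close>

lemma (in abelian_monoid) finsum_cartesian:
  assumes "finite A" "finite B" "\<And>a b. a \<in> A \<Longrightarrow> b \<in> B \<Longrightarrow> f (a, b) \<in> carrier G"
  shows "finsum G f (A \<times> B) = (\<Oplus>a\<in>A. \<Oplus>b\<in>B. f (a, b))"
  using assms(1,3)
proof (induction A rule: finite_induct)
  case (insert a A)
  have i: "inj_on (Pair a) B" by (simp add: inj_on_def)
  have row: "finsum G f (Pair a ` B) = (\<Oplus>b\<in>B. f (a, b))"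
    using insert.prems i by (intro add.finprod_reindex) auto
  have "insert a A \<times> B = Pair a ` B \<union> A \<times> B" by auto
  then have "finsum G f (insert a A \<times> B) = finsum G f (Pair a ` B) \<oplus> finsum G f (A \<times> B)"
    by (simp only:) (rule finsum_Un_disjoint; use insert.hyps insert.prems assms(2) in auto)
  also have "finsum G f (A \<times> B) = (\<Oplus>a\<in>A. \<Oplus>b\<in>B. f (a, b))"
    using insert by blast
  also have "finsum G f (Pair a ` B) \<oplus> \<dots> = (\<Oplus>a\<in>insert a A. \<Oplus>b\<in>B. f (a, b))"
    unfolding row using insert by (intro finsum_insert[symmetric]) (auto intro!: finsum_closed)
  finally show ?case .
qed simp

lemma (in abelian_monoid) finsum_swap:
  assumes "finite A" "finite B" "\<And>a b. a \<in> A \<Longrightarrow> b \<in> B \<Longrightarrow> f a b \<in> carrier G"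
  shows "(\<Oplus>a\<in>A. \<Oplus>b\<in>B. f a b) = (\<Oplus>b\<in>B. \<Oplus>a\<in>A. f a b)"
  using assms(1,3)
proof (induction A rule: finite_induct)
  case (insert a A)
  have "(\<Oplus>b\<in>B. \<Oplus>a\<in>insert a A. f a b) = (\<Oplus>b\<in>B. f a b \<oplus> (\<Oplus>a\<in>A. f a b))"
  proof (rule add.finprod_cong')
    show "(\<Oplus>a\<in>insert a A. f a b) = f a b \<oplus> (\<Oplus>a\<in>A. f a b)" if "b \<in> B" for b
      using insert that by (intro finsum_insert) auto
  qed (use insert in \<open>auto intro!: finsum_closed\<close>)
  also have "\<dots> = (\<Oplus>b\<in>B. f a b) \<oplus> (\<Oplus>b\<in>B. \<Oplus>a\<in>A. f a b)"
    using insert by (intro add.finprod_multf) (auto intro!: finsum_closed)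
  also have "(\<Oplus>b\<in>B. \<Oplus>a\<in>A. f a b) = (\<Oplus>a\<in>A. \<Oplus>b\<in>B. f a b)"
    using insert by simp
  also have "(\<Oplus>b\<in>B. f a b) \<oplus> \<dots> = (\<Oplus>a\<in>insert a A. \<Oplus>b\<in>B. f a b)"
    using insert by (intro finsum_insert[symmetric]) (auto intro!: finsum_closed)
  finally show ?case by simp
qed (simp add: finsum_zero)

text \<open>For a matrix \<open>x\<close> over \<open>A \<times> B\<close> and linear
  \<open>f\<close>, this is the tensor product of the identity with \<open>f\<close>;
  \<open>map_cols\<close> is that of \<open>f\<close> with the identity.\<close>

definition map_rows where
  "map_rows f A J B x = (\<lambda>(r, j)\<in>A \<times> J. f (\<lambda>s\<in>B. x (r, s)) j)"

definition map_cols where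
  "map_cols f I B A x = (\<lambda>(i, s)\<in>I \<times> B. f (\<lambda>r\<in>A. x (r, s)) i)"

lemma map_rows_closed:
  assumes "\<And>x. x \<in> B \<rightarrow>\<^sub>E C \<Longrightarrow> f x \<in> J \<rightarrow>\<^sub>E C" "x \<in> A \<times> B \<rightarrow>\<^sub>E C"
  shows "map_rows f A J B x \<in> A \<times> J \<rightarrow>\<^sub>E C"
proof -
  have "f (\<lambda>s\<in>B. x (r, s)) \<in> J \<rightarrow>\<^sub>E C" if "r \<in> A" for r
    using assms(2) that by (intro assms(1)) auto
  then have "f (\<lambda>s\<in>B. x (r, s)) j \<in> C" if "r \<in> A" "j \<in> J" for r j
    using that by (blast dest: PiE_mem)
  then show ?thesis unfolding map_rows_def by (intro restrict_PiE_iff[THEN iffD2]) auto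
qed

lemma bij_betw_map_rows:
  assumes f: "bij_betw f (B \<rightarrow>\<^sub>E C) (J \<rightarrow>\<^sub>E C)"
  shows "bij_betw (map_rows f A J B) (A \<times> B \<rightarrow>\<^sub>E C) (A \<times> J \<rightarrow>\<^sub>E C)"
proof -
  define g where "g = inv_into (B \<rightarrow>\<^sub>E C) f"
  have m: "f x \<in> J \<rightarrow>\<^sub>E C" "g (f x) = x" if "x \<in> B \<rightarrow>\<^sub>E C" for x
    using that f by (auto simp: g_def bij_betw_def)
  have n: "g y \<in> B \<rightarrow>\<^sub>E C" "f (g y) = y" if "y \<in> J \<rightarrow>\<^sub>E C" for y
    using that f bij_betw_inv_into[OF f] by (auto simp: g_def bij_betw_def f_inv_into_f)
  have row: "(\<lambda>s\<in>B. x (r, s)) \<in> B \<rightarrow>\<^sub>E C" if "x \<in> A \<times> B \<rightarrow>\<^sub>E C" "r \<in> A" for x r and B :: "'x set"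
    using that by auto
  have r1: "(\<lambda>j\<in>J. map_rows f A J B x (r, j)) = f (\<lambda>s\<in>B. x (r, s))" if "x \<in> A \<times> B \<rightarrow>\<^sub>E C" "r \<in> A" for x r
    using m(1)[OF row[OF that]] that(2) by (auto simp: map_rows_def PiE_def intro!: extensionalityI[where A=J])
  have r2: "(\<lambda>s\<in>B. map_rows g A B J y (r, s)) = g (\<lambda>j\<in>J. y (r, j))" if "y \<in> A \<times> J \<rightarrow>\<^sub>E C" "r \<in> A" for y r
    using n(1)[OF row[OF that]] that(2) by (auto simp: map_rows_def PiE_def intro!: extensionalityI[where A=B])
  show ?thesis
  proof (rule bij_betw_byWitness[where f' = "map_rows g A B J"])
    show "\<forall>x\<in>A \<times> B \<rightarrow>\<^sub>E C. map_rows g A B J (map_rows f A J B x) = x"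
    proof
      fix x assume x: "x \<in> A \<times> B \<rightarrow>\<^sub>E C"
      then show "map_rows g A B J (map_rows f A J B x) = x"
        by (intro extensionalityI[where A="A \<times> B"])
           (auto simp: map_rows_def[of g] r1 m(2)[OF row] simp del: restrict_apply restrict_PiE_iff simp: restrict_apply' PiE_def)
    qed
    show "\<forall>y\<in>A \<times> J \<rightarrow>\<^sub>E C. map_rows f A J B (map_rows g A B J y) = y"
    proof
      fix x assume x: "x \<in> A \<times> J \<rightarrow>\<^sub>E C"
      then show "map_rows f A J B (map_rows g A B J x) = x"
        by (intro extensionalityI[where A="A \<times> J"])
           (auto simp: map_rows_def[of f] r2 n(2)[OF row] simp del: restrict_apply restrict_PiE_iff simp: restrict_apply' PiE_def)
    qed
    show "map_rows f A J B ` (A \<times> B \<rightarrow>\<^sub>E C) \<subseteq> A \<times> J \<rightarrow>\<^sub>E C"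
      by (rule image_subsetI) (rule map_rows_closed[OF m(1)])
    show "map_rows g A B J ` (A \<times> J \<rightarrow>\<^sub>E C) \<subseteq> A \<times> B \<rightarrow>\<^sub>E C"
      by (rule image_subsetI) (rule map_rows_closed[OF n(1)])
  qed
qed

lemma bij_betw_swap_PiE: "bij_betw (\<lambda>x. \<lambda>(b, a)\<in>B \<times> A. x (a, b)) (A \<times> B \<rightarrow>\<^sub>E C) (B \<times> A \<rightarrow>\<^sub>E C)"
  by (rule bij_betw_byWitness[where f' = "\<lambda>x. \<lambda>(a, b)\<in>A \<times> B. x (b, a)"])
     (auto simp: PiE_def extensional_def fun_eq_iff)

lemma map_cols_swap:
  "map_cols f I B A x = (\<lambda>(i, s)\<in>I \<times> B. map_rows f B I A (\<lambda>(s, r)\<in>B \<times> A. x (r, s)) (s, i))"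
  by (auto simp: map_cols_def map_rows_def fun_eq_iff intro!: arg_cong[where f="\<lambda>z. f z _"])

lemma bij_betw_map_cols:
  assumes "bij_betw f (A \<rightarrow>\<^sub>E C) (I \<rightarrow>\<^sub>E C)"
  shows "bij_betw (map_cols f I B A) (A \<times> B \<rightarrow>\<^sub>E C) (I \<times> B \<rightarrow>\<^sub>E C)"
proof -
  have "map_cols f I B A = (\<lambda>x. \<lambda>(i, s)\<in>I \<times> B. x (s, i)) \<circ> map_rows f B I A \<circ> (\<lambda>x. \<lambda>(s, r)\<in>B \<times> A. x (r, s))"
    by (rule ext) (simp add: map_cols_swap)
  then show ?thesis
    using bij_betw_trans[OF bij_betw_trans[OF bij_betw_swap_PiE bij_betw_map_rows[OF assms, of B]] bij_betw_swap_PiE]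
    by (simp add: comp_assoc)
qed

text \<open>A tensor product of two linear maps, carried out one factor at a time in either order.
  Both orders are used when two pairs of bases are compared.\<close>

lemma (in cring) lin_comb_tensor:
  assumes "finite A" "finite B" "\<And>r. r \<in> A \<Longrightarrow> b r \<in> vectors R I" "\<And>s. s \<in> B \<Longrightarrow> c s \<in> vectors R J"
    "x \<in> vectors R (A \<times> B)"
  shows "lin_comb R (I \<times> J) (A \<times> B) (tensor_family R I J b c) x =
      map_cols (lin_comb R I A b) I J A (map_rows (lin_comb R J B c) A J B x)" (is "?L = ?C")
    and "lin_comb R (I \<times> J) (A \<times> B) (tensor_family R I J b c) x =
      map_rows (lin_comb R J B c) I J B (map_cols (lin_comb R I A b) I B A x)" (is "?L = ?R")
proof -
  have x: "x (r, s) \<in> carrier R" if "r \<in> A" "s \<in> B" for r s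
    using assms(5) that by (auto simp: vectors_def)
  have b: "b r i \<in> carrier R" if "r \<in> A" "i \<in> I" for r i
    using assms(3)[OF that(1)] that(2) by (auto simp: vectors_def)
  have c: "c s j \<in> carrier R" if "s \<in> B" "j \<in> J" for s j
    using assms(4)[OF that(1)] that(2) by (auto simp: vectors_def)
  have L: "?L (i, j) = (\<Oplus>r\<in>A. \<Oplus>s\<in>B. x (r, s) \<otimes> (b r i \<otimes> c s j))" if "i \<in> I" "j \<in> J" for i j
    using that assms(1,2) x b c by (simp add: lin_comb_def tensor_family_def case_prod_unfold) (subst finsum_cartesian, auto)
  have C: "?C (i, j) = (\<Oplus>r\<in>A. (\<Oplus>s\<in>B. x (r, s) \<otimes> c s j) \<otimes> b r i)" if ij: "i \<in> I" "j \<in> J" for i j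
    using ij assms(1,2) x b c
    by (simp add: lin_comb_def map_cols_def map_rows_def)
       (intro add.finprod_cong' refl arg_cong2[where f="(\<otimes>)"]; auto intro!: finsum_closed add.finprod_cong' )
  have R: "?R (i, j) = (\<Oplus>s\<in>B. (\<Oplus>r\<in>A. x (r, s) \<otimes> b r i) \<otimes> c s j)" if ij: "i \<in> I" "j \<in> J" for i j
    using ij assms(1,2) x b c
    by (simp add: lin_comb_def map_cols_def map_rows_def)
       (intro add.finprod_cong' refl arg_cong2[where f="(\<otimes>)"]; auto intro!: finsum_closed add.finprod_cong' )
  have 1: "?L (i, j) = ?C (i, j)" if ij: "i \<in> I" "j \<in> J" for i j
    unfolding L[OF ij] C[OF ij]
  proof (rule add.finprod_cong')
    show "(\<Oplus>s\<in>B. x (r, s) \<otimes> (b r i \<otimes> c s j)) = (\<Oplus>s\<in>B. x (r, s) \<otimes> c s j) \<otimes> b r i" if "r \<in> A" for r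
      using that ij assms(2) x b c
      by (subst finsum_ldistr) (auto intro!: add.finprod_cong' simp: m_ac)
  qed (use ij x b c in \<open>auto intro!: finsum_closed\<close>)
  have 2: "?L (i, j) = ?R (i, j)" if ij: "i \<in> I" "j \<in> J" for i j
  proof -
    have "?L (i, j) = (\<Oplus>s\<in>B. \<Oplus>r\<in>A. x (r, s) \<otimes> (b r i \<otimes> c s j))"
      unfolding L[OF ij] using ij assms(1,2) x b c by (intro finsum_swap) auto
    also have "\<dots> = ?R (i, j)"
      unfolding R[OF ij]
    proof (rule add.finprod_cong')
      show "(\<Oplus>r\<in>A. x (r, s) \<otimes> (b r i \<otimes> c s j)) = (\<Oplus>r\<in>A. x (r, s) \<otimes> b r i) \<otimes> c s j" if "s \<in> B" for s
        using that ij assms(1) x b c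
        by (subst finsum_ldistr) (auto intro!: add.finprod_cong' simp: m_ac)
    qed (use ij x b c in \<open>auto intro!: finsum_closed\<close>)
    finally show ?thesis .
  qed
  show "?L = ?C"
    by (rule extensionalityI[of _ "I \<times> J"]) (use 1 in \<open>auto simp: lin_comb_def map_cols_def\<close>)
  show "?L = ?R"
    by (rule extensionalityI[of _ "I \<times> J"]) (use 2 in \<open>auto simp: lin_comb_def map_rows_def\<close>)
qed

lemma (in cring) is_basis_tensor:
  assumes b: "is_basis R I A b" and c: "is_basis R J B c"
  shows "is_basis R (I \<times> J) (A \<times> B) (tensor_family R I J b c)"
proof -
  have fin: "finite A" "finite B" and v: "\<And>r. r \<in> A \<Longrightarrow> b r \<in> vectors R I" "\<And>s. s \<in> B \<Longrightarrow> c s \<in> vectors R J"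
    using b c by (auto simp: is_basis_def)
  have bb: "bij_betw (lin_comb R I A b) (A \<rightarrow>\<^sub>E carrier R) (I \<rightarrow>\<^sub>E carrier R)"
    and cc: "bij_betw (lin_comb R J B c) (B \<rightarrow>\<^sub>E carrier R) (J \<rightarrow>\<^sub>E carrier R)"
    using b c by (auto simp: is_basis_def vectors_def)
  have "bij_betw (map_cols (lin_comb R I A b) I J A \<circ> map_rows (lin_comb R J B c) A J B)
    (A \<times> B \<rightarrow>\<^sub>E carrier R) (I \<times> J \<rightarrow>\<^sub>E carrier R)"
    by (rule bij_betw_trans[OF bij_betw_map_rows[OF cc] bij_betw_map_cols[OF bb]])
  then have "bij_betw (lin_comb R (I \<times> J) (A \<times> B) (tensor_family R I J b c)) (A \<times> B \<rightarrow>\<^sub>E carrier R) (I \<times> J \<rightarrow>\<^sub>E carrier R)"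
    by (rule bij_betw_cong[THEN iffD1, rotated]) (use lin_comb_tensor(1)[OF fin v] in \<open>simp add: vectors_def\<close>)
  moreover have "tensor_family R I J b c p \<in> vectors R (I \<times> J)" if "p \<in> A \<times> B" for p
  proof -
    obtain r s where p: "p = (r, s)" "r \<in> A" "s \<in> B" using \<open>p \<in> A \<times> B\<close> by blast
    then have "b r i \<otimes> c s j \<in> carrier R" if "i \<in> I" "j \<in> J" for i j
      using v(1)[OF p(2)] v(2)[OF p(3)] that by (auto simp: vectors_def)
    then show ?thesis by (auto simp: p(1) tensor_family_def vectors_def)
  qed
  ultimately show ?thesis using fin by (simp add: is_basis_def vectors_def)
qed

section \<open>The norm of a tensor product\<close>

lemma norm2_cong: "(\<And>j. j \<in> J \<Longrightarrow> x j = y j) \<Longrightarrow> norm2 k v J x = norm2 k v J y"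
  by (simp add: norm2_def cong: image_cong)

lemma norm2_le_iff:
  "\<not> archimedean v \<Longrightarrow> finite J \<Longrightarrow> norm2 k v J x \<le> c \<longleftrightarrow> 0 \<le> c \<and> (\<forall>j\<in>J. Cv_abs k v (x j) \<le> c)"
  by (simp add: norm2_def)

lemma norm2_arch: "archimedean v \<Longrightarrow> (norm2 k v J x)\<^sup>2 = (\<Sum>j\<in>J. (Cv_abs k v (x j))\<^sup>2)"
  by (simp add: norm2_def sum_nonneg)

text \<open>The euclidean and the maximum norm of a matrix are both determined by the norms of its
  rows. Together with \<open>norm2_cols\<close> this makes tensor products of isometries
  isometric.\<close>

lemma norm2_rows:
  assumes fin: "finite A" "finite B"
    and eq: "\<And>r. r \<in> A \<Longrightarrow> norm2 k v B (\<lambda>s\<in>B. x (r, s)) = norm2 k v B (\<lambda>s\<in>B. y (r, s))"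
  shows "norm2 k v (A \<times> B) x = norm2 k v (A \<times> B) y"
proof (cases "archimedean v")
  case True
  have "(\<Sum>p\<in>A \<times> B. (Cv_abs k v (z p))\<^sup>2) = (\<Sum>r\<in>A. (norm2 k v B (\<lambda>s\<in>B. z (r, s)))\<^sup>2)" for z
    by (simp add: norm2_arch[OF True] sum.cartesian_product)
  then show ?thesis using eq True by (simp add: norm2_def)
next
  case False
  have "norm2 k v (A \<times> B) z \<le> c \<longleftrightarrow> 0 \<le> c \<and> (\<forall>r\<in>A. norm2 k v B (\<lambda>s\<in>B. z (r, s)) \<le> c)" for z c
    using fin by (auto simp: norm2_le_iff[OF False])
  then have "norm2 k v (A \<times> B) x \<le> c \<longleftrightarrow> norm2 k v (A \<times> B) y \<le> c" for c using eq by simp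
  then show ?thesis by (metis order_antisym order_refl)
qed

lemma norm2_cols:
  assumes fin: "finite A" "finite B"
    and eq: "\<And>s. s \<in> B \<Longrightarrow> norm2 k v A (\<lambda>r\<in>A. x (r, s)) = norm2 k v A (\<lambda>r\<in>A. y (r, s))"
  shows "norm2 k v (A \<times> B) x = norm2 k v (A \<times> B) y"
proof (cases "archimedean v")
  case True
  have "(\<Sum>p\<in>A \<times> B. (Cv_abs k v (z p))\<^sup>2) = (\<Sum>s\<in>B. (norm2 k v A (\<lambda>r\<in>A. z (r, s)))\<^sup>2)" for z
  proof -
    have "(\<Sum>p\<in>A \<times> B. (Cv_abs k v (z p))\<^sup>2) = (\<Sum>r\<in>A. \<Sum>s\<in>B. (Cv_abs k v (z (r, s)))\<^sup>2)"
      by (simp add: sum.cartesian_product)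
    also have "\<dots> = (\<Sum>s\<in>B. \<Sum>r\<in>A. (Cv_abs k v (z (r, s)))\<^sup>2)" by (rule sum.swap)
    finally show ?thesis by (simp add: norm2_arch[OF True])
  qed
  then show ?thesis using eq True by (simp add: norm2_def)
next
  case False
  have "norm2 k v (A \<times> B) z \<le> c \<longleftrightarrow> 0 \<le> c \<and> (\<forall>s\<in>B. norm2 k v A (\<lambda>r\<in>A. z (r, s)) \<le> c)" for z c
    using fin by (auto simp: norm2_le_iff[OF False])
  then have "norm2 k v (A \<times> B) x \<le> c \<longleftrightarrow> norm2 k v (A \<times> B) y \<le> c" for c using eq by simp
  then show ?thesis by (metis order_antisym order_refl)
qed

lemma orthonormal_basis_norm2_eq:
  assumes "orthonormal_basis k v I N A b" "orthonormal_basis k v I N A b'"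
    "x \<in> vectors (Cv_field k v) A" "y \<in> vectors (Cv_field k v) A"
    "lin_comb (Cv_field k v) I A b x = lin_comb (Cv_field k v) I A b' y"
  shows "norm2 k v A x = norm2 k v A y"
  using assms by (metis orthonormal_basis_def)

text \<open>The bases are exchanged one at a time. The coordinates \<open>z\<close> of the tensor in
  the mixed pair \<open>b'\<close>, \<open>c\<close> have the norm of \<open>x\<close>, by comparing
  columns, and that of \<open>y\<close>, by comparing rows.\<close>

lemma tensor_norm2_unique:
  fixes A B :: "nat set"
  assumes "field (Cv_field k v)"
    and b: "orthonormal_basis k v I N A b" "orthonormal_basis k v I N A b'"
    and c: "orthonormal_basis k v J M B c" "orthonormal_basis k v J M B c'"
    and x: "x \<in> vectors (Cv_field k v) (A \<times> B)" "y \<in> vectors (Cv_field k v) (A \<times> B)"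
    and eq: "lin_comb (Cv_field k v) (I \<times> J) (A \<times> B) (tensor_family (Cv_field k v) I J b c) x =
      lin_comb (Cv_field k v) (I \<times> J) (A \<times> B) (tensor_family (Cv_field k v) I J b' c') y"
  shows "norm2 k v (A \<times> B) x = norm2 k v (A \<times> B) y"
proof -
  define R where "R = Cv_field k v"
  interpret R: field R unfolding R_def by fact
  have fin: "finite A" "finite B"
    using b c by (auto simp: orthonormal_basis_def is_basis_def)
  have vb: "b r \<in> vectors R I" "b' r \<in> vectors R I" if "r \<in> A" for r
    using b that by (auto simp: orthonormal_basis_def is_basis_def R_def)
  have vc: "c s \<in> vectors R J" "c' s \<in> vectors R J" if "s \<in> B" for s
    using c that by (auto simp: orthonormal_basis_def is_basis_def R_def)
  have bb: "bij_betw (lin_comb R I A b) (A \<rightarrow>\<^sub>E carrier R) (I \<rightarrow>\<^sub>E carrier R)"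
    "bij_betw (lin_comb R I A b') (A \<rightarrow>\<^sub>E carrier R) (I \<rightarrow>\<^sub>E carrier R)"
    using b by (auto simp: orthonormal_basis_def is_basis_def vectors_def R_def)
  have bc: "bij_betw (lin_comb R J B c) (B \<rightarrow>\<^sub>E carrier R) (J \<rightarrow>\<^sub>E carrier R)"
    "bij_betw (lin_comb R J B c') (B \<rightarrow>\<^sub>E carrier R) (J \<rightarrow>\<^sub>E carrier R)"
    using c by (auto simp: orthonormal_basis_def is_basis_def vectors_def R_def)
  have V: "x \<in> A \<times> B \<rightarrow>\<^sub>E carrier R" "y \<in> A \<times> B \<rightarrow>\<^sub>E carrier R" using x by (auto simp: vectors_def R_def)
  have xV: "x \<in> vectors R (A \<times> B)" "y \<in> vectors R (A \<times> B)" using x by (auto simp: R_def)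
  let ?C = "map_cols (lin_comb R I A b) I B A" and ?C' = "map_cols (lin_comb R I A b') I B A"
  have "?C x \<in> I \<times> B \<rightarrow>\<^sub>E carrier R"
    using bij_betw_apply[OF bij_betw_map_cols[OF bb(1)] V(1)] .
  then have "?C x \<in> ?C' ` (A \<times> B \<rightarrow>\<^sub>E carrier R)"
    using bij_betw_imp_surj_on[OF bij_betw_map_cols[OF bb(2), of B]] by simp
  then obtain z where z: "z \<in> A \<times> B \<rightarrow>\<^sub>E carrier R" "?C' z = ?C x"
    by (elim imageE) simp
  have zV: "z \<in> vectors R (A \<times> B)" using z(1) by (simp add: vectors_def)
  have "norm2 k v (A \<times> B) z = norm2 k v (A \<times> B) x"
  proof (rule norm2_cols[OF fin])
    fix s assume s: "s \<in> B"
    show "norm2 k v A (\<lambda>r\<in>A. z (r, s)) = norm2 k v A (\<lambda>r\<in>A. x (r, s))"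
    proof (rule orthonormal_basis_norm2_eq[OF b(2,1)])
      show "(\<lambda>r\<in>A. z (r, s)) \<in> vectors (Cv_field k v) A" "(\<lambda>r\<in>A. x (r, s)) \<in> vectors (Cv_field k v) A"
        using z(1) V(1) s by (auto simp: vectors_def R_def)
      have "lin_comb R I A b' (\<lambda>r\<in>A. z (r, s)) i = lin_comb R I A b (\<lambda>r\<in>A. x (r, s)) i" if "i \<in> I" for i
        using fun_cong[OF z(2), of "(i, s)"] s that by (simp add: map_cols_def)
      then show "lin_comb (Cv_field k v) I A b' (\<lambda>r\<in>A. z (r, s)) = lin_comb (Cv_field k v) I A b (\<lambda>r\<in>A. x (r, s))"
        by (intro extensionalityI[of _ I]) (auto simp: lin_comb_def R_def)
    qed
  qed
  moreover have "norm2 k v (A \<times> B) z = norm2 k v (A \<times> B) y"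
  proof (rule norm2_rows[OF fin])
    let ?W = "map_rows (lin_comb R J B c) A J B" and ?W' = "map_rows (lin_comb R J B c') A J B"
    have "map_cols (lin_comb R I A b') I J A (?W z) = map_cols (lin_comb R I A b') I J A (?W' y)"
    proof -
      have "map_cols (lin_comb R I A b') I J A (?W z) = map_rows (lin_comb R J B c) I J B (?C x)"
        using R.lin_comb_tensor[of A B b' I c J z] fin vb vc zV z(2) by simp
      also have "\<dots> = map_cols (lin_comb R I A b') I J A (?W' y)"
        using R.lin_comb_tensor(2)[of A B b I c J x] R.lin_comb_tensor(1)[of A B b' I c' J y] fin vb vc xV eq
        by (simp add: R_def)
      finally show ?thesis .
    qed
    moreover have "?W z \<in> A \<times> J \<rightarrow>\<^sub>E carrier R" "?W' y \<in> A \<times> J \<rightarrow>\<^sub>E carrier R"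
      using bij_betw_apply[OF bij_betw_map_rows[OF bc(1)] z(1)] bij_betw_apply[OF bij_betw_map_rows[OF bc(2)] V(2)] .
    ultimately have W: "?W z = ?W' y"
      using bij_betw_map_cols[OF bb(2), of J] unfolding bij_betw_def inj_on_def by blast
    fix r assume r: "r \<in> A"
    show "norm2 k v B (\<lambda>s\<in>B. z (r, s)) = norm2 k v B (\<lambda>s\<in>B. y (r, s))"
    proof (rule orthonormal_basis_norm2_eq[OF c])
      show "(\<lambda>s\<in>B. z (r, s)) \<in> vectors (Cv_field k v) B" "(\<lambda>s\<in>B. y (r, s)) \<in> vectors (Cv_field k v) B"
        using z(1) V(2) r by (auto simp: vectors_def R_def)
      have "lin_comb R J B c (\<lambda>s\<in>B. z (r, s)) j = lin_comb R J B c' (\<lambda>s\<in>B. y (r, s)) j" if "j \<in> J" for j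
        using fun_cong[OF W, of "(r, j)"] r that by (simp add: map_rows_def)
      then show "lin_comb (Cv_field k v) J B c (\<lambda>s\<in>B. z (r, s)) = lin_comb (Cv_field k v) J B c' (\<lambda>s\<in>B. y (r, s))"
        by (intro extensionalityI[of _ J]) (auto simp: lin_comb_def R_def)
    qed
  qed
  ultimately show ?thesis by simp
qed

text \<open>The norm read off from the given pair of orthonormal bases works for every pair by
  \<open>tensor_norm2_unique\<close>, and a competitor has to agree with it on the given pair; so
  the description in \<open>tensor_norm\<close> determines it.\<close>

lemma tensor_norm_eq:
  assumes fd: "field (Cv_field k v)"
    and b: "orthonormal_basis k v (index_set E) (bundle_norm E v) {..<bundle_dim E} b"
    and c: "orthonormal_basis k v (index_set F) (bundle_norm F v) {..<bundle_dim F} c"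
    and x: "x \<in> vectors (Cv_field k v) ({..<bundle_dim E} \<times> {..<bundle_dim F})"
  shows "tensor_norm k E F v (lin_comb (Cv_field k v) (index_set E \<times> index_set F) ({..<bundle_dim E} \<times> {..<bundle_dim F})
      (tensor_family (Cv_field k v) (index_set E) (index_set F) b c) x) =
    norm2 k v ({..<bundle_dim E} \<times> {..<bundle_dim F}) x"
proof -
  define R where "R = Cv_field k v"
  interpret R: field R unfolding R_def by fact
  define IJ where "IJ = index_set E \<times> index_set F"
  define AB where "AB = {..<bundle_dim E} \<times> {..<bundle_dim F}"
  define ONE where "ONE = orthonormal_basis k v (index_set E) (bundle_norm E v) {..<bundle_dim E}"
  define ONF where "ONF = orthonormal_basis k v (index_set F) (bundle_norm F v) {..<bundle_dim F}"
  define T where "T b c = lin_comb R IJ AB (tensor_family R (index_set E) (index_set F) b c)" for b c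
  define N where "N = (\<lambda>z\<in>vectors R IJ. norm2 k v AB (inv_into (vectors R AB) (T b c) z))"
  have basis: "is_basis R IJ AB (tensor_family R (index_set E) (index_set F) b' c')" if "ONE b'" "ONF c'" for b' c'
    unfolding IJ_def AB_def
    by (rule R.is_basis_tensor) (use that in \<open>auto simp: ONE_def ONF_def orthonormal_basis_def R_def\<close>)
  have bij: "bij_betw (T b c) (vectors R AB) (vectors R IJ)"
    using basis[of b c] b c by (simp add: is_basis_def T_def ONE_def ONF_def)
  have ind: "norm2 k v AB x = norm2 k v AB y" if "ONE b'" "ONF c'" "x \<in> vectors R AB" "y \<in> vectors R AB" "T b c x = T b' c' y" for b' c' x y
    using tensor_norm2_unique[OF fd b _ c, of b' c' x y] that
    unfolding ONE_def ONF_def AB_def T_def R_def IJ_def by simp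
  have Nt: "N (T b' c' y) = norm2 k v AB y" if bc': "ONE b'" "ONF c'" and y: "y \<in> vectors R AB" for b' c' y
  proof -
    have "T b' c' y \<in> vectors R IJ"
      using basis[OF bc'] bij_betw_apply[OF _ y] unfolding is_basis_def T_def by blast
    moreover from this have "inv_into (vectors R AB) (T b c) (T b' c' y) \<in> vectors R AB"
      "T b c (inv_into (vectors R AB) (T b c) (T b' c' y)) = T b' c' y"
      using bij_betw_imp_surj_on[OF bij] by (simp_all add: inv_into_into f_inv_into_f)
    ultimately show ?thesis using ind[OF bc' _ y] by (simp add: N_def)
  qed
  have "tensor_norm k E F v = N"
    unfolding tensor_norm_def R_def[symmetric] IJ_def[symmetric] AB_def[symmetric] ONE_def[symmetric] ONF_def[symmetric]
  proof (rule the_equality)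
    show "N \<in> extensional (vectors R IJ) \<and> (\<forall>b c. ONE b \<and> ONF c \<longrightarrow>
        orthonormal_basis k v IJ N AB (tensor_family R (index_set E) (index_set F) b c))"
      using basis Nt by (auto simp: orthonormal_basis_def R_def[symmetric] T_def N_def)
    fix M assume M: "M \<in> extensional (vectors R IJ) \<and> (\<forall>b c. ONE b \<and> ONF c \<longrightarrow>
        orthonormal_basis k v IJ M AB (tensor_family R (index_set E) (index_set F) b c))"
    then have "M (T b c y) = norm2 k v AB y" if "y \<in> vectors R AB" for y
      using that b c by (auto simp: orthonormal_basis_def R_def[symmetric] T_def ONE_def[symmetric] ONF_def[symmetric])
    then have "M (T b c y) = N (T b c y)" if "y \<in> vectors R AB" for y
      using that Nt b c by (simp add: ONE_def ONF_def)
    moreover have "p \<in> T b c ` vectors R AB" if "p \<in> vectors R IJ" for p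
      using that bij_betw_imp_surj_on[OF bij] by simp
    ultimately have "M p = N p" if "p \<in> vectors R IJ" for p using that by blast
    then show "M = N"
      using M by (intro extensionalityI[of _ "vectors R IJ"]) (auto simp: N_def)
  qed
  then show ?thesis
    using Nt[of b c x] b c x unfolding T_def R_def IJ_def AB_def ONE_def ONF_def by simp
qed

section \<open>The adele ring\<close>

lemma kv_field_field: "number_field k \<Longrightarrow> v \<in> places k \<Longrightarrow> field (kv_field k v)"
  by (intro number_field_place.kv_is_field number_field_place.intro)

lemma adele_carrierI:
  assumes "\<And>v. v \<in> places k \<Longrightarrow> x v \<in> carrier (kv_field k v)"
    and "finite B" "\<And>v. v \<in> places k \<Longrightarrow> \<not> archimedean v \<Longrightarrow> kv_abs v (x v) > 1 \<Longrightarrow> v \<in> B"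
  shows "(\<lambda>v\<in>places k. x v) \<in> carrier (adele_ring k)"
proof -
  have "finite {v \<in> places k. \<not> archimedean v \<and> kv_abs v ((\<lambda>v\<in>places k. x v) v) > 1}"
    by (rule finite_subset[OF _ assms(2)]) (use assms(3) in auto)
  then show ?thesis using assms(1) by (auto simp: adele_ring_def)
qed

lemma adele_carrierD:
  assumes "x \<in> carrier (adele_ring k)"
  shows "v \<in> places k \<Longrightarrow> x v \<in> carrier (kv_field k v)" "x \<in> extensional (places k)"
    "finite {v \<in> places k. \<not> archimedean v \<and> kv_abs v (x v) > 1}"
  using assms by (auto simp: adele_ring_def PiE_def)

lemma adele_ring_simps:
  "x \<otimes>\<^bsub>adele_ring k\<^esub> y = (\<lambda>v\<in>places k. x v \<otimes>\<^bsub>kv_field k v\<^esub> y v)"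
  "x \<oplus>\<^bsub>adele_ring k\<^esub> y = (\<lambda>v\<in>places k. x v \<oplus>\<^bsub>kv_field k v\<^esub> y v)"
  "\<one>\<^bsub>adele_ring k\<^esub> = (\<lambda>v\<in>places k. \<one>\<^bsub>kv_field k v\<^esub>)"
  "\<zero>\<^bsub>adele_ring k\<^esub> = (\<lambda>v\<in>places k. \<zero>\<^bsub>kv_field k v\<^esub>)"
  by (auto simp: adele_ring_def)

lemma adele_closed:
  assumes k: "number_field k" and x: "x \<in> carrier (adele_ring k)" and y: "y \<in> carrier (adele_ring k)"
  shows "x \<otimes>\<^bsub>adele_ring k\<^esub> y \<in> carrier (adele_ring k)" "x \<oplus>\<^bsub>adele_ring k\<^esub> y \<in> carrier (adele_ring k)"
proof -
  define B where "B = {v \<in> places k. \<not> archimedean v \<and> kv_abs v (x v) > 1} \<union> {v \<in> places k. \<not> archimedean v \<and> kv_abs v (y v) > 1}"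
  have B: "finite B" using adele_carrierD(3)[OF x] adele_carrierD(3)[OF y] by (simp add: B_def)
  have inB: "v \<in> B" if v: "v \<in> places k" "\<not> archimedean v" "\<not> (kv_abs v (x v) \<le> 1 \<and> kv_abs v (y v) \<le> 1)" for v
    using v by (auto simp: B_def)
  have in_x: "x v \<in> carrier (kv_field k v)" and in_y: "y v \<in> carrier (kv_field k v)" if "v \<in> places k" for v
    using adele_carrierD(1)[OF x that] adele_carrierD(1)[OF y that] .
  show "x \<otimes>\<^bsub>adele_ring k\<^esub> y \<in> carrier (adele_ring k)"
    unfolding adele_ring_simps
  proof (rule adele_carrierI[OF _ B])
    fix v assume v: "v \<in> places k"
    interpret P: number_field_place k v by (intro number_field_place.intro k v)
    interpret V: valued_field "kv_field k v" "kv_abs v" by (rule P.kv_valued)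
    show "x v \<otimes>\<^bsub>kv_field k v\<^esub> y v \<in> carrier (kv_field k v)" using in_x[OF v] in_y[OF v] by simp
    assume "\<not> archimedean v" and gt: "1 < kv_abs v (x v \<otimes>\<^bsub>kv_field k v\<^esub> y v)"
    then show "v \<in> B"
      using V.v_mult[OF in_x[OF v] in_y[OF v]] V.v_nonneg[OF in_x[OF v]] V.v_nonneg[OF in_y[OF v]]
      by (intro inB[OF v]) (auto dest: mult_le_one)
  qed
  show "x \<oplus>\<^bsub>adele_ring k\<^esub> y \<in> carrier (adele_ring k)"
    unfolding adele_ring_simps
  proof (rule adele_carrierI[OF _ B])
    fix v assume v: "v \<in> places k"
    interpret P: number_field_place k v by (intro number_field_place.intro k v)
    interpret V: valued_field "kv_field k v" "kv_abs v" by (rule P.kv_valued)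
    show "x v \<oplus>\<^bsub>kv_field k v\<^esub> y v \<in> carrier (kv_field k v)" using in_x[OF v] in_y[OF v] by simp
    assume na: "\<not> archimedean v" and gt: "1 < kv_abs v (x v \<oplus>\<^bsub>kv_field k v\<^esub> y v)"
    then show "v \<in> B" using P.kv_ultrametric[OF na in_x[OF v] in_y[OF v]] by (intro inB[OF v]) auto
  qed
qed

lemma adele_abelian_monoid:
  assumes k: "number_field k"
  shows "abelian_monoid (adele_ring k)"
proof -
  have z: "\<zero>\<^bsub>adele_ring k\<^esub> \<in> carrier (adele_ring k)"
    unfolding adele_ring_simps
  proof (rule adele_carrierI[of _ _ "{}"])
    fix v assume v: "v \<in> places k"
    interpret P: number_field_place k v by (intro number_field_place.intro k v)
    interpret V: valued_field "kv_field k v" "kv_abs v" by (rule P.kv_valued)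
    show "\<zero>\<^bsub>kv_field k v\<^esub> \<in> carrier (kv_field k v)" by simp
    show "1 < kv_abs v \<zero>\<^bsub>kv_field k v\<^esub> \<Longrightarrow> v \<in> {}" by (simp add: V.v_0)
  qed simp
  show ?thesis
  proof (rule abelian_monoidI)
    fix x y z assume x: "x \<in> carrier (adele_ring k)" and y: "y \<in> carrier (adele_ring k)" and z: "z \<in> carrier (adele_ring k)"
    have c: "abelian_monoid (kv_field k v)" if "v \<in> places k" for v
      using kv_field_field[OF k that] by (metis abelian_group.axioms(1) field.is_ring ring_def)
    note xyz = adele_carrierD(1)[OF x] adele_carrierD(1)[OF y] adele_carrierD(1)[OF z]
    show "(x \<oplus>\<^bsub>adele_ring k\<^esub> y) \<oplus>\<^bsub>adele_ring k\<^esub> z = x \<oplus>\<^bsub>adele_ring k\<^esub> (y \<oplus>\<^bsub>adele_ring k\<^esub> z)"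
      unfolding adele_ring_simps
      by (intro restrict_ext) (use abelian_monoid.a_assoc[OF c] xyz in simp)
    show "x \<oplus>\<^bsub>adele_ring k\<^esub> y = y \<oplus>\<^bsub>adele_ring k\<^esub> x"
      unfolding adele_ring_simps
      by (intro restrict_ext) (use abelian_monoid.a_comm[OF c] xyz in simp)
    show "\<zero>\<^bsub>adele_ring k\<^esub> \<oplus>\<^bsub>adele_ring k\<^esub> x = x"
      unfolding adele_ring_simps
      by (rule extensionalityI[of _ "places k"])
         (use abelian_monoid.l_zero[OF c] xyz(1) adele_carrierD(2)[OF x] in auto)
  qed (use z adele_closed(2)[OF k] in auto)
qed

text \<open>Lets identities of adelic matrices be checked in each \<open>kv_field k v\<close>
  separately.\<close>

lemma finsum_adele:
  assumes k: "number_field k" and fin: "finite A" and f: "\<And>i. i \<in> A \<Longrightarrow> f i \<in> carrier (adele_ring k)"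
  shows "finsum (adele_ring k) f A = (\<lambda>v\<in>places k. finsum (kv_field k v) (\<lambda>i. f i v) A)"
  using fin f
proof (induction A rule: finite_induct)
  case empty
  interpret abelian_monoid "adele_ring k" by (rule adele_abelian_monoid[OF k])
  have "finsum (kv_field k v) g {} = \<zero>\<^bsub>kv_field k v\<^esub>" if "v \<in> places k" for v and g :: "'a \<Rightarrow> kv"
  proof -
    interpret field "kv_field k v" by (rule kv_field_field[OF k that])
    show ?thesis by simp
  qed
  then show ?case by (simp add: adele_ring_simps cong: restrict_cong)
next
  case (insert a A)
  interpret abelian_monoid "adele_ring k" by (rule adele_abelian_monoid[OF k])
  have "finsum (adele_ring k) f (insert a A) = f a \<oplus>\<^bsub>adele_ring k\<^esub> finsum (adele_ring k) f A"
    using insert by (intro finsum_insert) auto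
  also have "\<dots> = (\<lambda>v\<in>places k. f a v \<oplus>\<^bsub>kv_field k v\<^esub> finsum (kv_field k v) (\<lambda>i. f i v) A)"
    using insert by (auto simp: adele_ring_simps intro!: restrict_ext)
  also have "\<dots> = (\<lambda>v\<in>places k. finsum (kv_field k v) (\<lambda>i. f i v) (insert a A))"
  proof (rule restrict_ext)
    fix v assume v: "v \<in> places k"
    interpret V: field "kv_field k v" by (rule kv_field_field[OF k v])
    show "f a v \<oplus>\<^bsub>kv_field k v\<^esub> finsum (kv_field k v) (\<lambda>i. f i v) A = finsum (kv_field k v) (\<lambda>i. f i v) (insert a A)"
      using insert adele_carrierD(1)[OF _ v] by (intro V.finsum_insert[symmetric]) auto
  qed
  finally show ?case .
qed

section \<open>Elementary upper triangular matrices\<close>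

text \<open>The identity with upper left corner ((1, c), (0, d)): only the first two coordinates of
  the bundles are modified.\<close>

definition umat :: "('a, 'b) ring_scheme \<Rightarrow> 'a \<Rightarrow> 'a \<Rightarrow> nat \<Rightarrow> nat \<Rightarrow> 'a" where
  "umat R d c i j = (if i = j then if i = 1 then d else \<one>\<^bsub>R\<^esub> else if i = 0 \<and> j = 1 then c else \<zero>\<^bsub>R\<^esub>)"

definition umul :: "('a, 'b) ring_scheme \<Rightarrow> 'a \<Rightarrow> 'a \<Rightarrow> (nat \<Rightarrow> 'a) \<Rightarrow> nat \<Rightarrow> 'a" where
  "umul R d c x i = (if i = 0 then x 0 \<oplus>\<^bsub>R\<^esub> c \<otimes>\<^bsub>R\<^esub> x 1 else if i = 1 then d \<otimes>\<^bsub>R\<^esub> x 1 else x i)"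

context ring
begin

lemma umat_closed: "d \<in> carrier R \<Longrightarrow> c \<in> carrier R \<Longrightarrow> umat R d c i j \<in> carrier R"
  by (simp add: umat_def)

lemma finsum_umat:
  assumes n: "n \<ge> 2" "i < n" and c: "d \<in> carrier R" "c \<in> carrier R" and x: "\<And>l. l < n \<Longrightarrow> x l \<in> carrier R"
  shows "(\<Oplus>l\<in>{..<n}. umat R d c i l \<otimes> x l) = umul R d c x i"
proof -
  have cl: "(\<lambda>l. umat R d c i l \<otimes> x l) \<in> {..<n} \<rightarrow> carrier R"
    using umat_closed[OF c] x by auto
  show ?thesis
  proof (cases "i = 0")
    case True
    have "(\<Oplus>l\<in>{..<n}. umat R d c i l \<otimes> x l) = (\<Oplus>l\<in>{0, 1}. umat R d c i l \<otimes> x l)"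
      by (rule add.finprod_mono_neutral_cong_left[symmetric]) (use n True x cl in \<open>auto simp: umat_def\<close>)
    also have "\<dots> = umul R d c x i"
      using True n x c by (subst finsum_insert) (auto simp: umat_def umul_def)
    finally show ?thesis .
  next
    case False
    have "(\<Oplus>l\<in>{..<n}. umat R d c i l \<otimes> x l) = (\<Oplus>l\<in>{i}. umat R d c i l \<otimes> x l)"
      by (rule add.finprod_mono_neutral_cong_left[symmetric]) (use n False x cl in \<open>auto simp: umat_def\<close>)
    also have "\<dots> = umul R d c x i"
      using False n x c by (subst finsum_insert) (auto simp: umat_def umul_def)
    finally show ?thesis .
  qed
qed

lemma umul_closed: "n \<ge> 2 \<Longrightarrow> i < n \<Longrightarrow> d \<in> carrier R \<Longrightarrow> c \<in> carrier R \<Longrightarrow> (\<And>l. l < n \<Longrightarrow> x l \<in> carrier R) \<Longrightarrow>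
    umul R d c x i \<in> carrier R"
  by (simp add: umul_def)

text \<open>The conditions in \<open>inv\<close> say that the corners ((1, c), (0, d)) and ((1, c'),
  (0, d')) multiply to the identity.\<close>

lemma umul_inverse:
  assumes n: "n \<ge> 2" "i < n" and c: "d \<in> carrier R" "c \<in> carrier R" "d' \<in> carrier R" "c' \<in> carrier R"
    and x: "\<And>l. l < n \<Longrightarrow> x l \<in> carrier R" and inv: "d \<otimes> d' = \<one>" "c' \<oplus> c \<otimes> d' = \<zero>"
    and y: "\<And>l. l < n \<Longrightarrow> y l = umul R d' c' x l"
  shows "umul R d c y i = x i"
proof -
  have x': "x 0 \<in> carrier R" "x 1 \<in> carrier R" and y': "y 0 = x 0 \<oplus> c' \<otimes> x 1" "y 1 = d' \<otimes> x 1"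
    using x[of 0] x[of 1] y[of 0] y[of 1] n by (auto simp: umul_def)
  have "x 0 \<oplus> c' \<otimes> x 1 \<oplus> c \<otimes> (d' \<otimes> x 1) = x 0 \<oplus> (c' \<oplus> c \<otimes> d') \<otimes> x 1"
    using x' c by (simp add: l_distr m_assoc a_assoc)
  moreover have "d \<otimes> (d' \<otimes> x 1) = (d \<otimes> d') \<otimes> x 1" using x' c by (simp add: m_assoc)
  ultimately show ?thesis
    using n x' y' y[of i] c inv by (simp add: umul_def)
qed

end

lemma umat_hom:
  assumes "subf k" "field S" "h \<in> ring_hom (field_on k) S"
  shows "h (umat (field_on k) d c i j) = umat S (h d) (h c) i j"
  using j_simps(4,5)[OF assms(2,1,3) ring.ring_simprules(2)] assms(2)
  by (auto simp: umat_def field_def domain_def cring_def)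

lemma umul_hom:
  assumes "subf k" "field S" "h \<in> ring_hom (field_on k) S" "d \<in> k" "c \<in> k" "n \<ge> 2" "i < n"
    "\<And>l. l < n \<Longrightarrow> x l \<in> k" "\<And>l. l < n \<Longrightarrow> y l = h (x l)"
  shows "umul S (h d) (h c) y i = h (umul (field_on k) d c x i)"
proof -
  have z: "\<zero>\<^bsub>S\<^esub> \<in> carrier S" using assms(2) by (simp add: field_def domain_def cring_def ring.ring_simprules(2))
  have "x 0 \<in> k" "x 1 \<in> k" using assms by auto
  moreover have "c * x 1 \<in> k" using subfD(4)[OF assms(1,5)] calculation by simp
  ultimately show ?thesis
    using assms(4-9) j_simps(2,3)[OF assms(2,1,3) z] by (simp add: umul_def)
qed

section \<open>The bundles\<close>

lemma place_rat_le_1: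
  assumes "w \<in> places K" "\<not> archimedean w"
  shows "w (of_int a) \<le> 1"
proof -
  obtain p where p: "prime p" "\<And>q. w (of_rat q) = padic_abs p q" using assms by (elim place_cases) auto
  then show ?thesis using p(2)[of "of_int a"] padic_abs_of_int_le_1[OF p(1), of a] by simp
qed

lemma power_le_1_imp_le_1: "(x::real) ^ n \<le> 1 \<Longrightarrow> n > 0 \<Longrightarrow> x \<le> 1"
  using one_less_power[of x n] by linarith

locale twisted_bundle =
  fixes k :: "complex set" and \<rho> \<omega> :: complex
  assumes nk: "number_field k" and rho: "\<rho> \<in> k" "\<rho> ^ 4 = 2" and omega: "\<omega> \<in> k" "\<omega>\<^sup>2 + \<omega> + 1 = 0"
begin

definition \<theta> where "\<theta> = 2 * \<omega> + 1"

lemma sk: "subf k" by (rule number_field_subf[OF nk])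

lemma theta: "\<theta> \<in> k" "\<theta>\<^sup>2 = - 3"
proof -
  show "\<theta> \<in> k" using subfD[OF sk] omega(1) subf_numeral[OF sk] by (simp add: \<theta>_def)
  have "\<theta>\<^sup>2 = 4 * (\<omega>\<^sup>2 + \<omega> + 1) - 3" by (simp add: \<theta>_def power2_eq_square algebra_simps)
  then show "\<theta>\<^sup>2 = - 3" using omega(2) by simp
qed

lemma imaginary: "totally_imaginary k"
  unfolding totally_imaginary_def
proof (intro bexI[OF _ omega(1)] ballI notI)
  fix \<tau> assume t: "\<tau> \<in> embs \<rat> k" and im: "Im (\<tau> \<omega>) = 0"
  note s = emb_simps[OF subf_Rats sk Rats_subset[OF sk] t] embsD(2,3)[OF t]
  have "\<tau> (\<omega> * \<omega> + \<omega> + 1) = \<tau> \<omega> * \<tau> \<omega> + \<tau> \<omega> + 1"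
    using s subfD[OF sk] omega(1) by simp
  then have "\<tau> \<omega> * \<tau> \<omega> + \<tau> \<omega> + 1 = 0" using omega(2) s(1) by (simp add: power2_eq_square)
  then have "Re (\<tau> \<omega> * \<tau> \<omega> + \<tau> \<omega> + 1) = 0" by simp
  then have "Re (\<tau> \<omega>) * Re (\<tau> \<omega>) + Re (\<tau> \<omega>) + 1 = 0" using im by simp
  moreover have "0 \<le> (Re (\<tau> \<omega>) + 1/2)\<^sup>2" by simp
  ultimately show False by (simp add: power2_eq_square algebra_simps)
qed

text \<open>At the archimedean places and at the places above \<open>2\<close> the second coordinate is rescaled by a
  power of \<open>\<rho>\<close>; at the places above \<open>3\<close> the unit ball consists of the \<open>x\<close> for which all three numbers
  \<open>x\<^sub>0 - \<omega>\<^sup>i x\<^sub>1\<close> are integral (as \<open>1 - \<omega>\<close> is a unit times \<open>\<theta>\<close>).\<close>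

definition scale :: "place \<Rightarrow> complex" where
  "scale v = (if archimedean v then \<rho>\<^sup>2 else if v 2 < 1 then \<rho> else if v 3 < 1 then \<theta> else 1)"

text \<open>Above 3 the first coordinate becomes \<open>x 0 - x 1\<close>; the differences with
  \<open>\<omega>\<close> and \<open>\<omega>\<^sup>2\<close> deviate from it by something of the
  size of the second coordinate \<open>\<theta> * x 1\<close>.\<close>

definition shear :: "place \<Rightarrow> complex" where
  "shear v = (if \<not> archimedean v \<and> \<not> v 2 < 1 \<and> v 3 < 1 then 1 else 0)"

lemma scale: "scale v \<in> k" "scale v \<noteq> 0"
proof -
  show "scale v \<in> k" using rho(1) theta(1) subfD[OF sk] by (simp add: scale_def)
  have "\<rho> \<noteq> 0" "\<theta> \<noteq> 0" using rho(2) theta(2) by auto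
  then show "scale v \<noteq> 0" by (simp add: scale_def)
qed

lemma shear: "shear v \<in> k" "- shear v \<in> k" "1 / scale v \<in> k" "shear v / scale v \<in> k"
proof -
  show "shear v \<in> k" using subfD[OF sk] by (simp add: shear_def)
  then show "- shear v \<in> k" "1 / scale v \<in> k" "shear v / scale v \<in> k"
    using scale(1) subfD(2,7,8)[OF sk] by auto
qed

text \<open>The matrix product is written out so that the norm has literally the form required by
  \<open>adelic_hermitian_bundle\<close> for the standard basis; the lemma
  \<open>bundle_norm\<close> gives the short form.\<close>

definition twist :: "nat \<Rightarrow> nat herm_bundle" where
  "twist n = \<lparr>index_set = {..<n}, bundle_norm = (\<lambda>v z. norm2 k v {..<n}
     (\<lambda>i\<in>{..<n}. \<Oplus>\<^bsub>Cv_field k v\<^esub>j\<in>{..<n}. k_to_Cv k v (umat (field_on k) (scale v) (- shear v) i j) \<otimes>\<^bsub>Cv_field k v\<^esub> z j))\<rparr>"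

lemma twist_simps [simp]: "index_set (twist n) = {..<n}" "bundle_dim (twist n) = n"
  by (auto simp: twist_def bundle_dim_def)

lemma imaginary_place: "v \<in> places k \<Longrightarrow> imaginary_place k v"
  by (intro imaginary_place.intro number_field_place.intro imaginary_place_axioms.intro nk imaginary)

lemma Cv_field: "v \<in> places k \<Longrightarrow> field (Cv_field k v)"
  by (rule imaginary_place.Cv_is_field[OF imaginary_place])

lemma Cv_hom: "v \<in> places k \<Longrightarrow> k_to_Cv k v \<in> ring_hom (field_on k) (Cv_field k v)"
  by (rule imaginary_place.k_to_Cv[OF imaginary_place])

lemma bundle_norm:
  assumes v: "v \<in> places k" and n: "n \<ge> 2" and z: "\<And>l. l < n \<Longrightarrow> z l \<in> carrier (Cv_field k v)"
  shows "bundle_norm (twist n) v z =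
    norm2 k v {..<n} (umul (Cv_field k v) (k_to_Cv k v (scale v)) (k_to_Cv k v (- shear v)) z)"
proof -
  interpret V: field "Cv_field k v" by (rule Cv_field[OF v])
  have "k_to_Cv k v x \<in> carrier (Cv_field k v)" if "x \<in> k" for x
    using ring_hom_closed[OF Cv_hom[OF v]] that by simp
  note h = this[OF scale(1)] this[OF shear(2)]
  show ?thesis
    by (simp add: twist_def umat_hom[OF sk V.field_axioms Cv_hom[OF v]])
       (intro norm2_cong, simp add: V.finsum_umat[OF n _ h z])
qed

lemma unit_lin_comb:
  assumes "field R" "finite I" "x \<in> vectors R I" "\<And>j i. j \<in> I \<Longrightarrow> i \<in> I \<Longrightarrow> e j i = (if i = j then \<one>\<^bsub>R\<^esub> else \<zero>\<^bsub>R\<^esub>)"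
  shows "lin_comb R I I e x = x"
proof (rule extensionalityI[of _ I])
  interpret R: field R by fact
  have xc: "x j \<in> carrier R" if "j \<in> I" for j using assms(3) that by (auto simp: vectors_def)
  fix i assume i: "i \<in> I"
  have "(\<Oplus>\<^bsub>R\<^esub>j\<in>{i}. x j) = (\<Oplus>\<^bsub>R\<^esub>j\<in>I. x j \<otimes>\<^bsub>R\<^esub> e j i)"
    by (rule R.add.finprod_mono_neutral_cong_left) (use assms(2,4) xc i in auto)
  then show "lin_comb R I I e x i = x i" using i xc[OF i] by (simp add: lin_comb_def)
qed (use assms(3) in \<open>auto simp: lin_comb_def vectors_def PiE_def\<close>)

lemma places_le_1:
  assumes v: "v \<in> places k" "\<not> archimedean v"
  shows "v \<rho> \<le> 1" "v \<theta> \<le> 1" "v (scale v) \<le> 1" "v (shear v) \<le> 1"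
proof -
  note a = place_absv[OF v(1)]
  have "v \<rho> ^ 4 = v 2" using absv_power[OF sk a rho(1), of 4] rho(2) by simp
  then show r: "v \<rho> \<le> 1" using place_rat_le_1[OF v, of 2] by (simp add: power_le_1_imp_le_1[of _ 4])
  have "(v \<theta>)\<^sup>2 = v (- 3)" using absv_power[OF sk a theta(1), of 2] theta(2) by simp
  then show t: "v \<theta> \<le> 1" using place_rat_le_1[OF v, of "- 3"] by (simp add: power_le_1_imp_le_1[of _ 2])
  show "v (scale v) \<le> 1" "v (shear v) \<le> 1"
    using r t v(2) absv_1[OF sk a] absv_0[OF sk a] by (auto simp: scale_def shear_def)
qed

text \<open>The entries of the matrices are integral at all finite places. Those of the inverses can
  fail to be so only above 2 and 3, which are finitely many places since 2 and 3 have value 1 at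
  almost all of them.\<close>

lemma adelic:
  assumes n: "n \<ge> 2"
  shows "adelic_hermitian_bundle k (twist n)"
proof -
  define e where "e = (\<lambda>j::nat. \<lambda>i\<in>{..<n}. if i = j then 1 else 0 :: complex)"
  define m where "m v = umat (field_on k) (scale v) (- shear v)" for v
  define m' where "m' v = umat (field_on k) (1 / scale v) (shear v / scale v)" for v
  define a where "a i j = (\<lambda>v\<in>places k. k_to_kv k v (m v i j))" for i j
  define a' where "a' i j = (\<lambda>v\<in>places k. k_to_kv k v (m' v i j))" for i j
  have P: "number_field_place k v" if "v \<in> places k" for v
    by (intro number_field_place.intro nk that)
  note h = number_field_place.k_to_kv(1)[OF P]
  have hk: "k_to_kv k v x \<in> carrier (kv_field k v)" "kv_abs v (k_to_kv k v x) = v x" if "v \<in> places k" "x \<in> k" for v x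
    using ring_hom_closed[OF h[OF that(1)]] number_field_place.k_to_kv(2)[OF P[OF that(1)]] that(2) by auto
  have mk: "m v i j \<in> k" "m' v i j \<in> k" for v i j
    using scale shear subfD[OF sk] by (auto simp: m_def m'_def umat_def)
  have ac: "a i j \<in> carrier (adele_ring k)" for i j
    unfolding a_def
  proof (rule adele_carrierI[of _ _ "{}"])
    fix v assume v: "v \<in> places k"
    show "k_to_kv k v (m v i j) \<in> carrier (kv_field k v)" by (rule hk(1)[OF v mk(1)])
    assume na: "\<not> archimedean v" and gt: "1 < kv_abs v (k_to_kv k v (m v i j))"
    have "v (m v i j) \<le> 1"
      using places_le_1[OF v na] absv_0[OF sk place_absv[OF v]] absv_1[OF sk place_absv[OF v]]
        absv_minus[OF sk place_absv[OF v] shear(1)]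
      by (auto simp: m_def umat_def)
    then show "v \<in> {}" using gt hk(2)[OF v mk(1)] by simp
  qed simp
  have ac': "a' i j \<in> carrier (adele_ring k)" for i j
    unfolding a'_def
  proof (rule adele_carrierI[of _ _ "{v \<in> places k. v 2 \<noteq> 1} \<union> {v \<in> places k. v 3 \<noteq> 1}"])
    show "finite ({v \<in> places k. v 2 \<noteq> 1} \<union> {v \<in> places k. v 3 \<noteq> 1})"
      using product_formula(1)[OF nk, of 2] product_formula(1)[OF nk, of 3] subf_numeral[OF sk] by simp
    fix v assume v: "v \<in> places k"
    show "k_to_kv k v (m' v i j) \<in> carrier (kv_field k v)" by (rule hk(1)[OF v mk(2)])
    assume na: "\<not> archimedean v" and gt: "1 < kv_abs v (k_to_kv k v (m' v i j))"
    show "v \<in> {v \<in> places k. v 2 \<noteq> 1} \<union> {v \<in> places k. v 3 \<noteq> 1}"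
    proof (rule ccontr)
      assume "v \<notin> {v \<in> places k. v 2 \<noteq> 1} \<union> {v \<in> places k. v 3 \<noteq> 1}"
      then have "scale v = 1" "shear v = 0" using v na by (auto simp: scale_def shear_def)
      then have "v (m' v i j) \<le> 1"
        using absv_0[OF sk place_absv[OF v]] absv_1[OF sk place_absv[OF v]] by (auto simp: m'_def umat_def)
      then show False using gt hk(2)[OF v mk(2)] by simp
    qed
  qed
  \<comment> \<open>Stated for arbitrary corner data, so that it serves for both orders of
    \<open>a\<close> and \<open>a'\<close>.\<close>
  have prod: "finsum (adele_ring k) (\<lambda>l. c i l \<otimes>\<^bsub>adele_ring k\<^esub> c' l j) {..<n} =
      (if i = j then \<one>\<^bsub>adele_ring k\<^esub> else \<zero>\<^bsub>adele_ring k\<^esub>)"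
    if ij: "i < n" "j < n" and c: "\<And>i j. c i j \<in> carrier (adele_ring k)" "\<And>i j. c' i j \<in> carrier (adele_ring k)"
      and cc: "\<And>i j v. v \<in> places k \<Longrightarrow> c i j v = k_to_kv k v (umat (field_on k) (d v) (f v) i j)"
        "\<And>i j v. v \<in> places k \<Longrightarrow> c' i j v = k_to_kv k v (umat (field_on k) (d' v) (f' v) i j)"
      and df: "\<And>v. d v \<in> k" "\<And>v. f v \<in> k" "\<And>v. d' v \<in> k" "\<And>v. f' v \<in> k" "\<And>v. d v * d' v = 1" "\<And>v. f' v + f v * d' v = 0"
    for c c' i j d f d' f'
  proof -
    have "finsum (adele_ring k) (\<lambda>l. c i l \<otimes>\<^bsub>adele_ring k\<^esub> c' l j) {..<n} =
      (\<lambda>v\<in>places k. finsum (kv_field k v) (\<lambda>l. (c i l \<otimes>\<^bsub>adele_ring k\<^esub> c' l j) v) {..<n})"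
      by (rule finsum_adele[OF nk]) (use adele_closed(1)[OF nk] c in auto)
    also have "\<dots> = (\<lambda>v\<in>places k. if i = j then \<one>\<^bsub>kv_field k v\<^esub> else \<zero>\<^bsub>kv_field k v\<^esub>)"
    proof (rule restrict_ext)
      fix v assume v: "v \<in> places k"
      interpret V: field "kv_field k v" by (rule kv_field_field[OF nk v])
      let ?h = "k_to_kv k v" and ?F = "kv_field k v"
      note hv = hk(1)[OF v] and hs = j_simps[OF V.field_axioms sk h[OF v] V.zero_closed]
      note uh = umat_hom[OF sk V.field_axioms h[OF v]]
      have uc: "umat (?F) (?h (d' v)) (?h (f' v)) l j \<in> carrier (?F)" for l
        by (rule V.umat_closed[OF hv[OF df(3)] hv[OF df(4)]])
      have "finsum (?F) (\<lambda>l. (c i l \<otimes>\<^bsub>adele_ring k\<^esub> c' l j) v) {..<n} =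
        (\<Oplus>\<^bsub>?F\<^esub>l\<in>{..<n}. umat (?F) (?h (d v)) (?h (f v)) i l \<otimes>\<^bsub>?F\<^esub>
          umat (?F) (?h (d' v)) (?h (f' v)) l j)"
        using v by (simp add: adele_ring_simps cc uh)
      also have "\<dots> = umul (?F) (?h (d v)) (?h (f v)) (\<lambda>l. umat (?F) (?h (d' v)) (?h (f' v)) l j) i"
        by (rule V.finsum_umat[OF n ij(1) hv[OF df(1)] hv[OF df(2)] uc])
      also have "\<dots> = (if i = j then \<one>\<^bsub>?F\<^esub> else \<zero>\<^bsub>?F\<^esub>)"
      proof (rule V.umul_inverse[OF n ij(1) hv[OF df(1)] hv[OF df(2)] hv[OF df(3)] hv[OF df(4)], where x = "\<lambda>i. if i = j then \<one>\<^bsub>?F\<^esub> else \<zero>\<^bsub>?F\<^esub>"])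
        show "?h (d v) \<otimes>\<^bsub>?F\<^esub> ?h (d' v) = \<one>\<^bsub>?F\<^esub>"
          using hs(3)[OF df(1,3), of v v] hs(4) df(5) by simp
        have "f v * d' v \<in> k" using subfD(4)[OF sk df(2,3)] .
        then show "?h (f' v) \<oplus>\<^bsub>?F\<^esub> ?h (f v) \<otimes>\<^bsub>?F\<^esub> ?h (d' v) = \<zero>\<^bsub>?F\<^esub>"
          using hs(3)[OF df(2,3), of v v] hs(2)[OF df(4), of "f v * d' v" v] hs(5) df(6) by simp
        show "umat (?F) (?h (d' v)) (?h (f' v)) l j =
            umul (?F) (?h (d' v)) (?h (f' v)) (\<lambda>i. if i = j then \<one>\<^bsub>?F\<^esub> else \<zero>\<^bsub>?F\<^esub>) l" if "l < n" for l
          using hv[OF df(3)] hv[OF df(4)] by (auto simp: umat_def umul_def)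
      qed simp
      finally show "finsum (kv_field k v) (\<lambda>l. (c i l \<otimes>\<^bsub>adele_ring k\<^esub> c' l j) v) {..<n} =
        (if i = j then \<one>\<^bsub>kv_field k v\<^esub> else \<zero>\<^bsub>kv_field k v\<^esub>)" .
    qed
    also have "\<dots> = (if i = j then \<one>\<^bsub>adele_ring k\<^esub> else \<zero>\<^bsub>adele_ring k\<^esub>)"
      by (simp add: adele_ring_simps)
    finally show ?thesis .
  qed
  have "a \<in> GL n (adele_ring k)"
    unfolding GL_def
  proof (intro CollectI conjI exI[of _ a'] allI impI)
    fix i j assume ij: "i < n" "j < n"
    show "finsum (adele_ring k) (\<lambda>l. a i l \<otimes>\<^bsub>adele_ring k\<^esub> a' l j) {..<n} = (if i = j then \<one>\<^bsub>adele_ring k\<^esub> else \<zero>\<^bsub>adele_ring k\<^esub>)"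
      by (rule prod[OF ij ac ac', where d = scale and f = "\<lambda>v. - shear v" and d' = "\<lambda>v. 1 / scale v" and f' = "\<lambda>v. shear v / scale v"])
         (use scale shear in \<open>auto simp: a_def a'_def m_def m'_def\<close>)
    show "finsum (adele_ring k) (\<lambda>l. a' i l \<otimes>\<^bsub>adele_ring k\<^esub> a l j) {..<n} = (if i = j then \<one>\<^bsub>adele_ring k\<^esub> else \<zero>\<^bsub>adele_ring k\<^esub>)"
      by (rule prod[OF ij ac' ac, where d = "\<lambda>v. 1 / scale v" and f = "\<lambda>v. shear v / scale v" and d' = scale and f' = "\<lambda>v. - shear v"])
         (use scale shear in \<open>auto simp: a_def a'_def m_def m'_def\<close>)
  qed (use ac ac' in auto)
  moreover have "is_basis (field_on k) {..<n} {..<n} e"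
  proof -
    have "lin_comb (field_on k) {..<n} {..<n} e x = x" if "x \<in> vectors (field_on k) {..<n}" for x
      by (rule unit_lin_comb[OF field_on_field[OF sk]]) (use that in \<open>auto simp: e_def\<close>)
    then have "bij_betw (lin_comb (field_on k) {..<n} {..<n} e) (vectors (field_on k) {..<n}) (vectors (field_on k) {..<n})"
      using bij_betw_cong[of _ "lin_comb (field_on k) {..<n} {..<n} e" "\<lambda>x. x"] bij_betw_id[unfolded id_def] by blast
    moreover have "e j \<in> vectors (field_on k) {..<n}" for j
      using subfD(1,2)[OF sk] by (auto simp: e_def vectors_def)
    ultimately show ?thesis by (simp add: is_basis_def)
  qed
  moreover have "bundle_norm (twist n) v (lin_comb (Cv_field k v) {..<n} {..<n} (\<lambda>j i. k_to_Cv k v (e j i)) x) =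
      norm2 k v {..<n} (\<lambda>i\<in>{..<n}. \<Oplus>\<^bsub>Cv_field k v\<^esub>j\<in>{..<n}. kv_to_Cv k v (a i j v) \<otimes>\<^bsub>Cv_field k v\<^esub> x j)"
    if v: "v \<in> places k" and x: "x \<in> vectors (Cv_field k v) {..<n}" for v x
  proof -
    interpret V: field "Cv_field k v" by (rule Cv_field[OF v])
    note hs = j_simps[OF V.field_axioms sk Cv_hom[OF v] V.zero_closed]
    have "lin_comb (Cv_field k v) {..<n} {..<n} (\<lambda>j i. k_to_Cv k v (e j i)) x = x"
      by (rule unit_lin_comb[OF V.field_axioms _ x]) (auto simp: e_def hs(4,5))
    then show ?thesis using v by (simp add: twist_def a_def m_def k_to_Cv_def)
  qed
  ultimately show ?thesis unfolding adelic_hermitian_bundle_def by auto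
qed

end

section \<open>Norms at the places of an extension\<close>

text \<open>The counterpart of \<open>norm2\<close> over \<open>K\<close>, measured by
  \<open>w\<close> itself; once \<open>norm2_place_embedding\<close> is applied, heights no longer
  involve completions.\<close>

definition pnorm :: "place \<Rightarrow> 'j set \<Rightarrow> ('j \<Rightarrow> complex) \<Rightarrow> real" where
  "pnorm w J y = (if archimedean w then sqrt (\<Sum>j\<in>J. (w (y j))\<^sup>2) else Max (insert 0 ((\<lambda>j. w (y j)) ` J)))"

context twisted_bundle
begin

lemma norm2_place_embedding:
  assumes K: "number_field K" "k \<subseteq> K" and w: "w \<in> places K" and y: "\<And>j. j \<in> J \<Longrightarrow> y j \<in> K"
    and x: "\<And>j. j \<in> J \<Longrightarrow> x j = place_embedding k K w (y j)"
  shows "norm2 k (restrict w k) J x = pnorm w J y"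
proof -
  have "Cv_abs k (restrict w k) (x j) = w (y j)" if "j \<in> J" for j
    using place_embedding(3)[OF nk imaginary K w y[OF that]] x[OF that] by simp
  then show ?thesis
    using place_restrict(2)[OF w sk K(2)] by (simp add: norm2_def pnorm_def cong: image_cong)
qed

definition coords :: "place \<Rightarrow> (nat \<Rightarrow> complex) \<Rightarrow> nat \<Rightarrow> complex" where
  "coords v x i = (if i = 0 then x 0 - shear v * x 1 else if i = 1 then scale v * x 1 else x i)"

lemma norm_above_eq:
  assumes K: "number_field K" "k \<subseteq> K" and w: "w \<in> places K" and n: "n \<ge> 2" and x: "\<And>i. i < n \<Longrightarrow> x i \<in> K"
  shows "norm_above k (twist n) K w x = pnorm w {..<n} (coords (restrict w k) x)"
proof -
  define v where "v = restrict w k"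
  have v: "v \<in> places k" unfolding v_def using place_restrict(1)[OF w sk K(2)] .
  have sK: "subf K" using number_field_subf[OF K(1)] .
  let ?h = "place_embedding k K w"
  note e = place_embedding[OF nk imaginary K w, folded v_def]
  interpret V: field "Cv_field k v" by (rule Cv_field[OF v])
  define z where "z = (\<lambda>i\<in>{..<n}. ?h (x i))"
  have z: "z l \<in> carrier (Cv_field k v)" if "l < n" for l
    using ring_hom_closed[OF e(1)] x that by (simp add: z_def)
  have "norm_above k (twist n) K w x = bundle_norm (twist n) v z"
    by (simp add: norm_above_def v_def z_def)
  also have "\<dots> = norm2 k v {..<n} (umul (Cv_field k v) (?h (scale v)) (?h (- shear v)) z)"
    using bundle_norm[OF v n z] scale shear e(2) by simp
  also have "\<dots> = pnorm w {..<n} (umul (field_on K) (scale v) (- shear v) x)"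
    unfolding v_def
  proof (rule norm2_place_embedding[OF K w])
    fix j assume "j \<in> {..<n}"
    then have j: "j < n" by simp
    interpret F: field "field_on K" by (rule field_on_field[OF sK])
    have s: "scale v \<in> K" "- shear v \<in> K" using scale shear K(2) by auto
    show "umul (field_on K) (scale (restrict w k)) (- shear (restrict w k)) x j \<in> K"
      using F.umul_closed[OF n j, of "scale v" "- shear v" x] s x by (simp add: v_def)
    show "umul (Cv_field k (restrict w k)) (?h (scale (restrict w k))) (?h (- shear (restrict w k))) z j =
      ?h (umul (field_on K) (scale (restrict w k)) (- shear (restrict w k)) x j)"
      using umul_hom[OF sK V.field_axioms e(1) s n j, of x z] x by (simp add: z_def v_def)
  qed
  also have "umul (field_on K) (scale v) (- shear v) x = coords v x"
    by (auto simp: umul_def coords_def)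
  finally show ?thesis unfolding v_def .
qed

text \<open>The columns of the inverse of the matrix that defines the norm.\<close>

definition onb :: "place \<Rightarrow> nat \<Rightarrow> nat \<Rightarrow> nat \<Rightarrow> Cv" where
  "onb v n j = (\<lambda>i\<in>{..<n}. umat (Cv_field k v) (k_to_Cv k v (1 / scale v)) (k_to_Cv k v (shear v / scale v)) i j)"

lemma lin_comb_onb:
  assumes v: "v \<in> places k" and n: "n \<ge> 2" and x: "x \<in> vectors (Cv_field k v) {..<n}"
  shows "lin_comb (Cv_field k v) {..<n} {..<n} (onb v n) x =
    (\<lambda>i\<in>{..<n}. umul (Cv_field k v) (k_to_Cv k v (1 / scale v)) (k_to_Cv k v (shear v / scale v)) x i)"
  unfolding lin_comb_def
proof (rule restrict_ext)
  fix i assume "i \<in> {..<n}"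
  then have i: "i < n" by simp
  interpret V: field "Cv_field k v" by (rule Cv_field[OF v])
  have h: "k_to_Cv k v y \<in> carrier (Cv_field k v)" if "y \<in> k" for y
    using ring_hom_closed[OF Cv_hom[OF v]] that by simp
  note h2 = h[OF shear(3)] h[OF shear(4)]
  have xc: "x l \<in> carrier (Cv_field k v)" if "l < n" for l using x that by (auto simp: vectors_def)
  have "(\<Oplus>\<^bsub>Cv_field k v\<^esub>j\<in>{..<n}. x j \<otimes>\<^bsub>Cv_field k v\<^esub> onb v n j i) = (\<Oplus>\<^bsub>Cv_field k v\<^esub>j\<in>{..<n}.
      umat (Cv_field k v) (k_to_Cv k v (1 / scale v)) (k_to_Cv k v (shear v / scale v)) i j \<otimes>\<^bsub>Cv_field k v\<^esub> x j)"
    using i xc V.umat_closed[OF h2] by (intro V.add.finprod_cong') (auto simp: onb_def V.m_comm)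
  then show "(\<Oplus>\<^bsub>Cv_field k v\<^esub>j\<in>{..<n}. x j \<otimes>\<^bsub>Cv_field k v\<^esub> onb v n j i) =
      umul (Cv_field k v) (k_to_Cv k v (1 / scale v)) (k_to_Cv k v (shear v / scale v)) x i"
    using V.finsum_umat[OF n i h2 xc] by simp
qed

lemma onb:
  assumes v: "v \<in> places k" and n: "n \<ge> 2"
  shows "orthonormal_basis k v {..<n} (bundle_norm (twist n) v) {..<n} (onb v n)"
proof -
  interpret V: field "Cv_field k v" by (rule Cv_field[OF v])
  let ?C = "Cv_field k v" and ?h = "k_to_Cv k v"
  let ?L = "\<lambda>x. \<lambda>i\<in>{..<n}. umul ?C (?h (1 / scale v)) (?h (shear v / scale v)) x i"
  let ?M = "\<lambda>x. \<lambda>i\<in>{..<n}. umul ?C (?h (scale v)) (?h (- shear v)) x i"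
  have h: "?h y \<in> carrier ?C" if "y \<in> k" for y
    using ring_hom_closed[OF Cv_hom[OF v]] that by simp
  note hc = h[OF scale(1)] h[OF shear(2)] h[OF shear(3)] h[OF shear(4)]
  note hs = j_simps[OF V.field_axioms sk Cv_hom[OF v] V.zero_closed]
  have vec: "x l \<in> carrier ?C" if "x \<in> vectors ?C {..<n}" "l < n" for x l using that by (auto simp: vectors_def)
  have cl: "?L x \<in> vectors ?C {..<n}" "?M x \<in> vectors ?C {..<n}" if x: "x \<in> vectors ?C {..<n}" for x
    using V.umul_closed[OF n _ hc(3,4) vec[OF x]] V.umul_closed[OF n _ hc(1,2) vec[OF x]]
    by (auto simp: vectors_def)
  have inv: "?h (scale v) \<otimes>\<^bsub>?C\<^esub> ?h (1 / scale v) = \<one>\<^bsub>?C\<^esub>" "?h (1 / scale v) \<otimes>\<^bsub>?C\<^esub> ?h (scale v) = \<one>\<^bsub>?C\<^esub>"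
    "?h (shear v / scale v) \<oplus>\<^bsub>?C\<^esub> ?h (- shear v) \<otimes>\<^bsub>?C\<^esub> ?h (1 / scale v) = \<zero>\<^bsub>?C\<^esub>"
    "?h (- shear v) \<oplus>\<^bsub>?C\<^esub> ?h (shear v / scale v) \<otimes>\<^bsub>?C\<^esub> ?h (scale v) = \<zero>\<^bsub>?C\<^esub>"
  proof -
    show "?h (scale v) \<otimes>\<^bsub>?C\<^esub> ?h (1 / scale v) = \<one>\<^bsub>?C\<^esub>" "?h (1 / scale v) \<otimes>\<^bsub>?C\<^esub> ?h (scale v) = \<one>\<^bsub>?C\<^esub>"
      using hs(3)[OF scale(1) shear(3), of v v] hs(3)[OF shear(3) scale(1), of v v] hs(4) scale(2)[of v] by auto
    have m: "- shear v * (1 / scale v) \<in> k" "shear v / scale v * scale v \<in> k"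
      using subfD(4)[OF sk] shear scale by blast+
    show "?h (shear v / scale v) \<oplus>\<^bsub>?C\<^esub> ?h (- shear v) \<otimes>\<^bsub>?C\<^esub> ?h (1 / scale v) = \<zero>\<^bsub>?C\<^esub>"
      using hs(3)[OF shear(2) shear(3), of v v] hs(2)[OF shear(4) m(1), of v] hs(5) by simp
    show "?h (- shear v) \<oplus>\<^bsub>?C\<^esub> ?h (shear v / scale v) \<otimes>\<^bsub>?C\<^esub> ?h (scale v) = \<zero>\<^bsub>?C\<^esub>"
      using hs(3)[OF shear(4) scale(1), of v v] hs(2)[OF shear(2) m(2), of v] hs(5) scale(2)[of v] by simp
  qed
  have inv_left: "umul ?C (?h (scale v)) (?h (- shear v)) (?L x) i = x i" if x: "x \<in> vectors ?C {..<n}" and i: "i < n" for x i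
    by (rule V.umul_inverse[OF n i hc vec[OF x] inv(1,3)]) auto
  have inv_right: "umul ?C (?h (1 / scale v)) (?h (shear v / scale v)) (?M x) i = x i" if x: "x \<in> vectors ?C {..<n}" and i: "i < n" for x i
    by (rule V.umul_inverse[OF n i hc(3,4,1,2) vec[OF x] inv(2,4)]) auto
  have "bij_betw ?L (vectors ?C {..<n}) (vectors ?C {..<n})"
  proof (rule bij_betw_byWitness[where f' = ?M])
    show "\<forall>x\<in>vectors ?C {..<n}. ?M (?L x) = x"
      using inv_left by (auto intro!: extensionalityI[of _ "{..<n}"] simp: vectors_def PiE_def)
    show "\<forall>x\<in>vectors ?C {..<n}. ?L (?M x) = x"
      using inv_right by (auto intro!: extensionalityI[of _ "{..<n}"] simp: vectors_def PiE_def)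
  qed (use cl in blast)+
  then have "bij_betw (lin_comb ?C {..<n} {..<n} (onb v n)) (vectors ?C {..<n}) (vectors ?C {..<n})"
    using bij_betw_cong[of _ ?L "lin_comb ?C {..<n} {..<n} (onb v n)"] lin_comb_onb[OF v n] by simp
  moreover have "onb v n j \<in> vectors ?C {..<n}" for j
    using V.umat_closed[OF hc(3,4)] by (auto simp: onb_def vectors_def)
  ultimately have "is_basis ?C {..<n} {..<n} (onb v n)" by (simp add: is_basis_def)
  moreover have "bundle_norm (twist n) v (lin_comb ?C {..<n} {..<n} (onb v n) x) = norm2 k v {..<n} x"
    if x: "x \<in> vectors ?C {..<n}" for x
  proof -
    have "bundle_norm (twist n) v (?L x) = norm2 k v {..<n} (umul ?C (?h (scale v)) (?h (- shear v)) (?L x))"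
      using vec[OF cl(1)[OF x]] by (intro bundle_norm[OF v n]) blast
    also have "\<dots> = norm2 k v {..<n} x" by (rule norm2_cong) (use inv_left[OF x] in simp)
    finally show ?thesis unfolding lin_comb_onb[OF v n x] .
  qed
  ultimately show ?thesis by (simp add: orthonormal_basis_def)
qed

definition wedge :: "nat \<times> nat \<Rightarrow> complex" where
  "wedge p = (if p = (0, 1) then 1 else if p = (1, 0) then - 1 else 0)"

text \<open>Orthonormal coordinates in both factors arise from the same corner matrix, and an
  alternating tensor is thereby multiplied by its determinant \<open>scale\<close>. The proof runs
  backwards: the rescaled tensor \<open>Y\<close> is expanded in the tensor basis, which returns the
  original one.\<close>

lemma norm_above_wedge:
  assumes K: "number_field K" "k \<subseteq> K" and w: "w \<in> places K" and n: "n \<ge> 2" and m: "m \<ge> 2"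
  shows "norm_above k (tensor_bundle k (twist n) (twist m)) K w (restrict wedge ({..<n} \<times> {..<m})) =
    pnorm w ({..<n} \<times> {..<m}) (\<lambda>p. scale (restrict w k) * wedge p)"
proof -
  define v where "v = restrict w k"
  have v: "v \<in> places k" unfolding v_def using place_restrict(1)[OF w sk K(2)] .
  have sK: "subf K" using number_field_subf[OF K(1)] .
  let ?h = "place_embedding k K w" and ?C = "Cv_field k v"
  note e = place_embedding[OF nk imaginary K w, folded v_def]
  interpret V: field ?C by (rule Cv_field[OF v])
  interpret F: field "field_on K" by (rule field_on_field[OF sK])
  let ?N = "{..<n}" and ?M = "{..<m}"
  define d c where "d = 1 / scale v" and "c = shear v / scale v"
  have kd: "d \<in> k" "c \<in> k" and dc: "d \<in> K" "c \<in> K" using shear K(2) by (auto simp: d_def c_def)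
  have hdc: "k_to_Cv k v d = ?h d" "k_to_Cv k v c = ?h c" using e(2) kd by auto
  define y where "y p = scale v * wedge p" for p
  have y: "y p \<in> K" for p using scale(1)[of v] K(2) by (auto simp: y_def wedge_def intro!: subfD(1,8)[OF sK])
  define Y where "Y = (\<lambda>p\<in>?N \<times> ?M. ?h (y p))"
  have hc: "?h a \<in> carrier ?C" if "a \<in> K" for a using ring_hom_closed[OF e(1)] that by simp
  have Yv: "Y \<in> vectors ?C (?N \<times> ?M)" using hc y by (auto simp: Y_def vectors_def)
  have on: "r \<in> ?N \<Longrightarrow> onb v n r \<in> vectors ?C ?N" "s \<in> ?M \<Longrightarrow> onb v m s \<in> vectors ?C ?M" for r s
    using onb[OF v n] onb[OF v m] by (auto simp: orthonormal_basis_def is_basis_def)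
  have row: "(\<lambda>s\<in>?M. Y (r, s)) \<in> vectors ?C ?M" if "r < n" for r
    using hc y that by (auto simp: Y_def vectors_def)
  define y' where "y' r j = umul (field_on K) d c (\<lambda>s. y (r, s)) j" for r j
  have y': "y' r j \<in> K" if "j < m" for r j
    using F.umul_closed[OF m that, of d c "\<lambda>s. y (r, s)"] dc y by (simp add: y'_def)
  have inner: "lin_comb ?C ?M ?M (onb v m) (\<lambda>s\<in>?M. Y (r, s)) j = ?h (y' r j)" if "r < n" "j < m" for r j
    unfolding lin_comb_onb[OF v m row[OF that(1)]] y'_def d_def[symmetric] c_def[symmetric] hdc
    using that umul_hom[OF sK V.field_axioms e(1) dc m that(2), of "\<lambda>s. y (r, s)" "\<lambda>s\<in>?M. Y (r, s)"] y
    by (simp add: Y_def)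
  have "lin_comb ?C (?N \<times> ?M) (?N \<times> ?M) (tensor_family ?C ?N ?M (onb v n) (onb v m)) Y =
    map_cols (lin_comb ?C ?N ?N (onb v n)) ?N ?M ?N (map_rows (lin_comb ?C ?M ?M (onb v m)) ?N ?M ?M Y)"
    by (rule V.lin_comb_tensor(1)) (use on n m Yv in auto)
  also have "\<dots> = (\<lambda>p\<in>?N \<times> ?M. ?h (restrict wedge (?N \<times> ?M) p))"
    unfolding map_cols_def
  proof (rule restrict_ext)
    fix p assume "p \<in> ?N \<times> ?M"
    then obtain i j where p: "p = (i, j)" and ij: "i < n" "j < m" by auto
    have col: "(\<lambda>r\<in>?N. map_rows (lin_comb ?C ?M ?M (onb v m)) ?N ?M ?M Y (r, j)) = (\<lambda>r\<in>?N. ?h (y' r j))"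
      by (rule restrict_ext) (use ij inner in \<open>simp add: map_rows_def\<close>)
    have cv: "(\<lambda>r\<in>?N. ?h (y' r j)) \<in> vectors ?C ?N" using hc y' ij by (auto simp: vectors_def)
    have "lin_comb ?C ?N ?N (onb v n) (\<lambda>r\<in>?N. ?h (y' r j)) i = ?h (umul (field_on K) d c (\<lambda>r. y' r j) i)"
      unfolding lin_comb_onb[OF v n cv] d_def[symmetric] c_def[symmetric] hdc
      using ij umul_hom[OF sK V.field_axioms e(1) dc n ij(1), of "\<lambda>r. y' r j" "\<lambda>r\<in>?N. ?h (y' r j)"] y'
      by simp
    moreover have "umul (field_on K) d c (\<lambda>r. y' r j) i = wedge (i, j)"
      using scale(2)[of v] by (auto simp: umul_def y'_def y_def wedge_def d_def c_def)
    ultimately show "(case p of (i, s) \<Rightarrow> lin_comb ?C ?N ?N (onb v n)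
        (\<lambda>r\<in>?N. map_rows (lin_comb ?C ?M ?M (onb v m)) ?N ?M ?M Y (r, s)) i) = ?h (restrict wedge (?N \<times> ?M) p)"
      using col ij by (simp add: p)
  qed
  finally have lc: "lin_comb ?C (?N \<times> ?M) (?N \<times> ?M) (tensor_family ?C ?N ?M (onb v n) (onb v m)) Y =
    (\<lambda>p\<in>?N \<times> ?M. ?h (restrict wedge (?N \<times> ?M) p))" .
  have "norm_above k (tensor_bundle k (twist n) (twist m)) K w (restrict wedge (?N \<times> ?M)) =
    tensor_norm k (twist n) (twist m) v (\<lambda>p\<in>?N \<times> ?M. ?h (restrict wedge (?N \<times> ?M) p))"
    by (simp add: norm_above_def tensor_bundle_def v_def)
  also have "\<dots> = norm2 k v (?N \<times> ?M) Y"
    unfolding lc[symmetric]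
    using tensor_norm_eq[OF V.field_axioms, of "twist n" "onb v n" "twist m" "onb v m" Y] onb[OF v n] onb[OF v m] Yv by simp
  also have "\<dots> = pnorm w (?N \<times> ?M) y"
    unfolding v_def by (rule norm2_place_embedding[OF K w y]) (simp add: Y_def)
  finally show ?thesis unfolding y_def v_def .
qed

end

section \<open>The absolute minima\<close>

lemma pnorm_ge:
  assumes "finite J" "j \<in> J" "0 \<le> w (y j)"
  shows "w (y j) \<le> pnorm w J y"
proof (cases "archimedean w")
  case True
  have "(w (y j))\<^sup>2 \<le> (\<Sum>j\<in>J. (w (y j))\<^sup>2)" using assms by (intro member_le_sum) auto
  then show ?thesis using True assms(3) by (simp add: pnorm_def real_le_rsqrt)
qed (use assms in \<open>auto simp: pnorm_def\<close>)

lemma pnorm_nonneg: "finite J \<Longrightarrow> 0 \<le> pnorm w J y"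
  by (simp add: pnorm_def sum_nonneg)

lemma pnorm_arch_ge:
  assumes "archimedean w" "finite J" "i \<in> J" "j \<in> J" "i \<noteq> j"
  shows "(w (y i))\<^sup>2 + (w (y j))\<^sup>2 \<le> (pnorm w J y)\<^sup>2"
proof -
  have "(\<Sum>l\<in>{i, j}. (w (y l))\<^sup>2) \<le> (\<Sum>l\<in>J. (w (y l))\<^sup>2)"
    using assms by (intro sum_mono2) auto
  then show ?thesis using assms by (simp add: pnorm_def sum_nonneg)
qed

text \<open>The field inside \<open>height\<close> is an unspecified choice; the bounds below hold
  for every admissible field, hence for this one.\<close>

lemma height_exists:
  assumes "number_field k" "finite (index_set E)" "x \<in> vectors (field_on Qbar) (index_set E)"
  shows "\<exists>K. number_field K \<and> k \<subseteq> K \<and> x \<in> vectors (field_on K) (index_set E) \<and> height k E x = height_over k E K x"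
proof -
  have "\<exists>K. number_field K \<and> k \<subseteq> K \<and> x ` index_set E \<subseteq> K"
    using assms by (intro number_field_extending) (auto simp: vectors_def Qbar_def)
  then obtain K where "number_field K" "k \<subseteq> K" "x ` index_set E \<subseteq> K" by blast
  moreover from this(3) have "x \<in> vectors (field_on K) (index_set E)"
    using assms(3) by (auto simp: vectors_def PiE_def)
  ultimately have "\<exists>K. number_field K \<and> k \<subseteq> K \<and> x \<in> vectors (field_on K) (index_set E)" by blast
  from someI_ex[OF this] show ?thesis unfolding height_def by blast
qed

context twisted_bundle
begin

lemma omega_cube: "\<omega> ^ 3 = 1"
proof -
  have "\<omega> ^ 3 - 1 = (\<omega> - 1) * (\<omega>\<^sup>2 + \<omega> + 1)"
    by (simp add: algebra_simps power2_eq_square power3_eq_cube)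
  then show ?thesis using omega(2) by simp
qed

context
  fixes K w
  assumes K: "number_field K" "k \<subseteq> K" and w: "w \<in> places K"
begin

lemma sK: "subf K" by (rule number_field_subf[OF K(1)])

lemma aK: "absv K w" by (rule place_absv[OF w])

lemma K_mem: "\<rho> \<in> K" "\<theta> \<in> K" "\<omega> \<in> K" "numeral a \<in> K"
  using rho(1) theta(1) omega(1) K(2) subf_numeral[OF sK] by auto

lemma restrict_eq: "scale (restrict w k) = scale w" "shear (restrict w k) = shear w"
  using place_restrict(2)[OF w sk K(2)] subf_numeral[OF sk] by (auto simp: scale_def shear_def)

text \<open>\<open>\<omega>\<close> is a root of unity and
  \<open>\<theta> = \<omega> * (1 - \<omega>)\<close>, so \<open>1 - \<omega>\<close> and
  \<open>1 - \<omega>\<^sup>2\<close> both have the value of \<open>\<theta>\<close>.\<close>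

lemma w_powers: "w \<rho> ^ 4 = w 2" "(w \<theta>)\<^sup>2 = w 3" "w \<omega> = 1" "w (1 - \<omega>) = w \<theta>" "w (1 - \<omega>\<^sup>2) = w \<theta>"
proof -
  note [simp] = absv_mult[OF sK aK] absv_minus[OF sK aK] absv_power[OF sK aK] absv_1[OF sK aK] K_mem
    subfD(3-5,8,9)[OF sK] subfD(2)[OF sK]
  show "w \<rho> ^ 4 = w 2" using absv_power[OF sK aK K_mem(1), of 4] rho(2) by simp
  show "(w \<theta>)\<^sup>2 = w 3" using absv_power[OF sK aK K_mem(2), of 2] theta(2) by simp
  have o2: "\<omega>\<^sup>2 = - \<omega> - 1" using omega(2) by (simp add: eq_neg_iff_add_eq_0 algebra_simps)
  have "w \<omega> ^ 3 = 1" using absv_power[OF sK aK K_mem(3), of 3] omega_cube by simp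
  then show o: "w \<omega> = 1" using power_eq_imp_eq_base[of "w \<omega>" 3 1] absv_nonneg[OF sK aK K_mem(3)] by simp
  have "\<theta> = \<omega> * (1 - \<omega>)" using o2 by (simp add: \<theta>_def algebra_simps power2_eq_square)
  then show t: "w (1 - \<omega>) = w \<theta>" using o by simp
  have "1 - \<omega>\<^sup>2 = - (\<omega>\<^sup>2 * (1 - \<omega>))"
    using omega_cube by (simp add: algebra_simps power2_eq_square power3_eq_cube)
  then have "w (1 - \<omega>\<^sup>2) = w (- (\<omega>\<^sup>2 * (1 - \<omega>)))" by (rule arg_cong)
  then show "w (1 - \<omega>\<^sup>2) = w \<theta>" using o t by simp
qed

lemma w_arch:
  assumes "archimedean w"
  shows "w 2 = 2" "w 3 = 3" "(w (\<rho>\<^sup>2))\<^sup>2 = 2" "(w \<theta>)\<^sup>2 = 3"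
proof -
  show "w 2 = 2" "w 3 = 3" using archimedean_of_rat[OF assms, of 2] archimedean_of_rat[OF assms, of 3] by auto
  then show "(w (\<rho>\<^sup>2))\<^sup>2 = 2" "(w \<theta>)\<^sup>2 = 3"
    using w_powers(1,2) absv_power[OF sK aK K_mem(1), of 2] by (auto simp: power_mult[symmetric])
qed

lemma w_nonarch:
  assumes "\<not> archimedean w"
  shows "w 2 \<le> 1" "w 3 \<le> 1" "w \<rho> \<le> 1" "w \<theta> \<le> 1" "w 2 < 1 \<Longrightarrow> w 3 = 1"
proof -
  show r: "w 2 \<le> 1" "w 3 \<le> 1" using place_rat_le_1[OF w assms, of 2] place_rat_le_1[OF w assms, of 3] by auto
  then show "w \<rho> \<le> 1" "w \<theta> \<le> 1"
    using w_powers(1,2) by (auto intro: power_le_1_imp_le_1[of _ 4] power_le_1_imp_le_1[of _ 2])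
  have "w (3 + (- 2)) \<le> max (w 3) (w (- 2))"
    using K_mem(4) subfD(8)[OF sK] by (intro nonarch_place_add[OF sK w assms]) auto
  then have "1 \<le> max (w 3) (w 2)"
    using absv_1[OF sK aK] absv_minus[OF sK aK K_mem(4)] by simp
  then show "w 3 = 1" if "w 2 < 1" using that r by simp
qed

lemma nonarch_diff:
  assumes "\<not> archimedean w" "x \<in> K" "y \<in> K"
  shows "w (x - y) \<le> max (w x) (w y)"
  using nonarch_place_add[OF sK w assms(1,2), of "- y"] absv_minus[OF sK aK assms(3)] subfD(8)[OF sK assms(3)] assms(3)
  by simp

lemma pnorm_coords:
  fixes x :: "nat \<Rightarrow> complex"
  assumes n: "n \<ge> 2" and x: "\<And>i. i < n \<Longrightarrow> x i \<in> K"
  defines "N \<equiv> pnorm w {..<n} (coords w x)"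
  shows "0 \<le> N" "w (x 0 - shear w * x 1) \<le> N" "w (scale w * x 1) \<le> N" "2 \<le> i \<Longrightarrow> i < n \<Longrightarrow> w (x i) \<le> N"
    "archimedean w \<Longrightarrow> (w (x 0))\<^sup>2 + 2 * (w (x 1))\<^sup>2 \<le> N\<^sup>2"
proof -
  have x01: "x 0 \<in> K" "x 1 \<in> K" using n x by auto
  have s: "scale w \<in> K" "shear w \<in> K"
    using K_mem subfD[OF sK] by (auto simp: scale_def shear_def)
  have c: "coords w x i \<in> K" if "i < n" for i
    using that x x01 s subfD[OF sK] by (auto simp: coords_def)
  have ge: "w (coords w x i) \<le> N" if "i < n" for i
    unfolding N_def using that absv_nonneg[OF sK aK c[OF that]] by (intro pnorm_ge) auto
  show "0 \<le> N" unfolding N_def by (rule pnorm_nonneg) simp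
  show "w (x 0 - shear w * x 1) \<le> N" "w (scale w * x 1) \<le> N" "2 \<le> i \<Longrightarrow> i < n \<Longrightarrow> w (x i) \<le> N"
    using ge[of 0] ge[of 1] ge[of i] n by (auto simp: coords_def)
  assume ar: "archimedean w"
  have "(w (coords w x 0))\<^sup>2 + (w (coords w x 1))\<^sup>2 \<le> N\<^sup>2"
    unfolding N_def using n by (intro pnorm_arch_ge[OF ar]) auto
  moreover have "w (coords w x 1) = w (\<rho>\<^sup>2) * w (x 1)"
    using ar absv_mult[OF sK aK subfD(9)[OF sK K_mem(1)] x01(2)] by (simp add: coords_def scale_def)
  ultimately show "(w (x 0))\<^sup>2 + 2 * (w (x 1))\<^sup>2 \<le> N\<^sup>2"
    using ar w_arch(3)[OF ar] by (simp add: coords_def shear_def power_mult_distrib)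
qed

text \<open>At archimedean places this rests on \<open>(s\<^sup>2 + 2 * u\<^sup>2)\<^sup>2 = 4 * u *
  (s ^ 3 + u ^ 3) + (s * (s - 2 * u))\<^sup>2\<close>. Above 2, \<open>w 2 = w \<rho> ^ 4\<close>
  gives one \<open>\<rho>\<close> to each linear factor. Above 3, \<open>\<theta>\<close> joins
  \<open>x 1\<close>, and each of the three differences is bounded by \<open>N\<close>. Elsewhere
  both coordinates are.\<close>

lemma w_cube_diff_le:
  assumes n: "n \<ge> 2" and x: "\<And>i. i < n \<Longrightarrow> x i \<in> K"
  shows "w (2 * \<theta> * x 1 * (x 0 ^ 3 - x 1 ^ 3)) \<le> pnorm w {..<n} (coords w x) ^ 4"
proof -
  define N where "N = pnorm w {..<n} (coords w x)"
  note N = pnorm_coords[of n x, OF n x, folded N_def]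
  have x01: "x 0 \<in> K" "x 1 \<in> K" using n x by auto
  define s u where "s = w (x 0)" and "u = w (x 1)"
  have su: "0 \<le> s" "0 \<le> u" using absv_nonneg[OF sK aK] x01 by (auto simp: s_def u_def)
  have t0: "0 \<le> w \<theta>" "0 \<le> w \<rho>" "0 \<le> w 2" using absv_nonneg[OF sK aK] K_mem by auto
  note cl = subfD(3-5,9)[OF sK] x01 K_mem
  have d: "x 0 ^ 3 - x 1 ^ 3 \<in> K" by (intro cl)
  have cubes: "w (x 0 ^ 3) = s ^ 3" "w (x 1 ^ 3) = u ^ 3"
    using absv_power[OF sK aK] x01 by (auto simp: s_def u_def)
  have "w (2 * \<theta> * x 1 * (x 0 ^ 3 - x 1 ^ 3)) = w (2 * \<theta> * x 1) * w (x 0 ^ 3 - x 1 ^ 3)"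
    by (intro absv_mult[OF sK aK] cl)
  also have "w (2 * \<theta> * x 1) = w (2 * \<theta>) * u" unfolding u_def by (intro absv_mult[OF sK aK] cl)
  also have "w (2 * \<theta>) = w 2 * w \<theta>" by (intro absv_mult[OF sK aK] cl)
  finally have g: "w (2 * \<theta> * x 1 * (x 0 ^ 3 - x 1 ^ 3)) = w 2 * w \<theta> * u * w (x 0 ^ 3 - x 1 ^ 3)" .
  have "w 2 * w \<theta> * u * w (x 0 ^ 3 - x 1 ^ 3) \<le> N ^ 4"
  proof (cases "archimedean w")
    case True
    \<comment> \<open>The value is the square root of 3; rounding it up to 2 produces the
      coefficient 4 of the identity below.\<close>
    have "w \<theta> \<le> 2" using w_arch(4)[OF True] by (simp add: power2_le_imp_le)
    moreover have "w (x 0 ^ 3 - x 1 ^ 3) \<le> s ^ 3 + u ^ 3"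
      using absv_diff[OF sK aK, of "x 0 ^ 3" "x 1 ^ 3"] cubes cl by simp
    ultimately have "w 2 * w \<theta> * u * w (x 0 ^ 3 - x 1 ^ 3) \<le> 2 * 2 * u * (s ^ 3 + u ^ 3)"
      using w_arch(1)[OF True] su t0 absv_nonneg[OF sK aK d] by (intro mult_mono) auto
    also have "\<dots> \<le> 2 * 2 * u * (s ^ 3 + u ^ 3) + (s * (s - 2 * u))\<^sup>2" by simp
    also have "\<dots> = (s\<^sup>2 + 2 * u\<^sup>2)\<^sup>2"
      by (simp add: power2_eq_square power3_eq_cube algebra_simps)
    also have "\<dots> \<le> (N\<^sup>2)\<^sup>2"
      using N(5)[OF _ True] by (intro power_mono) (auto simp: s_def u_def)
    finally show ?thesis by (simp add: power_mult[symmetric])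
  next
    case na: False
    note le = w_nonarch[OF na]
    have dm: "w (x 0 ^ 3 - x 1 ^ 3) \<le> max (s ^ 3) (u ^ 3)"
      using nonarch_diff[OF na, of "x 0 ^ 3" "x 1 ^ 3"] cubes cl by simp
    consider "w 2 < 1" | "\<not> w 2 < 1" "w 3 < 1" | "\<not> w 2 < 1" "\<not> w 3 < 1" by blast
    then show ?thesis
    proof cases
      case 1
      have sN: "s \<le> N" and uN: "w \<rho> * u \<le> N"
        using N(2,3) na 1 absv_mult[OF sK aK K_mem(1) x01(2)] by (auto simp: scale_def shear_def s_def u_def)
      have "w 2 * w \<theta> * u * w (x 0 ^ 3 - x 1 ^ 3) \<le> w 2 * 1 * u * max (s ^ 3) (u ^ 3)"
        using le dm su t0 absv_nonneg[OF sK aK d] by (intro mult_mono) auto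
      also have "\<dots> = (w \<rho> * u) * max ((w \<rho> * s) ^ 3) ((w \<rho> * u) ^ 3)"
      proof -
        have "max ((w \<rho> * s) ^ 3) ((w \<rho> * u) ^ 3) = w \<rho> ^ 3 * max (s ^ 3) (u ^ 3)"
          using t0 by (simp add: power_mult_distrib max_mult_distrib_left)
        then show ?thesis by (simp add: w_powers(1)[symmetric] power3_eq_cube power4_eq_xxxx)
      qed
      also have "\<dots> \<le> N * N ^ 3"
      proof (rule mult_mono[OF uN])
        have "w \<rho> * s \<le> N" using mult_right_mono[OF le(3) su(1)] sN by simp
        then show "max ((w \<rho> * s) ^ 3) ((w \<rho> * u) ^ 3) \<le> N ^ 3"
          using uN t0 su by (auto intro!: power_mono)
      qed (use N(1) su t0 in \<open>auto simp: le_max_iff_disj\<close>)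
      finally show ?thesis by (simp add: power_Suc[symmetric] del: power_Suc)
    next
      case 2
      have N0: "w (x 0 - x 1) \<le> N" and N1: "w \<theta> * u \<le> N"
        using N(2,3) na 2 absv_mult[OF sK aK K_mem(2) x01(2)] by (auto simp: scale_def shear_def u_def)
      have o2: "\<omega>\<^sup>2 = - \<omega> - 1" using omega(2) by (simp add: eq_neg_iff_add_eq_0 algebra_simps)
      have lin: "w (x 0 - z * x 1) \<le> N" if z: "z \<in> K" "w (1 - z) = w \<theta>" for z
      proof -
        have "w ((x 0 - x 1) + (1 - z) * x 1) \<le> max (w (x 0 - x 1)) (w ((1 - z) * x 1))"
          using z subfD(2)[OF sK] by (intro nonarch_place_add[OF sK w na] cl) auto
        also have "w ((1 - z) * x 1) = w \<theta> * u"
          using absv_mult[OF sK aK _ x01(2), of "1 - z"] z subfD(2,5)[OF sK] by (simp add: u_def)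
        finally show ?thesis using N0 N1 by (simp add: algebra_simps)
      qed
      have L: "w (x 0 - \<omega> * x 1) \<le> N" "w (x 0 - \<omega>\<^sup>2 * x 1) \<le> N"
        using lin[OF K_mem(3) w_powers(4)] lin[OF subfD(9)[OF sK K_mem(3)] w_powers(5)] .
      have fac: "x 0 ^ 3 - x 1 ^ 3 = (x 0 - x 1) * ((x 0 - \<omega> * x 1) * (x 0 - \<omega>\<^sup>2 * x 1))"
      proof -
        have "\<omega> * \<omega>\<^sup>2 = 1" using omega_cube by (simp add: power2_eq_square power3_eq_cube mult.assoc)
        moreover have "(x 0 - \<omega> * x 1) * (x 0 - \<omega>\<^sup>2 * x 1) = (x 0)\<^sup>2 - (\<omega> + \<omega>\<^sup>2) * (x 0 * x 1) + (\<omega> * \<omega>\<^sup>2) * (x 1)\<^sup>2"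
          by (simp add: algebra_simps power2_eq_square)
        ultimately have "(x 0 - \<omega> * x 1) * (x 0 - \<omega>\<^sup>2 * x 1) = (x 0)\<^sup>2 + x 0 * x 1 + (x 1)\<^sup>2"
          using o2 by simp
        then show ?thesis by (simp add: algebra_simps power2_eq_square power3_eq_cube)
      qed
      have "w (x 0 ^ 3 - x 1 ^ 3) = w (x 0 - x 1) * w ((x 0 - \<omega> * x 1) * (x 0 - \<omega>\<^sup>2 * x 1))"
        unfolding fac by (intro absv_mult[OF sK aK] cl)
      also have "w ((x 0 - \<omega> * x 1) * (x 0 - \<omega>\<^sup>2 * x 1)) = w (x 0 - \<omega> * x 1) * w (x 0 - \<omega>\<^sup>2 * x 1)"
        by (intro absv_mult[OF sK aK] cl)
      also have "w (x 0 - x 1) * (w (x 0 - \<omega> * x 1) * w (x 0 - \<omega>\<^sup>2 * x 1)) \<le> N * (N * N)"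
        using N0 L N(1) by (intro mult_mono absv_nonneg[OF sK aK] cl mult_nonneg_nonneg) auto
      finally have "(w 2 * (w \<theta> * u)) * w (x 0 ^ 3 - x 1 ^ 3) \<le> (1 * N) * (N * (N * N))"
        using N1 N(1) le t0 su absv_nonneg[OF sK aK d] by (intro mult_mono) auto
      then show ?thesis by (simp add: power4_eq_xxxx mult.assoc)
    next
      case 3
      have sN: "s \<le> N" and uN: "u \<le> N"
        using N(2,3) na 3 by (auto simp: scale_def shear_def s_def u_def)
      have "w 2 * w \<theta> * u * w (x 0 ^ 3 - x 1 ^ 3) \<le> 1 * 1 * N * N ^ 3"
      proof (intro mult_mono)
        show "w (x 0 ^ 3 - x 1 ^ 3) \<le> N ^ 3"
          using dm power_mono[OF sN su(1), of 3] power_mono[OF uN su(2), of 3] by linarith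
      qed (use le uN su t0 N(1) absv_nonneg[OF sK aK d] in auto)
      then show ?thesis by (simp add: power_Suc[symmetric] del: power_Suc)
    qed
  qed
  then show ?thesis unfolding g N_def .
qed

text \<open>Both coordinates have the same value, one being a cube root of unity times the other if
  nonzero. The archimedean norm then gives the factor 1 + 2 = 3, the square of the value of
  \<open>\<theta>\<close>. Above 3, \<open>\<theta> * x 1\<close> is itself a coordinate; at the
  other finite places \<open>\<theta>\<close> is integral and \<open>x 0\<close> a
  coordinate.\<close>

lemma w_theta_le:
  assumes n: "n \<ge> 2" and x: "\<And>i. i < n \<Longrightarrow> x i \<in> K" and eq: "x 0 ^ 3 = x 1 ^ 3"
  shows "w (\<theta> * x 1) \<le> pnorm w {..<n} (coords w x)"
proof -
  define N where "N = pnorm w {..<n} (coords w x)"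
  note N = pnorm_coords[of n x, OF n x, folded N_def]
  have x01: "x 0 \<in> K" "x 1 \<in> K" using n x by auto
  have nn: "0 \<le> w (x 0)" "0 \<le> w (x 1)" "0 \<le> w \<theta>" using absv_nonneg[OF sK aK] x01 K_mem by auto
  have "w (x 0) ^ 3 = w (x 1) ^ 3"
    using arg_cong[OF eq, of w] absv_power[OF sK aK] x01 by simp
  then have su: "w (x 0) = w (x 1)" using nn power_eq_imp_eq_base[of "w (x 0)" 3 "w (x 1)"] by simp
  have t: "w (\<theta> * x 1) = w \<theta> * w (x 1)" using absv_mult[OF sK aK] x01 K_mem by simp
  have "w (\<theta> * x 1) \<le> N"
  proof (cases "archimedean w")
    case True
    have "(w (\<theta> * x 1))\<^sup>2 \<le> N\<^sup>2" using N(5)[OF _ True] w_arch(4)[OF True] su t by (simp add: power_mult_distrib)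
    then show ?thesis using N(1) by (rule power2_le_imp_le)
  next
    case na: False
    have le: "w \<theta> * w (x 1) \<le> w (x 1)" using mult_right_mono[OF w_nonarch(4)[OF na] nn(2)] by simp
    consider "w 2 < 1" | "\<not> w 2 < 1" "w 3 < 1" | "\<not> w 2 < 1" "\<not> w 3 < 1" by blast
    then show ?thesis
      using N(2,3) na su t le by cases (auto simp: scale_def shear_def)
  qed
  then show ?thesis unfolding N_def .
qed

lemma pnorm_wedge:
  assumes n: "n \<ge> 2" and m: "m \<ge> 2"
  shows "pnorm w ({..<n} \<times> {..<m}) (\<lambda>p. scale w * wedge p) = (if archimedean w then 2 else w (scale w))"
proof -
  have s: "scale w \<in> K" using K_mem subfD[OF sK] by (auto simp: scale_def)
  have v: "w (scale w * wedge p) = (if p \<in> {(0, 1), (1, 0)} then w (scale w) else 0)" for p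
    using absv_minus[OF sK aK s] absv_0[OF sK aK] by (auto simp: wedge_def)
  have sub: "{(0, 1), (1, 0)} \<subseteq> {..<n} \<times> {..<m}" using n m by auto
  show ?thesis
  proof (cases "archimedean w")
    case True
    have "(\<Sum>p\<in>{..<n} \<times> {..<m}. (w (scale w * wedge p))\<^sup>2) = (\<Sum>p\<in>{(0, 1), (1, 0)}. (w (scale w * wedge p))\<^sup>2)"
      by (rule sum.mono_neutral_right) (use sub v in auto)
    also have "\<dots> = 4" using w_arch(3)[OF True] True by (simp add: v) (simp add: scale_def)
    finally show ?thesis using True by (simp add: pnorm_def)
  next
    case False
    have "Max (insert 0 ((\<lambda>p. w (scale w * wedge p)) ` ({..<n} \<times> {..<m}))) = w (scale w)"
    proof (rule Max_eqI)
      have "w (scale w) = w (scale w * wedge (0, 1))" by (simp add: v)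
      then show "w (scale w) \<in> insert 0 ((\<lambda>p. w (scale w * wedge p)) ` ({..<n} \<times> {..<m}))"
        using sub by blast
    qed (use absv_nonneg[OF sK aK s] in \<open>auto simp: v\<close>)
    then show ?thesis using False by (simp add: pnorm_def)
  qed
qed

text \<open>The whole gain is archimedean. At a finite place \<open>N\<close> is the value of
  \<open>scale w\<close>, and \<open>\<rho> * \<theta>\<close> was built to match it:
  \<open>\<theta>\<close> is a unit above 2 and \<open>\<rho>\<close> is one above 3.\<close>

lemma pnorm_wedge_le:
  assumes n: "n \<ge> 2" and m: "m \<ge> 2"
  defines "N \<equiv> pnorm w ({..<n} \<times> {..<m}) (\<lambda>p. scale w * wedge p)"
  shows "0 < N" "N \<le> w (\<rho> * \<theta>)" "archimedean w \<Longrightarrow> N < w (\<rho> * \<theta>)" "w 2 = 1 \<Longrightarrow> w 3 = 1 \<Longrightarrow> N = 1"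
proof -
  have N: "N = (if archimedean w then 2 else w (scale w))" unfolding N_def by (rule pnorm_wedge[OF n m])
  have m1: "w (\<rho> * \<theta>) = w \<rho> * w \<theta>" using absv_mult[OF sK aK] K_mem by simp
  have nn: "0 \<le> w \<rho>" "0 \<le> w \<theta>" using absv_nonneg[OF sK aK] K_mem by auto
  have "scale w \<in> K" using K_mem subfD[OF sK] by (auto simp: scale_def)
  then show "0 < N" using absv_pos[OF sK aK _ scale(2)] by (simp add: N)
  have ar: "N < w (\<rho> * \<theta>)" if a: "archimedean w"
  proof -
    have "(w \<theta>) ^ 4 = ((w \<theta>)\<^sup>2)\<^sup>2" by (simp add: power_mult[symmetric])
    \<comment> \<open>The right side is 2 * 9, so the inequality is 16 < 18.\<close>
    then have "2 ^ 4 < (w \<rho> * w \<theta>) ^ 4" using w_arch[OF a] w_powers(1) by (simp add: power_mult_distrib)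
    then have "2 < w \<rho> * w \<theta>" by (rule power_less_imp_less_base) (use nn in simp)
    then show ?thesis using a by (simp add: N m1)
  qed
  show "N < w (\<rho> * \<theta>)" if "archimedean w" using ar that .
  have ge: "1 \<le> w \<rho>" if "w 2 = 1" using that w_powers(1) nn power_eq_imp_eq_base[of "w \<rho>" 4 1] by simp
  have ge': "1 \<le> w \<theta>" if "w 3 = 1" using that w_powers(2) nn by (simp add: power2_eq_1_iff)
  show "N \<le> w (\<rho> * \<theta>)"
  proof (cases "archimedean w")
    case na: False
    note le = w_nonarch[OF na]
    consider "w 2 < 1" | "w 2 = 1" "w 3 < 1" | "w 2 = 1" "w 3 = 1" using le by linarith
    then show ?thesis
    proof cases
      case 1
      then show ?thesis using na ge' le(5) mult_left_mono[of 1 "w \<theta>" "w \<rho>"] nn by (simp add: N m1 scale_def)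
    next
      case 2
      then show ?thesis using na ge mult_right_mono[of 1 "w \<rho>" "w \<theta>"] nn by (simp add: N m1 scale_def)
    next
      case 3
      then show ?thesis using na ge ge' mult_mono[of 1 "w \<rho>" 1 "w \<theta>"] nn absv_1[OF sK aK] by (simp add: N m1 scale_def)
    qed
  qed (use ar in simp)
  show "N = 1" if "w 2 = 1" "w 3 = 1"
    using that w_arch(1) absv_1[OF sK aK] by (auto simp: N scale_def)
qed

end

lemma prod_height_extend:
  assumes "finite T" "{w \<in> places K. f w \<noteq> 1} \<subseteq> T" "T \<subseteq> places K"
  shows "(\<Prod>w\<in>{w \<in> places K. f w \<noteq> 1}. f w) = (\<Prod>w\<in>T. f w :: real)"
  by (rule prod.mono_neutral_left) (use assms in auto)

lemma product_formula_powr: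
  assumes K: "number_field K" and g: "g \<in> K" "g \<noteq> 0"
    and T: "finite T" "T \<subseteq> places K" "{w \<in> places K. w g \<noteq> 1} \<subseteq> T"
  shows "(\<Prod>w\<in>T. w g powr (real (local_degree K w) / real (global_degree K))) = 1"
proof -
  have pos: "0 < w g" if "w \<in> T" for w
    using absv_pos[OF number_field_subf[OF K] place_absv g] that T(2) by blast
  have "(\<Prod>w\<in>T. w g powr (real (local_degree K w) / real (global_degree K))) =
    (\<Prod>w\<in>T. (w g ^ local_degree K w) powr (1 / real (global_degree K)))"
    by (rule prod.cong) (auto simp: powr_powr powr_realpow[symmetric] dest: pos)
  also have "\<dots> = (\<Prod>w\<in>T. w g ^ local_degree K w) powr (1 / real (global_degree K))"
    by (rule prod_powr_distrib[symmetric])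
  finally show ?thesis using product_formula(2)[OF K g T] by simp
qed

text \<open>The bounds \<open>w g \<le> N w ^ j\<close> are raised to the normalised local degrees
  and multiplied: the left product is 1 by the product formula, the right one is the
  \<open>j\<close>-th power of the height.\<close>

lemma height_over_ge_1:
  assumes K: "number_field K" "k \<subseteq> K" and n: "n \<ge> 2" and x: "\<And>i. i < n \<Longrightarrow> x i \<in> K" and nz: "\<exists>i<n. x i \<noteq> 0"
  shows "1 \<le> height_over k (twist n) K x"
proof -
  note sK = number_field_subf[OF K(1)]
  define N where "N w = pnorm w {..<n} (coords w x)" for w
  have x01: "x 0 \<in> K" "x 1 \<in> K" using n x by auto
  have tK: "\<theta> \<in> K" "2 \<in> K" using theta(1) K(2) subf_numeral[OF sK] by auto
  have t0: "\<theta> \<noteq> 0" using theta(2) by auto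
  have "\<exists>g j. g \<in> K \<and> g \<noteq> 0 \<and> j > 0 \<and> (\<forall>w\<in>places K. w g \<le> N w ^ (j::nat))"
  proof -
    \<comment> \<open>Off the zeros of the quartic; on the three zeros with
      \<open>x 1 \<noteq> 0\<close>; on the fourth; and where the first two coordinates
      vanish.\<close>
    consider "x 1 \<noteq> 0" "x 0 ^ 3 \<noteq> x 1 ^ 3" | "x 1 \<noteq> 0" "x 0 ^ 3 = x 1 ^ 3" | "x 1 = 0" "x 0 \<noteq> 0" | "x 1 = 0" "x 0 = 0" by blast
    then show ?thesis
    proof cases
      case 1
      have "2 * \<theta> * x 1 * (x 0 ^ 3 - x 1 ^ 3) \<in> K"
        by (intro subfD(4,5,9)[OF sK] x01 tK)
      moreover have "2 * \<theta> * x 1 * (x 0 ^ 3 - x 1 ^ 3) \<noteq> 0" using 1 t0 by simp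
      moreover have "\<forall>w\<in>places K. w (2 * \<theta> * x 1 * (x 0 ^ 3 - x 1 ^ 3)) \<le> N w ^ 4"
        unfolding N_def using w_cube_diff_le[OF K _ n, of _ x] x by blast
      ultimately show ?thesis by (intro exI[of _ "2 * \<theta> * x 1 * (x 0 ^ 3 - x 1 ^ 3)"] exI[of _ 4]) auto
    next
      case 2
      have "\<forall>w\<in>places K. w (\<theta> * x 1) \<le> N w"
        unfolding N_def using w_theta_le[OF K _ n, of _ x] x 2(2) by blast
      then show ?thesis
        using 2 t0 subfD(4)[OF sK tK(1) x01(2)] by (intro exI[of _ "\<theta> * x 1"] exI[of _ 1]) auto
    next
      case 3
      have "\<forall>w\<in>places K. w (x 0) \<le> N w"
        unfolding N_def using pnorm_coords(2)[OF K _ n, of _ x] x 3 by simp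
      then show ?thesis using 3 x01 by (intro exI[of _ "x 0"] exI[of _ 1]) auto
    next
      case 4
      obtain i where i: "i < n" "x i \<noteq> 0" using nz by blast
      then have "2 \<le> i" using 4 by (cases "i = 0 \<or> i = 1") auto
      then have "\<forall>w\<in>places K. w (x i) \<le> N w"
        unfolding N_def using pnorm_coords(4)[OF K _ n, of _ x] x i by blast
      then show ?thesis using i x by (intro exI[of _ "x i"] exI[of _ 1]) auto
    qed
  qed
  then obtain g j where g: "g \<in> K" "g \<noteq> 0" and j: "j > 0" and gN: "\<And>w. w \<in> places K \<Longrightarrow> w g \<le> N w ^ j" by blast
  define f where "f w = height_factor k (twist n) K x w" for w
  have f: "f w = N w powr (real (local_degree K w) / real (global_degree K))" if "w \<in> places K" for w
  proof -
    have "coords (restrict w k) x = coords w x"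
      using restrict_eq[OF K that] by (auto simp: coords_def fun_eq_iff)
    then show ?thesis
      using norm_above_eq[OF K that n, of x] x by (simp add: f_def height_factor_def N_def)
  qed
  have "1 \<le> (\<Prod>w\<in>{w \<in> places K. f w \<noteq> 1}. f w)"
  \<comment> \<open>Over an infinite index set \<open>prod\<close> is 1, so the bound is then
    immediate.\<close>
  proof (cases "finite {w \<in> places K. f w \<noteq> 1}")
    case True
    define T where "T = {w \<in> places K. f w \<noteq> 1} \<union> {w \<in> places K. w g \<noteq> 1}"
    have T: "finite T" "T \<subseteq> places K" "{w \<in> places K. w g \<noteq> 1} \<subseteq> T" "{w \<in> places K. f w \<noteq> 1} \<subseteq> T"
      using True product_formula(1)[OF K(1) g] by (auto simp: T_def)
    have "(\<Prod>w\<in>T. w g powr (real (local_degree K w) / real (global_degree K))) \<le> (\<Prod>w\<in>T. f w ^ j)"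
    proof (rule prod_mono, intro conjI)
      fix w assume "w \<in> T"
      then have w: "w \<in> places K" using T(2) by blast
      have "w g powr (real (local_degree K w) / real (global_degree K)) \<le> (N w ^ j) powr (real (local_degree K w) / real (global_degree K))"
        by (rule powr_mono2) (use gN[OF w] absv_nonneg[OF sK place_absv[OF w] g(1)] in auto)
      also have "\<dots> = f w ^ j" unfolding f[OF w] by (induction j) (auto simp: powr_mult)
      finally show "w g powr (real (local_degree K w) / real (global_degree K)) \<le> f w ^ j" .
    qed simp
    then have "1 \<le> (\<Prod>w\<in>T. f w) ^ j"
      using product_formula_powr[OF K(1) g T(1-3)] by (simp add: prod_power_distrib)
    moreover have "0 \<le> (\<Prod>w\<in>T. f w)"
      by (intro prod_nonneg) (auto simp: f_def height_factor_def)
    ultimately have "1 \<le> (\<Prod>w\<in>T. f w)"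
      using j power_less_one_iff[of "\<Prod>w\<in>T. f w" j] by linarith
    then show ?thesis using prod_height_extend[OF T(1,4,2)] by simp
  qed simp
  then show ?thesis by (simp add: height_over_def f_def)
qed

lemma absolute_minimum_ge_1:
  assumes n: "n \<ge> 2"
  shows "1 \<le> absolute_minimum k (twist n)"
  unfolding absolute_minimum_def
proof (rule cInf_greatest)
  \<comment> \<open>A witness that the set is nonempty, which a lower bound for \<open>Inf\<close>
    requires.\<close>
  define e where "e = (\<lambda>i\<in>{..<n}. if i = 0 then 1 else 0 :: complex)"
  have "e \<in> vectors (field_on Qbar) {..<n}" by (auto simp: e_def vectors_def Qbar_def)
  moreover have "e 0 \<noteq> (\<lambda>i\<in>{..<n}. 0) 0" using n by (simp add: e_def)
  then have "e \<noteq> (\<lambda>i\<in>{..<n}. 0)" by auto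
  ultimately show "{height k (twist n) x |x. x \<in> vectors (field_on Qbar) (index_set (twist n)) \<and>
      x \<noteq> (\<lambda>i\<in>index_set (twist n). 0)} \<noteq> {}" by auto
  fix h assume "h \<in> {height k (twist n) x |x. x \<in> vectors (field_on Qbar) (index_set (twist n)) \<and>
      x \<noteq> (\<lambda>i\<in>index_set (twist n). 0)}"
  then obtain x where x: "h = height k (twist n) x" "x \<in> vectors (field_on Qbar) {..<n}" "x \<noteq> (\<lambda>i\<in>{..<n}. 0)" by auto
  obtain K where K: "number_field K" "k \<subseteq> K" "x \<in> vectors (field_on K) {..<n}" "h = height_over k (twist n) K x"
    using height_exists[OF nk, of "twist n" x] x(1,2) by auto
  have "\<exists>i<n. x i \<noteq> 0"
  proof (rule ccontr)
    assume "\<not> (\<exists>i<n. x i \<noteq> 0)"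
    then have "x = (\<lambda>i\<in>{..<n}. 0)"
      using x(2) by (intro extensionalityI[of _ "{..<n}"]) (auto simp: vectors_def PiE_def)
    then show False using x(3) by blast
  qed
  then show "1 \<le> h" unfolding K(4) using K(3) by (intro height_over_ge_1[OF K(1,2) n]) (auto simp: vectors_def)
qed

text \<open>Comparison with \<open>\<rho> * \<theta>\<close>, whose product over all places is 1:
  every factor of the height is at most the corresponding one, strictly at archimedean places, where
  the local degree is positive.\<close>

lemma height_over_wedge_less_1:
  assumes K: "number_field K" "k \<subseteq> K" and n: "n \<ge> 2" and m: "m \<ge> 2"
  shows "height_over k (tensor_bundle k (twist n) (twist m)) K (restrict wedge ({..<n} \<times> {..<m})) < 1"
proof -
  note sK = number_field_subf[OF K(1)]
  define N where "N w = pnorm w ({..<n} \<times> {..<m}) (\<lambda>p. scale w * wedge p)" for w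
  define f where "f w = height_factor k (tensor_bundle k (twist n) (twist m)) K (restrict wedge ({..<n} \<times> {..<m})) w" for w
  define q where "q w = real (local_degree K w) / real (global_degree K)" for w
  have q: "0 < q w" if "w \<in> places K" for w
    using local_degree_pos[OF K(1) that] global_degree_pos[OF K(1)] by (simp add: q_def)
  have f: "f w = N w powr q w" if "w \<in> places K" for w
    using norm_above_wedge[OF K that n m] restrict_eq[OF K that] by (simp add: f_def height_factor_def N_def q_def)
  note N = pnorm_wedge_le[OF K _ n m, folded N_def]
  have gK: "\<rho> * \<theta> \<in> K" using rho(1) theta(1) K(2) subfD(4)[OF sK] by auto
  have "\<rho> \<noteq> 0" "\<theta> \<noteq> 0" using rho(2) theta(2) by auto
  then have g0: "\<rho> * \<theta> \<noteq> 0" by simp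
  \<comment> \<open>Contains the archimedean places and those above 2 and 3, where the norm may
    differ from 1, besides the places where \<open>\<rho> * \<theta>\<close> has value different
    from 1.\<close>
  define T where "T = {w \<in> places K. w 2 \<noteq> 1} \<union> {w \<in> places K. w 3 \<noteq> 1} \<union> {w \<in> places K. w (\<rho> * \<theta>) \<noteq> 1}"
  have T: "finite T" "T \<subseteq> places K" "{w \<in> places K. w (\<rho> * \<theta>) \<noteq> 1} \<subseteq> T"
    using product_formula(1)[OF K(1), of 2] product_formula(1)[OF K(1), of 3] product_formula(1)[OF K(1) gK g0]
      subf_numeral[OF sK] by (auto simp: T_def)
  have fT: "{w \<in> places K. f w \<noteq> 1} \<subseteq> T"
    using N(4) f by (auto simp: T_def)
  \<comment> \<open>The inclusion of \<open>K\<close> into the complex numbers gives the archimedean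
    place at which the inequality is strict.\<close>
  define w0 where "w0 = restrict cmod K"
  have ar: "archimedean w0"
    using subsetD[OF Rats_subset[OF sK] Rats_of_rat] by (simp add: archimedean_def w0_def norm_of_rat)
  have "absv K w0" using absv_cmod[of K] subfD(3,4)[OF sK] by (simp add: absv_iff w0_def)
  then have w0: "w0 \<in> places K" using ar by (simp add: places_def w0_def)
  have "w0 \<in> T" using w_arch(1)[OF K w0 ar] w0 by (simp add: T_def)
  have "(\<Prod>w\<in>T. f w) < (\<Prod>w\<in>T. w (\<rho> * \<theta>) powr q w)"
  proof (rule prod_mono_strict[OF \<open>w0 \<in> T\<close> _ T(1)])
    show "f w0 < w0 (\<rho> * \<theta>) powr q w0"
      unfolding f[OF w0] by (rule powr_less_mono2) (use N(1)[OF w0] N(3)[OF w0 ar] q[OF w0] in auto)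
    fix w assume "w \<in> T"
    then have w: "w \<in> places K" using T(2) by blast
    show "0 \<le> f w \<and> f w \<le> w (\<rho> * \<theta>) powr q w"
      unfolding f[OF w] by (intro conjI powr_ge_zero powr_mono2) (use N(1,2)[OF w] q[OF w] in auto)
    show "0 < w (\<rho> * \<theta>) powr q w" using N(1,2)[OF w] by simp
  qed
  also have "\<dots> = 1" unfolding q_def by (rule product_formula_powr[OF K(1) gK g0 T])
  finally show ?thesis using prod_height_extend[OF T(1) fT T(2)] by (simp add: height_over_def f_def)
qed

lemma tensor_minimum_less_1:
  assumes n: "n \<ge> 2" and m: "m \<ge> 2"
  shows "absolute_minimum k (tensor_bundle k (twist n) (twist m)) < 1"
proof -
  define E where "E = tensor_bundle k (twist n) (twist m)"
  have I: "index_set E = {..<n} \<times> {..<m}" by (simp add: E_def tensor_bundle_def)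
  define t where "t = restrict wedge ({..<n} \<times> {..<m})"
  have t: "t \<in> vectors (field_on Qbar) (index_set E)"
    by (auto simp: t_def I vectors_def wedge_def Qbar_def)
  have "t (0, 1) \<noteq> (\<lambda>i\<in>index_set E. 0) (0, 1)" using n m by (simp add: t_def I wedge_def)
  then have t0: "t \<noteq> (\<lambda>i\<in>index_set E. 0)" by auto
  \<comment> \<open>Boundedness from below is what makes \<open>Inf\<close> at most each of the
    heights.\<close>
  have "0 \<le> height k E x" for x
    unfolding height_def height_over_def by (intro prod_nonneg) (auto simp: height_factor_def)
  then have "bdd_below {height k E x |x. x \<in> vectors (field_on Qbar) (index_set E) \<and> x \<noteq> (\<lambda>i\<in>index_set E. 0)}"
    by (auto intro!: bdd_belowI[of _ 0])
  then have "absolute_minimum k E \<le> height k E t"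
    unfolding absolute_minimum_def using t t0 by (intro cInf_lower) auto
  moreover have "finite (index_set E)" by (simp add: I)
  then have "height k E t < 1"
    using height_exists[OF nk _ t] height_over_wedge_less_1[OF _ _ n m] unfolding E_def t_def by metis
  ultimately show ?thesis unfolding E_def by simp
qed

end

lemma twisted_bundle_exists: "\<exists>k \<rho> \<omega>. twisted_bundle k \<rho> \<omega>"
proof -
  define \<rho> where "\<rho> = csqrt (csqrt 2)"
  define \<omega> where "\<omega> = Complex (- 1 / 2) (sqrt 3 / 2)"
  have "\<rho> ^ 4 = (\<rho>\<^sup>2)\<^sup>2" by (simp flip: power_mult)
  also have "\<dots> = 2" by (simp only: \<rho>_def power2_csqrt)
  finally have r: "\<rho> ^ 4 = 2" .
  have o: "\<omega>\<^sup>2 + \<omega> + 1 = 0"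
    by (simp add: \<omega>_def complex_eq_iff power2_eq_square)
  have "algebraic \<omega>"
    by (rule algebraicI[of "[:1, 1, 1:]"])
       (use o in \<open>auto simp: coeff_pCons power2_eq_square algebra_simps split: nat.splits\<close>)
  moreover have "algebraic \<rho>" by (auto simp: \<rho>_def)
  ultimately obtain k where "number_field k" "{\<rho>, \<omega>} \<subseteq> k"
    using number_field_containing[of "{\<rho>, \<omega>}"] by auto
  then have "twisted_bundle k \<rho> \<omega>" using r o by (intro twisted_bundle.intro) auto
  then show ?thesis by blast
qed

theorem theorem1p5:
  fixes n m :: nat
  assumes "n \<ge> 2" and "m \<ge> 2"
  shows "\<exists>k (E :: nat herm_bundle) (F :: nat herm_bundle).
           number_field k \<and>
           adelic_hermitian_bundle k E \<and> bundle_dim E = n \<and>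
           adelic_hermitian_bundle k F \<and> bundle_dim F = m \<and>
           absolute_minimum k (tensor_bundle k E F) < absolute_minimum k E * absolute_minimum k F"
proof -
  obtain k \<rho> \<omega> where "twisted_bundle k \<rho> \<omega>" using twisted_bundle_exists by blast
  then interpret twisted_bundle k \<rho> \<omega> .
  have "absolute_minimum k (tensor_bundle k (twist n) (twist m)) < 1 * 1"
    using tensor_minimum_less_1[OF assms] by simp
  also have "\<dots> \<le> absolute_minimum k (twist n) * absolute_minimum k (twist m)"
    using absolute_minimum_ge_1 assms by (intro mult_mono) (auto intro: order_trans[OF zero_le_one])
  finally show ?thesis using nk adelic assms by (intro exI[of _ k] exI[of _ "twist n"] exI[of _ "twist m"]) auto
qed

end
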